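(* Let $m\geq 1$ be an integer. For sufficiently $\mathrm{S}_m[\phi,\mathbf{A}]$-small admissible data on $\Sigma=\{\tau=0\}$ for the Maxwell-scalar field system on $\widehat{\mathrm{dS}}_4\simeq\mathbb{S}^3\times[-\pi/2,\pi/2]$ in strong Coulomb gauge one has $$\mathrm{S}_m[\phi,A](0)\simeq\mathrm{S}_m[\phi,A](\tau)\qquad\text{for all }\tau\in[-\pi/2,\pi/2].$$ In particular, $$\mathrm{S}_m[\phi,A](\mathscr{I}^-)\simeq\mathrm{S}_m[\phi,A](\mathscr{I}^+),$$ where $\mathscr{I}^\pm=\{\tau=\pm\pi/2\}$ is the future (past) null infinity of de Sitter space $\mathrm{dS}_4$.
   Context: Conformally compactified de Sitter space $\widehat{\mathrm{dS}}_4$ is the subset $[-\pi/2,\pi/2]\times\mathbb{S}^3$ of the Einstein cylinder $\mathbb{R}\times\mathbb{S}^3$ with metric $d\tau^2-\mathfrak{s}_3$, where $\mathfrak{s}_3$ is the round unit metric on $\mathbb{S}^3$. A dot is $\partial_\tau$; $\mathring{\nabla}$ and $\mathring{\Delta}=\mathring{\nabla}^\mu\mathring{\nabla}_\mu$ are the Levi-Civita connection and connection Laplacian of $\mathfrak{s}_3$ (contractions and norms on $\mathbb{S}^3$ use $\mathfrak{s}_3$); $\Box=\partial_\tau^2-\mathring{\Delta}$. The unknowns are a complex scalar field $\phi$ and a real 1-form $A=A_0\,d\tau+\mathbf{A}$, with $\mathbf{A}$ tangential to $\mathbb{S}^3$. The Maxwell-scalar field system in strong Coulomb gauge is $$\Box\phi+2iA_0\dot\phi-2i\mathbf{A}\cdot\mathring{\nabla}\phi+(1-A_0^2+|\mathbf{A}|^2+i\dot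 A_0)\phi=0,$$ $$\Box\mathbf{A}+(2+|\phi|^2)\mathbf{A}=-\operatorname{Im}(\bar\phi\mathring{\nabla}\phi)+\mathring{\nabla}\dot A_0,$$ $$-\mathring{\Delta}A_0+|\phi|^2A_0=-\operatorname{Im}(\bar\phi\dot\phi),$$ together with the strong Coulomb gauge conditions $$\mathring{\nabla}\cdot\mathbf{A}=0,\qquad \int_{\mathbb{S}^3}A_0(\tau)\,\mathrm{dv}_{\mathfrak{s}_3}=0\ \text{ for all }\tau.$$ Data $(\phi_0,\mathbf{A}_0,\phi_1,\mathbf{A}_1,a_0)=(\phi,\mathbf{A},\dot\phi,\dot{\mathbf{A}},A_0)|_\Sigma$ is admissible if it satisfies the strong Coulomb gauge, i.e. $\mathring{\nabla}\cdot\mathbf{A}_0=\mathring{\nabla}\cdot\mathbf{A}_1=0$ and $\int_{\mathbb{S}^3}a_0\,\mathrm{dv}_{\mathfrak{s}_3}=0$, and $a_0$ solves $-\mathring{\Delta}a_0+|\phi_0|^2a_0=-\operatorname{Im}(\bar\phi_0\phi_1)$ on $\Sigma$. For integers $m\ge1$, with $H^k=H^k(\mathbb{S}^3)$ and $H^0=L^2$, evaluated at fixed $\tau$: $\mathrm{S}_m[\phi]=\|\dot\phi\|_{H^{m-1}}^2+\|\phi\|_{H^m}^2$, $\mathrm{S}_m[\mathbf{A}]=\|\dot{\mathbf{A}}\|_{H^{m-1}}^2+\|\mathbf{A}\|_{H^m}^2$, $\mathrm{S}_m[A_0]=\|A_0\|_{H^m}^2$, $\mathrm{S}_m[\phi,\mathbf{A}]=\mathrm{S}_m[\phi]+\mathrm{S}_m[\mathbf{A}]$,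 $\mathrm{S}_m[\phi,A]=\mathrm{S}_m[\phi,\mathbf{A}]+\mathrm{S}_m[A_0]$. $\mathrm{S}_m[\phi,A](\tau)$ is this quantity at time $\tau$ for the solution of the system arising from the given data, and $\mathrm{S}_m[\phi,A](\mathscr{I}^\pm)$ is its value at $\tau=\pm\pi/2$. "Sufficiently $\mathrm{S}_m[\phi,\mathbf{A}]$-small data" means $\mathrm{S}_m[\phi,\mathbf{A}](0)\leq\epsilon$ for some sufficiently small $\epsilon>0$; $X\simeq Y$ means that each of $X$, $Y$ is bounded by a constant multiple of the other, the constant not depending on the solution. *)

theory Defs
  imports "HOL-Analysis.Analysis"
begin

section \<open>The round unit 3-sphere\<close>

abbreviation S3 :: "(real^4) set" where
  "S3 \<equiv> sphere 0 1"

text \<open>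
  Riemannian volume of the round metric, obtained as cone measure: the surface area of a Borel set
  \<open>E\<close> of the unit sphere of a 4-dimensional space is 4 times the volume of the cone
  \<open>{t *\<^sub>R x | 0 < t < 1, x \<in> E}\<close>.
\<close>

definition S3_measure :: "(real^4) measure" where
  "S3_measure = density
     (distr (restrict_space lborel (ball 0 1 - {0})) (restrict_space borel S3) (\<lambda>x. x /\<^sub>R norm x))
     (\<lambda>_. 4)"

text \<open>
  \<open>C^k\<close> on a set, by derivatives within the set. It is only used for the open set \<open>- {0}\<close> and
  for products of a nondegenerate compact interval with \<open>- {0}\<close>, where derivatives within the set
  are unique (one-sided at the ends of the interval).
\<close>

primrec Ck_on ::
  "nat \<Rightarrow> 'a::real_normed_vector set \<Rightarrow> ('a \<Rightarrow> 'b::real_normed_vector) \<Rightarrow> bool" where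
  "Ck_on 0 S f = continuous_on S f"
| "Ck_on (Suc k) S f =
     (\<exists>f'. (\<forall>x\<in>S. (f has_derivative f' x) (at x within S)) \<and> (\<forall>v. Ck_on k S (\<lambda>x. f' x v)))"

text \<open>A function on \<open>S3\<close> is smooth iff its extension constant along rays is smooth.\<close>

definition smooth_S3 :: "(real^4 \<Rightarrow> 'v::real_normed_vector) \<Rightarrow> bool" where
  "smooth_S3 f \<longleftrightarrow> (\<forall>k. Ck_on k (- {0}) (\<lambda>x. f (x /\<^sub>R norm x)))"


section \<open>Tensor fields and the Levi-Civita connection\<close>

text \<open>
  A covariant tensor field of rank \<open>r\<close> with values in \<open>'v\<close> (real or complex numbers) is a map
  \<open>T\<close> such that \<open>T x [v\<^sub>1, \<dots>, v\<^sub>r]\<close> is the value at \<open>x \<in> S3\<close> on \<open>v\<^sub>1, \<dots>, v\<^sub>r\<close>. The arguments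
  range over the ambient space; a tensor is extended to it by tangential projection.
\<close>

type_synonym 'v tensor_field = "real^4 \<Rightarrow> (real^4) list \<Rightarrow> 'v"

definition tan_proj :: "real^4 \<Rightarrow> real^4 \<Rightarrow> real^4" where
  "tan_proj x v = v - (v \<bullet> x) *\<^sub>R x"

definition is_tensor_field :: "nat \<Rightarrow> 'v::real_normed_vector tensor_field \<Rightarrow> bool" where
  "is_tensor_field r T \<longleftrightarrow> (\<forall>x\<in>S3. \<forall>vs. length vs = r \<longrightarrow>
     (\<forall>k<r. linear (\<lambda>v. T x (vs[k := v]))) \<and> T x (map (tan_proj x) vs) = T x vs)"

definition scalar_field :: "(real^4 \<Rightarrow> 'v) \<Rightarrow> 'v tensor_field" where
  "scalar_field f = (\<lambda>x vs. f x)"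

text \<open>1-forms are given by the metrically equivalent vector fields.\<close>

definition one_form :: "(real^4 \<Rightarrow> real^4) \<Rightarrow> real tensor_field" where
  "one_form A = (\<lambda>x vs. A x \<bullet> hd vs)"

definition tangential :: "(real^4 \<Rightarrow> real^4) \<Rightarrow> bool" where
  "tangential A \<longleftrightarrow> (\<forall>x\<in>S3. A x \<bullet> x = 0)"

definition smooth_tensor :: "nat \<Rightarrow> 'v::real_normed_vector tensor_field \<Rightarrow> bool" where
  "smooth_tensor r T \<longleftrightarrow>
     is_tensor_field r T \<and> (\<forall>vs. length vs = r \<longrightarrow> smooth_S3 (\<lambda>x. T x vs))"

text \<open>
  Levi-Civita connection by Gauss's formula, the differentiation slot coming first. The
  vector field \<open>y \<mapsto> tan_proj y w\<close>, for \<open>w\<close> tangent at \<open>x\<close>, extends \<open>w\<close> and has vanishing covariant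
  derivative at \<open>x\<close>, so no correction terms appear: the covariant derivative at \<open>x\<close> is the
  ordinary derivative of the components with respect to fixed tangent vectors of \<open>S3\<close> at \<open>x\<close>.
\<close>

fun nabla :: "'v::real_normed_vector tensor_field \<Rightarrow> 'v tensor_field" where
  "nabla T x [] = 0"
| "nabla T x (v # vs) =
     frechet_derivative (\<lambda>y. T (y /\<^sub>R norm y) (map (tan_proj x) vs)) (at x) (tan_proj x v)"

text \<open>
  Metric contractions at \<open>x\<close> are computed with an orthonormal basis of the ambient space, the normal
  direction contributing nothing.
\<close>

definition divergence :: "'v::real_normed_vector tensor_field \<Rightarrow> 'v tensor_field" where
  "divergence T = (\<lambda>x vs. \<Sum>e\<in>Basis. nabla T x (e # e # vs))"

definition laplacian :: "'v::real_normed_vector tensor_field \<Rightarrow> 'v tensor_field" where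
  "laplacian T = divergence (nabla T)"

definition basis_lists :: "nat \<Rightarrow> (real^4) list set" where
  "basis_lists r = {es. set es \<subseteq> Basis \<and> length es = r}"

text \<open>For complex values this is the real part of the Hermitian product.\<close>

definition tensor_inner ::
  "nat \<Rightarrow> 'v::real_inner tensor_field \<Rightarrow> 'v tensor_field \<Rightarrow> real^4 \<Rightarrow> real" where
  "tensor_inner r S T x = (\<Sum>es\<in>basis_lists r. S x es \<bullet> T x es)"


section \<open>Sobolev spaces\<close>

definition L2_tensor :: "nat \<Rightarrow> 'v::euclidean_space tensor_field \<Rightarrow> bool" where
  "L2_tensor r T \<longleftrightarrow> is_tensor_field r T
     \<and> (\<forall>vs. length vs = r \<longrightarrow> (\<lambda>x. T x vs) \<in> borel_measurable S3_measure)
     \<and> integrable S3_measure (tensor_inner r T T)"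

text \<open>\<open>S\<close> is the \<open>j\<close>-th covariant derivative of \<open>T\<close> (of rank \<open>r\<close>), in the weak sense, and lies in \<open>L^2\<close>.\<close>

definition is_weak_nabla ::
  "nat \<Rightarrow> nat \<Rightarrow> 'v::euclidean_space tensor_field \<Rightarrow> 'v tensor_field \<Rightarrow> bool" where
  "is_weak_nabla j r T S \<longleftrightarrow> L2_tensor (r + j) S
     \<and> (\<forall>Y. smooth_tensor (r + j) Y \<longrightarrow>
          (LINT x|S3_measure. tensor_inner (r + j) S Y x)
          = (- 1) ^ j * (LINT x|S3_measure. tensor_inner r T ((divergence ^^ j) Y) x))"

definition in_Sobolev :: "nat \<Rightarrow> nat \<Rightarrow> 'v::euclidean_space tensor_field \<Rightarrow> bool" where
  "in_Sobolev k r T \<longleftrightarrow> L2_tensor r T \<and> (\<forall>j\<le>k. \<exists>S. is_weak_nabla j r T S)"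

text \<open>
  The square of the \<open>H^k\<close> norm of a tensor field of rank \<open>r\<close> in \<open>H^k\<close>. Weak derivatives are unique
  almost everywhere, so the choice is immaterial.
\<close>

definition Sobolev_sq :: "nat \<Rightarrow> nat \<Rightarrow> 'v::euclidean_space tensor_field \<Rightarrow> real" where
  "Sobolev_sq k r T =
     (\<Sum>j\<le>k. let S = (SOME S. is_weak_nabla j r T S) in LINT x|S3_measure. tensor_inner (r + j) S S x)"


section \<open>Cauchy data, admissibility and energies\<close>

text \<open>The values \<open>(\<phi>, \<A>, \<phi>\<^sub>\<tau>, \<A>\<^sub>\<tau>, A\<^sub>0)\<close> on a slice of constant time, \<open>\<A>\<close> being the spatial potential.\<close>

record slice =
  phi :: "real^4 \<Rightarrow> complex"
  pot :: "real^4 \<Rightarrow> real^4"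
  phi_dot :: "real^4 \<Rightarrow> complex"
  pot_dot :: "real^4 \<Rightarrow> real^4"
  pot0 :: "real^4 \<Rightarrow> real"

definition slice_diff :: "slice \<Rightarrow> slice \<Rightarrow> slice" where
  "slice_diff d e =
     \<lparr>phi = (\<lambda>x. phi d x - phi e x), pot = (\<lambda>x. pot d x - pot e x),
      phi_dot = (\<lambda>x. phi_dot d x - phi_dot e x), pot_dot = (\<lambda>x. pot_dot d x - pot_dot e x),
      pot0 = (\<lambda>x. pot0 d x - pot0 e x)\<rparr>"

definition slice_in_Sobolev :: "nat \<Rightarrow> slice \<Rightarrow> bool" where
  "slice_in_Sobolev m d \<longleftrightarrow>
     in_Sobolev m 0 (scalar_field (phi d)) \<and> in_Sobolev (m - 1) 0 (scalar_field (phi_dot d))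
     \<and> in_Sobolev m 1 (one_form (pot d)) \<and> in_Sobolev (m - 1) 1 (one_form (pot_dot d))
     \<and> in_Sobolev m 0 (scalar_field (pot0 d))"

text \<open>\<open>S\<^sub>m[\<phi>, \<A>]\<close> and \<open>S\<^sub>m[\<phi>, A]\<close>, for \<open>m \<ge> 1\<close>.\<close>

definition energy_dyn :: "nat \<Rightarrow> slice \<Rightarrow> real" where
  "energy_dyn m d =
     (Sobolev_sq (m - 1) 0 (scalar_field (phi_dot d)) + Sobolev_sq m 0 (scalar_field (phi d)))
     + (Sobolev_sq (m - 1) 1 (one_form (pot_dot d)) + Sobolev_sq m 1 (one_form (pot d)))"

definition energy :: "nat \<Rightarrow> slice \<Rightarrow> real" where
  "energy m d = energy_dyn m d + Sobolev_sq m 0 (scalar_field (pot0 d))"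

definition weakly_div_free :: "(real^4 \<Rightarrow> real^4) \<Rightarrow> bool" where
  "weakly_div_free A \<longleftrightarrow> (\<forall>\<psi>. smooth_S3 \<psi> \<longrightarrow>
     (LINT x|S3_measure. nabla (scalar_field \<psi>) x [A x]) = (0::real))"

text \<open>
  Admissible data with finite \<open>S\<^sub>m[\<phi>, A]\<close>. As the data are merely in Sobolev spaces, the
  divergence conditions and the elliptic equation for \<open>A\<^sub>0\<close> are understood in the weak sense.
\<close>

definition admissible :: "nat \<Rightarrow> slice \<Rightarrow> bool" where
  "admissible m d \<longleftrightarrow> slice_in_Sobolev m d
     \<and> weakly_div_free (pot d) \<and> weakly_div_free (pot_dot d)
     \<and> (LINT x|S3_measure. pot0 d x) = 0
     \<and> (\<forall>\<psi>. smooth_S3 \<psi> \<longrightarrow>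
          (LINT x|S3_measure. - pot0 d x * laplacian (scalar_field \<psi>) x []
                              + (cmod (phi d x))\<^sup>2 * pot0 d x * \<psi> x)
          = (LINT x|S3_measure. - Im (cnj (phi d x) * phi_dot d x) * \<psi> x))"


section \<open>The Maxwell-scalar field system in strong Coulomb gauge\<close>

definition dS_times :: "real set" where
  "dS_times = {- (pi / 2)..pi / 2}"

text \<open>The time coordinates of past and future null infinity.\<close>

abbreviation scri_minus :: real where "scri_minus \<equiv> - (pi / 2)"
abbreviation scri_plus :: real where "scri_plus \<equiv> pi / 2"

text \<open>Smoothness on the closed slab, up to and including its two boundary spheres.\<close>

definition smooth_slab :: "(real \<Rightarrow> real^4 \<Rightarrow> 'v::real_normed_vector) \<Rightarrow> bool" where
  "smooth_slab f \<longleftrightarrow>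
     (\<forall>k. Ck_on k (dS_times \<times> (- {0})) (\<lambda>p. f (fst p) (snd p /\<^sub>R norm (snd p))))"

definition dt :: "(real \<Rightarrow> real^4 \<Rightarrow> 'v::real_normed_vector) \<Rightarrow> real \<Rightarrow> real^4 \<Rightarrow> 'v" where
  "dt f \<tau> x = vector_derivative (\<lambda>s. f s x) (at \<tau> within dS_times)"

text \<open>
  Smooth solutions. Equations between 1-forms are evaluated on an arbitrary ambient vector \<open>v\<close>; both
  sides vanish for normal \<open>v\<close>.
\<close>

definition smooth_solution ::
  "(real \<Rightarrow> real^4 \<Rightarrow> complex) \<Rightarrow> (real \<Rightarrow> real^4 \<Rightarrow> real^4) \<Rightarrow> (real \<Rightarrow> real^4 \<Rightarrow> real) \<Rightarrow> bool" where
  "smooth_solution \<phi> A A0 \<longleftrightarrow>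
     smooth_slab \<phi> \<and> smooth_slab A \<and> smooth_slab A0
     \<and> (\<forall>\<tau>\<in>dS_times.
          tangential (A \<tau>)
          \<and> (\<forall>x\<in>S3. divergence (one_form (A \<tau>)) x [] = 0)
          \<and> (LINT x|S3_measure. A0 \<tau> x) = 0
          \<and> (\<forall>x\<in>S3.
               dt (dt \<phi>) \<tau> x - laplacian (scalar_field (\<phi> \<tau>)) x []
               + 2 * \<i> * of_real (A0 \<tau> x) * dt \<phi> \<tau> x
               - 2 * \<i> * nabla (scalar_field (\<phi> \<tau>)) x [A \<tau> x]
               + (1 - of_real ((A0 \<tau> x)\<^sup>2) + of_real ((norm (A \<tau> x))\<^sup>2)
                  + \<i> * of_real (dt A0 \<tau> x)) * \<phi> \<tau> x = 0)
          \<and> (\<forall>x\<in>S3. \<forall>v.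
               dt (dt A) \<tau> x \<bullet> v - laplacian (one_form (A \<tau>)) x [v]
               + (2 + (cmod (\<phi> \<tau> x))\<^sup>2) * (A \<tau> x \<bullet> v)
               = - Im (cnj (\<phi> \<tau> x) * nabla (scalar_field (\<phi> \<tau>)) x [v])
                 + nabla (scalar_field (dt A0 \<tau>)) x [v])
          \<and> (\<forall>x\<in>S3.
               - laplacian (scalar_field (A0 \<tau>)) x [] + (cmod (\<phi> \<tau> x))\<^sup>2 * A0 \<tau> x
               = - Im (cnj (\<phi> \<tau> x) * dt \<phi> \<tau> x)))"

definition slice_of ::
  "(real \<Rightarrow> real^4 \<Rightarrow> complex) \<Rightarrow> (real \<Rightarrow> real^4 \<Rightarrow> real^4) \<Rightarrow> (real \<Rightarrow> real^4 \<Rightarrow> real)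
    \<Rightarrow> real \<Rightarrow> slice" where
  "slice_of \<phi> A A0 \<tau> =
     \<lparr>phi = \<phi> \<tau>, pot = A \<tau>, phi_dot = dt \<phi> \<tau>, pot_dot = dt A \<tau>, pot0 = A0 \<tau>\<rparr>"

text \<open>
  Solutions at the regularity of \<open>S\<^sub>m\<close>, in the sense of generalized (finite energy) solutions of the
  Cauchy problem: uniform limits in \<open>S\<^sub>m\<close>, over the whole time interval, of smooth solutions. Such a
  limit is a continuous curve in \<open>H^m\<close>, \<open>phi_dot\<close> and \<open>pot_dot\<close> are the time derivatives of
  \<open>phi\<close> and \<open>pot\<close> in \<open>H^(m-1)\<close>, and, as \<open>m \<ge> 1\<close>, the equations hold in the sense of
  distributions. Every smooth solution is included.
\<close>

definition solution :: "nat \<Rightarrow> (real \<Rightarrow> slice) \<Rightarrow> bool" where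
  "solution m u \<longleftrightarrow>
     (\<forall>\<tau>\<in>dS_times. slice_in_Sobolev m (u \<tau>))
     \<and> (\<exists>\<phi> A A0. (\<forall>n::nat. smooth_solution (\<phi> n) (A n) (A0 n))
          \<and> uniform_limit dS_times
              (\<lambda>n \<tau>. energy m (slice_diff (slice_of (\<phi> n) (A n) (A0 n) \<tau>) (u \<tau>))) (\<lambda>_. 0)
              sequentially)"

definition comparable :: "real \<Rightarrow> real \<Rightarrow> real \<Rightarrow> bool" where
  "comparable C X Y \<longleftrightarrow> X \<le> C * Y \<and> Y \<le> C * X"

end

theory Submission
  imports Defs
begin

text \<open>
  \<open>S3\<close> is parallelized by the left-invariant fields \<open>X a\<close>, which commute with the Laplacian. In this frame
  the system becomes scalar wave equations for the real and imaginary parts of the field and for the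
  components of the potential, and covariant Sobolev norms of tensors become sums of \<open>L^2\<close> norms of
  iterated frame derivatives of components.

  For \<open>m \<ge> 2\<close> the product \<open>H^m \<cdot> H^(m-1) \<rightarrow> H^(m-1)\<close> is bounded, the time component of the potential and its
  time derivative are controlled quadratically by elliptic estimates, and so the energy \<open>S\<close> satisfies
  \<open>\<bar>S'\<bar> \<le> K S\<close> as long as it is small; a bootstrap and Gronwall's lemma on the compact time interval
  compare \<open>S(\<tau>)\<close> with \<open>S(0)\<close>. For \<open>m = 1\<close> these products are not available. There the gauge covariant
  energy is used instead: up to a divergence its density changes only by linear terms in the potential, because the
  work of the current on the field cancels against the forcing of the potential, and it is comparable with
  the plain energy when either is small, by the embedding \<open>H^1 \<subseteq> L^4\<close>.

  The constants do not depend on the solution, so the estimates pass to limits of smooth solutions.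
\<close>

subsection \<open>Functions of class C^k on a set\<close>

text \<open>The analysis rests on the group structure of the unit quaternions: rotations preserve
  the cone measure, and integration by parts, the Poincare inequality and the Sobolev embeddings all
  come from averaging over translates. The obstacle at \<open>m = 1\<close> is that terms such as
  \<open>A_0 dt phi\<close> and \<open>A . grad phi\<close> would need a bounded product
  \<open>H^1 * L^2 -> L^2\<close>, which fails in dimension 3; covariant derivatives absorb these
  terms. The system has no evolution equation for \<open>A_0\<close>, yet \<open>dt A_0\<close>
  enters the wave equations. Taking the divergence of the equation for the spatial potential leaves
  only the current and the gradient of \<open>dt A_0\<close>, whence
  \<open>lap (dt A_0) = div current\<close>, an elliptic equation without second time derivatives. A
  solution is given on the whole time interval, so the task is an a priori estimate for smooth
  solutions with constants fixed before the solution. Norms appear squared throughout, and the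
  factor 2 that accompanies each sum of two terms comes from there.\<close>

lemma Ck_on_cong:
  assumes "Ck_on k S f" "\<And>x. x \<in> S \<Longrightarrow> f x = g x"
  shows "Ck_on k S g"
proof (cases k)
  case 0
  then show ?thesis using assms by (simp cong: continuous_on_cong)
next
  case (Suc j)
  with assms(1) obtain f' where f': "\<And>x. x \<in> S \<Longrightarrow> (f has_derivative f' x) (at x within S)"
    "\<And>v. Ck_on j S (\<lambda>x. f' x v)" by auto
  have "(g has_derivative f' x) (at x within S)" if "x \<in> S" for x
    using f'(1)[OF that] that assms(2) by (metis has_derivative_transform)
  then show ?thesis using f'(2) Suc by auto
qed

lemma Ck_on_Suc_imp: "Ck_on (Suc k) S f \<Longrightarrow> Ck_on k S f"
proof (induction k arbitrary: f)
  case 0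
  then show ?case by (auto intro: has_derivative_continuous_on)
next
  case (Suc k)
  then obtain f' where "\<And>x. x \<in> S \<Longrightarrow> (f has_derivative f' x) (at x within S)"
    "\<And>v. Ck_on (Suc k) S (\<lambda>x. f' x v)" by (metis Ck_on.simps(2))
  then show ?case using Suc.IH by (metis Ck_on.simps(2))
qed

lemma Ck_on_imp_continuous_on: "Ck_on k S f \<Longrightarrow> continuous_on S f"
  by (induction k) (use Ck_on_Suc_imp in auto)

lemma Ck_on_const [simp]: "Ck_on k S (\<lambda>x. c)"
proof (induction k arbitrary: c)
  case (Suc k)
  have "\<forall>x\<in>S. ((\<lambda>x. c) has_derivative (\<lambda>v. 0)) (at x within S)" by simp
  then show ?case using Suc unfolding Ck_on.simps by (intro exI[of _ "\<lambda>x v. 0"]) simp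
qed simp

lemma Ck_on_bounded_linear:
  assumes "bounded_linear L"
  shows "Ck_on k S L"
proof (cases k)
  case 0 then show ?thesis using assms by (simp add: linear_continuous_on)
next
  case (Suc j)
  have "\<forall>x\<in>S. (L has_derivative L) (at x within S)"
    using assms bounded_linear_imp_has_derivative by blast
  then show ?thesis unfolding Suc Ck_on.simps by (intro exI[of _ "\<lambda>x. L"]) simp
qed

lemma Ck_on_bounded_linear_compose:
  assumes L: "bounded_linear L"
  shows "Ck_on k S f \<Longrightarrow> Ck_on k S (\<lambda>x. L (f x))"
proof (induction k arbitrary: f)
  case 0 then show ?case by (simp add: L bounded_linear.continuous_on)
next
  case (Suc k)
  then obtain f' where f': "\<forall>x\<in>S. (f has_derivative f' x) (at x within S)"
    "\<forall>v. Ck_on k S (\<lambda>x. f' x v)" by auto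
  then have "\<forall>x\<in>S. ((\<lambda>x. L (f x)) has_derivative (\<lambda>v. L (f' x v))) (at x within S)"
    using bounded_linear.has_derivative[OF L] by blast
  then show ?case using f'(2) Suc.IH unfolding Ck_on.simps
    by (intro exI[of _ "\<lambda>x v. L (f' x v)"]) simp
qed

lemma Ck_on_add: "Ck_on k S f \<Longrightarrow> Ck_on k S g \<Longrightarrow> Ck_on k S (\<lambda>x. f x + g x)"
proof (induction k arbitrary: f g)
  case 0 then show ?case by (simp add: continuous_on_add)
next
  case (Suc k)
  then obtain f' g' where f': "\<forall>x\<in>S. (f has_derivative f' x) (at x within S)"
    "\<forall>v. Ck_on k S (\<lambda>x. f' x v)"  "\<forall>x\<in>S. (g has_derivative g' x) (at x within S)"
    "\<forall>v. Ck_on k S (\<lambda>x. g' x v)" by auto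
  show ?case unfolding Ck_on.simps
    by (intro exI[of _ "\<lambda>x v. f' x v + g' x v"]) (use f' Suc.IH in \<open>auto intro: has_derivative_add\<close>)
qed

lemma Ck_on_bounded_bilinear:
  assumes P: "bounded_bilinear P"
  shows "Ck_on k S f \<Longrightarrow> Ck_on k S g \<Longrightarrow> Ck_on k S (\<lambda>x. P (f x) (g x))"
proof (induction k arbitrary: f g)
  case 0 then show ?case using bounded_bilinear.continuous_on[OF P] by simp
next
  case (Suc k)
  then obtain f' g' where f': "\<forall>x\<in>S. (f has_derivative f' x) (at x within S)"
    "\<forall>v. Ck_on k S (\<lambda>x. f' x v)"  "\<forall>x\<in>S. (g has_derivative g' x) (at x within S)"
    "\<forall>v. Ck_on k S (\<lambda>x. g' x v)" by auto
  have "Ck_on k S f" "Ck_on k S g" using Suc.prems Ck_on_Suc_imp by blast+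
  then show ?case unfolding Ck_on.simps using f' Suc.IH
    by (intro exI[of _ "\<lambda>x v. P (f x) (g' x v) + P (f' x v) (g x)"] conjI ballI allI Ck_on_add
         bounded_bilinear.FDERIV[OF P]) auto
qed

lemmas Ck_on_mult = Ck_on_bounded_bilinear[OF bounded_bilinear_mult]
lemmas Ck_on_scaleR = Ck_on_bounded_bilinear[OF bounded_bilinear_scaleR]
lemmas Ck_on_inner = Ck_on_bounded_bilinear[OF bounded_bilinear_inner]

lemma Ck_on_minus: "Ck_on k S f \<Longrightarrow> Ck_on k S (\<lambda>x. - f x)"
  by (rule Ck_on_bounded_linear_compose[OF bounded_linear_minus[OF bounded_linear_ident]])

lemma Ck_on_diff: "Ck_on k S f \<Longrightarrow> Ck_on k S g \<Longrightarrow> Ck_on k S (\<lambda>x. f x - g x)"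
  using Ck_on_add[of k S f "\<lambda>x. - g x"] Ck_on_minus by auto

lemma Ck_on_sum: "(\<And>i. i \<in> I \<Longrightarrow> Ck_on k S (f i)) \<Longrightarrow> Ck_on k S (\<lambda>x. \<Sum>i\<in>I. f i x)"
  by (induction I rule: infinite_finite_induct) (auto intro: Ck_on_add)

lemma has_derivative_inverse_norm:
  fixes x :: "'a::real_inner"
  assumes "x \<noteq> 0"
  shows "((\<lambda>x. inverse (norm x)) has_derivative (\<lambda>v. - ((x \<bullet> v) * inverse (norm x) ^ 3))) (at x within S)"
proof -
  have "(norm has_derivative (\<lambda>v. v \<bullet> sgn x)) (at x within S)"
    using assms has_derivative_norm has_derivative_at_withinI by blast
  from Deriv.has_derivative_inverse[OF _ this] assms
  have "((\<lambda>x. inverse (norm x)) has_derivative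
      (\<lambda>h. - (inverse (norm x) * (h \<bullet> sgn x) * inverse (norm x)))) (at x within S)" by simp
  also have "(\<lambda>h. - (inverse (norm x) * (h \<bullet> sgn x) * inverse (norm x)))
     = (\<lambda>v. - ((x \<bullet> v) * inverse (norm x) ^ 3))"
    by (auto simp: sgn_div_norm inner_commute power3_eq_cube field_simps)
  finally show ?thesis .
qed

text \<open>The differential of \<open>1 / |x|\<close> is a polynomial in \<open>x\<close> and
  \<open>1 / |x|\<close>, so the induction hypothesis applies to it again.\<close>

lemma Ck_on_inverse_norm: "Ck_on k (- {0}) (\<lambda>x::'a::real_inner. inverse (norm x))"
proof (induction k)
  case 0 show ?case by (auto intro!: continuous_intros)
next
  case (Suc k)
  have "Ck_on k (- {0}) (\<lambda>x. - ((x \<bullet> v) * (inverse (norm x) * (inverse (norm x) * inverse (norm x)))))" for v :: 'a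
    by (intro Ck_on_minus Ck_on_mult Suc Ck_on_inner Ck_on_const
         Ck_on_bounded_linear[OF bounded_linear_ident, unfolded id_def])
  then have "\<forall>v. Ck_on k (- {0}) (\<lambda>x::'a. - ((x \<bullet> v) * inverse (norm x) ^ 3))"
    by (simp add: power3_eq_cube mult.assoc)
  then show ?case unfolding Ck_on.simps
    by (intro exI[of _ "\<lambda>x v. - ((x \<bullet> v) * inverse (norm x) ^ 3)"] conjI ballI has_derivative_inverse_norm)
      auto
qed

lemma Ck_on_normalize: "Ck_on k (- {0}) (\<lambda>x::'a::real_inner. x /\<^sub>R norm x)"
  by (intro Ck_on_scaleR Ck_on_inverse_norm Ck_on_bounded_linear[OF bounded_linear_ident])

lemma Ck_on_compose_snd:
  "Ck_on k U f \<Longrightarrow> Ck_on k (T \<times> U) (\<lambda>p. f (snd p))"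
proof (induction k arbitrary: f)
  case 0
  then show ?case by (auto intro!: continuous_on_compose2[of U f] continuous_intros)
next
  case (Suc k)
  then obtain f' where f': "\<And>x. x\<in>U \<Longrightarrow> (f has_derivative f' x) (at x within U)"
    "\<forall>v. Ck_on k U (\<lambda>x. f' x v)" by auto
  have "((\<lambda>p. f (snd p)) has_derivative (\<lambda>v. f' (snd p) (snd v))) (at p within T \<times> U)"
    if "p \<in> T \<times> U" for p
  proof (rule has_derivative_in_compose[OF has_derivative_snd[OF has_derivative_ident]])
    show "(f has_derivative f' (snd p)) (at (snd p) within snd ` (T \<times> U))"
      using that by (intro has_derivative_subset[OF f'(1)]) auto
    qed
  then show ?case unfolding Ck_on.simps
    by (intro exI[of _ "\<lambda>p v. f' (snd p) (snd v)"]) (use f'(2) Suc.IH in auto)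
qed

lemma Ck_on_slice:
  assumes "t \<in> T"
  shows "Ck_on k (T \<times> U) f \<Longrightarrow> Ck_on k U (\<lambda>x. f (t, x))"
proof (induction k arbitrary: f)
  case 0
  then show ?case using assms by (auto intro!: continuous_on_compose2[of "T \<times> U" f] continuous_intros)
next
  case (Suc k)
  then obtain f' where f': "\<And>x. x\<in>T \<times> U \<Longrightarrow> (f has_derivative f' x) (at x within T \<times> U)"
    "\<And>v. Ck_on k (T \<times> U) (\<lambda>x. f' x v)" by auto
  have "((\<lambda>x. f (t, x)) has_derivative (\<lambda>v. f' (t, x) (0, v))) (at x within U)"
    if "x \<in> U" for x
  proof (rule has_derivative_in_compose[OF has_derivative_Pair[OF has_derivative_const has_derivative_ident]])
    show "(f has_derivative f' (t, x)) (at (t, x) within Pair t ` U)"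
      using that assms by (intro has_derivative_subset[OF f'(1)]) auto
  qed
  then show ?case unfolding Ck_on.simps
    by (intro exI[of _ "\<lambda>x v. f' (t, x) (0, v)"]) (use f'(2) Suc.IH in auto)
qed

text \<open>Derivatives within \<open>S\<close> are unique if \<open>S\<close> can be left along every axis.\<close>

definition axis_thick :: "'a::euclidean_space set \<Rightarrow> bool" where
  "axis_thick S \<longleftrightarrow> (\<forall>x\<in>S. \<forall>i\<in>Basis. \<forall>e>0. \<exists>d. 0 < \<bar>d\<bar> \<and> \<bar>d\<bar> < e \<and> x + d *\<^sub>R i \<in> S)"

lemma axis_thick_open: "open S \<Longrightarrow> axis_thick S"
  unfolding axis_thick_def
proof (intro ballI allI impI)
  fix x i :: 'a and e :: real assume *: "open S" "x \<in> S" "i \<in> Basis" "e > 0"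
  then obtain r where r: "r > 0" "ball x r \<subseteq> S" by (meson open_contains_ball)
  with * show "\<exists>d. 0 < \<bar>d\<bar> \<and> \<bar>d\<bar> < e \<and> x + d *\<^sub>R i \<in> S"
    by (intro exI[of _ "min r e / 2"]) (auto simp: subset_iff dist_norm)
qed

lemma axis_thick_slab:
  assumes "axis_thick U" "a < (b::real)"
  shows "axis_thick ({a..b} \<times> U)"
  unfolding axis_thick_def
proof (intro ballI allI impI)
  fix p i :: "real \<times> 'a" and e :: real assume *: "p \<in> {a..b} \<times> U" "i \<in> Basis" "e > 0"
  obtain t x where p: "p = (t,x)" by force
  have tx: "t \<in> {a..b}" "x \<in> U" using * p by auto
  consider "i = (1,0)" | j where "j \<in> Basis" "i = (0,j)"
    using * by (auto simp: Basis_prod_def)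
  then show "\<exists>d. 0 < \<bar>d\<bar> \<and> \<bar>d\<bar> < e \<and> p + d *\<^sub>R i \<in> {a..b} \<times> U"
  proof cases
    case 1
    show ?thesis
    proof (cases "t < b")
      case True then show ?thesis using 1 * tx unfolding p
        by (intro exI[of _ "min (b - t) e / 2"]) (auto simp: min_def field_simps)
    next
      \<comment> \<open>At the right end of the interval the step has to point backwards; this is
        why \<open>axis_thick\<close> asks for a nonzero \<open>d\<close> of either sign.\<close>
      case False then show ?thesis using 1 * tx assms(2) unfolding p
        by (intro exI[of _ "- (min (b - a) e / 2)"]) (auto simp: min_def field_simps)
    qed
  next
    case 2
    then obtain d where "0 < \<bar>d\<bar>" "\<bar>d\<bar> < e" "x + d *\<^sub>R j \<in> U"
      using assms(1) tx *(3) unfolding axis_thick_def by blast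
    then show ?thesis using 2 tx unfolding p by (intro exI[of _ d]) auto
  qed
qed

section \<open>Smooth functions on a thick set and the symmetry of second derivatives\<close>

definition Cinf_on :: "'a::real_normed_vector set \<Rightarrow> ('a \<Rightarrow> 'b::real_normed_vector) \<Rightarrow> bool" where
  "Cinf_on S f \<longleftrightarrow> (\<forall>k. Ck_on k S f)"

lemma Cinf_on_cong:
  "Cinf_on S f \<Longrightarrow> (\<And>x. x \<in> S \<Longrightarrow> f x = g x) \<Longrightarrow> Cinf_on S g"
  unfolding Cinf_on_def by (metis Ck_on_cong)

text \<open>\<open>Ck_on\<close> chooses a derivative anew for each \<open>k\<close>. Uniqueness on
  a thick set identifies these choices, which yields one derivative that is smooth itself.\<close>

lemma Cinf_on_derivative:
  fixes f :: "'a::euclidean_space \<Rightarrow> 'b::real_normed_vector"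
  assumes "axis_thick S" "Cinf_on S f"
  obtains f' where "\<And>x. x \<in> S \<Longrightarrow> (f has_derivative f' x) (at x within S)"
    "\<And>v. Cinf_on S (\<lambda>x. f' x v)"
proof -
  have "\<forall>k. \<exists>f'. (\<forall>x\<in>S. (f has_derivative f' x) (at x within S)) \<and> (\<forall>v. Ck_on k S (\<lambda>x. f' x v))"
    using assms(2) unfolding Cinf_on_def by (metis Ck_on.simps(2))
  then obtain D where D: "\<And>k x. x \<in> S \<Longrightarrow> (f has_derivative D k x) (at x within S)"
    "\<And>k v. Ck_on k S (\<lambda>x. D k x v)" by metis
  have D0: "D k x = D 0 x" if "x \<in> S" for k x
    by (rule frechet_derivative_unique_within[OF D(1)[OF that] D(1)[OF that]])
      (use assms(1) that in \<open>auto simp: axis_thick_def\<close>)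
  have "Ck_on k S (\<lambda>x. D 0 x v)" for k v
    by (rule Ck_on_cong[OF D(2)[of k v]]) (rule fun_cong[OF D0])
  then show thesis using that D(1) unfolding Cinf_on_def by blast
qed

lemma Cinf_on_const [simp]: "Cinf_on S (\<lambda>x. c)"
  by (simp add: Cinf_on_def)

lemma Cinf_on_bounded_linear: "bounded_linear L \<Longrightarrow> Cinf_on S L"
  by (simp add: Cinf_on_def Ck_on_bounded_linear)

lemma Cinf_on_bounded_bilinear:
  "bounded_bilinear P \<Longrightarrow> Cinf_on S f \<Longrightarrow> Cinf_on S g \<Longrightarrow> Cinf_on S (\<lambda>x. P (f x) (g x))"
  unfolding Cinf_on_def by (blast intro: Ck_on_bounded_bilinear)

lemma Cinf_on_sum: "(\<And>i. i \<in> I \<Longrightarrow> Cinf_on S (F i)) \<Longrightarrow> Cinf_on S (\<lambda>x. \<Sum>i\<in>I. F i x)"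
  unfolding Cinf_on_def by (blast intro: Ck_on_sum)

lemma Cinf_on_imp_continuous_on: "Cinf_on S f \<Longrightarrow> continuous_on S f"
  unfolding Cinf_on_def by (blast intro: Ck_on_imp_continuous_on)

text \<open>The mean value theorem is applied twice: along \<open>v\<close> to the difference in
  direction \<open>w\<close>, then along \<open>w\<close>. Only the parallelogram spanned at
  \<open>p\<close> has to lie in \<open>S\<close>, so \<open>p\<close> may be a boundary
  point.\<close>

lemma second_derivative_mean_value:
  fixes f :: "'a::real_normed_vector \<Rightarrow> real"
  assumes f': "\<And>x. x \<in> S \<Longrightarrow> (f has_derivative f' x) (at x within S)"
    and g': "\<And>x. x \<in> S \<Longrightarrow> ((\<lambda>x. f' x v) has_derivative g' x) (at x within S)"
    and r: "r > 0" "\<And>s t. s \<in> {0..r} \<Longrightarrow> t \<in> {0..r} \<Longrightarrow> p + s *\<^sub>R v + t *\<^sub>R w \<in> S"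
  shows "\<exists>s\<in>{0..r}. \<exists>t\<in>{0..r}.
    f (p + r *\<^sub>R v + r *\<^sub>R w) - f (p + r *\<^sub>R v) - f (p + r *\<^sub>R w) + f p
      = r * r * g' (p + s *\<^sub>R v + t *\<^sub>R w) w"
proof -
  have line: "((\<lambda>s. F (q + s *\<^sub>R u)) has_derivative (\<lambda>h. h * F' (q + s *\<^sub>R u) u)) (at s within {0..r})"
    if "\<And>x. x \<in> S \<Longrightarrow> (F has_derivative F' x) (at x within S)"
      "\<And>s. s \<in> {0..r} \<Longrightarrow> q + s *\<^sub>R u \<in> S" "s \<in> {0..r}" for F :: "'a \<Rightarrow> real" and F' q u s
  proof -
    have "(F has_derivative F' (q + s *\<^sub>R u)) (at (q + s *\<^sub>R u) within (\<lambda>s. q + s *\<^sub>R u) ` {0..r})"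
      using that by (intro has_derivative_subset[OF that(1)]) auto
    then have "((\<lambda>s. F (q + s *\<^sub>R u)) has_derivative (\<lambda>h. F' (q + s *\<^sub>R u) (h *\<^sub>R u))) (at s within {0..r})"
      by (rule has_derivative_in_compose[where f="\<lambda>s. q + s *\<^sub>R u", rotated])
        (auto intro!: derivative_eq_intros)
    moreover have "linear (F' (q + s *\<^sub>R u))"
      using that(1)[OF that(2)[OF that(3)]] has_derivative_linear by blast
    ultimately show ?thesis by (simp add: linear_cmul)
  qed
  define h where "h s = f ((p + r *\<^sub>R w) + s *\<^sub>R v) - f (p + s *\<^sub>R v)" for s
  have "(h has_derivative (\<lambda>k. k * f' ((p + r *\<^sub>R w) + s *\<^sub>R v) v - k * f' (p + s *\<^sub>R v) v)) (at s within {0..r})"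
    if "s \<in> {0..r}" for s
    unfolding h_def using r(1) that r(2)[of _ r] r(2)[of _ 0]
    by (intro has_derivative_diff line[OF f']) (auto simp: add.commute add.left_commute)
  from mvt_simple[OF r(1) this] obtain s where s: "s \<in> {0<..<r}"
    "h r - h 0 = (r - 0) * f' ((p + r *\<^sub>R w) + s *\<^sub>R v) v - (r - 0) * f' (p + s *\<^sub>R v) v" by auto
  define k where "k t = f' ((p + s *\<^sub>R v) + t *\<^sub>R w) v" for t
  have "(k has_derivative (\<lambda>h. h * g' ((p + s *\<^sub>R v) + t *\<^sub>R w) w)) (at t within {0..r})"
    if "t \<in> {0..r}" for t
    unfolding k_def using s(1) that r(2)[of s] by (intro line[OF g']) auto
  from mvt_simple[OF r(1) this] obtain t where t: "t \<in> {0<..<r}"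
    "k r - k 0 = (r - 0) * g' ((p + s *\<^sub>R v) + t *\<^sub>R w) w" by auto
  have "f (p + r *\<^sub>R v + r *\<^sub>R w) - f (p + r *\<^sub>R v) - f (p + r *\<^sub>R w) + f p = h r - h 0"
    by (simp add: h_def algebra_simps)
  also have "\<dots> = r * (k r - k 0)"
    using s(2) by (simp add: k_def algebra_simps)
  finally show ?thesis using t s by (intro bexI[of _ s] bexI[of _ t]) auto
qed

text \<open>Both mixed derivatives are limits of the same second differences, taken over
  parallelograms of side \<open>r / (n + 1)\<close>. Continuity is used within \<open>S\<close>
  only, so the result reaches the boundary times of the slab.\<close>

lemma second_derivative_symmetric_real:
  fixes f :: "'a::real_normed_vector \<Rightarrow> real"
  assumes f': "\<And>x. x \<in> S \<Longrightarrow> (f has_derivative f' x) (at x within S)"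
    and g': "\<And>x. x \<in> S \<Longrightarrow> ((\<lambda>x. f' x v) has_derivative g' x) (at x within S)"
    and h': "\<And>x. x \<in> S \<Longrightarrow> ((\<lambda>x. f' x w) has_derivative h' x) (at x within S)"
    and cont: "continuous_on S (\<lambda>x. g' x w)" "continuous_on S (\<lambda>x. h' x v)"
    and r: "r > 0" "\<And>s t. s \<in> {0..r} \<Longrightarrow> t \<in> {0..r} \<Longrightarrow> p + s *\<^sub>R v + t *\<^sub>R w \<in> S"
  shows "g' p w = h' p v"
proof -
  define \<rho> where "\<rho> n = r / real (Suc n)" for n
  have \<rho>: "\<rho> n > 0" "\<rho> n \<le> r" for n using r(1) by (auto simp: \<rho>_def field_simps)
  have "\<forall>n. \<exists>s t. s \<in> {0..\<rho> n} \<and> t \<in> {0..\<rho> n} \<and>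
      f (p + \<rho> n *\<^sub>R v + \<rho> n *\<^sub>R w) - f (p + \<rho> n *\<^sub>R v) - f (p + \<rho> n *\<^sub>R w) + f p
      = \<rho> n * \<rho> n * g' (p + s *\<^sub>R v + t *\<^sub>R w) w"
  proof
    fix n
    have "p + s *\<^sub>R v + t *\<^sub>R w \<in> S" if "s \<in> {0..\<rho> n}" "t \<in> {0..\<rho> n}" for s t
      using that r(2)[of s t] \<rho>(2)[of n] by auto
    from second_derivative_mean_value[OF f' g' \<rho>(1) this] show "\<exists>s t. s \<in> {0..\<rho> n} \<and> t \<in> {0..\<rho> n} \<and>
      f (p + \<rho> n *\<^sub>R v + \<rho> n *\<^sub>R w) - f (p + \<rho> n *\<^sub>R v) - f (p + \<rho> n *\<^sub>R w) + f p
      = \<rho> n * \<rho> n * g' (p + s *\<^sub>R v + t *\<^sub>R w) w" by blast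
  qed
  then obtain s t where st: "\<And>n. s n \<in> {0..\<rho> n}" "\<And>n. t n \<in> {0..\<rho> n}"
      "\<And>n. f (p + \<rho> n *\<^sub>R v + \<rho> n *\<^sub>R w) - f (p + \<rho> n *\<^sub>R v) - f (p + \<rho> n *\<^sub>R w) + f p
      = \<rho> n * \<rho> n * g' (p + s n *\<^sub>R v + t n *\<^sub>R w) w" by metis
  have "\<forall>n. \<exists>s t. s \<in> {0..\<rho> n} \<and> t \<in> {0..\<rho> n} \<and>
      f (p + \<rho> n *\<^sub>R w + \<rho> n *\<^sub>R v) - f (p + \<rho> n *\<^sub>R w) - f (p + \<rho> n *\<^sub>R v) + f p
      = \<rho> n * \<rho> n * h' (p + s *\<^sub>R w + t *\<^sub>R v) v"
  proof
    fix n
    have "p + s *\<^sub>R w + t *\<^sub>R v \<in> S" if "s \<in> {0..\<rho> n}" "t \<in> {0..\<rho> n}" for s t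
      using that r(2)[of t s] \<rho>(2)[of n] by (auto simp: add.assoc add.commute[of "_ *\<^sub>R v"])
    from second_derivative_mean_value[OF f' h' \<rho>(1) this] show "\<exists>s t. s \<in> {0..\<rho> n} \<and> t \<in> {0..\<rho> n} \<and>
      f (p + \<rho> n *\<^sub>R w + \<rho> n *\<^sub>R v) - f (p + \<rho> n *\<^sub>R w) - f (p + \<rho> n *\<^sub>R v) + f p
      = \<rho> n * \<rho> n * h' (p + s *\<^sub>R w + t *\<^sub>R v) v" by blast
  qed
  then obtain s' t' where st': "\<And>n. s' n \<in> {0..\<rho> n}" "\<And>n. t' n \<in> {0..\<rho> n}"
      "\<And>n. f (p + \<rho> n *\<^sub>R w + \<rho> n *\<^sub>R v) - f (p + \<rho> n *\<^sub>R w) - f (p + \<rho> n *\<^sub>R v) + f p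
      = \<rho> n * \<rho> n * h' (p + s' n *\<^sub>R w + t' n *\<^sub>R v) v" by metis
  have \<rho>0: "\<rho> \<longlonglongrightarrow> 0"
    unfolding \<rho>_def using LIMSEQ_Suc[OF lim_const_over_n[of r]] by simp
  have lim0: "x \<longlonglongrightarrow> 0" if "\<And>n. x n \<in> {0..\<rho> n}" for x
    by (rule tendsto_sandwich[OF _ _ tendsto_const \<rho>0]) (use that in auto)
  have eq: "g' (p + s n *\<^sub>R v + t n *\<^sub>R w) w = h' (p + t' n *\<^sub>R v + s' n *\<^sub>R w) v" for n
  proof -
    have "\<rho> n * \<rho> n * g' (p + s n *\<^sub>R v + t n *\<^sub>R w) w = \<rho> n * \<rho> n * h' (p + s' n *\<^sub>R w + t' n *\<^sub>R v) v"
      unfolding st(3)[symmetric] st'(3)[symmetric] by (simp add: algebra_simps)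
    with \<rho>(1)[of n] show ?thesis by (simp add: algebra_simps)
  qed
  have inS: "x \<in> {0..\<rho> n} \<Longrightarrow> y \<in> {0..\<rho> n} \<Longrightarrow> p + x *\<^sub>R v + y *\<^sub>R w \<in> S" for n x y
    using r(2)[of x y] \<rho>(2)[of n] by auto
  have pS: "p \<in> S" using r(2)[of 0 0] r(1) by simp
  have limp: "(\<lambda>n. p + x n *\<^sub>R v + y n *\<^sub>R w) \<longlonglongrightarrow> p"
    if "\<And>n. x n \<in> {0..\<rho> n}" "\<And>n. y n \<in> {0..\<rho> n}" for x y
  proof -
    have "(\<lambda>n. p + x n *\<^sub>R v + y n *\<^sub>R w) \<longlonglongrightarrow> p + 0 *\<^sub>R v + 0 *\<^sub>R w"
      by (intro tendsto_intros lim0 that)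
    then show ?thesis by simp
  qed
  have lim: "(\<lambda>n. F (p + x n *\<^sub>R v + y n *\<^sub>R w)) \<longlonglongrightarrow> F p"
    if "\<And>n. x n \<in> {0..\<rho> n}" "\<And>n. y n \<in> {0..\<rho> n}" "continuous_on S F" for x y and F :: "'a \<Rightarrow> real"
    using inS[OF that(1,2)] limp[OF that(1,2)]
    by (intro continuous_on_tendsto_compose[OF that(3) _ pS]) (auto intro!: always_eventually)
  from lim[OF st(1,2) cont(1)] lim[OF st'(2,1) cont(2)] show ?thesis
    unfolding eq using LIMSEQ_unique by blast
qed

lemma second_derivative_symmetric:
  fixes f :: "'a::real_normed_vector \<Rightarrow> 'b::euclidean_space"
  assumes f': "\<And>x. x \<in> S \<Longrightarrow> (f has_derivative f' x) (at x within S)"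
    and g': "\<And>x. x \<in> S \<Longrightarrow> ((\<lambda>x. f' x v) has_derivative g' x) (at x within S)"
    and h': "\<And>x. x \<in> S \<Longrightarrow> ((\<lambda>x. f' x w) has_derivative h' x) (at x within S)"
    and cont: "continuous_on S (\<lambda>x. g' x w)" "continuous_on S (\<lambda>x. h' x v)"
    and r: "r > 0" "\<And>s t. s \<in> {0..r} \<Longrightarrow> t \<in> {0..r} \<Longrightarrow> p + s *\<^sub>R v + t *\<^sub>R w \<in> S"
  shows "g' p w = h' p v"
proof (rule euclidean_eqI)
  fix i :: 'b
  show "g' p w \<bullet> i = h' p v \<bullet> i"
    by (rule second_derivative_symmetric_real[where f="\<lambda>x. f x \<bullet> i" and f'="\<lambda>x v. f' x v \<bullet> i" and g'="\<lambda>x v. g' x v \<bullet> i"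
          and h'="\<lambda>x v. h' x v \<bullet> i" and S=S and r=r])
      (use assms in \<open>auto intro!: has_derivative_inner_left continuous_intros\<close>)
qed

subsection \<open>The left-invariant frame of the 3-sphere\<close>

text \<open>\<open>J 1\<close>, \<open>J 2\<close>, \<open>J 3\<close> are the left multiplications by the quaternion units.\<close>

definition J :: "3 \<Rightarrow> real^4 \<Rightarrow> real^4" where
  "J a x = (\<chi> i.
     if a = 1 then (if i = 1 then - x$2 else if i = 2 then x$1 else if i = 3 then - x$4 else x$3)
     else if a = 2 then (if i = 1 then - x$3 else if i = 2 then x$4 else if i = 3 then x$1 else - x$2)
     else (if i = 1 then - x$4 else if i = 2 then - x$3 else if i = 3 then x$2 else x$1))"

text \<open>The Levi-Civita symbol; it yields both the commutators of the frame fields and the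
  connection coefficients.\<close>

definition eps :: "3 \<Rightarrow> 3 \<Rightarrow> 3 \<Rightarrow> real" where
  "eps a b c = (if (a, b, c) \<in> {(1,2,3), (2,3,1), (3,1,2)} then 1
                else if (a, b, c) \<in> {(2,1,3), (3,2,1), (1,3,2)} then - 1 else 0)"

text \<open>The quaternion product \<open>y x\<close>, the first coordinate being the real
  part.\<close>

definition qmul :: "real^4 \<Rightarrow> real^4 \<Rightarrow> real^4" where
  "qmul y x = y$1 *\<^sub>R x + y$2 *\<^sub>R J 1 x + y$3 *\<^sub>R J 2 x + y$4 *\<^sub>R J 3 x"

lemma three_distinct [simp]: "(1::3) \<noteq> 2" "(2::3) \<noteq> 1" "(1::3) \<noteq> 3" "(3::3) \<noteq> 1" "(2::3) \<noteq> 3" "(3::3) \<noteq> 2"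
  by simp_all

lemma J_comp [simp]:
  "J 1 x $ 1 = - x$2" "J 1 x $ 2 = x$1" "J 1 x $ 3 = - x$4" "J 1 x $ 4 = x$3"
  "J 2 x $ 1 = - x$3" "J 2 x $ 2 = x$4" "J 2 x $ 3 = x$1" "J 2 x $ 4 = - x$2"
  "J 3 x $ 1 = - x$4" "J 3 x $ 2 = - x$3" "J 3 x $ 3 = x$2" "J 3 x $ 4 = x$1"
  by (simp_all add: J_def)

lemma all3: "P 1 \<Longrightarrow> P 2 \<Longrightarrow> P 3 \<Longrightarrow> P (a::3)"
  using exhaust_3[of a] by auto

lemma inner_4: "(x::real^4) \<bullet> y = x$1 * y$1 + x$2 * y$2 + x$3 * y$3 + x$4 * y$4"
  by (simp add: inner_vec_def sum_4)

lemma linear_J: "linear (J a)"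
  by (rule all3[of _ a]) (auto intro!: linearI simp: vec_eq_iff forall_4)

lemma bounded_linear_J: "bounded_linear (J a)"
  using linear_J linear_conv_bounded_linear by blast

lemmas J_linear_simps [simp] = linear_add[OF linear_J] linear_diff[OF linear_J] linear_cmul[OF linear_J]
  linear_0[OF linear_J] linear_neg[OF linear_J]

lemma J_orthonormal: "J a x \<bullet> J b x = (if a = b then x \<bullet> x else 0)"
  by (rule all3[of _ a]; rule all3[of _ b]; simp add: inner_4)

lemma J_inner_self [simp]: "J a x \<bullet> x = 0" "x \<bullet> J a x = 0"
  by (rule all3[of _ a]; simp add: inner_4)+

lemma norm_J [simp]: "norm (J a x) = norm x"
  by (simp add: norm_eq_sqrt_inner J_orthonormal)

text \<open>The vectors \<open>x\<close> and \<open>J a x\<close> are mutually orthogonal and of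
  equal length. Multiplying by \<open>x . x\<close> instead of dividing makes this a polynomial
  identity, valid also at 0.\<close>

lemma J_expand: "(x \<bullet> x) *\<^sub>R v = (v \<bullet> x) *\<^sub>R x + (\<Sum>a\<in>UNIV. (v \<bullet> J a x) *\<^sub>R J a x)"
  unfolding vec_eq_iff forall_4 sum_3 by (simp add: inner_4 algebra_simps)

lemma J_J: "J a (J b x) = (\<Sum>c\<in>UNIV. eps a b c *\<^sub>R J c x) - (if a = b then x else 0)"
  unfolding vec_eq_iff forall_4 sum_3
  by (rule all3[of _ a]; rule all3[of _ b]; simp add: eps_def)

lemma eps_antisym: "eps a b c = - eps b a c" "eps a b c = - eps a c b" "eps a b c = - eps c b a"
  by (rule all3[of _ a]; rule all3[of _ b]; rule all3[of _ c]; simp add: eps_def)+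

lemma eps_same [simp]: "eps a a b = 0" "eps a b a = 0" "eps b a a = 0"
  by (rule all3[of _ a]; rule all3[of _ b]; simp add: eps_def)+

lemma J_inner_J_J: "J a x \<bullet> J c (J b x) = eps c b a * (x \<bullet> x)"
  unfolding J_J inner_diff_right inner_sum_right inner_scaleR_right J_orthonormal
  by (simp add: if_distrib[of "\<lambda>u. _ * u"] cong: if_cong)

lemma bilinear_qmul: "bounded_bilinear qmul"
proof -
  have "bilinear qmul"
    unfolding bilinear_def
    by (auto intro!: linearI simp: qmul_def algebra_simps)
  then show ?thesis using bilinear_conv_bounded_bilinear by blast
qed

lemma inner_qmul: "qmul y x \<bullet> qmul y z = (y \<bullet> y) * (x \<bullet> z)" "qmul y x \<bullet> qmul z x = (y \<bullet> z) * (x \<bullet> x)"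
  unfolding inner_4 qmul_def by (simp_all, algebra+)

lemma norm_qmul: "norm (qmul y x) = norm y * norm x"
  by (simp add: norm_eq_sqrt_inner inner_qmul real_sqrt_mult)

subsection \<open>Smooth functions and the frame derivatives\<close>

definition ext :: "(real^4 \<Rightarrow> 'v) \<Rightarrow> real^4 \<Rightarrow> 'v" where
  "ext f x = f (x /\<^sub>R norm x)"

lemma ext_S3 [simp]: "x \<in> S3 \<Longrightarrow> ext f x = f x"
  by (simp add: ext_def)

lemma normalize_S3 [simp]: "x \<noteq> 0 \<Longrightarrow> x /\<^sub>R norm x \<in> S3"
  by (simp add: dist_norm)

lemma S3_nonzero [simp]: "x \<in> S3 \<Longrightarrow> x \<noteq> 0"
  by auto

lemma S3_inner [simp]: "x \<in> S3 \<Longrightarrow> x \<bullet> x = 1"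
  by (simp add: dot_square_norm)

lemma ext_scale: "c > 0 \<Longrightarrow> ext f (c *\<^sub>R x) = ext f x"
  by (simp add: ext_def inverse_eq_divide)

lemma smooth_S3_Cinf: "smooth_S3 f \<longleftrightarrow> Cinf_on (- {0}) (ext f)"
  by (simp add: smooth_S3_def Cinf_on_def ext_def[abs_def])

lemma ext_eq: "(\<And>x. x \<in> S3 \<Longrightarrow> f x = g x) \<Longrightarrow> x \<noteq> 0 \<Longrightarrow> ext f x = ext g x"
  unfolding ext_def using normalize_S3 by blast

lemma smooth_S3_cong: "smooth_S3 f \<Longrightarrow> (\<And>x. x \<in> S3 \<Longrightarrow> f x = g x) \<Longrightarrow> smooth_S3 g"
  unfolding smooth_S3_Cinf by (erule Cinf_on_cong) (use ext_eq in auto)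

definition extD :: "(real^4 \<Rightarrow> 'v::real_normed_vector) \<Rightarrow> real^4 \<Rightarrow> real^4 \<Rightarrow> 'v" where
  "extD f x = frechet_derivative (ext f) (at x)"

text \<open>The direction \<open>J a x\<close> scales with \<open>x\<close> while the differential
  of the extension scales inversely. The result is again constant along rays, so \<open>X\<close>
  can be iterated without extending anew.\<close>

definition X :: "3 \<Rightarrow> (real^4 \<Rightarrow> 'v::real_normed_vector) \<Rightarrow> real^4 \<Rightarrow> 'v" where
  "X a f x = extD f x (J a x)"

lemma at_within_punctured: "x \<noteq> 0 \<Longrightarrow> at x within - {0} = at (x::'a::real_normed_vector)"
  by (rule at_within_open) auto

lemma axis_thick_punctured: "axis_thick (- {0::'a::euclidean_space})"
  by (rule axis_thick_open) auto

lemma smooth_S3_extD: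
  fixes f :: "real^4 \<Rightarrow> 'v::real_normed_vector"
  assumes "smooth_S3 f"
  shows "x \<noteq> 0 \<Longrightarrow> (ext f has_derivative extD f x) (at x)"
    and "Cinf_on (- {0}) (\<lambda>x. extD f x v)"
proof -
  from Cinf_on_derivative[OF axis_thick_punctured assms[unfolded smooth_S3_Cinf]]
  obtain f' where f': "\<And>x. x \<in> - {0} \<Longrightarrow> (ext f has_derivative f' x) (at x within - {0})"
    "\<And>v. Cinf_on (- {0}) (\<lambda>x. f' x v)" by blast
  have d: "(ext f has_derivative f' x) (at x)" if "x \<noteq> 0" for x
    using f'(1)[of x] that by (simp add: at_within_punctured)
  then have e: "extD f x = f' x" if "x \<noteq> 0" for x
    unfolding extD_def using that frechet_derivative_at by metis
  show "x \<noteq> 0 \<Longrightarrow> (ext f has_derivative extD f x) (at x)" using d e by simp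
  show "Cinf_on (- {0}) (\<lambda>x. extD f x v)"
    by (rule Cinf_on_cong[OF f'(2)[of v]]) (simp add: e)
qed

lemma linear_extD: "smooth_S3 f \<Longrightarrow> x \<noteq> 0 \<Longrightarrow> linear (extD f x)"
  using smooth_S3_extD(1) has_derivative_linear by blast

lemma extD_radial:
  assumes "smooth_S3 f" "x \<noteq> 0"
  shows "extD f x x = 0"
proof -
  have "((\<lambda>t. ext f (t *\<^sub>R x)) has_derivative (\<lambda>h. extD f x (h *\<^sub>R x))) (at 1)"
    by (rule has_derivative_compose[where f="\<lambda>t. t *\<^sub>R x" and g="ext f" and x=1, simplified])
      (auto intro!: derivative_eq_intros smooth_S3_extD assms)
  moreover have "((\<lambda>t. ext f (t *\<^sub>R x)) has_derivative (\<lambda>h. 0)) (at 1)"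
  proof (rule has_derivative_transform_within_open)
    show "((\<lambda>t::real. ext f x) has_derivative (\<lambda>h. 0)) (at 1)" by simp
    show "open {0::real<..}" by simp
  qed (auto simp: ext_scale)
  ultimately have "(\<lambda>h. extD f x (h *\<^sub>R x)) = (\<lambda>h. 0)" by (rule has_derivative_unique)
  from fun_cong[OF this, of 1] show ?thesis by simp
qed

lemma extD_expand:
  assumes "smooth_S3 f" "x \<noteq> 0"
  shows "(x \<bullet> x) *\<^sub>R extD f x v = (\<Sum>a\<in>UNIV. (v \<bullet> J a x) *\<^sub>R X a f x)"
proof -
  interpret l: linear "extD f x" by (rule linear_extD[OF assms])
  have "(x \<bullet> x) *\<^sub>R extD f x v = extD f x ((v \<bullet> x) *\<^sub>R x + (\<Sum>a\<in>UNIV. (v \<bullet> J a x) *\<^sub>R J a x))"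
    unfolding J_expand[symmetric] by (simp add: l.scale)
  also have "\<dots> = (\<Sum>a\<in>UNIV. (v \<bullet> J a x) *\<^sub>R X a f x)"
    by (simp add: l.add l.scale l.sum extD_radial[OF assms] X_def)
  finally show ?thesis .
qed

lemma extD_scale:
  assumes "smooth_S3 f" "x \<noteq> 0" "c > 0"
  shows "extD f (c *\<^sub>R x) (c *\<^sub>R v) = extD f x v"
proof -
  have "((\<lambda>y. ext f (c *\<^sub>R y)) has_derivative (\<lambda>v. extD f (c *\<^sub>R x) (c *\<^sub>R v))) (at x)"
    by (rule has_derivative_compose[where g="ext f"])
      (use assms in \<open>auto intro!: derivative_eq_intros smooth_S3_extD\<close>)
  moreover have "(\<lambda>y. ext f (c *\<^sub>R y)) = ext f" by (simp add: ext_scale assms)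
  ultimately show ?thesis using smooth_S3_extD(1)[OF assms(1,2)] has_derivative_unique by metis
qed

lemma ext_X:
  assumes "smooth_S3 f" "x \<noteq> 0"
  shows "ext (X a f) x = X a f x"
  using extD_scale[OF assms, of "inverse (norm x)" "J a x"] assms(2) unfolding ext_def X_def by simp

lemma extD_cong:
  assumes "\<And>x. x \<in> S3 \<Longrightarrow> f x = g x" "x \<noteq> 0"
  shows "extD f x = extD g x"
proof -
  have eq: "ext f y = ext g y" if "y \<in> - {0}" for y
    using ext_eq[of f g y] assms(1) that by auto
  have "(ext f has_derivative D) (at x) \<longleftrightarrow> (ext g has_derivative D) (at x)" for D
    using has_derivative_transform_within_open[of "ext f" D x UNIV "- {0}" "ext g"]
      has_derivative_transform_within_open[of "ext g" D x UNIV "- {0}" "ext f"] eq assms(2) by auto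
  then show ?thesis unfolding extD_def frechet_derivative_def by simp
qed

lemma X_cong:
  "(\<And>x. x \<in> S3 \<Longrightarrow> f x = g x) \<Longrightarrow> x \<in> S3 \<Longrightarrow> X a f x = X a g x"
  unfolding X_def using extD_cong[of f g x] by simp

lemma smooth_S3_X [simp]:
  assumes "smooth_S3 f"
  shows "smooth_S3 (X a f)"
  unfolding smooth_S3_Cinf
proof (rule Cinf_on_cong)
  show "Cinf_on (- {0}) (\<lambda>x. \<Sum>e\<in>Basis. (J a x \<bullet> e) *\<^sub>R extD f x e)"
    by (rule Cinf_on_sum, rule Cinf_on_bounded_bilinear[OF bounded_bilinear_scaleR],
        rule Cinf_on_bounded_bilinear[OF bounded_bilinear_inner])
      (auto intro: smooth_S3_extD assms Cinf_on_bounded_linear bounded_linear_J)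
  fix x :: "real^4" assume "x \<in> - {0}"
  then have x: "x \<noteq> 0" by simp
  interpret l: linear "extD f x" by (rule linear_extD[OF assms x])
  have "extD f x (J a x) = extD f x (\<Sum>e\<in>Basis. (J a x \<bullet> e) *\<^sub>R e)" by (simp add: euclidean_representation)
  then show "(\<Sum>e\<in>Basis. (J a x \<bullet> e) *\<^sub>R extD f x e) = ext (X a f) x"
    by (simp add: ext_X[OF assms x] X_def l.sum l.scale)
qed

lemma smooth_S3_const [simp]: "smooth_S3 (\<lambda>x. c)"
  by (simp add: smooth_S3_def)

lemma smooth_S3_linear:
  "bounded_linear L \<Longrightarrow> smooth_S3 f \<Longrightarrow> smooth_S3 (\<lambda>x. L (f x))"
  unfolding smooth_S3_def using Ck_on_bounded_linear_compose[of L _ _ "\<lambda>x. f (x /\<^sub>R norm x)"] by blast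

lemma smooth_S3_bilinear:
  "bounded_bilinear P \<Longrightarrow> smooth_S3 f \<Longrightarrow> smooth_S3 g \<Longrightarrow> smooth_S3 (\<lambda>x. P (f x) (g x))"
  unfolding smooth_S3_def
  using Ck_on_bounded_bilinear[of P _ _ "\<lambda>x. f (x /\<^sub>R norm x)" "\<lambda>x. g (x /\<^sub>R norm x)"] by blast

lemma smooth_S3_sum [simp]:
  "(\<And>i. i \<in> I \<Longrightarrow> smooth_S3 (F i)) \<Longrightarrow> smooth_S3 (\<lambda>x. \<Sum>i\<in>I. F i x)"
  unfolding smooth_S3_def by (simp add: Ck_on_sum)

lemma smooth_S3_add [simp]: "smooth_S3 f \<Longrightarrow> smooth_S3 g \<Longrightarrow> smooth_S3 (\<lambda>x. f x + g x)"
  unfolding smooth_S3_def by (simp add: Ck_on_add)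

lemma smooth_S3_minus [simp]: "smooth_S3 f \<Longrightarrow> smooth_S3 (\<lambda>x. - f x)"
  unfolding smooth_S3_def by (simp add: Ck_on_minus)

lemma smooth_S3_diff [simp]: "smooth_S3 f \<Longrightarrow> smooth_S3 g \<Longrightarrow> smooth_S3 (\<lambda>x. f x - g x)"
  unfolding smooth_S3_def by (simp add: Ck_on_diff)

lemma smooth_S3_mult [simp]:
  "smooth_S3 f \<Longrightarrow> smooth_S3 g \<Longrightarrow> smooth_S3 (\<lambda>x. f x * g x :: 'a::real_normed_algebra)"
  by (rule smooth_S3_bilinear[OF bounded_bilinear_mult])

lemma smooth_S3_power [simp]:
  "smooth_S3 f \<Longrightarrow> smooth_S3 (\<lambda>x. f x ^ n :: 'a::real_normed_algebra_1)"
  by (induction n) simp_all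

lemma smooth_S3_scaleR [simp]: "smooth_S3 f \<Longrightarrow> smooth_S3 g \<Longrightarrow> smooth_S3 (\<lambda>x. f x *\<^sub>R g x)"
  by (rule smooth_S3_bilinear[OF bounded_bilinear_scaleR])

lemma smooth_S3_inner [simp]: "smooth_S3 f \<Longrightarrow> smooth_S3 g \<Longrightarrow> smooth_S3 (\<lambda>x. f x \<bullet> g x)"
  by (rule smooth_S3_bilinear[OF bounded_bilinear_inner])

lemma smooth_S3_ident: "smooth_S3 (\<lambda>x. x)"
  unfolding smooth_S3_def using Ck_on_normalize by auto

lemma smooth_S3_linear_map: "bounded_linear L \<Longrightarrow> smooth_S3 L"
  by (rule smooth_S3_linear[OF _ smooth_S3_ident])

lemma smooth_S3_J [simp]: "smooth_S3 (J a)"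
  by (rule smooth_S3_linear_map[OF bounded_linear_J])

lemma smooth_S3_continuous_on: "smooth_S3 f \<Longrightarrow> continuous_on S3 f"
proof -
  assume "smooth_S3 f"
  then have "continuous_on (- {0}) (ext f)" unfolding smooth_S3_Cinf by (rule Cinf_on_imp_continuous_on)
  then have "continuous_on S3 (ext f)" by (rule continuous_on_subset) auto
  then show ?thesis by (rule continuous_on_eq) simp
qed

lemma extD_eqI: "(ext f has_derivative D) (at x) \<Longrightarrow> extD f x = D"
  unfolding extD_def using frechet_derivative_at by metis

lemma X_const [simp]: "X a (\<lambda>x. c) x = 0"
proof -
  have "(ext (\<lambda>x. c) has_derivative (\<lambda>v. 0)) (at x)" unfolding ext_def[abs_def] by simp
  then show ?thesis unfolding X_def by (simp add: extD_eqI)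
qed

lemma X_linear:
  assumes "bounded_linear L" "smooth_S3 f" "x \<in> S3"
  shows "X a (\<lambda>x. L (f x)) x = L (X a f x)"
proof -
  have "(ext (\<lambda>x. L (f x)) has_derivative (\<lambda>v. L (extD f x v))) (at x)"
    using bounded_linear.has_derivative[OF assms(1) smooth_S3_extD(1)[OF assms(2) S3_nonzero[OF assms(3)]]]
    by (simp add: ext_def[abs_def])
  then show ?thesis unfolding X_def by (simp add: extD_eqI)
qed

lemma X_bilinear:
  assumes "bounded_bilinear P" "smooth_S3 f" "smooth_S3 g" "x \<in> S3"
  shows "X a (\<lambda>x. P (f x) (g x)) x = P (X a f x) (g x) + P (f x) (X a g x)"
proof -
  have x: "x \<noteq> 0" using assms(4) by simp
  have "(ext (\<lambda>x. P (f x) (g x)) has_derivative (\<lambda>v. P (ext f x) (extD g x v) + P (extD f x v) (ext g x))) (at x)"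
    using bounded_bilinear.FDERIV[OF assms(1) smooth_S3_extD(1)[OF assms(2) x] smooth_S3_extD(1)[OF assms(3) x]]
    by (simp add: ext_def[abs_def])
  then show ?thesis using assms(4) unfolding X_def by (simp add: extD_eqI)
qed

lemma X_add [simp]:
  assumes "smooth_S3 f" "smooth_S3 g" "x \<in> S3"
  shows "X a (\<lambda>x. f x + g x) x = X a f x + X a g x"
proof -
  have x: "x \<noteq> 0" using assms(3) by simp
  have "(ext (\<lambda>x. f x + g x) has_derivative (\<lambda>v. extD f x v + extD g x v)) (at x)"
    using has_derivative_add[OF smooth_S3_extD(1)[OF assms(1) x] smooth_S3_extD(1)[OF assms(2) x]]
    by (simp add: ext_def[abs_def])
  then show ?thesis unfolding X_def by (simp add: extD_eqI)
qed

lemma X_minus [simp]: "smooth_S3 f \<Longrightarrow> x \<in> S3 \<Longrightarrow> X a (\<lambda>x. - f x) x = - X a f x"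
  by (rule X_linear[OF bounded_linear_minus[OF bounded_linear_ident]])

lemma X_diff [simp]:
  "smooth_S3 f \<Longrightarrow> smooth_S3 g \<Longrightarrow> x \<in> S3 \<Longrightarrow> X a (\<lambda>x. f x - g x) x = X a f x - X a g x"
  using X_add[of f "\<lambda>x. - g x" x a] by simp

lemma X_sum [simp]:
  "(\<And>i. i \<in> I \<Longrightarrow> smooth_S3 (F i)) \<Longrightarrow> x \<in> S3 \<Longrightarrow> X a (\<lambda>x. \<Sum>i\<in>I. F i x) x = (\<Sum>i\<in>I. X a (F i) x)"
  by (induction I rule: infinite_finite_induct) simp_all

lemma X_cmult [simp]:
  "smooth_S3 f \<Longrightarrow> x \<in> S3 \<Longrightarrow> X a (\<lambda>x. c * f x) x = c * (X a f x :: 'a::real_normed_algebra)"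
  by (rule X_linear[OF bounded_linear_mult_right])

lemma X_scaleR_const [simp]:
  "smooth_S3 f \<Longrightarrow> x \<in> S3 \<Longrightarrow> X a (\<lambda>x. c *\<^sub>R f x) x = c *\<^sub>R X a f x"
  by (rule X_linear[OF bounded_linear_scaleR_right])

lemma X_mult:
  "smooth_S3 f \<Longrightarrow> smooth_S3 g \<Longrightarrow> x \<in> S3 \<Longrightarrow>
    X a (\<lambda>x. f x * g x :: 'a::real_normed_algebra) x = X a f x * g x + f x * X a g x"
  by (rule X_bilinear[OF bounded_bilinear_mult])

lemma X_inner:
  "smooth_S3 f \<Longrightarrow> smooth_S3 g \<Longrightarrow> x \<in> S3 \<Longrightarrow>
    X a (\<lambda>x. f x \<bullet> g x) x = X a f x \<bullet> g x + f x \<bullet> X a g x"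
  by (rule X_bilinear[OF bounded_bilinear_inner])

text \<open>\<open>H\<close> is the Hessian of the extension along rays. Its symmetry is all that
  the commutator relies on, so it is left abstract; the first-order term arises from differentiating
  the linear field \<open>J b\<close>.\<close>

lemma X_X_eq:
  fixes f :: "real^4 \<Rightarrow> 'v::euclidean_space"
  assumes f: "smooth_S3 f"
  obtains H where "\<And>x u v. x \<noteq> 0 \<Longrightarrow> H x u v = H x v u"
    "\<And>x a b. x \<noteq> 0 \<Longrightarrow> X a (X b f) x = extD f x (J b (J a x)) + H x (J a x) (J b x)"
proof -
  have "\<exists>h. (\<forall>x. x \<noteq> 0 \<longrightarrow> ((\<lambda>x. extD f x v) has_derivative h x) (at x within - {0})) \<and> (\<forall>w. Cinf_on (- {0}) (\<lambda>x. h x w))" for v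
    by (rule Cinf_on_derivative[OF axis_thick_punctured smooth_S3_extD(2)[OF f, of v]]) (rule exI, auto)
  then obtain h where h: "\<And>v x. x \<noteq> 0 \<Longrightarrow> ((\<lambda>x. extD f x v) has_derivative h v x) (at x within - {0})"
    "\<And>v w. Cinf_on (- {0}) (\<lambda>x. h v x w)" by metis
  have sym: "h v x w = h w x v" if x: "x \<noteq> 0" for v w x
  proof -
    \<comment> \<open>Small enough for the parallelogram spanned by \<open>v\<close> and
      \<open>w\<close> at \<open>x\<close> to avoid the origin.\<close>
    define r where "r = norm x / (2 * (norm v + norm w + 1))"
    have pos: "norm v + norm w + 1 > 0" by (smt (verit) norm_ge_zero)
    have r: "r > 0" unfolding r_def using x pos by simp
    have nz: "x + s *\<^sub>R v + t *\<^sub>R w \<in> - {0}" if "s \<in> {0..r}" "t \<in> {0..r}" for s t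
    proof -
      have "norm (s *\<^sub>R v + t *\<^sub>R w) \<le> r * norm v + r * norm w"
        using that by (intro norm_triangle_le add_mono) (auto simp: mult_right_mono)
      also have "\<dots> \<le> r * (norm v + norm w + 1)" using r by (simp add: algebra_simps)
      also have "\<dots> = norm x / 2" unfolding r_def using pos by (simp add: field_simps del: distrib_left_numeral)
      also have "\<dots> < norm x" using x by simp
      finally have "s *\<^sub>R v + t *\<^sub>R w \<noteq> - x" by auto
      then show ?thesis by (simp add: add.assoc add_eq_0_iff)
    qed
    show ?thesis
      by (rule second_derivative_symmetric[where S="- {0}" and f="ext f" and f'="extD f", OF _ h(1) h(1) _ _ r nz])
        (use h(2) smooth_S3_extD(1)[OF f] in \<open>auto intro: Cinf_on_imp_continuous_on has_derivative_at_withinI\<close>)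
  qed
  \<comment> \<open>Smoothness provides second derivatives for fixed first directions
    \<open>e\<close>; linearity in that direction is built in by expanding \<open>v\<close> in the
    standard basis.\<close>
  define H where "H x u v = (\<Sum>e\<in>Basis. (v \<bullet> e) *\<^sub>R h e x u)" for x u v
  have lin: "linear (h e x)" if "x \<noteq> 0" for e x using h(1)[OF that] has_derivative_linear by blast
  have Hexp: "H x u v = (\<Sum>e\<in>Basis. \<Sum>e'\<in>Basis. ((v \<bullet> e) * (u \<bullet> e')) *\<^sub>R h e x e')" if "x \<noteq> 0" for x u v
  proof -
    have "h e x u = (\<Sum>e'\<in>Basis. (u \<bullet> e') *\<^sub>R h e x e')" for e
    proof -
      interpret l: linear "h e x" by (rule lin[OF that])
      have "h e x u = h e x (\<Sum>e'\<in>Basis. (u \<bullet> e') *\<^sub>R e')" by (simp add: euclidean_representation)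
      then show ?thesis by (simp add: l.sum l.scale)
    qed
    then show ?thesis unfolding H_def by (simp add: scaleR_sum_right)
  qed
  have Hsym: "H x u v = H x v u" if "x \<noteq> 0" for x u v
    unfolding Hexp[OF that] by (subst sum.swap) (simp add: sym[OF that] mult.commute)
  have "X a (X b f) x = extD f x (J b (J a x)) + H x (J a x) (J b x)" if x: "x \<noteq> 0" for x a b
  proof -
    interpret l: linear "extD f x" by (rule linear_extD[OF f x])
    have *: "((\<lambda>y. \<Sum>e\<in>Basis. (J b y \<bullet> e) *\<^sub>R extD f y e) has_derivative
       (\<lambda>v. \<Sum>e\<in>Basis. (J b x \<bullet> e) *\<^sub>R h e x v + (J b v \<bullet> e) *\<^sub>R extD f x e)) (at x)"
      using h(1)[OF x] x
      by (intro has_derivative_sum has_derivative_scaleR has_derivative_inner_left bounded_linear_imp_has_derivative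
          bounded_linear_J) (simp add: at_within_punctured)
    have "(ext (X b f) has_derivative
       (\<lambda>v. \<Sum>e\<in>Basis. (J b x \<bullet> e) *\<^sub>R h e x v + (J b v \<bullet> e) *\<^sub>R extD f x e)) (at x)"
    proof (rule has_derivative_transform_within_open[OF *, of "- {0}"])
      fix y :: "real^4" assume "y \<in> - {0}"
      then have y: "y \<noteq> 0" by simp
      interpret ly: linear "extD f y" by (rule linear_extD[OF f y])
      have "extD f y (J b y) = extD f y (\<Sum>e\<in>Basis. (J b y \<bullet> e) *\<^sub>R e)" by (simp add: euclidean_representation)
      then show "(\<Sum>e\<in>Basis. (J b y \<bullet> e) *\<^sub>R extD f y e) = ext (X b f) y"
        by (simp add: ext_X[OF f y] X_def ly.sum ly.scale)
    qed (use x in auto)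
    then have "X a (X b f) x = (\<Sum>e\<in>Basis. (J b x \<bullet> e) *\<^sub>R h e x (J a x)) + (\<Sum>e\<in>Basis. (J b (J a x) \<bullet> e) *\<^sub>R extD f x e)"
      unfolding X_def[of a] by (simp add: extD_eqI sum.distrib)
    also have "(\<Sum>e\<in>Basis. (J b (J a x) \<bullet> e) *\<^sub>R extD f x e) = extD f x (J b (J a x))"
      by (metis (no_types, lifting) euclidean_representation l.scale l.sum sum.cong)
    finally show ?thesis unfolding H_def by simp
  qed
  with Hsym that show thesis by blast
qed

text \<open>The Hessian parts cancel. Differentiating first along \<open>J b\<close> and then along
  \<open>J a\<close> produces the matrices in the reversed order \<open>J b (J a x)\<close>, whence
  the minus sign in front of the quaternion relations.\<close>

lemma X_commutator:
  fixes f :: "real^4 \<Rightarrow> 'v::euclidean_space"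
  assumes f: "smooth_S3 f" and x: "x \<in> S3"
  shows "X a (X b f) x = X b (X a f) x - 2 *\<^sub>R (\<Sum>c\<in>UNIV. eps a b c *\<^sub>R X c f x)"
proof -
  have x0: "x \<noteq> 0" using x by simp
  obtain H where H: "\<And>x u v. x \<noteq> 0 \<Longrightarrow> H x u v = H x v u"
    "\<And>x a b. x \<noteq> 0 \<Longrightarrow> X a (X b f) x = extD f x (J b (J a x)) + H x (J a x) (J b x)"
    using X_X_eq[OF f] by blast
  interpret l: linear "extD f x" by (rule linear_extD[OF f x0])
  have "X a (X b f) x - X b (X a f) x = extD f x (J b (J a x) - J a (J b x))"
    using H x0 by (simp add: l.diff)
  also have "J b (J a x) - J a (J b x) = - (2 *\<^sub>R (\<Sum>c\<in>UNIV. eps a b c *\<^sub>R J c x))"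
    unfolding J_J using eps_antisym(1)[of b a]
    by (simp add: sum_negf scaleR_2 if_split_eq1)
  also have "extD f x \<dots> = - (2 *\<^sub>R (\<Sum>c\<in>UNIV. eps a b c *\<^sub>R X c f x))"
    by (simp add: l.neg l.scale l.sum X_def)
  finally show ?thesis by (simp add: algebra_simps)
qed

text \<open>The sum of squares of an orthonormal frame, which is also the Casimir operator of the
  rotations generated by the \<open>J a\<close>; \<open>laplacian_scalar\<close> identifies it with
  the Laplacian of the metric.\<close>

definition lap :: "(real^4 \<Rightarrow> 'v::real_normed_vector) \<Rightarrow> real^4 \<Rightarrow> 'v" where
  "lap f x = (\<Sum>a\<in>UNIV. X a (X a f) x)"

lemma smooth_S3_lap [simp]: "smooth_S3 f \<Longrightarrow> smooth_S3 (lap f)"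
  unfolding lap_def by simp

lemma lap_cong: "(\<And>x. x \<in> S3 \<Longrightarrow> f x = g x) \<Longrightarrow> x \<in> S3 \<Longrightarrow> lap f x = lap g x"
  unfolding lap_def by (intro sum.cong X_cong) auto

text \<open>A Casimir operator commutes with its algebra: the commutator is a sum of
  \<open>eps b a c\<close> against second derivatives symmetrized in \<open>a\<close> and
  \<open>c\<close>, and such a sum equals its own negative.\<close>

lemma X_lap:
  fixes f :: "real^4 \<Rightarrow> 'v::euclidean_space"
  assumes f: "smooth_S3 f" and x: "x \<in> S3"
  shows "X b (lap f) x = lap (X b f) x"
proof -
  have 1: "X b (X a (X a f)) x = X a (X a (X b f)) x - 2 *\<^sub>R (\<Sum>c\<in>UNIV. eps b a c *\<^sub>R (X a (X c f) x + X c (X a f) x))" for a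
  proof -
    have "X b (X a (X a f)) x = X a (X b (X a f)) x - 2 *\<^sub>R (\<Sum>c\<in>UNIV. eps b a c *\<^sub>R X c (X a f) x)"
      by (rule X_commutator) (use f x in auto)
    also have "X a (X b (X a f)) x = X a (\<lambda>x. X a (X b f) x - 2 *\<^sub>R (\<Sum>c\<in>UNIV. eps b a c *\<^sub>R X c f x)) x"
      by (rule X_cong[OF X_commutator]) (use f x in auto)
    also have "\<dots> = X a (X a (X b f)) x - 2 *\<^sub>R (\<Sum>c\<in>UNIV. eps b a c *\<^sub>R X a (X c f) x)"
      using f x by simp
    finally show ?thesis by (simp add: algebra_simps sum.distrib)
  qed
  have 0: "(\<Sum>a\<in>UNIV. \<Sum>c\<in>UNIV. eps b a c *\<^sub>R (X a (X c f) x + X c (X a f) x)) = 0" (is "?S = 0")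
  proof -
    have "?S = (\<Sum>c\<in>UNIV. \<Sum>a\<in>UNIV. eps b a c *\<^sub>R (X a (X c f) x + X c (X a f) x))" by (rule sum.swap)
    also have "\<dots> = - ?S"
      unfolding sum_negf[symmetric] scaleR_minus_left[symmetric]
      by (intro sum.cong refl) (subst eps_antisym(2), simp add: add.commute)
    finally have "2 *\<^sub>R ?S = 0" unfolding scaleR_2 by (rule eq_neg_iff_add_eq_0[THEN iffD1])
    then show ?thesis by simp
  qed
  have "X b (lap f) x = (\<Sum>a\<in>UNIV. X b (X a (X a f)) x)"
    unfolding lap_def[abs_def] using f x by simp
  also have "\<dots> = lap (X b f) x - 2 *\<^sub>R (\<Sum>a\<in>UNIV. \<Sum>c\<in>UNIV. eps b a c *\<^sub>R (X a (X c f) x + X c (X a f) x))"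
    unfolding 1 lap_def by (simp add: sum_subtractf scaleR_sum_right)
  finally show ?thesis unfolding 0 by simp
qed

subsection \<open>Integration over the 3-sphere\<close>

lemmas continuous_on_J [continuous_intros] = bounded_linear.continuous_on[OF bounded_linear_J]

lemma sets_S3_measure [measurable_cong]: "sets S3_measure = sets (restrict_space borel S3)"
  by (simp add: S3_measure_def)

lemma space_S3_measure [simp]: "space S3_measure = S3"
  by (simp add: S3_measure_def space_restrict_space)

lemma measurable_normalize:
  "(\<lambda>x::real^4. x /\<^sub>R norm x) \<in> restrict_space lborel (ball 0 1 - {0}) \<rightarrow>\<^sub>M restrict_space borel S3"
proof (rule measurable_restrict_space2)
  show "(\<lambda>x. x /\<^sub>R norm x) \<in> space (restrict_space lborel (ball 0 1 - {0})) \<rightarrow> S3"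
    by (auto simp: space_restrict_space)
  show "(\<lambda>x. x /\<^sub>R norm x) \<in> restrict_space lborel (ball 0 1 - {0}) \<rightarrow>\<^sub>M borel"
    by (rule measurable_restrict_space1) measurable
qed

lemma measurable_ext:
  assumes "f \<in> borel_measurable (restrict_space borel S3)"
  shows "(\<lambda>x. if x = 0 then c else ext f x) \<in> borel_measurable (borel :: (real^4) measure)"
proof -
  have "(\<lambda>x::real^4. x /\<^sub>R norm x) \<in> restrict_space borel (- {0}) \<rightarrow>\<^sub>M restrict_space borel S3"
    by (intro measurable_restrict_space2 measurable_restrict_space1) (auto simp: space_restrict_space)
  from measurable_compose[OF this assms]
  have "ext f \<in> borel_measurable (restrict_space borel (- {0}))" unfolding ext_def[abs_def] .
  then have "(\<lambda>x. if x \<in> {0} then c else ext f x) \<in> borel_measurable borel"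
    by (subst measurable_If_restrict_space_iff) (auto simp: Compl_eq)
  then show ?thesis by simp
qed

lemma measurable_ext_continuous:
  assumes "continuous_on (- {0}) (F :: real^4 \<Rightarrow> 'b::{topological_space})"
  shows "(\<lambda>x. if x = 0 then c else F x) \<in> borel_measurable borel"
proof -
  have "F \<in> borel_measurable (restrict_space borel (- {0}))"
    by (rule borel_measurable_continuous_on_restrict[OF assms])
  then have "(\<lambda>x. if x \<in> {0} then c else F x) \<in> borel_measurable borel"
    by (subst measurable_If_restrict_space_iff) (auto simp: Compl_eq)
  then show ?thesis by simp
qed

lemma nn_integral_S3:
  assumes f: "f \<in> borel_measurable (restrict_space borel S3)"
  shows "(\<integral>\<^sup>+x. f x \<partial>S3_measure) = 4 * (\<integral>\<^sup>+x. ext f x * indicator (ball 0 1 - {0}) x \<partial>lborel)"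
proof -
  have "(\<integral>\<^sup>+x. f x \<partial>S3_measure) = (\<integral>\<^sup>+x. 4 * f x \<partial>distr (restrict_space lborel (ball 0 1 - {0}))
     (restrict_space borel S3) (\<lambda>x. x /\<^sub>R norm x))"
    unfolding S3_measure_def using f by (subst nn_integral_density) auto
  also have "\<dots> = (\<integral>\<^sup>+x. 4 * ext f x \<partial>restrict_space lborel (ball 0 1 - {0}))"
    unfolding ext_def using f by (subst nn_integral_distr[OF measurable_normalize]) auto
  also have "\<dots> = (\<integral>\<^sup>+x. 4 * ext f x * indicator (ball 0 1 - {0}) x \<partial>lborel)"
    by (subst nn_integral_restrict_space) auto
  also have "\<dots> = (\<integral>\<^sup>+x. 4 * ((if x = 0 then 0 else ext f x) * indicator (ball 0 1 - {0}) x) \<partial>lborel)"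
    by (intro nn_integral_cong) (auto simp: indicator_def)
  also have "\<dots> = 4 * (\<integral>\<^sup>+x. (if x = 0 then 0 else ext f x) * indicator (ball 0 1 - {0}) x \<partial>lborel)"
    using measurable_ext[OF f, of 0]
    by (intro nn_integral_cmult borel_measurable_times_ennreal borel_measurable_indicator) auto
  also have "(\<integral>\<^sup>+x. (if x = 0 then 0 else ext f x) * indicator (ball 0 1 - {0}) x \<partial>lborel)
     = (\<integral>\<^sup>+x. ext f x * indicator (ball 0 1 - {0}) x \<partial>lborel)"
    by (intro nn_integral_cong) (auto simp: indicator_def)
  finally show ?thesis .
qed

text \<open>Dilation by \<open>R\<close> scales four-dimensional volume by \<open>R ^ 4\<close>; the
  1/4 undoes the normalization of the cone measure.\<close>

lemma nn_integral_ext_ball: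
  assumes f: "f \<in> borel_measurable (restrict_space borel S3)" and R: "R > 0"
  shows "(\<integral>\<^sup>+x. ext f x * indicator (ball 0 R - {0}) x \<partial>lborel) = ennreal (R ^ 4 / 4) * (\<integral>\<^sup>+x. f x \<partial>S3_measure)"
proof -
  define F where "F x = (if x = 0 then 0 else ext f x) * indicator (ball 0 R - {0}) x" for x
  have F [measurable]: "F \<in> borel_measurable borel" unfolding F_def
    using measurable_ext[OF f, of 0] by (intro borel_measurable_times_ennreal borel_measurable_indicator) auto
  have "(\<integral>\<^sup>+x. ext f x * indicator (ball 0 R - {0}) x \<partial>lborel) = (\<integral>\<^sup>+x. F x \<partial>lborel)"
    unfolding F_def by (intro nn_integral_cong) (auto simp: indicator_def)
  also have "\<dots> = (\<integral>\<^sup>+x. F x \<partial>density (distr lborel borel (\<lambda>x. 0 + R *\<^sub>R x)) (\<lambda>_. \<bar>R\<bar>^DIM(real^4)))"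
    using R by (subst lborel_affine[of R 0]) auto
  also have "\<dots> = (\<integral>\<^sup>+x. ennreal (R^4) * F (R *\<^sub>R x) \<partial>lborel)"
    using F R by (simp add: nn_integral_density nn_integral_distr)
  also have "\<dots> = ennreal (R^4) * (\<integral>\<^sup>+x. F (R *\<^sub>R x) \<partial>lborel)"
    using F by (intro nn_integral_cmult) measurable
  also have "(\<integral>\<^sup>+x. F (R *\<^sub>R x) \<partial>lborel) = (\<integral>\<^sup>+x. ext f x * indicator (ball 0 1 - {0}) x \<partial>lborel)"
    using R by (intro nn_integral_cong) (auto simp: F_def ext_scale indicator_def)
  finally have "(\<integral>\<^sup>+x. ext f x * indicator (ball 0 R - {0}) x \<partial>lborel)
     = ennreal (R^4) * (\<integral>\<^sup>+x. ext f x * indicator (ball 0 1 - {0}) x \<partial>lborel)" .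
  also have "ennreal (R^4) = ennreal (R ^ 4 / 4) * 4"
    using R by (simp add: ennreal_mult[symmetric] flip: ennreal_numeral)
  finally show ?thesis unfolding nn_integral_S3[OF f] by (simp add: mult.assoc)
qed

lemma emeasure_S3_finite: "emeasure S3_measure S3 < \<infinity>"
proof -
  have "emeasure S3_measure S3 = (\<integral>\<^sup>+x. 1 \<partial>S3_measure)"
    by simp
  also have "\<dots> = 4 * (\<integral>\<^sup>+x. indicator (ball 0 1 - {0}) (x::real^4) \<partial>lborel)"
    by (subst nn_integral_S3) (auto simp: ext_def)
  also have "\<dots> = 4 * emeasure lborel (ball 0 1 - {0::real^4})" by simp
  also have "\<dots> \<le> 4 * emeasure lborel (ball (0::real^4) 1)"
    by (intro mult_left_mono emeasure_mono) auto
  also have "\<dots> < \<infinity>"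
    using emeasure_lborel_ball_finite[of "0::real^4" 1] by (simp add: ennreal_mult_less_top)
  finally show ?thesis .
qed

interpretation S3: finite_measure S3_measure
  by standard (use emeasure_S3_finite in auto)

lemma measurable_S3_continuous:
  "continuous_on S3 f \<Longrightarrow> f \<in> borel_measurable S3_measure"
  using borel_measurable_continuous_on_restrict[of S3 f] by (simp cong: measurable_cong_sets add: sets_S3_measure)

lemma integrable_S3_continuous:
  fixes f :: "real^4 \<Rightarrow> 'v::euclidean_space"
  assumes "continuous_on S3 f"
  shows "integrable S3_measure f"
proof -
  have "compact (f ` S3)" by (intro compact_continuous_image assms compact_sphere)
  then obtain B where "\<And>x. x \<in> S3 \<Longrightarrow> norm (f x) \<le> B"
    using compact_imp_bounded bounded_iff by (metis imageI)
  then show ?thesis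
    by (intro S3.integrable_const_bound[of _ B] measurable_S3_continuous assms AE_I2) auto
qed

lemma integrable_S3_smooth [simp]:
  fixes f :: "real^4 \<Rightarrow> 'v::euclidean_space"
  shows "smooth_S3 f \<Longrightarrow> integrable S3_measure f"
  by (intro integrable_S3_continuous smooth_S3_continuous_on)

lemma integral_S3_cong:
  "(\<And>x. x \<in> S3 \<Longrightarrow> f x = g x) \<Longrightarrow> (LINT x|S3_measure. f x) = (LINT x|S3_measure. g x)"
  by (rule Bochner_Integration.integral_cong) auto

section \<open>Rotation invariance of the measure on the sphere\<close>

lemma lborel_distr_orthogonal:
  fixes U :: "real^4 \<Rightarrow> real^4"
  assumes U: "orthogonal_transformation U"
  shows "distr lborel borel U = lborel"
proof (rule lborel_eqI[symmetric])
  have lin: "linear U" using U orthogonal_transformation_linear by blast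
  have meas: "U \<in> borel_measurable borel"
    using lin linear_conv_bounded_linear linear_continuous_on borel_measurable_continuous_onI by blast
  fix l u :: "real^4" assume lu: "\<And>b. b \<in> Basis \<Longrightarrow> l \<bullet> b \<le> u \<bullet> b"
  have bij: "bij U" using U orthogonal_transformation_bij by blast
  have eq: "U -` box l u = inv U ` box l u"
    using bij by (simp add: bij_vimage_eq_inv_image)
  have o: "orthogonal_transformation (inv U)" using U orthogonal_transformation_inv by blast
  have m: "inv U ` box l u \<in> lmeasurable" "measure lebesgue (inv U ` box l u) = measure lebesgue (box l u)"
    using measurable_orthogonal_image[OF o] measure_orthogonal_image[OF o] lmeasurable_box by auto
  have "emeasure (distr lborel borel U) (box l u) = emeasure lborel (U -` box l u)"
    using meas by (subst emeasure_distr) auto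
  also have "\<dots> = emeasure lebesgue (U -` box l u)"
    using measurable_sets_borel[OF meas, of "box l u"] by simp
  also have "\<dots> = ennreal (measure lebesgue (box l u))"
    unfolding eq using m by (simp add: emeasure_eq_measure2)
  also have "\<dots> = emeasure lborel (box l u)"
    using lmeasurable_box by (simp add: emeasure_eq_measure2[symmetric])
  finally show "emeasure (distr lborel borel U) (box l u) = ennreal (\<Prod>b\<in>Basis. (u - l) \<bullet> b)"
    using lu by (simp add: emeasure_lborel_box)
qed simp

lemma measurable_orthogonal_S3:
  assumes "orthogonal_transformation U"
  shows "U \<in> S3_measure \<rightarrow>\<^sub>M S3_measure"
proof -
  have meas: "U \<in> borel_measurable borel"
    using assms orthogonal_transformation_linear linear_conv_bounded_linear linear_continuous_on
      borel_measurable_continuous_onI by blast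
  have "U \<in> restrict_space borel S3 \<rightarrow>\<^sub>M restrict_space borel S3"
    by (intro measurable_restrict_space2 measurable_restrict_space1 meas)
      (use assms in \<open>auto simp: space_restrict_space orthogonal_transformation\<close>)
  then show ?thesis by (simp cong: measurable_cong_sets add: sets_S3_measure)
qed

text \<open>An orthogonal map commutes with normalization and preserves the punctured unit ball, so
  invariance descends from Lebesgue measure to the cone measure.\<close>

lemma S3_measure_orthogonal:
  assumes U: "orthogonal_transformation U"
  shows "distr S3_measure S3_measure U = S3_measure"
proof (rule measure_eqI)
  have lin: "linear U" and nU: "\<And>x. norm (U x) = norm x"
    using U by (auto simp: orthogonal_transformation)
  have meas: "U \<in> borel_measurable borel"
    using lin linear_conv_bounded_linear linear_continuous_on borel_measurable_continuous_onI by blast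
  fix A assume "A \<in> sets (distr S3_measure S3_measure U)"
  then have A: "A \<in> sets S3_measure" by simp
  define f where "f = (indicator A :: real^4 \<Rightarrow> ennreal)"
  have f: "f \<in> borel_measurable (restrict_space borel S3)"
    unfolding f_def using A by (simp add: sets_S3_measure)
  have fU: "(\<lambda>x. f (U x)) \<in> borel_measurable (restrict_space borel S3)"
    using measurable_compose[OF measurable_orthogonal_S3[OF U], of f] f
    by (simp cong: measurable_cong_sets add: sets_S3_measure)
  define F where "F x = (if x = 0 then 0 else ext f x) * indicator (ball 0 1 - {0}) x" for x
  have F [measurable]: "F \<in> borel_measurable borel" unfolding F_def
    using measurable_ext[OF f, of 0] by (intro borel_measurable_times_ennreal borel_measurable_indicator) auto
  have "emeasure (distr S3_measure S3_measure U) A = (\<integral>\<^sup>+x. f x \<partial>distr S3_measure S3_measure U)"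
    unfolding f_def using A by simp
  also have "\<dots> = (\<integral>\<^sup>+x. f (U x) \<partial>S3_measure)"
    using f by (subst nn_integral_distr[OF measurable_orthogonal_S3[OF U]])
      (auto cong: measurable_cong_sets simp: sets_S3_measure)
  also have "\<dots> = 4 * (\<integral>\<^sup>+x. ext (\<lambda>x. f (U x)) x * indicator (ball 0 1 - {0}) x \<partial>lborel)"
    by (rule nn_integral_S3[OF fU])
  also have "(\<integral>\<^sup>+x. ext (\<lambda>x. f (U x)) x * indicator (ball 0 1 - {0}) x \<partial>lborel) = (\<integral>\<^sup>+x. F (U x) \<partial>lborel)"
  proof (rule nn_integral_cong)
    fix x :: "real^4"
    have "U (x /\<^sub>R norm x) = U x /\<^sub>R norm (U x)" using linear_cmul[OF lin] nU by simp
    moreover have "U x = 0 \<longleftrightarrow> x = 0" using nU by (metis norm_eq_zero)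
    ultimately show "ext (\<lambda>x. f (U x)) x * indicator (ball 0 1 - {0}) x = F (U x)"
      unfolding F_def ext_def using nU by (auto simp: indicator_def)
  qed
  also have "\<dots> = (\<integral>\<^sup>+x. F x \<partial>distr lborel borel U)"
    using F meas by (subst nn_integral_distr) auto
  also have "\<dots> = (\<integral>\<^sup>+x. F x \<partial>lborel)" unfolding lborel_distr_orthogonal[OF U] ..
  also have "\<dots> = (\<integral>\<^sup>+x. ext f x * indicator (ball 0 1 - {0}) x \<partial>lborel)"
    unfolding F_def by (intro nn_integral_cong) (auto simp: indicator_def)
  also have "4 * \<dots> = (\<integral>\<^sup>+x. f x \<partial>S3_measure)" by (rule nn_integral_S3[OF f, symmetric])
  also have "\<dots> = emeasure S3_measure A" unfolding f_def using A by simp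
  finally show "emeasure (distr S3_measure S3_measure U) A = emeasure S3_measure A" .
qed simp

lemma nn_integral_S3_orthogonal:
  assumes U: "orthogonal_transformation U" and f: "f \<in> borel_measurable S3_measure"
  shows "(\<integral>\<^sup>+x. f (U x) \<partial>S3_measure) = (\<integral>\<^sup>+x. f x \<partial>S3_measure)"
  using nn_integral_distr[OF measurable_orthogonal_S3[OF U], of f] f S3_measure_orthogonal[OF U] by simp

lemma integral_S3_orthogonal:
  fixes f :: "real^4 \<Rightarrow> 'v::euclidean_space"
  assumes U: "orthogonal_transformation U" and f: "f \<in> borel_measurable S3_measure"
  shows "(LINT x|S3_measure. f (U x)) = (LINT x|S3_measure. f x)"
  using integral_distr[OF measurable_orthogonal_S3[OF U] f] S3_measure_orthogonal[OF U] by simp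

lemma orthogonal_qmul_left: "norm y = 1 \<Longrightarrow> orthogonal_transformation (qmul y)"
  unfolding orthogonal_transformation using bilinear_qmul
  by (simp add: norm_qmul bounded_bilinear.bounded_linear_right bounded_linear.linear)

lemma orthogonal_qmul_right: "norm x = 1 \<Longrightarrow> orthogonal_transformation (\<lambda>y. qmul y x)"
  unfolding orthogonal_transformation using bilinear_qmul
  by (simp add: norm_qmul bounded_bilinear.bounded_linear_left bounded_linear.linear)

text \<open>On the compact product the derivative is uniformly continuous, so the linearization
  error is small uniformly in \<open>x\<close>. The argument is one-sided at the ends of the
  interval, as the boundary times of the slab demand.\<close>

lemma has_vector_derivative_integral_S3:
  fixes g :: "real \<Rightarrow> real^4 \<Rightarrow> 'v::euclidean_space"
  assumes g': "\<And>t x. t \<in> {a..b} \<Longrightarrow> x \<in> S3 \<Longrightarrow> ((\<lambda>s. g s x) has_vector_derivative g' t x) (at t within {a..b})"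
    and cont: "continuous_on ({a..b} \<times> S3) (\<lambda>p. g' (fst p) (snd p))"
    and g: "\<And>t. t \<in> {a..b} \<Longrightarrow> continuous_on S3 (g t)"
    and t: "t \<in> {a..b}"
  shows "((\<lambda>s. LINT x|S3_measure. g s x) has_vector_derivative (LINT x|S3_measure. g' t x)) (at t within {a..b})"
proof -
  have g'c: "continuous_on S3 (g' t)" if "t \<in> {a..b}" for t
  proof -
    have "continuous_on S3 (\<lambda>x. g' (fst (t, x)) (snd (t, x)))"
      by (rule continuous_on_compose2[OF cont]) (use that in \<open>auto intro!: continuous_intros\<close>)
    then show ?thesis by simp
  qed
  have unif: "uniformly_continuous_on ({a..b} \<times> S3) (\<lambda>p. g' (fst p) (snd p))"
    by (intro compact_uniformly_continuous cont compact_Times compact_Icc compact_sphere)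
  define M where "M = measure S3_measure S3"
  have M: "M \<ge> 0" unfolding M_def by simp
  show ?thesis
    unfolding has_vector_derivative_def has_derivative_within_alt
  proof (intro conjI allI impI)
    show "bounded_linear (\<lambda>x. x *\<^sub>R (LINT x|S3_measure. g' t x))" by (rule bounded_linear_scaleR_left)
    fix e :: real assume e: "e > 0"
    \<comment> \<open>The summand 1 keeps the denominator positive whatever the total mass.\<close>
    define e' where "e' = e / (M + 1)"
    have e': "e' > 0" "e' * M \<le> e" using e M unfolding e'_def by (auto simp: field_simps)
    obtain d where d: "d > 0" "\<And>p q. p \<in> {a..b} \<times> S3 \<Longrightarrow> q \<in> {a..b} \<times> S3 \<Longrightarrow> dist q p < d \<Longrightarrow>
       dist (g' (fst q) (snd q)) (g' (fst p) (snd p)) < e'"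
      using unif e'(1) unfolding uniformly_continuous_on_def by metis
    have "norm ((LINT x|S3_measure. g s x) - (LINT x|S3_measure. g t x) - (s - t) *\<^sub>R (LINT x|S3_measure. g' t x)) \<le> e * norm (s - t)"
      if s: "s \<in> {a..b}" "norm (s - t) < d" for s
    proof -
      have seg: "closed_segment t s \<subseteq> {a..b}" using t s closed_segment_subset[of t "{a..b}" s] by (simp add: convex_real_interval)
      have segd: "r \<in> closed_segment t s \<Longrightarrow> dist r t < d" for r
        using s(2) dist_in_closed_segment[of r t s] by (simp add: dist_commute dist_norm)
      have pt: "norm (g s x - g t x - (s - t) *\<^sub>R g' t x) \<le> norm (s - t) * e'" if x: "x \<in> S3" for x
      proof (rule vector_differentiable_bound_linearization[where S="closed_segment t s"])
        fix r assume r: "r \<in> closed_segment t s"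
        show "((\<lambda>s. g s x) has_vector_derivative g' r x) (at r within closed_segment t s)"
          by (rule has_vector_derivative_within_subset[OF g' seg]) (use r seg x in auto)
        have "dist (g' r x) (g' t x) < e'"
          using d(2)[of "(t,x)" "(r,x)"] r seg x t segd[OF r] by (auto simp: dist_Pair_Pair)
        then show "norm (g' r x - g' t x) \<le> e'" by (simp add: dist_norm)
      qed auto
      have int: "integrable S3_measure (g s)" "integrable S3_measure (g t)" "integrable S3_measure (g' t)"
        using g g'c s t by (auto intro!: integrable_S3_continuous)
      have "norm ((LINT x|S3_measure. g s x) - (LINT x|S3_measure. g t x) - (s - t) *\<^sub>R (LINT x|S3_measure. g' t x))
         = norm (LINT x|S3_measure. g s x - g t x - (s - t) *\<^sub>R g' t x)"
        using int by simp
      also have "\<dots> \<le> (LINT x|S3_measure. norm (s - t) * e')"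
        by (rule Bochner_Integration.integral_norm_bound_integral) (use int pt in auto)
      also have "\<dots> = (e' * M) * norm (s - t)" by (simp add: M_def mult_ac)
      also have "\<dots> \<le> e * norm (s - t)" using e' by (intro mult_right_mono) auto
      finally show ?thesis .
    qed
    then show "\<exists>d>0. \<forall>y\<in>{a..b}. norm (y - t) < d \<longrightarrow>
      norm ((LINT x|S3_measure. g y x) - (LINT x|S3_measure. g t x) - (y - t) *\<^sub>R (LINT x|S3_measure. g' t x)) \<le> e * norm (y - t)"
      using d(1) by blast
  qed
qed

section \<open>Integration by parts along the flows of the frame fields\<close>

lemma has_vector_derivative_along:
  assumes f: "smooth_S3 f" and c: "(c has_vector_derivative c') (at t within T)" and nz: "c t \<noteq> 0"
  shows "((\<lambda>s. ext f (c s)) has_vector_derivative extD f (c t) c') (at t within T)"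
  using vector_derivative_diff_chain_within[OF c has_derivative_at_withinI[OF smooth_S3_extD(1)[OF f nz]]]
  by (simp add: o_def)

text \<open>The flow of the field \<open>J a\<close>: the exponential of \<open>t\<close> times the
  matrix \<open>J a\<close>, whose square is minus the identity.\<close>

definition rot :: "3 \<Rightarrow> real \<Rightarrow> real^4 \<Rightarrow> real^4" where
  "rot a t x = cos t *\<^sub>R x + sin t *\<^sub>R J a x"

lemma rot_inner: "rot a t x \<bullet> rot a t x = x \<bullet> x"
proof -
  have "rot a t x \<bullet> rot a t x = (cos t * cos t + sin t * sin t) * (x \<bullet> x)"
    unfolding rot_def by (simp only: inner_add_left inner_add_right inner_scaleR_left inner_scaleR_right
        J_orthonormal J_inner_self refl if_True mult_zero_right add_0_right add_0_left) algebra
  also have "\<dots> = x \<bullet> x" using sin_cos_squared_add2[of t] by (simp add: power2_eq_square)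
  finally show ?thesis .
qed

lemma orthogonal_rot: "orthogonal_transformation (rot a t)"
  unfolding orthogonal_transformation
proof (intro conjI allI)
  show "linear (rot a t)" by (auto intro!: linearI simp: rot_def algebra_simps)
  show "norm (rot a t v) = norm v" for v unfolding norm_eq_sqrt_inner rot_inner ..
qed

lemma rot_S3: "x \<in> S3 \<Longrightarrow> rot a t x \<in> S3"
  using orthogonal_rot[of a t] by (simp add: orthogonal_transformation)

lemma rot_derivative: "((\<lambda>t. rot a t x) has_vector_derivative J a (rot a t x)) (at t within T)"
proof -
  have "J a (rot a t x) = - sin t *\<^sub>R x + cos t *\<^sub>R J a x"
    unfolding rot_def by (simp add: J_J)
  then show ?thesis unfolding rot_def
    by (auto intro!: derivative_eq_intros simp: has_real_derivative_iff_has_vector_derivative[symmetric])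
qed

text \<open>The flow of \<open>J a\<close> preserves the measure, so the integral of
  \<open>f\<close> composed with the flow is constant in time, and its derivative at time 0 is the
  integral of \<open>X a f\<close>.\<close>

lemma integral_X:
  fixes f :: "real^4 \<Rightarrow> 'v::euclidean_space"
  assumes f: "smooth_S3 f"
  shows "(LINT x|S3_measure. X a f x) = 0"
proof -
  have c: "continuous_on S3 (X a f)" "continuous_on S3 f" by (intro smooth_S3_continuous_on smooth_S3_X f)+
  have rc: "continuous_on T (\<lambda>p. rot a (fst p) (snd p))" for T
    unfolding rot_def by (intro continuous_intros)
  have "((\<lambda>s. LINT x|S3_measure. f (rot a s x)) has_vector_derivative (LINT x|S3_measure. X a f (rot a 0 x))) (at 0 within {0..1})"
  proof (rule has_vector_derivative_integral_S3)
    fix t x assume x: "x \<in> S3"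
    have "((\<lambda>s. ext f (rot a s x)) has_vector_derivative extD f (rot a t x) (J a (rot a t x))) (at t within {0..1})"
      by (rule has_vector_derivative_along[OF f rot_derivative]) (use rot_S3[OF x] in auto)
    then show "((\<lambda>s. f (rot a s x)) has_vector_derivative X a f (rot a t x)) (at t within {0..1})"
      unfolding X_def using rot_S3[OF x] by simp
  next
    show "continuous_on ({0..1} \<times> S3) (\<lambda>p. X a f (rot a (fst p) (snd p)))"
      by (rule continuous_on_compose2[OF c(1) rc]) (use rot_S3 in auto)
    show "continuous_on S3 (\<lambda>x. f (rot a t x))" for t
      by (rule continuous_on_compose2[OF c(2)])
        (use rot_S3 in \<open>auto simp: rot_def intro!: continuous_intros\<close>)
  qed auto
  moreover have "(\<lambda>s. LINT x|S3_measure. f (rot a s x)) = (\<lambda>s. LINT x|S3_measure. f x)"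
    by (intro ext integral_S3_orthogonal orthogonal_rot measurable_S3_continuous c)
  moreover have "(LINT x|S3_measure. X a f (rot a 0 x)) = (LINT x|S3_measure. X a f x)"
    by (intro integral_S3_orthogonal orthogonal_rot measurable_S3_continuous c)
  ultimately have "((\<lambda>s. LINT x|S3_measure. f x) has_vector_derivative (LINT x|S3_measure. X a f x)) (at 0 within {0..1::real})"
    by simp
  from vector_derivative_unique_within[OF _ this has_vector_derivative_const]
  show ?thesis by (simp add: trivial_limit_within islimpt_Icc)
qed

lemma integral_X_by_parts:
  fixes f g :: "real^4 \<Rightarrow> 'v::euclidean_space"
  assumes "smooth_S3 f" "smooth_S3 g"
  shows "(LINT x|S3_measure. X a f x \<bullet> g x) = - (LINT x|S3_measure. f x \<bullet> X a g x)"
proof -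
  have "0 = (LINT x|S3_measure. X a (\<lambda>x. f x \<bullet> g x) x)" using assms by (simp add: integral_X)
  also have "\<dots> = (LINT x|S3_measure. X a f x \<bullet> g x + f x \<bullet> X a g x)"
    by (rule integral_S3_cong) (simp add: X_inner assms)
  also have "\<dots> = (LINT x|S3_measure. X a f x \<bullet> g x) + (LINT x|S3_measure. f x \<bullet> X a g x)"
    using assms by (intro Bochner_Integration.integral_add integrable_S3_smooth) auto
  finally show ?thesis by simp
qed

subsection \<open>Sobolev and Poincare inequalities on the 3-sphere\<close>

lemma measurable_S3_ident: "(\<lambda>x. x) \<in> S3_measure \<rightarrow>\<^sub>M borel"
  by (rule measurable_S3_continuous) (rule continuous_on_id)

lemma measurable_qmul [measurable]:
  assumes "f \<in> borel_measurable M" "g \<in> borel_measurable M"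
  shows "(\<lambda>x. qmul (f x) (g x)) \<in> borel_measurable M"
  using assms by (rule borel_measurable_continuous_Pair)
    (intro bounded_bilinear.continuous_on[OF bilinear_qmul] continuous_intros)

definition one4 :: "real^4" where "one4 = axis 1 1"

lemma qmul_one [simp]: "qmul one4 x = x"
  by (simp add: qmul_def one4_def axis_def)

lemma norm_one4 [simp]: "norm one4 = 1"
  by (simp add: one4_def)

lemmas qmul_add_left = bounded_bilinear.add_left[OF bilinear_qmul]
lemmas qmul_scaleR_left = bounded_bilinear.scaleR_left[OF bilinear_qmul]
text \<open>For \<open>x\<close> on the sphere, \<open>y\<close> in this ball and
  \<open>0 \<le> t \<le> 1\<close>, the points \<open>x + t y\<close> keep a distance of at least
  1/2 from the origin, where the extensions along rays are singular.\<close>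

abbreviation half_ball :: "(real^4) set" where "half_ball \<equiv> ball 0 (1/2)"

abbreviation half_vol :: real where "half_vol \<equiv> measure lborel half_ball"

lemma sets_half_ball [measurable]: "half_ball \<in> sets borel" "half_ball \<in> sets lborel"
  by auto

lemma ennreal_mult_two: "a \<ge> 0 \<Longrightarrow> b \<ge> 0 \<Longrightarrow> ennreal a * (2 * ennreal b) = ennreal (2 * a * b)"
proof -
  assume *: "a \<ge> 0" "b \<ge> 0"
  have "(2::ennreal) = ennreal 2" by simp
  then have "ennreal a * (2 * ennreal b) = ennreal a * (ennreal 2 * ennreal b)" by simp
  also have "\<dots> = ennreal (a * (2 * b))" using * by (simp add: ennreal_mult)
  finally show ?thesis by (simp add: mult_ac)
qed

lemma half_vol: "emeasure lborel half_ball = ennreal half_vol" "half_vol > 0"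
proof -
  show 1: "emeasure lborel half_ball = ennreal half_vol"
    using emeasure_lborel_ball_finite[of "0::real^4" "1/2"] by (intro emeasure_eq_ennreal_measure) auto
  show "half_vol > 0" using content_ball_pos[of "1/2" "0::real^4"] by simp
qed

text \<open>
  Nonnegative functions that are constant along rays: their averages over small balls of the ambient
  space, centred on the sphere, behave like averages over caps of the sphere.
\<close>

lemma ray_constant_ext:
  assumes "\<And>c z. c > 0 \<Longrightarrow> G (c *\<^sub>R z) = G z"
  shows "ext G = G"
proof
  fix z show "ext G z = G z"
    using assms[of "inverse (norm z)" z] unfolding ext_def by (cases "z = 0") auto
qed

text \<open>Under \<open>z = x + t y\<close> the Jacobian contributes \<open>t ^ 4\<close>, and
  \<open>z\<close> lies in a spherical shell of thickness \<open>t\<close>. The shell carries at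
  most \<open>2 t\<close> times the integral over the sphere, which leaves the exponent 3, the
  dimension of the sphere.\<close>

lemma cap_average_le:
  fixes G :: "real^4 \<Rightarrow> ennreal"
  assumes G [measurable]: "G \<in> borel_measurable borel" and hom: "\<And>c z. c > 0 \<Longrightarrow> G (c *\<^sub>R z) = G z"
    and t: "0 < t" "t \<le> 1" and x: "x \<in> S3"
  shows "ennreal (t ^ 3) * (\<integral>\<^sup>+y. G (x + t *\<^sub>R y) * indicator half_ball y \<partial>lborel) \<le> 2 * (\<integral>\<^sup>+z. G z \<partial>S3_measure)"
proof -
  define q where "q = (\<integral>\<^sup>+z. G z \<partial>S3_measure)"
  define R1 R2 where "R1 = 1 - t / 2" and "R2 = 1 + t / 2"
  have R: "0 < R1" "R1 < R2" "0 < R2" using t by (auto simp: R1_def R2_def)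
  have Gr: "G \<in> borel_measurable (restrict_space borel S3)" by (rule measurable_restrict_space1) measurable
  have ball: "(\<integral>\<^sup>+z. G z * indicator (ball 0 R - {0}) z \<partial>lborel) = ennreal (R ^ 4 / 4) * q" if "R > 0" for R
    using nn_integral_ext_ball[OF Gr that] by (simp add: q_def ray_constant_ext[OF hom])
  define A where "A = (\<integral>\<^sup>+z. G z * indicator (ball 0 R2 - ball 0 R1) z \<partial>lborel)"
  have split: "ennreal (R2 ^ 4 / 4) * q = A + ennreal (R1 ^ 4 / 4) * q"
  proof -
    have "ennreal (R2 ^ 4 / 4) * q = (\<integral>\<^sup>+z. G z * indicator (ball 0 R2 - {0}) z \<partial>lborel)"
      using ball R by simp
    also have "\<dots> = (\<integral>\<^sup>+z. G z * indicator (ball 0 R2 - ball 0 R1) z + G z * indicator (ball 0 R1 - {0}) z \<partial>lborel)"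
      using R by (intro nn_integral_cong) (auto simp: indicator_def)
    also have "\<dots> = A + (\<integral>\<^sup>+z. G z * indicator (ball 0 R1 - {0}) z \<partial>lborel)"
      unfolding A_def by (intro nn_integral_add borel_measurable_times_ennreal borel_measurable_indicator) auto
    finally show ?thesis using ball R by simp
  qed
  \<comment> \<open>The shell is a difference of two balls, and
    \<open>(R2 ^ 4 - R1 ^ 4) / 4 = t + t ^ 3 / 4\<close> is at most \<open>2 t\<close>. An infinite
    integral is treated apart because the common ball is subtracted.\<close>
  have A: "A \<le> ennreal (2 * t) * q"
  proof (cases "q = \<infinity>")
    case True then show ?thesis using t by (simp add: ennreal_mult_top)
  next
    case False
    then obtain r where r: "q = ennreal r" "r \<ge> 0" by (cases q) auto
    have "R2 ^ 4 / 4 = R1 ^ 4 / 4 + t * (1 + t\<^sup>2 / 4)"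
      unfolding R1_def R2_def by (simp add: power4_eq_xxxx power2_eq_square field_simps)
    also have "t * (1 + t\<^sup>2 / 4) \<le> t * 2"
      using t power_le_one[of t 2] by (intro mult_left_mono) auto
    finally have "R2 ^ 4 / 4 * r \<le> (R1 ^ 4 / 4 + 2 * t) * r" using r by (intro mult_right_mono) auto
    then have "ennreal (R2 ^ 4 / 4 * r) \<le> ennreal ((R1 ^ 4 / 4 + 2 * t) * r)" by (rule ennreal_leI)
    moreover have "A + ennreal (R1 ^ 4 / 4) * q = ennreal (R2 ^ 4 / 4 * r)"
      using split r(2) R unfolding r(1) by (subst ennreal_mult) auto
    moreover have "ennreal ((R1 ^ 4 / 4 + 2 * t) * r) = ennreal (2 * t) * q + ennreal (R1 ^ 4 / 4) * q"
      unfolding r(1) using r(2) t R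
      by (simp add: ennreal_mult[symmetric] ennreal_plus[symmetric] algebra_simps del: ennreal_plus)
    ultimately have "A + ennreal (R1 ^ 4 / 4) * q \<le> ennreal (2 * t) * q + ennreal (R1 ^ 4 / 4) * q" by simp
    moreover have "ennreal (R1 ^ 4 / 4) * q \<noteq> top" using r by (simp add: ennreal_mult_eq_top_iff)
    ultimately show ?thesis by (simp add: ennreal_add_left_cancel_le add.commute)
  qed
  have "(\<integral>\<^sup>+y. G (x + t *\<^sub>R y) * indicator half_ball y \<partial>lborel)
     \<le> (\<integral>\<^sup>+y. G (x + t *\<^sub>R y) * indicator (ball 0 R2 - ball 0 R1) (x + t *\<^sub>R y) \<partial>lborel)"
  proof (intro nn_integral_mono mult_left_mono)
    fix y :: "real^4"
    have "norm (x + t *\<^sub>R y) < R2 \<and> \<not> norm (x + t *\<^sub>R y) < R1" if "norm y < 1/2"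
    proof -
      have "norm (t *\<^sub>R y) < t / 2" using that t by simp
      moreover have "norm x = 1" using x by simp
      ultimately show ?thesis unfolding R1_def R2_def
        using norm_triangle_ineq[of x "t *\<^sub>R y"] norm_diff_ineq[of x "t *\<^sub>R y"] by linarith
    qed
    then show "indicator half_ball y \<le> (indicator (ball 0 R2 - ball 0 R1) (x + t *\<^sub>R y) :: ennreal)"
      by (auto simp: indicator_def)
  qed simp
  also have "ennreal (t ^ 4) * \<dots> = A"
  proof -
    define F where "F z = G z * indicator (ball 0 R2 - ball 0 R1) z" for z
    have F [measurable]: "F \<in> borel_measurable borel" unfolding F_def
      by (intro borel_measurable_times_ennreal borel_measurable_indicator) auto
    have "A = (\<integral>\<^sup>+z. F z \<partial>density (distr lborel borel (\<lambda>y. x + t *\<^sub>R y)) (\<lambda>_. \<bar>t\<bar>^DIM(real^4)))"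
      using t unfolding A_def F_def by (subst lborel_affine[of t x]) auto
    also have "\<dots> = (\<integral>\<^sup>+y. ennreal (t^4) * F (x + t *\<^sub>R y) \<partial>lborel)"
      using F t by (simp add: nn_integral_density nn_integral_distr)
    also have "\<dots> = ennreal (t^4) * (\<integral>\<^sup>+y. F (x + t *\<^sub>R y) \<partial>lborel)"
      by (intro nn_integral_cmult) measurable
    finally show ?thesis unfolding F_def ..
  qed
  finally have "ennreal (t ^ 4) * (\<integral>\<^sup>+y. G (x + t *\<^sub>R y) * indicator half_ball y \<partial>lborel) \<le> ennreal (2 * t) * q"
    using A by (meson mult_left_mono order_trans zero_le)
  then have "ennreal (inverse t) * (ennreal (t ^ 4) * (\<integral>\<^sup>+y. G (x + t *\<^sub>R y) * indicator half_ball y \<partial>lborel))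
      \<le> ennreal (inverse t) * (ennreal (2 * t) * q)" by (rule mult_left_mono) simp
  moreover have "ennreal (inverse t) * ennreal (t ^ 4) = ennreal (t ^ 3)"
    using t by (simp add: ennreal_mult[symmetric] power3_eq_cube power4_eq_xxxx)
  moreover have "ennreal (inverse t) * ennreal (2 * t) = 2"
  proof -
    have "inverse t * (2 * t) = 2" using t by simp
    have "ennreal (inverse t) * ennreal (2 * t) = ennreal (inverse t * (2 * t))"
      using t by (intro ennreal_mult[symmetric]) auto
    also have "\<dots> = 2" unfolding \<open>inverse t * (2 * t) = 2\<close> by simp
    finally show ?thesis .
  qed
  ultimately show ?thesis unfolding q_def by (simp add: mult.assoc[symmetric])
qed

text \<open>Right multiplication by a unit quaternion \<open>x\<close> preserves Lebesgue measure
  and the half ball, so \<open>x + t y\<close> may be replaced by the product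
  \<open>(1 + t y) x\<close>. After the integrals are exchanged, this is for fixed \<open>y\<close>
  a rotation in \<open>x\<close> up to a positive factor, to which \<open>G\<close> is
  insensitive.\<close>

lemma integral_cap_average:
  fixes G :: "real^4 \<Rightarrow> ennreal"
  assumes G [measurable]: "G \<in> borel_measurable borel" and hom: "\<And>c z. c > 0 \<Longrightarrow> G (c *\<^sub>R z) = G z"
    and t: "0 \<le> t" "t \<le> 1"
  shows "(\<integral>\<^sup>+x. (\<integral>\<^sup>+y. G (x + t *\<^sub>R y) * indicator half_ball y \<partial>lborel) \<partial>S3_measure)
     = ennreal half_vol * (\<integral>\<^sup>+z. G z \<partial>S3_measure)"
proof -
  interpret pair_sigma_finite S3_measure "lborel :: (real^4) measure"
    by (intro pair_sigma_finite.intro S3.sigma_finite_measure_axioms sigma_finite_lborel)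
  have "(\<integral>\<^sup>+x. (\<integral>\<^sup>+y. G (x + t *\<^sub>R y) * indicator half_ball y \<partial>lborel) \<partial>S3_measure)
    = (\<integral>\<^sup>+x. (\<integral>\<^sup>+y. G (qmul (one4 + t *\<^sub>R y) x) * indicator half_ball y \<partial>lborel) \<partial>S3_measure)"
  proof (rule nn_integral_cong)
    fix x assume "x \<in> space S3_measure"
    then have x: "norm x = 1" by simp
    define F where "F y = G (x + t *\<^sub>R y) * indicator half_ball y" for y
    have F [measurable]: "F \<in> borel_measurable borel" unfolding F_def by measurable
    have "(\<integral>\<^sup>+y. F y \<partial>lborel) = (\<integral>\<^sup>+y. F y \<partial>distr lborel borel (\<lambda>y. qmul y x))"
      unfolding lborel_distr_orthogonal[OF orthogonal_qmul_right[OF x]] ..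
    also have "\<dots> = (\<integral>\<^sup>+y. F (qmul y x) \<partial>lborel)" using orthogonal_qmul_right[OF x, THEN orthogonal_transformation_linear] linear_conv_bounded_linear
      linear_continuous_on borel_measurable_continuous_onI by (subst nn_integral_distr) auto
    also have "\<dots> = (\<integral>\<^sup>+y. G (qmul (one4 + t *\<^sub>R y) x) * indicator half_ball y \<partial>lborel)"
      unfolding F_def by (intro nn_integral_cong)
        (simp add: qmul_add_left qmul_scaleR_left indicator_def norm_qmul x)
    finally show "(\<integral>\<^sup>+y. G (x + t *\<^sub>R y) * indicator half_ball y \<partial>lborel)
       = (\<integral>\<^sup>+y. G (qmul (one4 + t *\<^sub>R y) x) * indicator half_ball y \<partial>lborel)" unfolding F_def .
  qed
  also have "\<dots> = (\<integral>\<^sup>+y. (\<integral>\<^sup>+x. G (qmul (one4 + t *\<^sub>R y) x) * indicator half_ball y \<partial>S3_measure) \<partial>lborel)"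
  proof (rule Fubini'[symmetric])
    note [measurable] = measurable_compose[OF measurable_fst measurable_S3_ident]
    show "(\<lambda>(x, y). G (qmul (one4 + t *\<^sub>R y) x) * indicator half_ball y) \<in> borel_measurable (S3_measure \<Otimes>\<^sub>M lborel)"
      by measurable
  qed
  also have "\<dots> = (\<integral>\<^sup>+y. (\<integral>\<^sup>+z. G z \<partial>S3_measure) * indicator half_ball y \<partial>lborel)"
  proof (rule nn_integral_cong)
    fix y :: "real^4"
    show "(\<integral>\<^sup>+x. G (qmul (one4 + t *\<^sub>R y) x) * indicator half_ball y \<partial>S3_measure)
       = (\<integral>\<^sup>+z. G z \<partial>S3_measure) * indicator half_ball y"
    proof (cases "y \<in> half_ball")
      case True
      define p where "p = one4 + t *\<^sub>R y"
      have "norm (t *\<^sub>R y) < 1" using True t mult_left_le_one_le[of "norm y" t] by auto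
      then have p: "norm p > 0" unfolding p_def using norm_diff_ineq[of one4 "t *\<^sub>R y"] norm_one4 by linarith
      have "G (qmul p x) = G (qmul (p /\<^sub>R norm p) x)" for x
        using hom[of "inverse (norm p)" "qmul p x"] p by (simp add: qmul_scaleR_left)
      moreover have "(\<integral>\<^sup>+x. G (qmul (p /\<^sub>R norm p) x) \<partial>S3_measure) = (\<integral>\<^sup>+z. G z \<partial>S3_measure)"
        using p measurable_compose[OF measurable_S3_ident G]
        by (intro nn_integral_S3_orthogonal[OF orthogonal_qmul_left]) auto
      ultimately show ?thesis using True unfolding p_def by simp
    qed simp
  qed
  also have "\<dots> = ennreal half_vol * (\<integral>\<^sup>+z. G z \<partial>S3_measure)"
    unfolding half_vol(1)[symmetric] by (subst nn_integral_cmult) (auto simp: mult.commute)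
  finally show ?thesis .
qed

section \<open>Pointwise bounds by path integrals of first derivatives\<close>

lemma abs_extD_le:
  fixes f :: "real^4 \<Rightarrow> real"
  assumes "smooth_S3 f" "x \<noteq> 0"
  shows "\<bar>extD f x v\<bar> \<le> norm v / norm x * (\<Sum>a\<in>UNIV. \<bar>X a f x\<bar>)"
proof -
  have "\<bar>(x \<bullet> x) * extD f x v\<bar> = \<bar>\<Sum>a\<in>UNIV. (v \<bullet> J a x) * X a f x\<bar>"
    using extD_expand[OF assms, of v] by simp
  then have "(x \<bullet> x) * \<bar>extD f x v\<bar> = \<bar>\<Sum>a\<in>UNIV. (v \<bullet> J a x) * X a f x\<bar>"
    by (simp add: abs_mult)
  also have "\<dots> \<le> (\<Sum>a\<in>UNIV. (norm v * norm x) * \<bar>X a f x\<bar>)"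
    using Cauchy_Schwarz_ineq2[of v "J _ x"]
    by (intro order_trans[OF sum_abs] sum_mono) (auto simp: abs_mult intro!: mult_right_mono)
  also have "\<dots> = (x \<bullet> x) * (norm v / norm x * (\<Sum>a\<in>UNIV. \<bar>X a f x\<bar>))"
    using assms(2) by (simp add: sum_distrib_left[symmetric] dot_square_norm power2_eq_square)
  finally show ?thesis using assms(2) by (subst (asm) mult_le_cancel_left_pos) auto
qed

definition jet1 :: "(real^4 \<Rightarrow> real) \<Rightarrow> real^4 \<Rightarrow> real" where
  "jet1 f x = \<bar>f x\<bar> + (\<Sum>a\<in>UNIV. \<bar>X a f x\<bar>)"

text \<open>A fixed value at the origin, where all rays meet, gives a Borel function on the whole
  space.\<close>

definition xjet1 :: "(real^4 \<Rightarrow> real) \<Rightarrow> real^4 \<Rightarrow> real" where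
  "xjet1 f x = (if x = 0 then 0 else ext (jet1 f) x)"

lemma jet1_nonneg: "jet1 f x \<ge> 0"
  unfolding jet1_def by (intro add_nonneg_nonneg sum_nonneg) auto

lemma xjet1_nonneg [simp]: "xjet1 f x \<ge> 0"
  by (simp add: xjet1_def ext_def jet1_nonneg)

lemma xjet1_scale: "c > 0 \<Longrightarrow> xjet1 f (c *\<^sub>R x) = xjet1 f x"
  by (simp add: xjet1_def ext_scale)

lemma continuous_jet1: "smooth_S3 f \<Longrightarrow> continuous_on S3 (jet1 f)"
  unfolding jet1_def by (intro continuous_intros smooth_S3_continuous_on smooth_S3_X)

lemma xjet1_eq: "smooth_S3 f \<Longrightarrow> x \<noteq> 0 \<Longrightarrow> xjet1 f x = \<bar>ext f x\<bar> + (\<Sum>a\<in>UNIV. \<bar>X a f x\<bar>)"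
  unfolding xjet1_def jet1_def by (simp add: ext_X[symmetric]) (simp add: ext_def)

lemma continuous_xjet1: "smooth_S3 f \<Longrightarrow> continuous_on (- {0}) (xjet1 f)"
proof -
  assume f: "smooth_S3 f"
  have c: "continuous_on (- {0}) (ext g)" if "smooth_S3 g" for g :: "real^4 \<Rightarrow> real"
    using that unfolding smooth_S3_Cinf by (rule Cinf_on_imp_continuous_on)
  have "continuous_on (- {0}) (\<lambda>x. \<bar>ext f x\<bar> + (\<Sum>a\<in>UNIV. \<bar>ext (X a f) x\<bar>))"
    by (intro continuous_intros c smooth_S3_X f)
  then show ?thesis by (rule continuous_on_eq) (simp add: xjet1_eq f ext_X)
qed

lemma measurable_xjet1: "smooth_S3 f \<Longrightarrow> xjet1 f \<in> borel_measurable borel"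
  using measurable_ext_continuous[OF continuous_xjet1, of f 0]
  by (rule measurable_cong[THEN iffD1, rotated]) (auto simp: xjet1_def)

text \<open>The fundamental theorem of calculus, moved from the gauge integral to a nonnegative
  Lebesgue integral, where Fubini and Cauchy-Schwarz can follow without tracking
  integrability.\<close>

lemma abs_increment_le:
  fixes \<psi> :: "real \<Rightarrow> real"
  assumes ab: "a \<le> b"
    and d: "\<And>s. s \<in> {a..b} \<Longrightarrow> (\<psi> has_vector_derivative \<psi>' s) (at s within {a..b})"
    and bound: "\<And>s. s \<in> {a..b} \<Longrightarrow> norm (\<psi>' s) \<le> k s" and k: "continuous_on {a..b} k"
  shows "ennreal \<bar>\<psi> b - \<psi> a\<bar> \<le> (\<integral>\<^sup>+s. ennreal (k s) * indicator {a..b} s \<partial>lborel)"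
proof -
  have I: "(\<psi>' has_integral \<psi> b - \<psi> a) {a..b}"
    using fundamental_theorem_of_calculus[OF ab d] by auto
  have int: "k integrable_on {a..b}" by (rule integrable_continuous_real[OF k])
  have k0: "0 \<le> k s" if "s \<in> {a..b}" for s using order_trans[OF norm_ge_zero bound[OF that]] .
  have "\<bar>\<psi> b - \<psi> a\<bar> = norm (integral {a..b} \<psi>')" using integral_unique[OF I] by simp
  also have "\<dots> \<le> integral {a..b} k"
    by (rule Henstock_Kurzweil_Integration.integral_norm_bound_integral[OF _ int bound]) (use I in auto)
  finally have le: "\<bar>\<psi> b - \<psi> a\<bar> \<le> integral {a..b} k" .
  have "(\<integral>\<^sup>+s. ennreal (indicator {a..b} s * k s) \<partial>lborel) = integral {a..b} k"
  proof (rule nn_integral_has_integral_lborel)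
    show "(\<lambda>s. indicator {a..b} s * k s) \<in> borel_measurable borel"
      using borel_measurable_continuous_on_indicator[OF _ k] by simp
    have "(\<lambda>s. indicator {a..b} s * k s) = (\<lambda>s. if s \<in> {a..b} then k s else 0)"
      by (auto simp: indicator_def)
    then show "((\<lambda>s. indicator {a..b} s * k s) has_integral integral {a..b} k) UNIV"
      using integrable_integral[OF int] by (simp only: has_integral_restrict_UNIV)
  qed (use k0 in \<open>auto simp: indicator_def\<close>)
  moreover have "(\<lambda>s. ennreal (indicator {a..b} s * k s)) = (\<lambda>s. ennreal (k s) * indicator {a..b} s)"
    by (auto simp: indicator_def)
  ultimately have "ennreal (integral {a..b} k) = (\<integral>\<^sup>+s. ennreal (k s) * indicator {a..b} s \<partial>lborel)" by simp
  with ennreal_leI[OF le] show ?thesis by (rule ord_le_eq_trans)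
qed

text \<open>
  The fundamental theorem of calculus for \<open>s \<mapsto> (1 - s^4) f (x + s^4 y)\<close>; the substitution \<open>t = s^4\<close>
  makes the singular weights in the averages below cancel exactly.
\<close>

lemma abs_le_path_integral:
  assumes f: "smooth_S3 f" and x: "x \<in> S3" and y: "y \<in> half_ball"
  shows "ennreal \<bar>f x\<bar> \<le> (\<integral>\<^sup>+s. ennreal (4 * s ^ 3 * xjet1 f (x + s ^ 4 *\<^sub>R y)) * indicator {0..1} s \<partial>lborel)"
proof -
  define c where "c s = x + s ^ 4 *\<^sub>R y" for s :: real
  have c: "norm (c s) \<ge> 1/2" if "s \<in> {0..1}" for s
  proof -
    have "norm (s ^ 4 *\<^sub>R y) \<le> 1 * (1/2)"
      using that y unfolding norm_scaleR by (intro mult_mono) (auto simp: power_le_one)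
    then show ?thesis using x norm_diff_ineq[of x "s ^ 4 *\<^sub>R y"] unfolding c_def by simp
  qed
  then have c0: "c s \<noteq> 0" if "s \<in> {0..1}" for s using that by fastforce
  \<comment> \<open>The weight \<open>1 - s ^ 4\<close> vanishes at \<open>s = 1\<close>, so no
    boundary term survives at the far end; its own derivative is what brings the zeroth-order part
    into \<open>jet1\<close>.\<close>
  define \<psi>' where "\<psi>' s = (1 - s ^ 4) * extD f (c s) ((4 * s ^ 3) *\<^sub>R y) - 4 * s ^ 3 * ext f (c s)" for s
  have d: "((\<lambda>s. (1 - s ^ 4) * ext f (c s)) has_vector_derivative \<psi>' s) (at s within {0..1})" if "s \<in> {0..1}" for s
  proof -
    have "(c has_vector_derivative (4 * s ^ 3) *\<^sub>R y) (at s within {0..1})"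
      unfolding c_def by (auto intro!: derivative_eq_intros simp: has_real_derivative_iff_has_vector_derivative[symmetric])
    from has_vector_derivative_along[OF f this c0[OF that]]
    have "((\<lambda>s. ext f (c s)) has_real_derivative extD f (c s) ((4 * s ^ 3) *\<^sub>R y)) (at s within {0..1})"
      by (simp add: has_real_derivative_iff_has_vector_derivative)
    then show ?thesis unfolding \<psi>'_def has_real_derivative_iff_has_vector_derivative[symmetric]
      by (auto intro!: derivative_eq_intros)
  qed
  have cc: "continuous_on {0..1} c" unfolding c_def by (intro continuous_intros)
  have cG: "continuous_on {0..1} (\<lambda>s. 4 * s ^ 3 * xjet1 f (c s))"
    by (intro continuous_intros continuous_on_compose2[OF continuous_xjet1[OF f] cc]) (use c0 in auto)
  have bound: "norm (\<psi>' s) \<le> 4 * s ^ 3 * xjet1 f (c s)" if s: "s \<in> {0..1}" for s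
  proof -
    have s4: "0 \<le> 1 - s ^ 4" "1 - s ^ 4 \<le> 1" using s by (auto simp: power_le_one)
    have "\<bar>extD f (c s) ((4 * s ^ 3) *\<^sub>R y)\<bar> \<le> norm ((4 * s ^ 3) *\<^sub>R y) / norm (c s) * (\<Sum>a\<in>UNIV. \<bar>X a f (c s)\<bar>)"
      by (rule abs_extD_le[OF f c0[OF s]])
    also have "\<dots> \<le> (4 * s ^ 3) * (\<Sum>a\<in>UNIV. \<bar>X a f (c s)\<bar>)"
    proof (intro mult_right_mono sum_nonneg)
      have "norm ((4 * s ^ 3) *\<^sub>R y) \<le> (4 * s ^ 3) * norm (c s)"
        unfolding norm_scaleR using s y c[OF s] by (intro mult_mono) auto
      then show "norm ((4 * s ^ 3) *\<^sub>R y) / norm (c s) \<le> 4 * s ^ 3"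
        using c[OF s] by (subst pos_divide_le_eq) linarith+
    qed auto
    finally have E: "\<bar>extD f (c s) ((4 * s ^ 3) *\<^sub>R y)\<bar> \<le> (4 * s ^ 3) * (\<Sum>a\<in>UNIV. \<bar>X a f (c s)\<bar>)" .
    have "norm (\<psi>' s) \<le> (1 - s ^ 4) * \<bar>extD f (c s) ((4 * s ^ 3) *\<^sub>R y)\<bar> + 4 * s ^ 3 * \<bar>ext f (c s)\<bar>"
      unfolding \<psi>'_def using s s4 by (intro order_trans[OF norm_triangle_ineq4]) (auto simp: abs_mult)
    also have "\<dots> \<le> \<bar>extD f (c s) ((4 * s ^ 3) *\<^sub>R y)\<bar> + 4 * s ^ 3 * \<bar>ext f (c s)\<bar>"
      using s4 by (intro add_right_mono mult_left_le_one_le) auto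
    also have "\<dots> \<le> 4 * s ^ 3 * xjet1 f (c s)"
      using E unfolding xjet1_eq[OF f c0[OF s]] by (simp add: distrib_left)
    finally show ?thesis .
  qed
  have "ennreal \<bar>(1 - 1 ^ 4) * ext f (c 1) - (1 - 0 ^ 4) * ext f (c 0)\<bar>
      \<le> (\<integral>\<^sup>+s. ennreal (4 * s ^ 3 * xjet1 f (c s)) * indicator {0..1} s \<partial>lborel)"
    by (rule abs_increment_le[OF _ d bound cG]) auto
  then show ?thesis using x by (simp add: c_def)
qed

section \<open>Sobolev embeddings from cap averages\<close>

lemma nn_integral_square_le:
  assumes [measurable]: "f \<in> borel_measurable M" "A \<in> sets M"
  shows "(\<integral>\<^sup>+x. f x * indicator A x \<partial>M)\<^sup>2 \<le> emeasure M A * (\<integral>\<^sup>+x. (f x)\<^sup>2 * indicator A x \<partial>M)"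
proof -
  have "(\<integral>\<^sup>+x. (f x * indicator A x) * indicator A x \<partial>M)\<^sup>2
     \<le> (\<integral>\<^sup>+x. (f x * indicator A x)\<^sup>2 \<partial>M) * (\<integral>\<^sup>+x. (indicator A x)\<^sup>2 \<partial>M)"
    by (rule Cauchy_Schwarz_nn_integral) measurable
  also have "(\<lambda>x. (f x * indicator A x) * indicator A x) = (\<lambda>x. f x * indicator A x)"
    by (auto simp: indicator_def)
  also have "(\<lambda>x. (f x * indicator A x)\<^sup>2) = (\<lambda>x. (f x)\<^sup>2 * indicator A x)"
    by (auto simp: indicator_def)
  also have "(\<lambda>x. (indicator A x)\<^sup>2) = (indicator A :: _ \<Rightarrow> ennreal)" by (auto simp: indicator_def)
  finally show ?thesis by (simp add: mult.commute)
qed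

text \<open>Moments over the ball of radius \<open>s ^ 4 / 2\<close> about \<open>x\<close>,
  parametrized by the fixed half ball and not normalized by its volume.\<close>

definition cap_av :: "(real^4 \<Rightarrow> real) \<Rightarrow> nat \<Rightarrow> real \<Rightarrow> real^4 \<Rightarrow> ennreal" where
  "cap_av f p s x = (\<integral>\<^sup>+y. ennreal (xjet1 f (x + s ^ 4 *\<^sub>R y) ^ p) * indicator half_ball y \<partial>lborel)"

lemma measurable_cap_av:
  assumes f: "smooth_S3 f"
  shows "(\<lambda>p. cap_av f k (fst p) (snd p)) \<in> borel_measurable (borel \<Otimes>\<^sub>M borel)"
proof -
  note [measurable] = measurable_compose[OF _ measurable_xjet1[OF f]]
  show ?thesis unfolding cap_av_def by measurable
qed

lemma cap_av_square:
  assumes f: "smooth_S3 f"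
  shows "(cap_av f k s x)\<^sup>2 \<le> ennreal half_vol * cap_av f (2 * k) s x"
proof -
  note [measurable] = measurable_compose[OF _ measurable_xjet1[OF f]]
  have "(cap_av f k s x)\<^sup>2 \<le> emeasure lborel half_ball *
      (\<integral>\<^sup>+y. (ennreal (xjet1 f (x + s ^ 4 *\<^sub>R y) ^ k))\<^sup>2 * indicator half_ball y \<partial>lborel)"
    unfolding cap_av_def by (rule nn_integral_square_le) measurable
  also have "\<dots> = ennreal half_vol * cap_av f (2 * k) s x"
    unfolding half_vol(1) cap_av_def by (simp add: ennreal_power power_even_eq)
  finally show ?thesis .
qed

lemma cap_av_le:
  assumes f: "smooth_S3 f" and s: "s \<in> {0..1}" and x: "x \<in> S3"
  shows "ennreal (s ^ 12) * cap_av f k s x \<le> 2 * (\<integral>\<^sup>+z. ennreal (jet1 f z ^ k) \<partial>S3_measure)"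
proof (cases "s = 0")
  case False
  note [measurable] = measurable_compose[OF _ measurable_xjet1[OF f]]
  have "ennreal ((s ^ 4) ^ 3) * cap_av f k s x \<le> 2 * (\<integral>\<^sup>+z. ennreal (xjet1 f z ^ k) \<partial>S3_measure)"
    unfolding cap_av_def by (rule cap_average_le[where G="\<lambda>z. ennreal (xjet1 f z ^ k)"])
      (use s x False in \<open>auto simp: xjet1_scale power_le_one\<close>)
  also have "(\<integral>\<^sup>+z. ennreal (xjet1 f z ^ k) \<partial>S3_measure) = (\<integral>\<^sup>+z. ennreal (jet1 f z ^ k) \<partial>S3_measure)"
    by (intro nn_integral_cong) (auto simp: xjet1_def)
  finally show ?thesis by (simp add: power_mult[symmetric])
qed simp

lemma integral_cap_av:
  assumes f: "smooth_S3 f" and s: "s \<in> {0..1}"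
  shows "(\<integral>\<^sup>+x. cap_av f k s x \<partial>S3_measure) = ennreal half_vol * (\<integral>\<^sup>+z. ennreal (jet1 f z ^ k) \<partial>S3_measure)"
proof -
  note [measurable] = measurable_compose[OF _ measurable_xjet1[OF f]]
  have "(\<integral>\<^sup>+x. cap_av f k s x \<partial>S3_measure) = ennreal half_vol * (\<integral>\<^sup>+z. ennreal (xjet1 f z ^ k) \<partial>S3_measure)"
    unfolding cap_av_def by (rule integral_cap_average[where G="\<lambda>z. ennreal (xjet1 f z ^ k)"])
      (use s in \<open>auto simp: xjet1_scale power_le_one\<close>)
  also have "(\<integral>\<^sup>+z. ennreal (xjet1 f z ^ k) \<partial>S3_measure) = (\<integral>\<^sup>+z. ennreal (jet1 f z ^ k) \<partial>S3_measure)"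
    by (intro nn_integral_cong) (auto simp: xjet1_def)
  finally show ?thesis .
qed

text \<open>The path integral is averaged over \<open>y\<close> in the half ball, and Cauchy-Schwarz
  is applied twice in \<open>s\<close> over an interval of length 1. The weight becomes
  \<open>(4 s ^ 3) ^ 4 = 256 s ^ 12\<close>.\<close>

lemma pow4_le_cap_av:
  assumes f: "smooth_S3 f" and x: "x \<in> S3"
  shows "ennreal (half_vol ^ 4 * f x ^ 4)
    \<le> (\<integral>\<^sup>+s. ennreal (256 * s ^ 12) * (cap_av f 1 s x) ^ 4 * indicator {0..1} s \<partial>lborel)"
proof -
  note [measurable] = measurable_compose[OF _ measurable_xjet1[OF f]]
  have m [measurable]: "(\<lambda>s. cap_av f k s x) \<in> borel_measurable borel" for k
    using measurable_compose[OF measurable_Pair[OF measurable_ident measurable_const] measurable_cap_av[OF f, of k], of x]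
    by simp
  have "ennreal (half_vol * \<bar>f x\<bar>) = (\<integral>\<^sup>+y. ennreal \<bar>f x\<bar> * indicator half_ball y \<partial>lborel)"
    by (subst nn_integral_cmult_indicator) (auto simp: half_vol(1) ennreal_mult mult.commute)
  also have "\<dots> \<le> (\<integral>\<^sup>+y. (\<integral>\<^sup>+s. ennreal (4 * s ^ 3 * xjet1 f (x + s ^ 4 *\<^sub>R y)) * indicator {0..1} s \<partial>lborel)
      * indicator half_ball y \<partial>lborel)"
  proof (rule nn_integral_mono)
    fix y show "ennreal \<bar>f x\<bar> * indicator half_ball y
      \<le> (\<integral>\<^sup>+s. ennreal (4 * s ^ 3 * xjet1 f (x + s ^ 4 *\<^sub>R y)) * indicator {0..1} s \<partial>lborel) * indicator half_ball y"
    proof (cases "y \<in> half_ball")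
      case True
      show ?thesis by (intro mult_right_mono abs_le_path_integral[OF f x True]) simp
    qed simp
  qed
  also have "\<dots> = (\<integral>\<^sup>+y. (\<integral>\<^sup>+s. ennreal (4 * s ^ 3 * xjet1 f (x + s ^ 4 *\<^sub>R y)) * indicator {0..1} s
      * indicator half_ball y \<partial>lborel) \<partial>lborel)"
    by (intro nn_integral_cong nn_integral_multc[symmetric]) measurable
  also have "\<dots> = (\<integral>\<^sup>+s. (\<integral>\<^sup>+y. ennreal (4 * s ^ 3 * xjet1 f (x + s ^ 4 *\<^sub>R y)) * indicator {0..1} s
      * indicator half_ball y \<partial>lborel) \<partial>lborel)"
    by (rule lborel_pair.Fubini') measurable
  also have "\<dots> = (\<integral>\<^sup>+s. ennreal (4 * s ^ 3) * cap_av f 1 s x * indicator {0..1} s \<partial>lborel)"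
  proof (rule nn_integral_cong)
    fix s :: real
    show "(\<integral>\<^sup>+y. ennreal (4 * s ^ 3 * xjet1 f (x + s ^ 4 *\<^sub>R y)) * indicator {0..1} s
      * indicator half_ball y \<partial>lborel) = ennreal (4 * s ^ 3) * cap_av f 1 s x * indicator {0..1} s"
    proof (cases "s \<in> {0..1}")
      case True
      then have "(\<integral>\<^sup>+y. ennreal (4 * s ^ 3 * xjet1 f (x + s ^ 4 *\<^sub>R y)) * indicator {0..1} s
        * indicator half_ball y \<partial>lborel)
        = (\<integral>\<^sup>+y. ennreal (4 * s ^ 3) * (ennreal (xjet1 f (x + s ^ 4 *\<^sub>R y) ^ 1) * indicator half_ball y) \<partial>lborel)"
        by (intro nn_integral_cong) (simp add: ennreal_mult mult.assoc)
      also have "\<dots> = ennreal (4 * s ^ 3) * cap_av f 1 s x"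
        unfolding cap_av_def by (rule nn_integral_cmult) measurable
      finally show ?thesis using True by simp
    qed simp
  qed
  finally have 1: "ennreal (half_vol * \<bar>f x\<bar>) \<le> (\<integral>\<^sup>+s. ennreal (4 * s ^ 3) * cap_av f 1 s x * indicator {0..1} s \<partial>lborel)" .
  have e1: "emeasure lborel {0..1::real} = 1" by simp
  have "(ennreal (half_vol * \<bar>f x\<bar>))\<^sup>2 \<le> (\<integral>\<^sup>+s. ennreal (4 * s ^ 3) * cap_av f 1 s x * indicator {0..1} s \<partial>lborel)\<^sup>2"
    by (rule power_mono[OF 1]) simp
  also have "\<dots> \<le> (\<integral>\<^sup>+s. (ennreal (4 * s ^ 3) * cap_av f 1 s x)\<^sup>2 * indicator {0..1} s \<partial>lborel)"
    using nn_integral_square_le[of "\<lambda>s. ennreal (4 * s ^ 3) * cap_av f 1 s x" lborel "{0..1}"] unfolding e1 by simp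
  finally have "((ennreal (half_vol * \<bar>f x\<bar>))\<^sup>2)\<^sup>2 \<le> (\<integral>\<^sup>+s. (ennreal (4 * s ^ 3) * cap_av f 1 s x)\<^sup>2 * indicator {0..1} s \<partial>lborel)\<^sup>2"
    by (rule power_mono) simp
  also have "\<dots> \<le> (\<integral>\<^sup>+s. ((ennreal (4 * s ^ 3) * cap_av f 1 s x)\<^sup>2)\<^sup>2 * indicator {0..1} s \<partial>lborel)"
    using nn_integral_square_le[of "\<lambda>s. (ennreal (4 * s ^ 3) * cap_av f 1 s x)\<^sup>2" lborel "{0..1}"] unfolding e1 by simp
  also have "\<dots> = (\<integral>\<^sup>+s. ennreal (256 * s ^ 12) * (cap_av f 1 s x) ^ 4 * indicator {0..1} s \<partial>lborel)"
  proof (rule nn_integral_cong)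
    fix s :: real
    have "(ennreal (4 * s ^ 3)) ^ 4 = ennreal (256 * s ^ 12)" if "s \<in> {0..1}"
      using that by (simp add: ennreal_power power_mult_distrib power_mult[symmetric])
    then show "((ennreal (4 * s ^ 3) * cap_av f 1 s x)\<^sup>2)\<^sup>2 * indicator {0..1} s
      = ennreal (256 * s ^ 12) * (cap_av f 1 s x) ^ 4 * indicator {0..1} s"
      by (simp add: power_mult[symmetric] power_mult_distrib indicator_def)
  qed
  also have "((ennreal (half_vol * \<bar>f x\<bar>))\<^sup>2)\<^sup>2 = ennreal (half_vol ^ 4 * f x ^ 4)"
    using half_vol(2) by (simp add: ennreal_power power_mult[symmetric] power_mult_distrib)
  finally show ?thesis .
qed

lemma nn_integral_S3_eq_integral:
  assumes "continuous_on S3 f" "\<And>x. x \<in> S3 \<Longrightarrow> f x \<ge> 0"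
  shows "(\<integral>\<^sup>+x. ennreal (f x) \<partial>S3_measure) = ennreal (LINT x|S3_measure. f x)"
  by (rule nn_integral_eq_integral[OF integrable_S3_continuous[OF assms(1)]]) (use assms(2) in auto)

text \<open>Cauchy-Schwarz twice in \<open>y\<close> turns the fourth power of the first moment into
  the fourth moment, and \<open>s ^ 12 = (s ^ 4) ^ 3\<close> is exactly the weight that
  \<open>cap_av_le\<close> asks for. In dimension 3 this is the embedding of one derivative in
  \<open>L^4\<close> into bounded functions.\<close>

lemma Sobolev_sup:
  obtains C where "C > 0" "\<And>f x. smooth_S3 f \<Longrightarrow> x \<in> S3 \<Longrightarrow> f x ^ 4 \<le> C * (LINT z|S3_measure. jet1 f z ^ 4)"
proof -
  \<comment> \<open>512 = 256 * 2, with 256 from \<open>pow4_le_cap_av\<close> and 2 from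
    \<open>cap_av_le\<close>; the volume occurs to the power 3 on one side and 4 on the
    other.\<close>
  define C where "C = 512 / half_vol"
  have "f x ^ 4 \<le> C * (LINT z|S3_measure. jet1 f z ^ 4)" if f: "smooth_S3 f" and x: "x \<in> S3" for f x
  proof -
    define Q where "Q = (LINT z|S3_measure. jet1 f z ^ 4)"
    have Q: "(\<integral>\<^sup>+z. ennreal (jet1 f z ^ 4) \<partial>S3_measure) = ennreal Q" "Q \<ge> 0"
      unfolding Q_def by (auto intro!: nn_integral_S3_eq_integral continuous_intros continuous_jet1 f integral_nonneg_AE jet1_nonneg)
    have "ennreal (256 * s ^ 12) * (cap_av f 1 s x) ^ 4 \<le> ennreal (512 * half_vol ^ 3 * Q)" if s: "s \<in> {0..1}" for s
    proof -
      have "(cap_av f 1 s x) ^ 4 = ((cap_av f 1 s x)\<^sup>2)\<^sup>2" by (simp add: power_mult[symmetric])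
      also have "\<dots> \<le> (ennreal half_vol * cap_av f 2 s x)\<^sup>2"
        using cap_av_square[OF f, of 1 s x] by (intro power_mono) auto
      also have "\<dots> = (ennreal half_vol)\<^sup>2 * (cap_av f 2 s x)\<^sup>2" by (simp add: power_mult_distrib)
      also have "\<dots> \<le> (ennreal half_vol)\<^sup>2 * (ennreal half_vol * cap_av f 4 s x)"
        using cap_av_square[OF f, of 2 s x] by (intro mult_left_mono) auto
      finally have "ennreal (256 * s ^ 12) * (cap_av f 1 s x) ^ 4
         \<le> ennreal (256 * s ^ 12) * ((ennreal half_vol)\<^sup>2 * (ennreal half_vol * cap_av f 4 s x))"
        by (rule mult_left_mono) simp
      also have "\<dots> = ennreal (256 * half_vol ^ 3) * (ennreal (s ^ 12) * cap_av f 4 s x)"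
        using half_vol(2) s by (simp add: ennreal_mult ennreal_power[symmetric] power2_eq_square power3_eq_cube mult_ac)
      also have "\<dots> \<le> ennreal (256 * half_vol ^ 3) * (2 * ennreal Q)"
        using cap_av_le[OF f s x, of 4] unfolding Q(1) by (intro mult_left_mono) auto
      also have "\<dots> = ennreal (512 * half_vol ^ 3 * Q)"
        using ennreal_mult_two[of "256 * half_vol ^ 3" Q] half_vol(2) Q(2) by simp
      finally show ?thesis .
    qed
    then have "(\<integral>\<^sup>+s. ennreal (256 * s ^ 12) * (cap_av f 1 s x) ^ 4 * indicator {0..1} s \<partial>lborel)
       \<le> (\<integral>\<^sup>+s. ennreal (512 * half_vol ^ 3 * Q) * indicator {0..1::real} s \<partial>lborel)"
      by (intro nn_integral_mono) (auto simp: indicator_def)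
    also have "\<dots> = ennreal (512 * half_vol ^ 3 * Q)" by (subst nn_integral_cmult) auto
    finally have "ennreal (half_vol ^ 4 * f x ^ 4) \<le> ennreal (512 * half_vol ^ 3 * Q)"
      using pow4_le_cap_av[OF f x] order_trans by blast
    then have "half_vol ^ 4 * f x ^ 4 \<le> 512 * half_vol ^ 3 * Q"
      using half_vol(2) Q(2) by (simp add: ennreal_le_iff)
    then have "half_vol ^ 3 * (half_vol * f x ^ 4) \<le> half_vol ^ 3 * (512 * Q)"
      by (simp add: power4_eq_xxxx power3_eq_cube mult_ac)
    then have "half_vol * f x ^ 4 \<le> 512 * Q" using half_vol(2) by simp
    then show ?thesis unfolding C_def Q_def using half_vol(2) by (simp add: field_simps)
  qed
  moreover have "C > 0" unfolding C_def using half_vol(2) by simp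
  ultimately show thesis using that by blast
qed

text \<open>As for the supremum, but with one Cauchy-Schwarz in \<open>y\<close>: of the two second
  moments obtained, one is bounded pointwise by \<open>cap_av_le\<close>, which uses up
  \<open>s ^ 12\<close>, and the other is integrated over \<open>x\<close> by
  \<open>integral_cap_av\<close>.\<close>

lemma Sobolev_L4:
  obtains C where "C > 0"
    "\<And>f. smooth_S3 f \<Longrightarrow> (LINT x|S3_measure. f x ^ 4) \<le> C * (LINT z|S3_measure. (jet1 f z)\<^sup>2)\<^sup>2"
proof -
  define C where "C = 512 / half_vol"
  have "(LINT x|S3_measure. f x ^ 4) \<le> C * (LINT z|S3_measure. (jet1 f z)\<^sup>2)\<^sup>2" if f: "smooth_S3 f" for f
  proof -
    define Q where "Q = (LINT z|S3_measure. (jet1 f z)\<^sup>2)"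
    have Q: "(\<integral>\<^sup>+z. ennreal ((jet1 f z)\<^sup>2) \<partial>S3_measure) = ennreal Q" "Q \<ge> 0"
      unfolding Q_def by (auto intro!: nn_integral_S3_eq_integral continuous_intros continuous_jet1 f integral_nonneg_AE)
    define I where "I = (LINT x|S3_measure. f x ^ 4)"
    have I: "(\<integral>\<^sup>+x. ennreal (f x ^ 4) \<partial>S3_measure) = ennreal I" "I \<ge> 0"
      unfolding I_def by (auto intro!: nn_integral_S3_eq_integral continuous_on_power smooth_S3_continuous_on[OF f] integral_nonneg_AE)
    interpret pair_sigma_finite S3_measure "lborel :: real measure"
      by (intro pair_sigma_finite.intro S3.sigma_finite_measure_axioms sigma_finite_lborel)
    have m [measurable]: "(\<lambda>p. cap_av f k (snd p) (fst p)) \<in> borel_measurable (S3_measure \<Otimes>\<^sub>M lborel)" for k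
    proof -
      note [measurable] = measurable_compose[OF measurable_fst measurable_S3_ident]
      have "(\<lambda>p. (snd p, fst p)) \<in> S3_measure \<Otimes>\<^sub>M lborel \<rightarrow>\<^sub>M (borel :: real measure) \<Otimes>\<^sub>M borel" by measurable
      from measurable_compose[OF this measurable_cap_av[OF f, of k]] show ?thesis by simp
    qed
    have m1 [measurable]: "(\<lambda>x. cap_av f k s x) \<in> borel_measurable S3_measure" for k s
      using measurable_compose[OF measurable_Pair[OF measurable_const measurable_S3_ident] measurable_cap_av[OF f, of k], of s]
      by simp
    have inner: "(\<integral>\<^sup>+x. ennreal (256 * s ^ 12) * (cap_av f 1 s x) ^ 4 \<partial>S3_measure) \<le> ennreal (512 * half_vol ^ 3 * Q\<^sup>2)"
      if s: "s \<in> {0..1}" for s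
    proof -
      have "(\<integral>\<^sup>+x. ennreal (256 * s ^ 12) * (cap_av f 1 s x) ^ 4 \<partial>S3_measure)
         \<le> (\<integral>\<^sup>+x. ennreal (512 * half_vol\<^sup>2 * Q) * cap_av f 2 s x \<partial>S3_measure)"
      proof (rule nn_integral_mono)
        fix x assume "x \<in> space S3_measure"
        then have x: "x \<in> S3" by simp
        have "(cap_av f 1 s x) ^ 4 = ((cap_av f 1 s x)\<^sup>2)\<^sup>2" by (simp add: power_mult[symmetric])
        also have "\<dots> \<le> (ennreal half_vol * cap_av f 2 s x)\<^sup>2"
          using cap_av_square[OF f, of 1 s x] by (intro power_mono) auto
        finally have "ennreal (256 * s ^ 12) * (cap_av f 1 s x) ^ 4
           \<le> ennreal (256 * s ^ 12) * (ennreal half_vol * cap_av f 2 s x)\<^sup>2" by (rule mult_left_mono) simp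
        also have "\<dots> = ennreal (256 * half_vol\<^sup>2) * (ennreal (s ^ 12) * cap_av f 2 s x) * cap_av f 2 s x"
          using half_vol(2) s by (simp add: ennreal_mult ennreal_power[symmetric] power2_eq_square mult_ac)
        also have "\<dots> \<le> ennreal (256 * half_vol\<^sup>2) * (2 * ennreal Q) * cap_av f 2 s x"
          using cap_av_le[OF f s x, of 2] unfolding Q(1) by (intro mult_right_mono mult_left_mono) auto
        also have "ennreal (256 * half_vol\<^sup>2) * (2 * ennreal Q) = ennreal (512 * half_vol\<^sup>2 * Q)"
          using ennreal_mult_two[of "256 * half_vol\<^sup>2" Q] half_vol(2) Q(2) by simp
        finally show "ennreal (256 * s ^ 12) * (cap_av f 1 s x) ^ 4 \<le> ennreal (512 * half_vol\<^sup>2 * Q) * cap_av f 2 s x" .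
      qed
      also have "\<dots> = ennreal (512 * half_vol\<^sup>2 * Q) * (\<integral>\<^sup>+x. cap_av f 2 s x \<partial>S3_measure)"
        by (rule nn_integral_cmult) measurable
      also have "\<dots> = ennreal (512 * half_vol ^ 3 * Q\<^sup>2)"
        unfolding integral_cap_av[OF f s] Q(1) using half_vol(2) Q(2)
        by (simp add: ennreal_mult[symmetric] power2_eq_square power3_eq_cube mult_ac)
      finally show ?thesis .
    qed
    have "ennreal (half_vol ^ 4 * I) = (\<integral>\<^sup>+x. ennreal (half_vol ^ 4 * f x ^ 4) \<partial>S3_measure)"
    proof -
      have [measurable]: "f \<in> borel_measurable S3_measure"
        by (intro measurable_S3_continuous smooth_S3_continuous_on f)
      have "(\<integral>\<^sup>+x. ennreal (half_vol ^ 4 * f x ^ 4) \<partial>S3_measure) = (\<integral>\<^sup>+x. ennreal (half_vol ^ 4) * ennreal (f x ^ 4) \<partial>S3_measure)"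
        by (simp add: ennreal_mult)
      also have "\<dots> = ennreal (half_vol ^ 4) * ennreal I"
        unfolding I(1)[symmetric] by (rule nn_integral_cmult) measurable
      finally show ?thesis using I(2) by (simp add: ennreal_mult)
    qed
    also have "\<dots> \<le> (\<integral>\<^sup>+x. (\<integral>\<^sup>+s. ennreal (256 * s ^ 12) * (cap_av f 1 s x) ^ 4 * indicator {0..1} s \<partial>lborel) \<partial>S3_measure)"
      by (intro nn_integral_mono pow4_le_cap_av[OF f]) simp
    also have "\<dots> = (\<integral>\<^sup>+s. (\<integral>\<^sup>+x. ennreal (256 * s ^ 12) * (cap_av f 1 s x) ^ 4 * indicator {0..1} s \<partial>S3_measure) \<partial>lborel)"
      using m[of 1] by (intro Fubini'[symmetric]) (auto simp: case_prod_beta')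
    also have "\<dots> \<le> (\<integral>\<^sup>+s. ennreal (512 * half_vol ^ 3 * Q\<^sup>2) * indicator {0..1::real} s \<partial>lborel)"
      by (intro nn_integral_mono) (use inner in \<open>auto simp: indicator_def\<close>)
    also have "\<dots> = ennreal (512 * half_vol ^ 3 * Q\<^sup>2)" by (subst nn_integral_cmult) auto
    finally have "half_vol ^ 4 * I \<le> 512 * half_vol ^ 3 * Q\<^sup>2"
      using half_vol(2) Q(2) I(2) by (simp add: ennreal_le_iff)
    then have "half_vol ^ 3 * (half_vol * I) \<le> half_vol ^ 3 * (512 * Q\<^sup>2)"
      by (simp add: power4_eq_xxxx power3_eq_cube mult_ac)
    then have "half_vol * I \<le> 512 * Q\<^sup>2" using half_vol(2) by simp
    then show ?thesis unfolding C_def Q_def I_def using half_vol(2) by (simp add: field_simps)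
  qed
  moreover have "C > 0" unfolding C_def using half_vol(2) by simp
  ultimately show thesis using that by blast
qed

section \<open>The Poincare inequality\<close>

lemma unit_quaternion_polar:
  assumes "norm q = 1"
  obtains \<theta> \<xi> where "0 \<le> \<theta>" "\<theta> \<le> pi" "norm \<xi> = 1" "one4 \<bullet> \<xi> = 0" "q = cos \<theta> *\<^sub>R one4 + sin \<theta> *\<^sub>R \<xi>"
proof -
  define c where "c = q \<bullet> one4"
  define r where "r = q - c *\<^sub>R one4"
  have one: "one4 \<bullet> one4 = 1" by (simp add: dot_square_norm)
  have ro: "one4 \<bullet> r = 0" unfolding r_def c_def using one by (simp add: inner_diff_right inner_commute)
  have c: "\<bar>c\<bar> \<le> 1" unfolding c_def using Cauchy_Schwarz_ineq2[of q one4] assms by simp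
  have "r \<bullet> r = q \<bullet> q - c * c"
    unfolding r_def using one by (simp add: inner_diff_left inner_diff_right c_def inner_commute)
  then have "(norm r)\<^sup>2 = 1 - c\<^sup>2"
    using assms by (simp add: power2_norm_eq_inner[symmetric] power2_eq_square)
  then have r2: "norm r = sqrt (1 - c\<^sup>2)" by (intro real_sqrt_unique[symmetric]) auto
  \<comment> \<open>For real \<open>q\<close> any imaginary unit will do, as its coefficient
    vanishes.\<close>
  define \<xi> where "\<xi> = (if r = 0 then axis 2 1 else r /\<^sub>R norm r)"
  have \<xi>: "norm \<xi> = 1" "one4 \<bullet> \<xi> = 0" "r = norm r *\<^sub>R \<xi>"
    using ro by (auto simp: \<xi>_def one4_def inner_axis_axis)
  have "q = c *\<^sub>R one4 + norm r *\<^sub>R \<xi>" using \<xi>(3) unfolding r_def by (metis add.commute diff_add_cancel)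
  moreover have "cos (arccos c) = c" "sin (arccos c) = norm r" "0 \<le> arccos c" "arccos c \<le> pi"
    using c r2 by (auto simp: sin_arccos arccos_lbound arccos_ubound abs_le_iff)
  ultimately show thesis using that[of "arccos c" \<xi>] \<xi> by simp
qed

text \<open>The one-parameter group from 1 to \<open>q\<close> moves every point at unit speed for a
  time \<theta> \<le> pi. One factor \<theta> comes from Cauchy-Schwarz in time, the other from the
  integral over time once rotation invariance has removed the dependence on
  \<open>s\<close>.\<close>

lemma rotation_increment_le:
  assumes f: "smooth_S3 f" and q: "norm q = 1"
  shows "(\<integral>\<^sup>+x. ennreal ((f (qmul q x) - f x)\<^sup>2) \<partial>S3_measure)
    \<le> ennreal (pi\<^sup>2 * (LINT x|S3_measure. (\<Sum>a\<in>UNIV. \<bar>X a f x\<bar>)\<^sup>2))"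
proof -
  obtain \<theta> \<xi> where \<theta>: "0 \<le> \<theta>" "\<theta> \<le> pi" and \<xi>: "norm \<xi> = 1" "one4 \<bullet> \<xi> = 0"
    and q: "q = cos \<theta> *\<^sub>R one4 + sin \<theta> *\<^sub>R \<xi>" using unit_quaternion_polar[OF q] by blast
  define h where "h x = (\<Sum>a\<in>UNIV. \<bar>X a f x\<bar>)" for x
  have h0: "h x \<ge> 0" for x unfolding h_def by (intro sum_nonneg) auto
  have hc: "continuous_on S3 h" unfolding h_def by (intro continuous_intros smooth_S3_continuous_on smooth_S3_X f)
  define p where "p s = cos s *\<^sub>R one4 + sin s *\<^sub>R \<xi>" for s
  have comb: "norm (a *\<^sub>R one4 + b *\<^sub>R \<xi>) = sqrt (a\<^sup>2 + b\<^sup>2)" for a b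
  proof -
    have "\<xi> \<bullet> \<xi> = 1" "one4 \<bullet> one4 = 1" "\<xi> \<bullet> one4 = 0" using \<xi> by (auto simp: dot_square_norm inner_commute)
    then have "(a *\<^sub>R one4 + b *\<^sub>R \<xi>) \<bullet> (a *\<^sub>R one4 + b *\<^sub>R \<xi>) = a\<^sup>2 + b\<^sup>2"
      using \<xi>(2) by (simp add: inner_add_left inner_add_right power2_eq_square)
    then show ?thesis by (simp only: norm_eq_sqrt_inner)
  qed
  have p: "norm (p s) = 1" for s unfolding p_def comb by simp
  have pS: "qmul (p s) x \<in> S3" if "x \<in> S3" for s x using that by (simp add: norm_qmul p)
  have pcont: "continuous_on T (\<lambda>s. qmul (p s) x)" for T x unfolding p_def
    by (intro bounded_bilinear.continuous_on[OF bilinear_qmul] continuous_intros)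
  define H where "H z = (if z = 0 then 0 else ext h z)" for z :: "real^4"
  have [measurable]: "H \<in> borel_measurable borel" unfolding H_def
    by (rule measurable_ext) (intro borel_measurable_continuous_on_restrict hc)
  have [measurable]: "p \<in> borel_measurable borel" unfolding p_def by measurable
  have HS: "x \<in> S3 \<Longrightarrow> H x = h x" for x by (auto simp: H_def)
  have inc: "ennreal \<bar>f (qmul q x) - f x\<bar> \<le> (\<integral>\<^sup>+s. ennreal (H (qmul (p s) x)) * indicator {0..\<theta>} s \<partial>lborel)"
    if x: "x \<in> S3" for x
  proof -
    have "ennreal \<bar>ext f (qmul (p \<theta>) x) - ext f (qmul (p 0) x)\<bar>
        \<le> (\<integral>\<^sup>+s. ennreal (H (qmul (p s) x)) * indicator {0..\<theta>} s \<partial>lborel)"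
    proof (rule abs_increment_le[OF \<theta>(1)])
      fix s
      define p' where "p' = (- sin s) *\<^sub>R one4 + cos s *\<^sub>R \<xi>"
      have "norm p' = 1" unfolding p'_def comb by simp
      then have p'x: "norm (qmul p' x) = 1" using x by (simp add: norm_qmul)
      have "((\<lambda>s. qmul (p s) x) has_vector_derivative qmul p' x) (at s within {0..\<theta>})"
      proof -
        have "(p has_vector_derivative p') (at s within {0..\<theta>})" unfolding p_def p'_def
          by (auto intro!: derivative_eq_intros simp: has_real_derivative_iff_has_vector_derivative[symmetric])
        then show ?thesis
          by (rule bounded_linear.has_vector_derivative[OF bounded_bilinear.bounded_linear_left[OF bilinear_qmul]])
      qed
      then show "((\<lambda>s. ext f (qmul (p s) x)) has_vector_derivative extD f (qmul (p s) x) (qmul p' x)) (at s within {0..\<theta>})"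
        by (rule has_vector_derivative_along[OF f]) (use pS[OF x, of s] in auto)
      have "\<bar>extD f (qmul (p s) x) (qmul p' x)\<bar> \<le> norm (qmul p' x) / norm (qmul (p s) x) * h (qmul (p s) x)"
        unfolding h_def by (rule abs_extD_le[OF f]) (use pS[OF x, of s] in auto)
      then show "norm (extD f (qmul (p s) x) (qmul p' x)) \<le> H (qmul (p s) x)"
        using pS[OF x, of s] p'x HS[OF pS[OF x]] by simp
    next
      have "continuous_on {0..\<theta>} (\<lambda>s. h (qmul (p s) x))"
        by (rule continuous_on_compose2[OF hc pcont]) (use pS[OF x] in auto)
      then show "continuous_on {0..\<theta>} (\<lambda>s. H (qmul (p s) x))"
        by (rule continuous_on_eq) (simp add: HS[OF pS[OF x]])
    qed
    then show ?thesis using pS[OF x, of \<theta>] x by (simp add: p_def q)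
  qed
  interpret pair_sigma_finite S3_measure "lborel :: real measure"
    by (intro pair_sigma_finite.intro S3.sigma_finite_measure_axioms sigma_finite_lborel)
  define Q where "Q = (LINT x|S3_measure. (h x)\<^sup>2)"
  have Q: "(\<integral>\<^sup>+x. ennreal ((h x)\<^sup>2) \<partial>S3_measure) = ennreal Q" "Q \<ge> 0"
    unfolding Q_def by (auto intro!: nn_integral_S3_eq_integral continuous_on_power hc)
  have "(\<integral>\<^sup>+x. ennreal ((f (qmul q x) - f x)\<^sup>2) \<partial>S3_measure)
     \<le> (\<integral>\<^sup>+x. (\<integral>\<^sup>+s. ennreal \<theta> * ennreal ((H (qmul (p s) x))\<^sup>2) * indicator {0..\<theta>} s \<partial>lborel) \<partial>S3_measure)"
  proof (rule nn_integral_mono)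
    fix x assume "x \<in> space S3_measure"
    then have x: "x \<in> S3" by simp
    have "ennreal ((f (qmul q x) - f x)\<^sup>2) = (ennreal \<bar>f (qmul q x) - f x\<bar>)\<^sup>2" by (simp add: ennreal_power)
    also have "\<dots> \<le> (\<integral>\<^sup>+s. ennreal (H (qmul (p s) x)) * indicator {0..\<theta>} s \<partial>lborel)\<^sup>2"
      by (intro power_mono inc x) simp
    also have "\<dots> \<le> emeasure lborel {0..\<theta>} * (\<integral>\<^sup>+s. (ennreal (H (qmul (p s) x)))\<^sup>2 * indicator {0..\<theta>} s \<partial>lborel)"
      by (rule nn_integral_square_le) measurable
    also have "\<dots> = (\<integral>\<^sup>+s. ennreal \<theta> * ((ennreal (H (qmul (p s) x)))\<^sup>2 * indicator {0..\<theta>} s) \<partial>lborel)"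
      using \<theta> by (subst nn_integral_cmult) auto
    finally show "ennreal ((f (qmul q x) - f x)\<^sup>2)
       \<le> (\<integral>\<^sup>+s. ennreal \<theta> * ennreal ((H (qmul (p s) x))\<^sup>2) * indicator {0..\<theta>} s \<partial>lborel)"
      using h0 pS[OF x] HS by (simp add: ennreal_power mult.assoc)
  qed
  also have "\<dots> = (\<integral>\<^sup>+s. (\<integral>\<^sup>+x. ennreal \<theta> * ennreal ((H (qmul (p s) x))\<^sup>2) * indicator {0..\<theta>} s \<partial>S3_measure) \<partial>lborel)"
  proof (rule Fubini'[symmetric])
    note [measurable] = measurable_compose[OF measurable_fst measurable_S3_ident]
    show "(\<lambda>(x, s). ennreal \<theta> * ennreal ((H (qmul (p s) x))\<^sup>2) * indicator {0..\<theta>} s) \<in> borel_measurable (S3_measure \<Otimes>\<^sub>M lborel)"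
      by measurable
  qed
  also have "\<dots> = (\<integral>\<^sup>+s. ennreal (\<theta> * Q) * indicator {0..\<theta>} s \<partial>lborel)"
  proof (rule nn_integral_cong)
    fix s :: real
    have mH: "(\<lambda>x. ennreal ((H x)\<^sup>2)) \<in> borel_measurable S3_measure"
      by (rule measurable_compose[OF measurable_S3_ident]) measurable
    have mHq: "(\<lambda>x. ennreal ((H (qmul (p s) x))\<^sup>2)) \<in> borel_measurable S3_measure"
      by (rule measurable_compose[OF measurable_S3_ident]) measurable
    have "(\<integral>\<^sup>+x. ennreal ((H (qmul (p s) x))\<^sup>2) \<partial>S3_measure) = (\<integral>\<^sup>+x. ennreal ((H x)\<^sup>2) \<partial>S3_measure)"
      by (rule nn_integral_S3_orthogonal[OF orthogonal_qmul_left[OF p] mH])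
    also have "\<dots> = ennreal Q" unfolding Q(1)[symmetric] by (intro nn_integral_cong) (simp add: HS)
    finally have "(\<integral>\<^sup>+x. ennreal \<theta> * ennreal ((H (qmul (p s) x))\<^sup>2) \<partial>S3_measure) = ennreal (\<theta> * Q)"
      using \<theta> Q(2) mHq by (simp add: nn_integral_cmult ennreal_mult)
    then show "(\<integral>\<^sup>+x. ennreal \<theta> * ennreal ((H (qmul (p s) x))\<^sup>2) * indicator {0..\<theta>} s \<partial>S3_measure)
       = ennreal (\<theta> * Q) * indicator {0..\<theta>} s" by (cases "s \<in> {0..\<theta>}") auto
  qed
  also have "\<dots> = ennreal (\<theta> * Q * \<theta>)"
    using \<theta> Q(2) by (subst nn_integral_cmult_indicator) (auto simp: ennreal_mult)
  also have "\<dots> \<le> ennreal (pi\<^sup>2 * Q)"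
    using \<theta> Q(2) by (intro ennreal_leI) (auto simp: power2_eq_square mult_ac intro!: mult_mono)
  finally show ?thesis unfolding Q_def h_def .
qed

text \<open>The squared increments are averaged over all rotations \<open>q\<close>. For fixed
  \<open>x\<close> the point \<open>q x\<close> is uniformly distributed, so for mean zero the
  double integral is \<open>2 * V * I\<close>, while \<open>rotation_increment_le\<close> bounds the
  inner integral for each single \<open>q\<close>.\<close>

lemma Poincare:
  assumes f: "smooth_S3 f" and mean: "(LINT x|S3_measure. f x) = 0"
  shows "(LINT x|S3_measure. (f x)\<^sup>2) \<le> pi\<^sup>2 * (LINT x|S3_measure. (\<Sum>a\<in>UNIV. \<bar>X a f x\<bar>)\<^sup>2)"
proof -
  define V where "V = measure S3_measure S3"
  define I where "I = (LINT x|S3_measure. (f x)\<^sup>2)"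
  define Q where "Q = (LINT x|S3_measure. (\<Sum>a\<in>UNIV. \<bar>X a f x\<bar>)\<^sup>2)"
  have I0: "I \<ge> 0" unfolding I_def by simp
  have Q0: "Q \<ge> 0" unfolding Q_def by simp
  have fc: "continuous_on S3 f" by (rule smooth_S3_continuous_on[OF f])
  have int: "integrable S3_measure f" "integrable S3_measure (\<lambda>x. (f x)\<^sup>2)" using f by simp_all
  define F where "F z = (if z = 0 then 0 else ext f z)" for z :: "real^4"
  have [measurable]: "F \<in> borel_measurable borel" unfolding F_def
    by (rule measurable_ext) (intro borel_measurable_continuous_on_restrict fc)
  have FS: "x \<in> S3 \<Longrightarrow> F x = f x" for x by (auto simp: F_def)
  interpret pair_sigma_finite S3_measure S3_measure
    by (intro pair_sigma_finite.intro S3.sigma_finite_measure_axioms)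
  have "(\<integral>\<^sup>+q. (\<integral>\<^sup>+x. ennreal ((F (qmul q x) - F x)\<^sup>2) \<partial>S3_measure) \<partial>S3_measure)
      \<le> (\<integral>\<^sup>+q. ennreal (pi\<^sup>2 * Q) \<partial>S3_measure)"
  proof (rule nn_integral_mono)
    fix q assume "q \<in> space S3_measure"
    then have q: "norm q = 1" by simp
    have "(\<integral>\<^sup>+x. ennreal ((F (qmul q x) - F x)\<^sup>2) \<partial>S3_measure) = (\<integral>\<^sup>+x. ennreal ((f (qmul q x) - f x)\<^sup>2) \<partial>S3_measure)"
      using q by (intro nn_integral_cong) (simp add: FS norm_qmul)
    then show "(\<integral>\<^sup>+x. ennreal ((F (qmul q x) - F x)\<^sup>2) \<partial>S3_measure) \<le> ennreal (pi\<^sup>2 * Q)"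
      using rotation_increment_le[OF f q] unfolding Q_def by simp
  qed
  also have "\<dots> = ennreal (pi\<^sup>2 * Q * V)"
    unfolding V_def using Q0 by (simp add: S3.emeasure_eq_measure ennreal_mult)
  finally have 1: "(\<integral>\<^sup>+q. (\<integral>\<^sup>+x. ennreal ((F (qmul q x) - F x)\<^sup>2) \<partial>S3_measure) \<partial>S3_measure) \<le> ennreal (pi\<^sup>2 * Q * V)" .
  have "(\<integral>\<^sup>+q. (\<integral>\<^sup>+x. ennreal ((F (qmul q x) - F x)\<^sup>2) \<partial>S3_measure) \<partial>S3_measure)
     = (\<integral>\<^sup>+x. (\<integral>\<^sup>+q. ennreal ((F (qmul q x) - F x)\<^sup>2) \<partial>S3_measure) \<partial>S3_measure)"
  proof (rule Fubini'[symmetric])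
    note [measurable] = measurable_compose[OF measurable_fst measurable_S3_ident] measurable_compose[OF measurable_snd measurable_S3_ident]
    show "(\<lambda>(q, x). ennreal ((F (qmul q x) - F x)\<^sup>2)) \<in> borel_measurable (S3_measure \<Otimes>\<^sub>M S3_measure)"
      by measurable
  qed
  also have "\<dots> = (\<integral>\<^sup>+x. ennreal (I + V * (f x)\<^sup>2) \<partial>S3_measure)"
  proof (rule nn_integral_cong)
    fix x assume "x \<in> space S3_measure"
    then have x: "norm x = 1" by simp
    have m: "(\<lambda>y. ennreal ((F y - F x)\<^sup>2)) \<in> borel_measurable S3_measure"
      by (rule measurable_compose[OF measurable_S3_ident]) measurable
    have "(\<integral>\<^sup>+q. ennreal ((F (qmul q x) - F x)\<^sup>2) \<partial>S3_measure) = (\<integral>\<^sup>+y. ennreal ((F y - F x)\<^sup>2) \<partial>S3_measure)"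
      by (rule nn_integral_S3_orthogonal[OF orthogonal_qmul_right[OF x] m])
    also have "\<dots> = (\<integral>\<^sup>+y. ennreal ((f y - f x)\<^sup>2) \<partial>S3_measure)"
      using x by (intro nn_integral_cong) (simp add: FS)
    also have "\<dots> = ennreal (LINT y|S3_measure. (f y - f x)\<^sup>2)"
      by (intro nn_integral_S3_eq_integral continuous_intros fc) auto
    also have "(LINT y|S3_measure. (f y - f x)\<^sup>2) = (LINT y|S3_measure. (f y)\<^sup>2 - 2 * f x * f y + (f x)\<^sup>2)"
      by (simp add: power2_diff algebra_simps)
    also have "\<dots> = I + V * (f x)\<^sup>2"
      using int mean unfolding I_def V_def by simp
    finally show "(\<integral>\<^sup>+q. ennreal ((F (qmul q x) - F x)\<^sup>2) \<partial>S3_measure) = ennreal (I + V * (f x)\<^sup>2)" .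
  qed
  also have "\<dots> = ennreal (LINT x|S3_measure. I + V * (f x)\<^sup>2)"
    by (intro nn_integral_S3_eq_integral continuous_intros fc) (auto simp: I0 V_def)
  also have "(LINT x|S3_measure. I + V * (f x)\<^sup>2) = 2 * V * I"
    using int unfolding V_def by (simp add: I_def mult.commute)
  finally have "ennreal (2 * V * I) \<le> ennreal (pi\<^sup>2 * Q * V)" using 1 by simp
  then have "2 * V * I \<le> pi\<^sup>2 * Q * V" using Q0 V_def by (simp add: ennreal_le_iff)
  \<comment> \<open>The factor \<open>V\<close> is to be cancelled; if the total mass vanished, both
    integrals would be trivial.\<close>
  moreover have "V > 0 \<or> I = 0"
  proof (cases "V = 0")
    case True
    then have "emeasure S3_measure (space S3_measure) = 0" unfolding V_def by (simp add: S3.emeasure_eq_measure)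
    then have "AE x in S3_measure. (f x)\<^sup>2 = 0" by (metis AE_I' emeasure_0_AE)
    then have "I = 0" unfolding I_def by (simp add: integral_eq_zero_AE)
    then show ?thesis ..
  qed (auto simp: V_def zero_less_measure_iff)
  ultimately have "2 * I \<le> pi\<^sup>2 * Q" using Q0 by (auto simp: mult.commute mult.left_commute)
  then show ?thesis using I0 unfolding I_def Q_def by linarith
qed

subsection \<open>Sobolev norms in the frame\<close>

text \<open>
  As the frame fields commute with \<open>lap\<close>, \<open>hB k f g\<close> equals the \<open>L^2\<close> product of \<open>f\<close> and \<open>(- lap)^k g\<close>;
  this makes the frame fields skew for it.
\<close>

primrec hB :: "nat \<Rightarrow> (real^4 \<Rightarrow> 'v::euclidean_space) \<Rightarrow> (real^4 \<Rightarrow> 'v) \<Rightarrow> real" where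
  "hB 0 f g = (LINT x|S3_measure. f x \<bullet> g x)"
| "hB (Suc k) f g = (\<Sum>a\<in>UNIV. hB k (X a f) (X a g))"

definition hN :: "nat \<Rightarrow> (real^4 \<Rightarrow> 'v::euclidean_space) \<Rightarrow> real" where
  "hN k f = (\<Sum>j\<le>k. hB j f f)"

lemma hB_cong:
  "(\<And>x. x \<in> S3 \<Longrightarrow> f x = f' x) \<Longrightarrow> (\<And>x. x \<in> S3 \<Longrightarrow> g x = g' x) \<Longrightarrow> hB k f g = hB k f' g'"
proof (induction k arbitrary: f f' g g')
  case 0 then show ?case by (auto intro!: integral_S3_cong)
next
  case (Suc k)
  have "hB k (X a f) (X a g) = hB k (X a f') (X a g')" for a
    by (intro Suc.IH X_cong Suc.prems)
  then show ?case by simp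
qed

lemma hN_cong: "(\<And>x. x \<in> S3 \<Longrightarrow> f x = g x) \<Longrightarrow> hN k f = hN k g"
  unfolding hN_def by (intro sum.cong hB_cong) auto

lemma hB_sym: "hB k f g = hB k g f"
  by (induction k arbitrary: f g) (simp_all add: inner_commute cong: sum.cong)

lemma hB_nonneg [simp]: "hB k f f \<ge> 0"
  by (induction k arbitrary: f) (auto intro!: sum_nonneg)

lemma hN_nonneg [simp]: "hN k f \<ge> 0"
  unfolding hN_def by (intro sum_nonneg) auto

lemma hB_add_left:
  "smooth_S3 f \<Longrightarrow> smooth_S3 g \<Longrightarrow> smooth_S3 h \<Longrightarrow> hB k (\<lambda>x. f x + g x) h = hB k f h + hB k g h"
proof (induction k arbitrary: f g h)
  case 0
  then show ?case by (simp add: inner_add_left)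
next
  case (Suc k)
  have "hB k (X a (\<lambda>x. f x + g x)) (X a h) = hB k (X a f) (X a h) + hB k (X a g) (X a h)" for a
  proof -
    have "hB k (X a (\<lambda>x. f x + g x)) (X a h) = hB k (\<lambda>x. X a f x + X a g x) (X a h)"
      using Suc.prems by (intro hB_cong) auto
    then show ?thesis using Suc.IH[of "X a f" "X a g" "X a h"] Suc.prems by simp
  qed
  then show ?case by (simp add: sum.distrib)
qed

lemma hB_scaleR_left:
  "smooth_S3 f \<Longrightarrow> smooth_S3 h \<Longrightarrow> hB k (\<lambda>x. c *\<^sub>R f x) h = c * hB k f h"
proof (induction k arbitrary: f h)
  case 0
  then show ?case by simp
next
  case (Suc k)
  have "hB k (X a (\<lambda>x. c *\<^sub>R f x)) (X a h) = c * hB k (X a f) (X a h)" for a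
  proof -
    have "hB k (X a (\<lambda>x. c *\<^sub>R f x)) (X a h) = hB k (\<lambda>x. c *\<^sub>R X a f x) (X a h)"
      using Suc.prems by (intro hB_cong) auto
    then show ?thesis using Suc.IH[of "X a f" "X a h"] Suc.prems by simp
  qed
  then show ?case by (simp add: sum_distrib_left)
qed

lemma hB_zero_left [simp]: "hB k (\<lambda>x. 0) h = 0"
proof (induction k arbitrary: h)
  case (Suc k)
  have "hB k (X a (\<lambda>x. 0)) (X a h) = hB k (\<lambda>x. 0) (X a h)" for a by (intro hB_cong) auto
  then show ?case using Suc by simp
qed simp

lemma hB_sum_left:
  "(\<And>i. i \<in> I \<Longrightarrow> smooth_S3 (F i)) \<Longrightarrow> smooth_S3 h \<Longrightarrow> hB k (\<lambda>x. \<Sum>i\<in>I. F i x) h = (\<Sum>i\<in>I. hB k (F i) h)"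
  by (induction I rule: infinite_finite_induct) (simp_all add: hB_add_left)

lemma hB_diff_left:
  "smooth_S3 f \<Longrightarrow> smooth_S3 g \<Longrightarrow> smooth_S3 h \<Longrightarrow> hB k (\<lambda>x. f x - g x) h = hB k f h - hB k g h"
  using hB_add_left[of f "\<lambda>x. (- 1) *\<^sub>R g x" h k] hB_scaleR_left[of g h k "- 1"] by simp

text \<open>The two claims feed each other. Skewness at order \<open>k + 1\<close> follows from both
  claims at order \<open>k\<close>, because the frame fields commute with \<open>lap\<close>;
  applying it to each \<open>X a f\<close> and summing over the frame gives the Laplacian form at
  order \<open>k + 1\<close>.\<close>

lemma hB_X_skew:
  "smooth_S3 f \<Longrightarrow> smooth_S3 g \<Longrightarrow> hB k (X a f) g = - hB k f (X a g)"
  and hB_Suc_lap: "smooth_S3 f \<Longrightarrow> smooth_S3 g \<Longrightarrow> hB (Suc k) f g = - hB k (lap f) g"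
proof (induction k arbitrary: f g a)
  case 0
  { case 1 then show ?case by (simp add: integral_X_by_parts)
  next
    case 2
    have "hB 0 (X a f) (X a g) = - hB 0 (X a (X a f)) g" for a
      using integral_X_by_parts[of "X a f" g a] 2 by simp
    then have "hB (Suc 0) f g = - (\<Sum>a\<in>UNIV. hB 0 (X a (X a f)) g)" by (simp only: hB.simps(2) sum_negf)
    also have "(\<Sum>a\<in>UNIV. hB 0 (X a (X a f)) g) = hB 0 (lap f) g"
      unfolding lap_def using 2 by (subst hB_sum_left) auto
    finally show ?case . }
next
  case (Suc k)
  { case 1
    have "hB (Suc k) (X a f) g = - hB k (lap (X a f)) g" using Suc(2) 1 by simp
    also have "hB k (lap (X a f)) g = hB k (X a (lap f)) g"
      using 1 by (intro hB_cong) (auto simp: X_lap)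
    also have "\<dots> = - hB k (lap f) (X a g)" using Suc(1) 1 by simp
    also have "hB k (lap f) (X a g) = - hB (Suc k) f (X a g)" using Suc(2)[of f "X a g"] 1 by simp
    finally show ?case by simp
  }
  note skew = this
  { case 2
    have "hB (Suc k) (X a f) (X a g) = - hB (Suc k) (X a (X a f)) g" for a
      using skew[of "X a f" g a] 2 by simp
    then have "hB (Suc (Suc k)) f g = - (\<Sum>a\<in>UNIV. hB (Suc k) (X a (X a f)) g)"
      by (simp only: hB.simps(2)[of "Suc k"] sum_negf)
    also have "(\<Sum>a\<in>UNIV. hB (Suc k) (X a (X a f)) g) = hB (Suc k) (lap f) g"
      unfolding lap_def using 2 by (subst hB_sum_left) auto
    finally show ?case . }
qed

lemma hB_lap_lap: "smooth_S3 f \<Longrightarrow> hB (Suc (Suc k)) f f = hB k (lap f) (lap f)"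
  using hB_Suc_lap[of f f "Suc k"] hB_Suc_lap[of f "lap f" k] by (simp only: hB_sym[of "Suc k" "lap f" f]) simp

section \<open>Inequalities for the frame norms\<close>

lemma hB_weighted:
  assumes c: "c > 0"
  shows "smooth_S3 f \<Longrightarrow> smooth_S3 g \<Longrightarrow> 2 * \<bar>hB k f g\<bar> \<le> c * hB k f f + hB k g g / c"
proof (induction k arbitrary: f g)
  case 0
  have pt: "2 * \<bar>u \<bullet> v\<bar> \<le> c * (u \<bullet> u) + (v \<bullet> v) / c" for u v :: 'a
  proof -
    have "2 * \<bar>u \<bullet> v\<bar> \<le> 2 * (norm u * norm v)" using Cauchy_Schwarz_ineq2[of u v] by simp
    also have "\<dots> \<le> c * (norm u)\<^sup>2 + (norm v)\<^sup>2 / c"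
    proof -
      have "0 \<le> (c * norm u - norm v)\<^sup>2 / c" using c by simp
      also have "\<dots> = c * (norm u)\<^sup>2 + (norm v)\<^sup>2 / c - 2 * (norm u * norm v)"
        using c by (simp add: power2_eq_square field_simps)
      finally show ?thesis by simp
    qed
    finally show ?thesis by (simp add: dot_square_norm)
  qed
  have int: "integrable S3_measure (\<lambda>x. f x \<bullet> g x)" "integrable S3_measure (\<lambda>x. f x \<bullet> f x)"
    "integrable S3_measure (\<lambda>x. g x \<bullet> g x)" using 0 by simp_all
  have "2 * \<bar>hB 0 f g\<bar> \<le> 2 * (LINT x|S3_measure. \<bar>f x \<bullet> g x\<bar>)"
    using integral_abs_bound[of S3_measure "\<lambda>x. f x \<bullet> g x"] by simp
  also have "\<dots> = (LINT x|S3_measure. 2 * \<bar>f x \<bullet> g x\<bar>)" by simp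
  also have "\<dots> \<le> (LINT x|S3_measure. c * (f x \<bullet> f x) + (g x \<bullet> g x) / c)"
    using int pt by (intro integral_mono) auto
  also have "\<dots> = c * hB 0 f f + hB 0 g g / c" using int by simp
  finally show ?case .
next
  case (Suc k)
  have "2 * \<bar>hB (Suc k) f g\<bar> \<le> (\<Sum>a\<in>UNIV. 2 * \<bar>hB k (X a f) (X a g)\<bar>)"
    by (simp add: sum_distrib_left[symmetric])
  also have "\<dots> \<le> (\<Sum>a\<in>UNIV. c * hB k (X a f) (X a f) + hB k (X a g) (X a g) / c)"
    by (intro sum_mono Suc.IH) (use Suc.prems in auto)
  also have "\<dots> = c * hB (Suc k) f f + hB (Suc k) g g / c"
    by (simp add: sum.distrib sum_distrib_left sum_divide_distrib)
  finally show ?case .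
qed

lemma hB_le: "smooth_S3 f \<Longrightarrow> smooth_S3 g \<Longrightarrow> 2 * \<bar>hB k f g\<bar> \<le> hB k f f + hB k g g"
  using hB_weighted[of 1 f g k] by simp

lemma hB_add_self_le:
  assumes "smooth_S3 f" "smooth_S3 g"
  shows "hB k (\<lambda>x. f x + g x) (\<lambda>x. f x + g x) \<le> 2 * hB k f f + 2 * hB k g g"
proof -
  have "hB k (\<lambda>x. f x + g x) (\<lambda>x. f x + g x) = hB k f f + hB k g g + 2 * hB k f g"
    using assms hB_sym[of k f "\<lambda>x. f x + g x"] hB_sym[of k g "\<lambda>x. f x + g x"] hB_sym[of k g f]
    by (simp add: hB_add_left)
  then show ?thesis using hB_le[OF assms, of k] by simp
qed

lemma hN_add:
  "smooth_S3 f \<Longrightarrow> smooth_S3 g \<Longrightarrow> hN k (\<lambda>x. f x + g x) \<le> 2 * hN k f + 2 * hN k g"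
  unfolding hN_def sum_distrib_left sum.distrib[symmetric] by (intro sum_mono hB_add_self_le)

lemma hN_scaleR: "smooth_S3 f \<Longrightarrow> hN k (\<lambda>x. c *\<^sub>R f x) = c\<^sup>2 * hN k f"
proof -
  assume f: "smooth_S3 f"
  have "hB j (\<lambda>x. c *\<^sub>R f x) (\<lambda>x. c *\<^sub>R f x) = c\<^sup>2 * hB j f f" for j
    using f hB_sym[of j f "\<lambda>x. c *\<^sub>R f x"] by (simp add: hB_scaleR_left power2_eq_square)
  then show ?thesis by (simp add: hN_def sum_distrib_left)
qed

lemma hN_cmult: "smooth_S3 f \<Longrightarrow> hN k (\<lambda>x. c * f x) = c\<^sup>2 * hN k f"
  using hN_scaleR[of f k c] by simp

lemma hN_minus: "smooth_S3 f \<Longrightarrow> hN k (\<lambda>x. - f x) = hN k f"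
  using hN_scaleR[of f k "- 1"] by simp

lemma hN_diff:
  "smooth_S3 f \<Longrightarrow> smooth_S3 g \<Longrightarrow> hN k (\<lambda>x. f x - g x) \<le> 2 * hN k f + 2 * hN k g"
  using hN_add[of f "\<lambda>x. - g x" k] by (simp add: hN_minus)

lemma hN_sum3:
  assumes "\<And>a::3. smooth_S3 (F a)"
  shows "hN k (\<lambda>x. \<Sum>a\<in>UNIV. F a x) \<le> 4 * (\<Sum>a\<in>UNIV. hN k (F a))"
proof -
  have "hN k (\<lambda>x. (F 1 x + F 2 x) + F 3 x) \<le> 2 * hN k (\<lambda>x. F 1 x + F 2 x) + 2 * hN k (F 3)"
    using assms by (intro hN_add) auto
  also have "\<dots> \<le> 2 * (2 * hN k (F 1) + 2 * hN k (F 2)) + 2 * hN k (F 3)"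
    using hN_add[of "F 1" "F 2" k] assms by simp
  also have "\<dots> \<le> 4 * (hN k (F 1) + hN k (F 2) + hN k (F 3))"
    using hN_nonneg[of k "F 3"] by (simp only: distrib_left)
  finally show ?thesis unfolding sum_3 .
qed

lemma hN_Suc: "hN (Suc k) f = hB 0 f f + (\<Sum>a\<in>UNIV. hN k (X a f))"
proof -
  have "hN (Suc k) f = hB 0 f f + (\<Sum>j\<le>k. hB (Suc j) f f)"
    unfolding hN_def by (rule sum.atMost_Suc_shift)
  also have "(\<Sum>j\<le>k. hB (Suc j) f f) = (\<Sum>a\<in>UNIV. hN k (X a f))"
    unfolding hN_def hB.simps by (rule sum.swap)
  finally show ?thesis .
qed

lemma hN_0: "hN 0 f = hB 0 f f"
  by (simp add: hN_def)

lemma hN_mono: "j \<le> k \<Longrightarrow> hN j f \<le> hN k f"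
  unfolding hN_def by (intro sum_mono2) auto

lemma hN_X_le: "hN k (X a f) \<le> hN (Suc k) f"
proof -
  have "hN k (X a f) \<le> (\<Sum>a\<in>UNIV. hN k (X a f))"
    using member_le_sum[of a UNIV "\<lambda>a. hN k (X a f)"] by simp
  then show ?thesis unfolding hN_Suc using hB_nonneg[of 0 f] by linarith
qed

lemma hB_le_hN: "j \<le> k \<Longrightarrow> hB j f f \<le> hN k f"
  unfolding hN_def using member_le_sum[of j "{..k}" "\<lambda>j. hB j f f"] by simp

lemma hN_Suc_last: "hN (Suc k) f = hN k f + hB (Suc k) f f"
  by (simp add: hN_def)

lemma hN_linear_le:
  fixes f :: "real^4 \<Rightarrow> 'v::euclidean_space" and L :: "'v \<Rightarrow> 'w::euclidean_space"
  assumes L: "bounded_linear L" and K: "\<And>v. norm (L v) \<le> K * norm v"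
  shows "smooth_S3 f \<Longrightarrow> hN k (\<lambda>x. L (f x)) \<le> K\<^sup>2 * hN k f"
proof -
  have "smooth_S3 f \<Longrightarrow> hB j (\<lambda>x. L (f x)) (\<lambda>x. L (f x)) \<le> K\<^sup>2 * hB j f f" for j
  proof (induction j arbitrary: f)
    case 0
    have "L v \<bullet> L v \<le> K\<^sup>2 * (v \<bullet> v)" for v
      using power_mono[OF K[of v] norm_ge_zero, of 2] by (simp add: power_mult_distrib dot_square_norm)
    then have "hB 0 (\<lambda>x. L (f x)) (\<lambda>x. L (f x)) \<le> (LINT x|S3_measure. K\<^sup>2 * (f x \<bullet> f x))"
      unfolding hB.simps using 0 smooth_S3_linear[OF L 0] by (intro integral_mono) auto
    then show ?case by simp
  next
    case (Suc j)
    have "hB j (X a (\<lambda>x. L (f x))) (X a (\<lambda>x. L (f x))) \<le> K\<^sup>2 * hB j (X a f) (X a f)" for a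
    proof -
      have "hB j (X a (\<lambda>x. L (f x))) (X a (\<lambda>x. L (f x))) = hB j (\<lambda>x. L (X a f x)) (\<lambda>x. L (X a f x))"
        by (intro hB_cong X_linear[OF L Suc.prems])
      then show ?thesis using Suc.IH[of "X a f"] Suc.prems by simp
    qed
    then show ?case by (simp add: sum_distrib_left sum_mono)
  qed
  then show "smooth_S3 f \<Longrightarrow> hN k (\<lambda>x. L (f x)) \<le> K\<^sup>2 * hN k f"
    unfolding hN_def sum_distrib_left by (intro sum_mono)
qed

text \<open>Pairing the equation with \<open>f\<close> and moving \<open>X a\<close> across by
  skewness gives \<open>2 E \<le> G + E\<close> for \<open>E = hB (Suc k) f f\<close>, so half of
  the left side is absorbed and the constant is 1. A right-hand side in divergence form thus gains
  one derivative.\<close>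

lemma hN_div_form:
  assumes f: "smooth_S3 f" and G: "\<And>a. smooth_S3 (G a)"
    and eq: "\<And>x. x \<in> S3 \<Longrightarrow> lap f x = (\<Sum>a\<in>UNIV. X a (G a) x)"
  shows "hB (Suc k) f f \<le> (\<Sum>a\<in>UNIV. hB k (G a) (G a))"
proof -
  have "hB (Suc k) f f = - hB k (lap f) f" by (rule hB_Suc_lap[OF f f])
  also have "hB k (lap f) f = hB k (\<lambda>x. \<Sum>a\<in>UNIV. X a (G a) x) f" by (intro hB_cong eq refl)
  also have "\<dots> = (\<Sum>a\<in>UNIV. hB k (X a (G a)) f)" using f G by (intro hB_sum_left) auto
  also have "\<dots> = - (\<Sum>a\<in>UNIV. hB k (G a) (X a f))"
    unfolding sum_negf[symmetric] using f G by (intro sum.cong hB_X_skew) auto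
  finally have "2 * hB (Suc k) f f = (\<Sum>a\<in>UNIV. 2 * hB k (G a) (X a f))" by (simp add: sum_distrib_left)
  also have "\<dots> \<le> (\<Sum>a\<in>UNIV. hB k (G a) (G a) + hB k (X a f) (X a f))"
  proof (rule sum_mono)
    fix a :: 3
    show "2 * hB k (G a) (X a f) \<le> hB k (G a) (G a) + hB k (X a f) (X a f)"
      using hB_le[of "G a" "X a f" k] f G by simp
  qed
  also have "\<dots> = (\<Sum>a\<in>UNIV. hB k (G a) (G a)) + hB (Suc k) f f" by (simp add: sum.distrib)
  finally show ?thesis by simp
qed

lemma square_sum3_le: "(\<Sum>a\<in>(UNIV::3 set). F a)\<^sup>2 \<le> 3 * (\<Sum>a\<in>UNIV. (F a :: real)\<^sup>2)"
proof -
  have "0 \<le> (F 1 - F 2)\<^sup>2 + (F 1 - F 3)\<^sup>2 + (F 2 - F 3)\<^sup>2" by simp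
  then show ?thesis unfolding sum_3 by (simp add: power2_eq_square algebra_simps)
qed

lemma hB_0_real: "hB 0 f f = (LINT x|S3_measure. (f x :: real)\<^sup>2)"
  by (simp add: power2_eq_square)

lemma hN_1: "hN (Suc 0) f = hB 0 f f + (\<Sum>a\<in>UNIV. hB 0 (X a f) (X a f))"
  by (simp add: hN_def)

lemma Poincare_hB:
  fixes f :: "real^4 \<Rightarrow> real"
  assumes f: "smooth_S3 f" and mean: "(LINT x|S3_measure. f x) = 0"
  shows "hB 0 f f \<le> 3 * pi\<^sup>2 * hB 1 f f"
proof -
  have int: "integrable S3_measure (\<lambda>x. (\<Sum>a\<in>UNIV. \<bar>X a f x\<bar>)\<^sup>2)"
    by (intro integrable_S3_continuous continuous_intros smooth_S3_continuous_on smooth_S3_X f)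
  have "(LINT x|S3_measure. (\<Sum>a\<in>UNIV. \<bar>X a f x\<bar>)\<^sup>2) \<le> (LINT x|S3_measure. 3 * (\<Sum>a\<in>UNIV. (X a f x)\<^sup>2))"
    using square_sum3_le[of "\<lambda>a. \<bar>X a f _\<bar>"] f by (intro integral_mono int) auto
  also have "\<dots> = 3 * hB 1 f f" using f by (simp add: hB_0_real del: hB.simps(1))
  finally have "(LINT x|S3_measure. (\<Sum>a\<in>UNIV. \<bar>X a f x\<bar>)\<^sup>2) \<le> 3 * hB 1 f f" .
  then have "pi\<^sup>2 * (LINT x|S3_measure. (\<Sum>a\<in>UNIV. \<bar>X a f x\<bar>)\<^sup>2) \<le> pi\<^sup>2 * (3 * hB 1 f f)"
    by (rule mult_left_mono) simp
  moreover have "pi\<^sup>2 * (3 * hB 1 f f) = 3 * pi\<^sup>2 * hB 1 f f" by (simp only: mult_ac)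
  ultimately show ?thesis using Poincare[OF f mean] unfolding hB_0_real by linarith
qed

section \<open>Embeddings and products in frame norms\<close>

lemma integral_Cauchy_Schwarz:
  fixes u v :: "real^4 \<Rightarrow> real"
  assumes "smooth_S3 u" "smooth_S3 v"
  shows "(LINT x|S3_measure. u x * v x)\<^sup>2 \<le> (LINT x|S3_measure. (u x)\<^sup>2) * (LINT x|S3_measure. (v x)\<^sup>2)"
proof -
  define A B D where "A = (LINT x|S3_measure. (u x)\<^sup>2)" and "B = (LINT x|S3_measure. u x * v x)"
    and "D = (LINT x|S3_measure. (v x)\<^sup>2)"
  have q: "0 \<le> t\<^sup>2 * A - 2 * t * B + D" for t
  proof -
    have "0 \<le> (LINT x|S3_measure. (t * u x - v x)\<^sup>2)" by simp
    also have "\<dots> = (LINT x|S3_measure. t\<^sup>2 * (u x)\<^sup>2 - 2 * t * (u x * v x) + (v x)\<^sup>2)"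
      by (intro integral_S3_cong) (simp add: power2_eq_square algebra_simps)
    also have "\<dots> = t\<^sup>2 * A - 2 * t * B + D"
      using assms by (simp add: A_def B_def D_def)
    finally show ?thesis .
  qed
  have A: "A \<ge> 0" "D \<ge> 0" unfolding A_def D_def by simp_all
  show ?thesis unfolding A_def[symmetric] B_def[symmetric] D_def[symmetric]
  proof (cases "A = 0")
    case True
    have "B = 0"
    proof (rule ccontr)
      assume "B \<noteq> 0"
      \<comment> \<open>With \<open>A = 0\<close> the quadratic in \<open>t\<close> is affine, and
        this \<open>t\<close> gives it the value -1.\<close>
      then have "2 * ((D + 1) / (2 * B)) * B = D + 1" by simp
      then show False using q[of "(D + 1) / (2 * B)"] True by simp
    qed
    then show "B\<^sup>2 \<le> A * D" using A True by simp
  next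
    case False
    then have A0: "A > 0" using A by simp
    have "0 \<le> A * ((B / A)\<^sup>2 * A - 2 * (B / A) * B + D)" using q[of "B / A"] A0 by simp
    also have "\<dots> = A * D - B\<^sup>2" using A0 by (simp add: power2_eq_square field_simps)
    finally show "B\<^sup>2 \<le> A * D" by simp
  qed
qed

lemma jet1_square_le: "(jet1 f x)\<^sup>2 \<le> 4 * ((f x)\<^sup>2 + (\<Sum>a\<in>UNIV. (X a f x)\<^sup>2))"
proof -
  define a b c d where "a = \<bar>f x\<bar>" and "b = \<bar>X 1 f x\<bar>" and "c = \<bar>X 2 f x\<bar>" and "d = \<bar>X 3 f x\<bar>"
  have "0 \<le> (a - b)\<^sup>2 + (a - c)\<^sup>2 + (a - d)\<^sup>2 + (b - c)\<^sup>2 + (b - d)\<^sup>2 + (c - d)\<^sup>2" by simp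
  then have "(a + (b + c + d))\<^sup>2 \<le> 4 * (a\<^sup>2 + (b\<^sup>2 + c\<^sup>2 + d\<^sup>2))" by (simp add: power2_eq_square algebra_simps)
  then show ?thesis unfolding jet1_def sum_3 a_def b_def c_def d_def by simp
qed

lemma integral_pow4_le:
  obtains C where "C > 0"
    "\<And>f. smooth_S3 f \<Longrightarrow> (LINT x|S3_measure. f x ^ 4) \<le> C * (hN (Suc 0) f)\<^sup>2"
proof -
  obtain C where C: "C > 0" "\<And>f. smooth_S3 f \<Longrightarrow> (LINT x|S3_measure. f x ^ 4) \<le> C * (LINT z|S3_measure. (jet1 f z)\<^sup>2)\<^sup>2"
    using Sobolev_L4 by blast
  have "(LINT x|S3_measure. f x ^ 4) \<le> (16 * C) * (hN (Suc 0) f)\<^sup>2" if f: "smooth_S3 f" for f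
  proof -
    have "(LINT z|S3_measure. (jet1 f z)\<^sup>2) \<le> (LINT z|S3_measure. 4 * ((f z)\<^sup>2 + (\<Sum>a\<in>UNIV. (X a f z)\<^sup>2)))"
      using jet1_square_le[of f] f
      by (intro integral_mono integrable_S3_continuous[of "\<lambda>x. (jet1 f x)\<^sup>2"] continuous_on_power continuous_jet1) auto
    also have "\<dots> = 4 * hN (Suc 0) f"
      using f by (simp add: hN_1 hB_0_real del: hB.simps(1))
    finally have "(LINT z|S3_measure. (jet1 f z)\<^sup>2)\<^sup>2 \<le> (4 * hN (Suc 0) f)\<^sup>2"
      by (intro power_mono) auto
    then have "C * (LINT z|S3_measure. (jet1 f z)\<^sup>2)\<^sup>2 \<le> C * (4 * hN (Suc 0) f)\<^sup>2"
      using C(1) by (intro mult_left_mono) auto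
    then show ?thesis using C(2)[OF f] by (simp add: power_mult_distrib mult_ac)
  qed
  then show thesis using that[of "16 * C"] C(1) by simp
qed

lemma pow4_add_le: "(a + b + c + d :: real) ^ 4 \<le> 64 * (a ^ 4 + b ^ 4 + c ^ 4 + d ^ 4)"
proof -
  have sq: "(p + q + r + s)\<^sup>2 \<le> 4 * (p\<^sup>2 + q\<^sup>2 + r\<^sup>2 + s\<^sup>2)" for p q r s :: real
  proof -
    have "0 \<le> (p - q)\<^sup>2 + (p - r)\<^sup>2 + (p - s)\<^sup>2 + (q - r)\<^sup>2 + (q - s)\<^sup>2 + (r - s)\<^sup>2" by simp
    then show ?thesis by (simp add: power2_eq_square algebra_simps)
  qed
  have "(a + b + c + d) ^ 4 = ((a + b + c + d)\<^sup>2)\<^sup>2" by (simp add: power_mult[symmetric])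
  also have "\<dots> \<le> (4 * (a\<^sup>2 + b\<^sup>2 + c\<^sup>2 + d\<^sup>2))\<^sup>2" by (intro power_mono sq) simp
  also have "\<dots> = 16 * (a\<^sup>2 + b\<^sup>2 + c\<^sup>2 + d\<^sup>2)\<^sup>2"
    by (simp only: power_mult_distrib) simp
  also have "\<dots> \<le> 16 * (4 * ((a\<^sup>2)\<^sup>2 + (b\<^sup>2)\<^sup>2 + (c\<^sup>2)\<^sup>2 + (d\<^sup>2)\<^sup>2))" by (intro mult_left_mono sq) simp
  finally show ?thesis by (simp add: power_mult[symmetric])
qed

text \<open>Two derivatives in \<open>L^2\<close> control \<open>f\<close> and its frame derivatives
  in \<open>L^4\<close>, and one derivative in \<open>L^4\<close> controls the supremum.\<close>

lemma sup_le_hN: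
  obtains C where "C > 0"
    "\<And>f x. smooth_S3 f \<Longrightarrow> x \<in> S3 \<Longrightarrow> (f x)\<^sup>2 \<le> C * hN (Suc (Suc 0)) f"
proof -
  obtain C where C: "C > 0" "\<And>f x. smooth_S3 f \<Longrightarrow> x \<in> S3 \<Longrightarrow> f x ^ 4 \<le> C * (LINT z|S3_measure. jet1 f z ^ 4)"
    using Sobolev_sup by blast
  obtain D where D: "D > 0" "\<And>f. smooth_S3 f \<Longrightarrow> (LINT x|S3_measure. f x ^ 4) \<le> D * (hN (Suc 0) f)\<^sup>2"
    using integral_pow4_le by blast
  \<comment> \<open>256 = 64 * 4: the constant of \<open>pow4_add_le\<close> times the four entries
    of the jet. The square root returns from fourth powers to squares.\<close>
  define K where "K = sqrt (256 * C * D)"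
  have K: "K > 0" "K\<^sup>2 = 256 * C * D" using C D by (auto simp: K_def)
  have "(f x)\<^sup>2 \<le> K * hN (Suc (Suc 0)) f" if f: "smooth_S3 f" and x: "x \<in> S3" for f x
  proof -
    define N where "N = hN (Suc (Suc 0)) f"
    have N: "hN (Suc 0) f \<le> N" "hN (Suc 0) (X a f) \<le> N" for a
      unfolding N_def using hN_mono[of "Suc 0" "Suc (Suc 0)" f] hN_X_le[of "Suc 0" a f] by auto
    have N4: "(LINT x|S3_measure. g x ^ 4) \<le> D * N\<^sup>2" if "smooth_S3 g" "hN (Suc 0) g \<le> N" for g
    proof -
      have "(hN (Suc 0) g)\<^sup>2 \<le> N\<^sup>2" using that(2) by (intro power_mono) auto
      then have "D * (hN (Suc 0) g)\<^sup>2 \<le> D * N\<^sup>2" using D(1) by simp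
      then show ?thesis using D(2)[OF that(1)] by linarith
    qed
    have "(LINT z|S3_measure. jet1 f z ^ 4) \<le> (LINT z|S3_measure. 64 * (f z ^ 4 + X 1 f z ^ 4 + X 2 f z ^ 4 + X 3 f z ^ 4))"
    proof (rule integral_mono)
      show "integrable S3_measure (\<lambda>z. jet1 f z ^ 4)"
        by (intro integrable_S3_continuous continuous_on_power continuous_jet1 f)
      show "integrable S3_measure (\<lambda>z. 64 * (f z ^ 4 + X 1 f z ^ 4 + X 2 f z ^ 4 + X 3 f z ^ 4))" using f by simp
      fix z
      show "jet1 f z ^ 4 \<le> 64 * (f z ^ 4 + X 1 f z ^ 4 + X 2 f z ^ 4 + X 3 f z ^ 4)"
        using pow4_add_le[of "\<bar>f z\<bar>" "\<bar>X 1 f z\<bar>" "\<bar>X 2 f z\<bar>" "\<bar>X 3 f z\<bar>"]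
        unfolding jet1_def sum_3 by (simp add: add.assoc)
    qed
    also have "\<dots> = 64 * ((LINT z|S3_measure. f z ^ 4) + (LINT z|S3_measure. X 1 f z ^ 4)
         + (LINT z|S3_measure. X 2 f z ^ 4) + (LINT z|S3_measure. X 3 f z ^ 4))"
      using f by simp
    also have "\<dots> \<le> 64 * (D * N\<^sup>2 + D * N\<^sup>2 + D * N\<^sup>2 + D * N\<^sup>2)"
      using f by (intro mult_left_mono add_mono N4 N) auto
    finally have "C * (LINT z|S3_measure. jet1 f z ^ 4) \<le> C * (256 * (D * N\<^sup>2))"
      using C(1) by (intro mult_left_mono) auto
    then have "((f x)\<^sup>2)\<^sup>2 \<le> (K * N)\<^sup>2"
      using C(2)[OF f x] by (simp add: power_mult_distrib K(2) power_mult[symmetric] mult_ac)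
    moreover have "0 \<le> K * N" unfolding N_def using K(1) by simp
    ultimately show ?thesis unfolding N_def by (rule power2_le_imp_le)
  qed
  then show thesis using that K(1) by blast
qed

text \<open>Two derivatives suffice however they are distributed: both on one factor bound its
  supremum, one on each bounds two \<open>L^4\<close> norms.\<close>

lemma hN_0_mult_le:
  assumes "s + t \<ge> 2"
  obtains C where "C > 0" "\<And>f g :: real^4 \<Rightarrow> real. smooth_S3 f \<Longrightarrow> smooth_S3 g \<Longrightarrow> hN 0 (\<lambda>x. f x * g x) \<le> C * hN s f * hN t g"
proof -
  obtain C where C: "C > 0" "\<And>f x. smooth_S3 f \<Longrightarrow> x \<in> S3 \<Longrightarrow> (f x)\<^sup>2 \<le> C * hN (Suc (Suc 0)) f"
    using sup_le_hN by blast
  obtain D where D: "D > 0" "\<And>f. smooth_S3 f \<Longrightarrow> (LINT x|S3_measure. f x ^ 4) \<le> D * (hN (Suc 0) f)\<^sup>2"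
    using integral_pow4_le by blast
  have sup: "hN 0 (\<lambda>x. f x * g x) \<le> C * hN s f * hN t g"
    if "s \<ge> 2" "smooth_S3 f" "smooth_S3 g" for f g :: "real^4 \<Rightarrow> real" and s t
  proof -
    have "hN 0 (\<lambda>x. f x * g x) \<le> (LINT x|S3_measure. (C * hN (Suc (Suc 0)) f) * (g x)\<^sup>2)"
      unfolding hN_0 hB_0_real using that C(2) by (intro integral_mono) (auto simp: power_mult_distrib intro!: mult_right_mono)
    also have "\<dots> = C * hN (Suc (Suc 0)) f * hN 0 g" unfolding hN_0 hB_0_real by simp
    also have "\<dots> \<le> C * hN s f * hN t g"
      using C(1) that(1) by (intro mult_mono hN_mono mult_nonneg_nonneg) auto
    finally show ?thesis .
  qed
  have L4: "hN 0 (\<lambda>x. f x * g x) \<le> D * hN s f * hN t g"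
    if "s \<ge> 1" "t \<ge> 1" "smooth_S3 f" "smooth_S3 g" for f g :: "real^4 \<Rightarrow> real"
  proof -
    have "(hN 0 (\<lambda>x. f x * g x))\<^sup>2 \<le> (LINT x|S3_measure. f x ^ 4) * (LINT x|S3_measure. g x ^ 4)"
      using integral_Cauchy_Schwarz[of "\<lambda>x. (f x)\<^sup>2" "\<lambda>x. (g x)\<^sup>2"] that
      unfolding hN_0 hB_0_real by (simp add: power_mult_distrib power_mult[symmetric])
    also have "\<dots> \<le> (D * (hN (Suc 0) f)\<^sup>2) * (D * (hN (Suc 0) g)\<^sup>2)"
      using D that by (intro mult_mono) auto
    also have "\<dots> = (D * hN (Suc 0) f * hN (Suc 0) g)\<^sup>2" by (simp add: power2_eq_square mult_ac)
    finally have "hN 0 (\<lambda>x. f x * g x) \<le> D * hN (Suc 0) f * hN (Suc 0) g"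
      using D(1) by (intro power2_le_imp_le[of "hN 0 (\<lambda>x. f x * g x)"]) auto
    also have "\<dots> \<le> D * hN s f * hN t g"
      using D(1) that by (intro mult_mono hN_mono mult_nonneg_nonneg) auto
    finally show ?thesis .
  qed
  consider "s \<ge> 2" | "t \<ge> 2" | "s \<ge> 1" "t \<ge> 1" using assms by linarith
  then show thesis
  proof cases
    case 1 then show ?thesis using that[OF C(1)] sup by blast
  next
    case 2
    have "hN 0 (\<lambda>x. f x * g x) \<le> C * hN s f * hN t g" if "smooth_S3 f" "smooth_S3 g" for f g :: "real^4 \<Rightarrow> real"
      using sup[OF 2 that(2,1), of s] by (simp add: mult_ac)
    then show ?thesis using that[OF C(1)] by blast
  next
    case 3 then show ?thesis using that[OF D(1)] L4 by blast
  qed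
qed

text \<open>By the Leibniz rule a derivative of the product falls on one of the factors. Then
  \<open>r\<close> and one of \<open>s\<close>, \<open>t\<close> drop by one, which preserves all
  three conditions.\<close>

lemma hN_mult_le:
  assumes "r \<le> s" "r \<le> t" "r + 2 \<le> s + t"
  obtains C where "C > 0" "\<And>f g :: real^4 \<Rightarrow> real. smooth_S3 f \<Longrightarrow> smooth_S3 g \<Longrightarrow> hN r (\<lambda>x. f x * g x) \<le> C * hN s f * hN t g"
proof -
  have "\<exists>C>0. \<forall>f g :: real^4 \<Rightarrow> real. smooth_S3 f \<longrightarrow> smooth_S3 g \<longrightarrow> hN r (\<lambda>x. f x * g x) \<le> C * hN s f * hN t g"
    using assms
  proof (induction r arbitrary: s t)
    case 0
    then have "s + t \<ge> 2" by simp
    from hN_0_mult_le[OF this] obtain C where "C > 0"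
      "\<And>f g :: real^4 \<Rightarrow> real. smooth_S3 f \<Longrightarrow> smooth_S3 g \<Longrightarrow> hN 0 (\<lambda>x. f x * g x) \<le> C * hN s f * hN t g" by blast
    then show ?case by blast
  next
    case (Suc r)
    obtain C0 where C0: "C0 > 0" "\<And>f g :: real^4 \<Rightarrow> real. smooth_S3 f \<Longrightarrow> smooth_S3 g \<Longrightarrow> hN 0 (\<lambda>x. f x * g x) \<le> C0 * hN s f * hN t g"
      using hN_0_mult_le[of s t] Suc.prems by auto
    obtain s' t' where s': "s = Suc s'" and t': "t = Suc t'" using Suc.prems by (metis Suc_le_D)
    obtain C1 where C1: "C1 > 0" "\<And>f g :: real^4 \<Rightarrow> real. smooth_S3 f \<Longrightarrow> smooth_S3 g \<Longrightarrow> hN r (\<lambda>x. f x * g x) \<le> C1 * hN s' f * hN t g"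
      using Suc.IH[of s' t] Suc.prems s' by auto
    obtain C2 where C2: "C2 > 0" "\<And>f g :: real^4 \<Rightarrow> real. smooth_S3 f \<Longrightarrow> smooth_S3 g \<Longrightarrow> hN r (\<lambda>x. f x * g x) \<le> C2 * hN s f * hN t' g"
      using Suc.IH[of s t'] Suc.prems t' by auto
    have "hN (Suc r) (\<lambda>x. f x * g x) \<le> (C0 + 6 * C1 + 6 * C2) * hN s f * hN t g"
      if f: "smooth_S3 f" and g: "smooth_S3 g" for f g :: "real^4 \<Rightarrow> real"
    proof -
      define N where "N = hN s f * hN t g"
      have *: "hN r (X a (\<lambda>x. f x * g x)) \<le> (2 * C1 + 2 * C2) * N" for a
      proof -
        have "hN r (X a (\<lambda>x. f x * g x)) = hN r (\<lambda>x. X a f x * g x + f x * X a g x)"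
          by (intro hN_cong X_mult f g)
        also have "\<dots> \<le> 2 * hN r (\<lambda>x. X a f x * g x) + 2 * hN r (\<lambda>x. f x * X a g x)"
          using f g by (intro hN_add) auto
        also have "\<dots> \<le> 2 * (C1 * hN s' (X a f) * hN t g) + 2 * (C2 * hN s f * hN t' (X a g))"
          using C1(2)[of "X a f" g] C2(2)[of f "X a g"] f g by simp
        also have "\<dots> \<le> 2 * (C1 * hN s f * hN t g) + 2 * (C2 * hN s f * hN t g)"
          using C1(1) C2(1) unfolding s' t'
          by (intro add_mono mult_left_mono mult_mono hN_X_le order_refl mult_nonneg_nonneg) auto
        finally show ?thesis unfolding N_def by (simp add: algebra_simps)
      qed
      have "hN (Suc r) (\<lambda>x. f x * g x) = hN 0 (\<lambda>x. f x * g x) + (\<Sum>a\<in>UNIV. hN r (X a (\<lambda>x. f x * g x)))"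
        unfolding hN_Suc hN_0 ..
      also have "\<dots> \<le> C0 * N + (\<Sum>a\<in>(UNIV::3 set). (2 * C1 + 2 * C2) * N)"
        using C0(2)[OF f g] * by (intro add_mono sum_mono) (auto simp: N_def mult.assoc)
      also have "\<dots> = (C0 + 6 * C1 + 6 * C2) * N" by (simp add: algebra_simps)
      finally show ?thesis unfolding N_def by (simp add: mult.assoc)
    qed
    then show ?case using C0(1) C1(1) C2(1) by (intro exI[of _ "C0 + 6 * C1 + 6 * C2"]) auto
  qed
  then show thesis using that by blast
qed

subsection \<open>Tensor fields in the frame\<close>

lemma tan_proj_frame: "x \<in> S3 \<Longrightarrow> tan_proj x v = (\<Sum>a\<in>UNIV. (v \<bullet> J a x) *\<^sub>R J a x)"
  using J_expand[of x v] unfolding tan_proj_def by (simp add: algebra_simps)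

lemma tan_proj_J [simp]: "tan_proj x (J a x) = J a x"
  by (simp add: tan_proj_def)

lemma linear_tan_proj: "linear (tan_proj x)"
  by (rule linearI) (simp_all add: tan_proj_def inner_add_left algebra_simps)

lemma tan_proj_idem [simp]: "x \<in> S3 \<Longrightarrow> tan_proj x (tan_proj x v) = tan_proj x v"
  by (simp add: tan_proj_def inner_diff_left)

text \<open>Contraction of the first slot with a frame field; iterated over all slots it yields the
  scalar frame components of a tensor.\<close>

definition con :: "3 \<Rightarrow> 'v tensor_field \<Rightarrow> 'v tensor_field" where
  "con a T = (\<lambda>x vs. T x (J a x # vs))"

lemma tensor_cons_linear:
  assumes "is_tensor_field (Suc r) T" "x \<in> S3" "length ws = r"
  shows "linear (\<lambda>v. T x (v # ws))"
proof -
  have "linear (\<lambda>v. T x ((0 # ws)[0 := v]))"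
    using assms unfolding is_tensor_field_def by (auto simp del: list_update.simps)
  then show ?thesis by simp
qed

lemma tensor_tan:
  assumes "is_tensor_field r T" "x \<in> S3" "length vs = r"
  shows "T x (map (tan_proj x) vs) = T x vs"
  using assms unfolding is_tensor_field_def by blast

lemma tensor_cons_tan:
  assumes "is_tensor_field (Suc r) T" "x \<in> S3" "length ws = r"
  shows "T x (tan_proj x v # ws) = T x (v # ws)" "T x (v # map (tan_proj x) ws) = T x (v # ws)"
proof -
  show "T x (tan_proj x v # ws) = T x (v # ws)"
    using tensor_tan[OF assms(1,2), of "tan_proj x v # ws"] tensor_tan[OF assms(1,2), of "v # ws"] assms by simp
  have "map (tan_proj x \<circ> tan_proj x) ws = map (tan_proj x) ws" using assms(2) by simp
  then show "T x (v # map (tan_proj x) ws) = T x (v # ws)"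
    using tensor_tan[OF assms(1,2), of "v # map (tan_proj x) ws"] tensor_tan[OF assms(1,2), of "v # ws"] assms
    by (simp del: map_eq_conv)
qed

lemma tensor_cons_frame:
  assumes "is_tensor_field (Suc r) T" "x \<in> S3" "length ws = r"
  shows "T x (v # ws) = (\<Sum>a\<in>UNIV. (v \<bullet> J a x) *\<^sub>R con a T x ws)"
proof -
  interpret l: linear "\<lambda>v. T x (v # ws)" by (rule tensor_cons_linear[OF assms])
  have "T x (v # ws) = T x ((\<Sum>a\<in>UNIV. (v \<bullet> J a x) *\<^sub>R J a x) # ws)"
    unfolding tan_proj_frame[OF assms(2), symmetric] tensor_cons_tan(1)[OF assms] ..
  then show ?thesis by (simp add: l.sum l.scale con_def)
qed

lemma tensor_cons_basis:
  assumes "is_tensor_field (Suc r) T" "x \<in> S3" "length ws = r"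
  shows "T x (v # ws) = (\<Sum>e\<in>Basis. (v \<bullet> e) *\<^sub>R T x (e # ws))"
proof -
  interpret l: linear "\<lambda>v. T x (v # ws)" by (rule tensor_cons_linear[OF assms])
  have "T x (v # ws) = T x ((\<Sum>e\<in>Basis. (v \<bullet> e) *\<^sub>R e) # ws)" by (simp add: euclidean_representation)
  then show ?thesis by (simp add: l.sum l.scale)
qed

lemma is_tensor_field_0 [simp]: "is_tensor_field 0 T"
  by (simp add: is_tensor_field_def)

lemma is_tensor_field_con:
  assumes T: "is_tensor_field (Suc r) T"
  shows "is_tensor_field r (con a T)"
  unfolding is_tensor_field_def
proof (intro ballI allI impI conjI)
  fix x and vs :: "(real^4) list" assume x: "x \<in> S3" and vs: "length vs = r"
  show "con a T x (map (tan_proj x) vs) = con a T x vs"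
    unfolding con_def by (rule tensor_cons_tan(2)[OF T x vs])
  fix k assume k: "k < r"
  have "linear (\<lambda>v. T x ((J a x # vs)[Suc k := v]))"
    using T x vs k unfolding is_tensor_field_def by (auto simp del: list_update.simps)
  then show "linear (\<lambda>v. con a T x (vs[k := v]))" by (simp add: con_def)
qed

lemma smooth_tensorD:
  "smooth_tensor r T \<Longrightarrow> is_tensor_field r T"
  "smooth_tensor r T \<Longrightarrow> length vs = r \<Longrightarrow> smooth_S3 (\<lambda>x. T x vs)"
  by (simp_all add: smooth_tensor_def)

lemma smooth_tensor_0: "smooth_tensor 0 T \<longleftrightarrow> smooth_S3 (\<lambda>x. T x [])"
  by (simp add: smooth_tensor_def)

lemma smooth_tensor_con:
  fixes T :: "'v::real_normed_vector tensor_field"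
  assumes T: "smooth_tensor (Suc r) T"
  shows "smooth_tensor r (con a T)"
  unfolding smooth_tensor_def
proof (intro conjI allI impI)
  show "is_tensor_field r (con a T)" by (rule is_tensor_field_con[OF smooth_tensorD(1)[OF T]])
  fix vs :: "(real^4) list" assume vs: "length vs = r"
  have "smooth_S3 (\<lambda>x. \<Sum>e\<in>Basis. (J a x \<bullet> e) *\<^sub>R T x (e # vs))"
    using smooth_tensorD(2)[OF T] vs by (intro smooth_S3_sum smooth_S3_scaleR smooth_S3_inner smooth_S3_J) auto
  then show "smooth_S3 (\<lambda>x. con a T x vs)"
    by (rule smooth_S3_cong) (simp add: con_def tensor_cons_basis[OF smooth_tensorD(1)[OF T] _ vs, of _ "J a _"])
qed

lemma smooth_tensorI:
  fixes T :: "'v::real_normed_vector tensor_field"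
  assumes T: "is_tensor_field (Suc r) T" and "\<And>a. smooth_tensor r (con a T)"
  shows "smooth_tensor (Suc r) T"
  unfolding smooth_tensor_def
proof (intro conjI allI impI T)
  fix vs :: "(real^4) list" assume "length vs = Suc r"
  then obtain v ws where vs: "vs = v # ws" and ws: "length ws = r" by (cases vs) auto
  have "smooth_S3 (\<lambda>x. \<Sum>a\<in>UNIV. (v \<bullet> J a x) *\<^sub>R con a T x ws)"
    using smooth_tensorD(2)[OF assms(2) ws] by (intro smooth_S3_sum smooth_S3_scaleR smooth_S3_inner smooth_S3_J smooth_S3_const)
  then show "smooth_S3 (\<lambda>x. T x vs)"
    unfolding vs by (rule smooth_S3_cong) (simp add: tensor_cons_frame[OF T _ ws, of _ v])
qed

text \<open>Tensor fields are constrained only on the sphere and on argument lists of the right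
  length, so equality is meant there.\<close>

definition tensor_eq :: "nat \<Rightarrow> 'v tensor_field \<Rightarrow> 'v tensor_field \<Rightarrow> bool" where
  "tensor_eq r S T \<longleftrightarrow> (\<forall>x\<in>S3. \<forall>vs. length vs = r \<longrightarrow> S x vs = T x vs)"

lemma tensor_eq_con: "tensor_eq (Suc r) S T \<Longrightarrow> tensor_eq r (con a S) (con a T)"
  by (simp add: tensor_eq_def con_def)

lemma is_tensor_field_cong:
  assumes "is_tensor_field r S" "tensor_eq r S T"
  shows "is_tensor_field r T"
  unfolding is_tensor_field_def
proof (intro ballI allI impI conjI)
  fix x and vs :: "(real^4) list" assume x: "x \<in> S3" and vs: "length vs = r"
  show "T x (map (tan_proj x) vs) = T x vs"
    using assms x vs unfolding is_tensor_field_def tensor_eq_def by (metis length_map)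
  fix k assume k: "k < r"
  have "linear (\<lambda>v. S x (vs[k := v]))" using assms x vs k unfolding is_tensor_field_def by blast
  moreover have "(\<lambda>v. S x (vs[k := v])) = (\<lambda>v. T x (vs[k := v]))"
    using assms(2) x vs unfolding tensor_eq_def by auto
  ultimately show "linear (\<lambda>v. T x (vs[k := v]))" by simp
qed

lemma smooth_tensor_cong:
  assumes "smooth_tensor r S" "tensor_eq r S T"
  shows "smooth_tensor r T"
  using assms is_tensor_field_cong[of r S T] unfolding smooth_tensor_def
  by (auto simp: tensor_eq_def intro: smooth_S3_cong)

lemma is_tensor_field_add:
  "is_tensor_field r S \<Longrightarrow> is_tensor_field r T \<Longrightarrow> is_tensor_field r (\<lambda>x vs. S x vs + T x vs)"
  unfolding is_tensor_field_def by (simp add: linear_compose_add)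

lemma is_tensor_field_scaleR:
  "is_tensor_field r T \<Longrightarrow> is_tensor_field r (\<lambda>x vs. f x *\<^sub>R T x vs)"
  unfolding is_tensor_field_def by (simp add: linear_compose_scale_right)

lemma smooth_tensor_add:
  "smooth_tensor r S \<Longrightarrow> smooth_tensor r T \<Longrightarrow> smooth_tensor r (\<lambda>x vs. S x vs + T x vs)"
  unfolding smooth_tensor_def by (simp add: is_tensor_field_add)

lemma smooth_tensor_scaleR:
  "smooth_tensor r T \<Longrightarrow> smooth_tensor r (\<lambda>x vs. c *\<^sub>R T x vs)"
  unfolding smooth_tensor_def by (simp add: is_tensor_field_scaleR)

lemma smooth_tensor_zero: "smooth_tensor r (\<lambda>x vs. 0)"
  unfolding smooth_tensor_def is_tensor_field_def by (simp add: linear_zero)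

lemma smooth_tensor_sum:
  "(\<And>i. i \<in> I \<Longrightarrow> smooth_tensor r (F i)) \<Longrightarrow> smooth_tensor r (\<lambda>x vs. \<Sum>i\<in>I. F i x vs)"
  by (induction I rule: infinite_finite_induct) (auto intro: smooth_tensor_add smooth_tensor_zero)

section \<open>Covariant derivatives in frame components\<close>

lemma X_ident: "x \<in> S3 \<Longrightarrow> X b (\<lambda>x. x) x = J b x"
proof -
  assume x: "x \<in> S3"
  then have "x \<noteq> 0" by simp
  have "((\<lambda>y. y /\<^sub>R norm y) has_derivative (\<lambda>v. inverse (norm x) *\<^sub>R v + (- ((x \<bullet> v) * inverse (norm x) ^ 3)) *\<^sub>R x)) (at x)"
    by (rule has_derivative_scaleR[OF has_derivative_inverse_norm[OF \<open>x \<noteq> 0\<close>] has_derivative_ident])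
  then have "(ext (\<lambda>x. x) has_derivative (\<lambda>v. inverse (norm x) *\<^sub>R v + (- ((x \<bullet> v) * inverse (norm x) ^ 3)) *\<^sub>R x)) (at x)"
    unfolding ext_def[abs_def] .
  then show ?thesis using x unfolding X_def by (simp add: extD_eqI)
qed

lemma X_inner_J: "x \<in> S3 \<Longrightarrow> X b (\<lambda>y. w \<bullet> J c y) x = w \<bullet> J c (J b x)"
proof -
  assume x: "x \<in> S3"
  have L: "bounded_linear (\<lambda>y. w \<bullet> J c y)"
    by (rule bounded_linear_compose[OF bounded_linear_inner_right bounded_linear_J])
  show ?thesis using X_linear[OF L smooth_S3_ident x, of b] X_ident[OF x] by simp
qed

declare nabla.simps [simp del]

lemma nabla_cons: "nabla T x (v # vs) = extD (\<lambda>y. T y (map (tan_proj x) vs)) x (tan_proj x v)"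
  by (simp add: extD_def ext_def[abs_def] nabla.simps)

abbreviation nab :: "3 \<Rightarrow> 'v::real_normed_vector tensor_field \<Rightarrow> 'v tensor_field" where
  "nab b T \<equiv> con b (nabla T)"

lemma nab_eq: "nab b T x vs = X b (\<lambda>y. T y (map (tan_proj x) vs)) x"
  unfolding con_def nabla_cons X_def by simp

lemma nab_Nil: "nab b T x [] = X b (\<lambda>y. T y []) x"
  by (simp add: nab_eq)

lemma extD_add:
  "smooth_S3 f \<Longrightarrow> smooth_S3 g \<Longrightarrow> x \<noteq> 0 \<Longrightarrow> extD (\<lambda>x. f x + g x) x v = extD f x v + extD g x v"
  using extD_eqI[of "\<lambda>x. f x + g x" "\<lambda>v. extD f x v + extD g x v" x]
    has_derivative_add[OF smooth_S3_extD(1)[of f x] smooth_S3_extD(1)[of g x]]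
  by (simp add: ext_def[abs_def])

lemma extD_scaleR:
  "smooth_S3 f \<Longrightarrow> x \<noteq> 0 \<Longrightarrow> extD (\<lambda>x. c *\<^sub>R f x) x v = c *\<^sub>R extD f x v"
  using extD_eqI[of "\<lambda>x. c *\<^sub>R f x" "\<lambda>v. c *\<^sub>R extD f x v" x]
    has_derivative_scaleR_right[OF smooth_S3_extD(1)[of f x], of c]
  by (simp add: ext_def[abs_def])

text \<open>The arguments of the later slots are frozen at \<open>x\<close> while the base point
  moves, so a linear relation that holds at every point of the sphere passes to the
  derivative.\<close>

lemma is_tensor_field_nabla:
  fixes T :: "'v::real_normed_vector tensor_field"
  assumes T: "smooth_tensor r T"
  shows "is_tensor_field (Suc r) (nabla T)"
  unfolding is_tensor_field_def
proof (intro ballI allI impI conjI)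
  fix x and vs :: "(real^4) list" assume x: "x \<in> S3" and "length vs = Suc r"
  then obtain v ws where vs: "vs = v # ws" and ws: "length ws = r" by (cases vs) auto
  have x0: "x \<noteq> 0" using x by simp
  have "map (tan_proj x \<circ> tan_proj x) ws = map (tan_proj x) ws" using x by simp
  then show "nabla T x (map (tan_proj x) vs) = nabla T x vs"
    unfolding vs list.map nabla_cons using x by (simp del: map_eq_conv)
  fix k assume k: "k < Suc r"
  show "linear (\<lambda>v. nabla T x (vs[k := v]))"
  proof (cases k)
    case 0
    have "linear (extD (\<lambda>y. T y (map (tan_proj x) ws)) x)"
      using smooth_tensorD(2)[OF T] ws x0 by (intro linear_extD) auto
    from linear_compose[OF linear_tan_proj this]
    show ?thesis unfolding 0 vs list_update.simps nat.case nabla_cons by (simp add: o_def)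
  next
    case (Suc j)
    then have j: "j < r" using k by simp
    define us where "us = map (tan_proj x) ws"
    have us: "length us = r" using ws us_def by simp
    define F where "F w y = T y (us[j := w])" for w y
    have Fs: "smooth_S3 (F w)" for w unfolding F_def using smooth_tensorD(2)[OF T] us by simp
    have Fl: "linear (\<lambda>w. F w y)" if "y \<in> S3" for y
      using smooth_tensorD(1)[OF T] us j that unfolding F_def is_tensor_field_def by blast
    have eq: "nabla T x (vs[k := w]) = extD (F (tan_proj x w)) x (tan_proj x v)" for w
      unfolding Suc vs list_update.simps nat.case nabla_cons F_def us_def by (simp add: map_update)
    show ?thesis unfolding eq
    proof (rule linearI)
      fix w w' :: "real^4" and c :: real
      have "extD (F (tan_proj x (w + w'))) x = extD (\<lambda>y. F (tan_proj x w) y + F (tan_proj x w') y) x"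
        by (rule extD_cong[OF _ x0]) (simp add: linear_add[OF linear_tan_proj] linear_add[OF Fl])
      then show "extD (F (tan_proj x (w + w'))) x (tan_proj x v)
         = extD (F (tan_proj x w)) x (tan_proj x v) + extD (F (tan_proj x w')) x (tan_proj x v)"
        using extD_add[OF Fs Fs x0] by simp
      have "extD (F (tan_proj x (c *\<^sub>R w))) x = extD (\<lambda>y. c *\<^sub>R F (tan_proj x w) y) x"
        by (rule extD_cong[OF _ x0]) (simp add: linear_cmul[OF linear_tan_proj] linear_cmul[OF Fl])
      then show "extD (F (tan_proj x (c *\<^sub>R w))) x (tan_proj x v) = c *\<^sub>R extD (F (tan_proj x w)) x (tan_proj x v)"
        using extD_scaleR[OF Fs x0] by simp
    qed
  qed
qed

text \<open>The frame components of a covariant derivative; \<open>eps\<close> gives the connection coefficients.\<close>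

lemma con_nab:
  fixes T :: "'v::euclidean_space tensor_field"
  assumes T: "smooth_tensor (Suc r) T" and x: "x \<in> S3" and ws: "length ws = r"
  shows "con a (nab b T) x ws = (\<Sum>c\<in>UNIV. eps c b a *\<^sub>R con c T x ws) + nab b (con a T) x ws"
proof -
  define us where "us = map (tan_proj x) ws"
  have us: "length us = r" using ws us_def by simp
  have tf: "is_tensor_field (Suc r) T" by (rule smooth_tensorD(1)[OF T])
  have sm: "smooth_S3 (\<lambda>y. con c T y us)" for c by (rule smooth_tensorD(2)[OF smooth_tensor_con[OF T] us])
  have smw: "smooth_S3 (\<lambda>y. w \<bullet> J c y)" for w c by simp
  have "con a (nab b T) x ws = X b (\<lambda>y. T y (J a x # us)) x"
    unfolding con_def[of a] nab_eq us_def by simp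
  \<comment> \<open>The vector frozen at \<open>x\<close> is expanded in the frame at the moving
    point \<open>y\<close>; differentiating the coefficients is what creates the connection
    term.\<close>
  also have "\<dots> = X b (\<lambda>y. \<Sum>c\<in>UNIV. (J a x \<bullet> J c y) *\<^sub>R con c T y us) x"
    by (rule X_cong[OF _ x]) (simp add: tensor_cons_frame[OF tf _ us, of _ "J a x"])
  also have "\<dots> = (\<Sum>c\<in>UNIV. X b (\<lambda>y. (J a x \<bullet> J c y) *\<^sub>R con c T y us) x)"
    using sm smw x by (intro X_sum smooth_S3_scaleR) auto
  also have "\<dots> = (\<Sum>c\<in>UNIV. eps c b a *\<^sub>R con c T x us + (if a = c then 1 else 0) *\<^sub>R X b (\<lambda>y. con c T y us) x)"
  proof (rule sum.cong[OF refl])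
    fix c :: 3
    show "X b (\<lambda>y. (J a x \<bullet> J c y) *\<^sub>R con c T y us) x
      = eps c b a *\<^sub>R con c T x us + (if a = c then 1 else 0) *\<^sub>R X b (\<lambda>y. con c T y us) x"
      using X_bilinear[OF bounded_bilinear_scaleR smw sm x, of b "J a x" c c] x
      by (simp add: X_inner_J J_inner_J_J J_orthonormal)
  qed
  also have "\<dots> = (\<Sum>c\<in>UNIV. eps c b a *\<^sub>R con c T x us) + X b (\<lambda>y. con a T y us) x"
    by (simp add: sum.distrib if_distrib[of "\<lambda>u. u *\<^sub>R _"] cong: if_cong)
  also have "X b (\<lambda>y. con a T y us) x = nab b (con a T) x ws"
    unfolding nab_eq us_def ..
  also have "(\<Sum>c\<in>UNIV. eps c b a *\<^sub>R con c T x us) = (\<Sum>c\<in>UNIV. eps c b a *\<^sub>R con c T x ws)"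
    unfolding us_def con_def tensor_cons_tan(2)[OF tf x ws] ..
  finally show ?thesis .
qed

text \<open>Smoothness can be tested on frame components. By \<open>con_nab\<close> those of
  \<open>nab b T\<close> consist of components of \<open>T\<close> and of \<open>nab b\<close>
  applied to tensors of lower rank, which suits an induction on the rank.\<close>

lemma smooth_tensor_nabla:
  fixes T :: "'v::euclidean_space tensor_field"
  assumes "smooth_tensor r T"
  shows "smooth_tensor (Suc r) (nabla T)"
proof (rule smooth_tensorI[OF is_tensor_field_nabla[OF assms]])
  fix b show "smooth_tensor r (nab b T)" using assms
  proof (induction r arbitrary: T)
    case 0
    then show ?case unfolding smooth_tensor_0 nab_Nil by (intro smooth_S3_X)
  next
    case (Suc r)
    show ?case
    proof (rule smooth_tensorI)
      show "is_tensor_field (Suc r) (nab b T)"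
        by (rule is_tensor_field_con[OF is_tensor_field_nabla[OF Suc.prems]])
      fix a
      have "smooth_tensor r (\<lambda>x vs. (\<Sum>c\<in>UNIV. eps c b a *\<^sub>R con c T x vs) + nab b (con a T) x vs)"
        using Suc.prems by (intro smooth_tensor_add smooth_tensor_sum smooth_tensor_scaleR smooth_tensor_con Suc.IH)
      then show "smooth_tensor r (con a (nab b T))"
        by (rule smooth_tensor_cong) (simp add: tensor_eq_def con_nab[OF Suc.prems])
    qed
  qed
qed

text \<open>A trace can be taken in any orthonormal basis. The two expansion hypotheses express that
  \<open>F\<close> is linear in each argument and sees tangential parts only, so the normal
  direction drops out.\<close>

lemma sum_Basis_frame:
  fixes F :: "real^4 \<Rightarrow> real^4 \<Rightarrow> 'v::real_vector"
  assumes x: "x \<in> S3"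
    and 1: "\<And>u v. F u v = (\<Sum>a\<in>UNIV. (u \<bullet> J a x) *\<^sub>R F (J a x) v)"
    and 2: "\<And>u v. F u v = (\<Sum>a\<in>UNIV. (v \<bullet> J a x) *\<^sub>R F u (J a x))"
  shows "(\<Sum>e\<in>Basis. F e e) = (\<Sum>a\<in>UNIV. F (J a x) (J a x))"
proof -
  have "(\<Sum>e\<in>Basis. F e e) = (\<Sum>e\<in>Basis. \<Sum>a\<in>UNIV. \<Sum>b\<in>UNIV. ((e \<bullet> J a x) * (e \<bullet> J b x)) *\<^sub>R F (J a x) (J b x))"
  proof (rule sum.cong[OF refl])
    fix e :: "real^4"
    have "F e e = (\<Sum>a\<in>UNIV. (e \<bullet> J a x) *\<^sub>R F (J a x) e)" by (rule 1)
    also have "\<dots> = (\<Sum>a\<in>UNIV. (e \<bullet> J a x) *\<^sub>R (\<Sum>b\<in>UNIV. (e \<bullet> J b x) *\<^sub>R F (J a x) (J b x)))"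
      using 2[of "J _ x" e] by simp
    finally show "F e e = (\<Sum>a\<in>UNIV. \<Sum>b\<in>UNIV. ((e \<bullet> J a x) * (e \<bullet> J b x)) *\<^sub>R F (J a x) (J b x))"
      by (simp add: scaleR_sum_right)
  qed
  also have "\<dots> = (\<Sum>a\<in>UNIV. \<Sum>b\<in>UNIV. (\<Sum>e\<in>Basis. (e \<bullet> J a x) * (e \<bullet> J b x)) *\<^sub>R F (J a x) (J b x))"
    by (subst sum.swap, intro sum.cong[OF refl], subst sum.swap) (simp add: scaleR_sum_left)
  also have "\<dots> = (\<Sum>a\<in>UNIV. \<Sum>b\<in>UNIV. (if a = b then 1 else 0) *\<^sub>R F (J a x) (J b x))"
  proof (intro sum.cong refl)
    fix a b :: 3
    have "(\<Sum>e\<in>Basis. (e \<bullet> J a x) * (e \<bullet> J b x)) = J a x \<bullet> J b x"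
      by (subst euclidean_inner[of "J a x"]) (simp add: inner_commute)
    then show "(\<Sum>e\<in>Basis. (e \<bullet> J a x) * (e \<bullet> J b x)) *\<^sub>R F (J a x) (J b x) = (if a = b then 1 else 0) *\<^sub>R F (J a x) (J b x)"
      using x by (simp add: J_orthonormal)
  qed
  also have "\<dots> = (\<Sum>a\<in>UNIV. F (J a x) (J a x))" by (simp add: if_distrib[of "\<lambda>u. u *\<^sub>R _"] cong: if_cong)
  finally show ?thesis .
qed

text \<open>The connection terms vanish upon contraction because \<open>eps c b b = 0\<close>; in
  other words, the frame fields are divergence free.\<close>

lemma divergence_frame:
  fixes T :: "'v::euclidean_space tensor_field"
  assumes T: "smooth_tensor (Suc r) T" and x: "x \<in> S3" and vs: "length vs = r"
  shows "divergence T x vs = (\<Sum>b\<in>UNIV. nab b (con b T) x vs)"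
proof -
  have tf: "is_tensor_field (Suc (Suc r)) (nabla T)" by (rule is_tensor_field_nabla[OF T])
  have "divergence T x vs = (\<Sum>b\<in>UNIV. nabla T x (J b x # J b x # vs))"
    unfolding divergence_def
  proof (rule sum_Basis_frame[OF x, of "\<lambda>u v. nabla T x (u # v # vs)"])
    fix u v
    show "nabla T x (u # v # vs) = (\<Sum>a\<in>UNIV. (u \<bullet> J a x) *\<^sub>R nabla T x (J a x # v # vs))"
      using tensor_cons_frame[OF tf x, of "v # vs" u] vs by (simp add: con_def)
    have "nabla T x (u # v # vs) = (\<Sum>a\<in>UNIV. (u \<bullet> J a x) *\<^sub>R nabla T x (J a x # v # vs))" for v
      using tensor_cons_frame[OF tf x, of "v # vs" u] vs by (simp add: con_def)
    moreover have "nabla T x (J a x # v # vs) = (\<Sum>b\<in>UNIV. (v \<bullet> J b x) *\<^sub>R nabla T x (J a x # J b x # vs))" for a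
      using tensor_cons_frame[OF is_tensor_field_con[OF tf, of a] x vs, of v] by (simp add: con_def)
    ultimately show "nabla T x (u # v # vs) = (\<Sum>a\<in>UNIV. (v \<bullet> J a x) *\<^sub>R nabla T x (u # J a x # vs))"
      by (simp add: scaleR_sum_right) (subst sum.swap, simp add: mult.commute)
  qed
  also have "\<dots> = (\<Sum>b\<in>UNIV. con b (nab b T) x vs)" by (simp add: con_def)
  also have "\<dots> = (\<Sum>b\<in>UNIV. nab b (con b T) x vs)"
    by (rule sum.cong[OF refl]) (simp add: con_nab[OF T x vs])
  finally show ?thesis .
qed

lemma smooth_tensor_divergence:
  fixes T :: "'v::euclidean_space tensor_field"
  assumes T: "smooth_tensor (Suc r) T"
  shows "smooth_tensor r (divergence T)"
proof (rule smooth_tensor_cong)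
  show "smooth_tensor r (\<lambda>x vs. \<Sum>b\<in>UNIV. nab b (con b T) x vs)"
    by (intro smooth_tensor_sum smooth_tensor_con smooth_tensor_nabla T)
  show "tensor_eq r (\<lambda>x vs. \<Sum>b\<in>UNIV. nab b (con b T) x vs) (divergence T)"
    by (simp add: tensor_eq_def divergence_frame[OF T])
qed

section \<open>Inner products of tensors and covariant integration by parts\<close>

lemma basis_lists_Suc: "basis_lists (Suc r) = (\<lambda>(e, es). e # es) ` (Basis \<times> basis_lists r)"
  unfolding basis_lists_def
  by (auto simp: image_iff length_Suc_conv)

lemma sum_basis_lists_Suc:
  "(\<Sum>es\<in>basis_lists (Suc r). f es) = (\<Sum>e\<in>Basis. \<Sum>es\<in>basis_lists r. f (e # es))"
  unfolding basis_lists_Suc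
  by (subst sum.reindex) (auto simp: inj_on_def sum.cartesian_product case_prod_beta')

lemma basis_lists_0: "basis_lists 0 = {[]}"
  by (auto simp: basis_lists_def)

lemma finite_basis_lists: "finite (basis_lists r)"
  unfolding basis_lists_def by (rule finite_lists_length_eq) simp

lemma tensor_inner_0: "tensor_inner 0 S T x = S x [] \<bullet> T x []"
  by (simp add: tensor_inner_def basis_lists_0)

lemma tensor_inner_Suc:
  assumes S: "is_tensor_field (Suc r) S" and T: "is_tensor_field (Suc r) T" and x: "x \<in> S3"
  shows "tensor_inner (Suc r) S T x = (\<Sum>a\<in>UNIV. tensor_inner r (con a S) (con a T) x)"
proof -
  have "tensor_inner (Suc r) S T x = (\<Sum>es\<in>basis_lists r. \<Sum>e\<in>Basis. S x (e # es) \<bullet> T x (e # es))"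
    unfolding tensor_inner_def sum_basis_lists_Suc by (rule sum.swap)
  also have "\<dots> = (\<Sum>es\<in>basis_lists r. \<Sum>a\<in>UNIV. S x (J a x # es) \<bullet> T x (J a x # es))"
  proof (rule sum.cong[OF refl])
    fix es assume "es \<in> basis_lists r"
    then have es: "length es = r" by (simp add: basis_lists_def)
    show "(\<Sum>e\<in>Basis. S x (e # es) \<bullet> T x (e # es)) = (\<Sum>a\<in>UNIV. S x (J a x # es) \<bullet> T x (J a x # es))"
    proof (rule sum_Basis_frame[OF x, of "\<lambda>u v. S x (u # es) \<bullet> T x (v # es)"])
      fix u v
      show "S x (u # es) \<bullet> T x (v # es) = (\<Sum>a\<in>UNIV. (u \<bullet> J a x) *\<^sub>R (S x (J a x # es) \<bullet> T x (v # es)))"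
        by (subst tensor_cons_frame[OF S x es, of u]) (simp add: inner_sum_left con_def)
      show "S x (u # es) \<bullet> T x (v # es) = (\<Sum>a\<in>UNIV. (v \<bullet> J a x) *\<^sub>R (S x (u # es) \<bullet> T x (J a x # es)))"
        by (subst tensor_cons_frame[OF T x es, of v]) (simp add: inner_sum_right con_def)
    qed
  qed
  also have "\<dots> = (\<Sum>a\<in>UNIV. tensor_inner r (con a S) (con a T) x)"
    unfolding tensor_inner_def con_def by (rule sum.swap)
  finally show ?thesis .
qed

lemma tensor_inner_cong:
  "tensor_eq r S S' \<Longrightarrow> tensor_eq r T T' \<Longrightarrow> x \<in> S3 \<Longrightarrow> tensor_inner r S T x = tensor_inner r S' T' x"
  unfolding tensor_inner_def tensor_eq_def basis_lists_def by (intro sum.cong) auto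

lemma smooth_tensor_inner:
  "smooth_tensor r S \<Longrightarrow> smooth_tensor r T \<Longrightarrow> smooth_S3 (tensor_inner r S T)"
  unfolding tensor_inner_def
  by (intro smooth_S3_sum smooth_S3_inner smooth_tensorD(2)) (auto simp: basis_lists_def)

lemma tensor_inner_sum_left:
  "tensor_inner r (\<lambda>x vs. \<Sum>i\<in>I. F i x vs) T x = (\<Sum>i\<in>I. tensor_inner r (F i) T x)"
  unfolding tensor_inner_def inner_sum_left by (rule sum.swap)

lemma tensor_inner_sum_right:
  "tensor_inner r S (\<lambda>x vs. \<Sum>i\<in>I. F i x vs) x = (\<Sum>i\<in>I. tensor_inner r S (F i) x)"
  unfolding tensor_inner_def inner_sum_right by (rule sum.swap)

lemma tensor_inner_add_left:
  "tensor_inner r (\<lambda>x vs. S x vs + S' x vs) T x = tensor_inner r S T x + tensor_inner r S' T x"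
  unfolding tensor_inner_def inner_add_left by (rule sum.distrib)

lemma tensor_inner_add_right:
  "tensor_inner r S (\<lambda>x vs. T x vs + T' x vs) x = tensor_inner r S T x + tensor_inner r S T' x"
  unfolding tensor_inner_def inner_add_right by (rule sum.distrib)

lemma tensor_inner_scaleR_left:
  "tensor_inner r (\<lambda>x vs. c *\<^sub>R S x vs) T x = c * tensor_inner r S T x"
  unfolding tensor_inner_def by (simp add: sum_distrib_left)

lemma tensor_inner_scaleR_right:
  "tensor_inner r S (\<lambda>x vs. c *\<^sub>R T x vs) x = c * tensor_inner r S T x"
  unfolding tensor_inner_def by (simp add: sum_distrib_left)

text \<open>By induction on the rank. The connection terms of the two sides cancel because
  \<open>eps c b a\<close> is antisymmetric in \<open>a\<close> and \<open>c\<close>, that is, the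
  connection respects the metric.\<close>

lemma integral_nab_by_parts:
  fixes S Z :: "'v::euclidean_space tensor_field"
  shows "smooth_tensor r S \<Longrightarrow> smooth_tensor r Z \<Longrightarrow>
    (LINT x|S3_measure. tensor_inner r (nab b S) Z x) = - (LINT x|S3_measure. tensor_inner r S (nab b Z) x)"
proof (induction r arbitrary: S Z)
  case 0
  then show ?case unfolding tensor_inner_0 nab_Nil smooth_tensor_0 by (rule integral_X_by_parts)
next
  case (Suc r)
  note sm = Suc.prems
  have sS: "smooth_tensor r (con a S)" for a by (rule smooth_tensor_con[OF sm(1)])
  have sZ: "smooth_tensor r (con a Z)" for a by (rule smooth_tensor_con[OF sm(2)])
  have snS: "smooth_tensor r (nab b (con a S))" for a by (intro smooth_tensor_con smooth_tensor_nabla sS)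
  have snZ: "smooth_tensor r (nab b (con a Z))" for a by (intro smooth_tensor_con smooth_tensor_nabla sZ)
  have L: "(LINT x|S3_measure. tensor_inner (Suc r) (nab b S) Z x)
     = (\<Sum>a\<in>UNIV. (\<Sum>c\<in>UNIV. eps c b a * (LINT x|S3_measure. tensor_inner r (con c S) (con a Z) x))
         + (LINT x|S3_measure. tensor_inner r (nab b (con a S)) (con a Z) x))"
  proof -
    have "(LINT x|S3_measure. tensor_inner (Suc r) (nab b S) Z x)
      = (LINT x|S3_measure. (\<Sum>a\<in>UNIV. (\<Sum>c\<in>UNIV. eps c b a * tensor_inner r (con c S) (con a Z) x)
           + tensor_inner r (nab b (con a S)) (con a Z) x))"
    proof (rule integral_S3_cong)
      fix x assume x: "x \<in> S3"
      have "tensor_inner (Suc r) (nab b S) Z x = (\<Sum>a\<in>UNIV. tensor_inner r (con a (nab b S)) (con a Z) x)"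
        using sm x by (intro tensor_inner_Suc is_tensor_field_con is_tensor_field_nabla smooth_tensorD(1))
      also have "\<dots> = (\<Sum>a\<in>UNIV. tensor_inner r (\<lambda>x ws. (\<Sum>c\<in>UNIV. eps c b a *\<^sub>R con c S x ws) + nab b (con a S) x ws) (con a Z) x)"
        using x by (intro sum.cong refl tensor_inner_cong) (auto simp: tensor_eq_def con_nab[OF sm(1)])
      finally show "tensor_inner (Suc r) (nab b S) Z x = (\<Sum>a\<in>UNIV. (\<Sum>c\<in>UNIV. eps c b a * tensor_inner r (con c S) (con a Z) x)
           + tensor_inner r (nab b (con a S)) (con a Z) x)"
        by (simp add: tensor_inner_add_left tensor_inner_sum_left tensor_inner_scaleR_left)
    qed
    also have "\<dots> = (\<Sum>a\<in>UNIV. (\<Sum>c\<in>UNIV. eps c b a * (LINT x|S3_measure. tensor_inner r (con c S) (con a Z) x))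
         + (LINT x|S3_measure. tensor_inner r (nab b (con a S)) (con a Z) x))"
      using smooth_tensor_inner[OF sS sZ] smooth_tensor_inner[OF snS sZ] by simp
    finally show ?thesis .
  qed
  have R: "(LINT x|S3_measure. tensor_inner (Suc r) S (nab b Z) x)
     = (\<Sum>a\<in>UNIV. (\<Sum>c\<in>UNIV. eps c b a * (LINT x|S3_measure. tensor_inner r (con a S) (con c Z) x))
         + (LINT x|S3_measure. tensor_inner r (con a S) (nab b (con a Z)) x))"
  proof -
    have "(LINT x|S3_measure. tensor_inner (Suc r) S (nab b Z) x)
      = (LINT x|S3_measure. (\<Sum>a\<in>UNIV. (\<Sum>c\<in>UNIV. eps c b a * tensor_inner r (con a S) (con c Z) x)
           + tensor_inner r (con a S) (nab b (con a Z)) x))"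
    proof (rule integral_S3_cong)
      fix x assume x: "x \<in> S3"
      have "tensor_inner (Suc r) S (nab b Z) x = (\<Sum>a\<in>UNIV. tensor_inner r (con a S) (con a (nab b Z)) x)"
        using sm x by (intro tensor_inner_Suc is_tensor_field_con is_tensor_field_nabla smooth_tensorD(1))
      also have "\<dots> = (\<Sum>a\<in>UNIV. tensor_inner r (con a S) (\<lambda>x ws. (\<Sum>c\<in>UNIV. eps c b a *\<^sub>R con c Z x ws) + nab b (con a Z) x ws) x)"
        using x by (intro sum.cong refl tensor_inner_cong) (auto simp: tensor_eq_def con_nab[OF sm(2)])
      finally show "tensor_inner (Suc r) S (nab b Z) x = (\<Sum>a\<in>UNIV. (\<Sum>c\<in>UNIV. eps c b a * tensor_inner r (con a S) (con c Z) x)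
           + tensor_inner r (con a S) (nab b (con a Z)) x)"
        by (simp add: tensor_inner_add_right tensor_inner_sum_right tensor_inner_scaleR_right)
    qed
    also have "\<dots> = (\<Sum>a\<in>UNIV. (\<Sum>c\<in>UNIV. eps c b a * (LINT x|S3_measure. tensor_inner r (con a S) (con c Z) x))
         + (LINT x|S3_measure. tensor_inner r (con a S) (nab b (con a Z)) x))"
      using smooth_tensor_inner[OF sS sZ] smooth_tensor_inner[OF sS snZ] by simp
    finally show ?thesis .
  qed
  have "(\<Sum>a\<in>UNIV. \<Sum>c\<in>UNIV. eps c b a * (LINT x|S3_measure. tensor_inner r (con c S) (con a Z) x))
     = (\<Sum>c\<in>UNIV. \<Sum>a\<in>UNIV. eps c b a * (LINT x|S3_measure. tensor_inner r (con c S) (con a Z) x))"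
    by (rule sum.swap)
  also have "\<dots> = - (\<Sum>a\<in>UNIV. \<Sum>c\<in>UNIV. eps c b a * (LINT x|S3_measure. tensor_inner r (con a S) (con c Z) x))"
    unfolding sum_negf[symmetric] by (intro sum.cong refl) (subst eps_antisym(3), simp)
  finally show ?case unfolding L R using Suc.IH[OF sS sZ] by (simp add: sum.distrib sum_negf sum_subtractf)
qed

lemma integral_nabla_by_parts:
  fixes T Y :: "'v::euclidean_space tensor_field"
  assumes T: "smooth_tensor r T" and Y: "smooth_tensor (Suc r) Y"
  shows "(LINT x|S3_measure. tensor_inner (Suc r) (nabla T) Y x) = - (LINT x|S3_measure. tensor_inner r T (divergence Y) x)"
proof -
  have s: "smooth_tensor r (nab b T)" "smooth_tensor r (con b Y)" "smooth_tensor r (nab b (con b Y))" for b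
    by (intro smooth_tensor_con smooth_tensor_nabla T Y)+
  have "(LINT x|S3_measure. tensor_inner (Suc r) (nabla T) Y x) = (LINT x|S3_measure. (\<Sum>b\<in>UNIV. tensor_inner r (nab b T) (con b Y) x))"
    by (intro integral_S3_cong tensor_inner_Suc is_tensor_field_nabla T smooth_tensorD(1) Y)
  also have "\<dots> = (\<Sum>b\<in>UNIV. (LINT x|S3_measure. tensor_inner r (nab b T) (con b Y) x))"
    using smooth_tensor_inner[OF s(1,2)] by simp
  also have "\<dots> = - (\<Sum>b\<in>UNIV. (LINT x|S3_measure. tensor_inner r T (nab b (con b Y)) x))"
    using integral_nab_by_parts[OF T s(2)] by (simp add: sum_negf)
  also have "(\<Sum>b\<in>UNIV. (LINT x|S3_measure. tensor_inner r T (nab b (con b Y)) x))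
     = (LINT x|S3_measure. tensor_inner r T (\<lambda>x vs. \<Sum>b\<in>UNIV. nab b (con b Y) x vs) x)"
    unfolding tensor_inner_sum_right using smooth_tensor_inner[OF T s(3)] by simp
  also have "\<dots> = (LINT x|S3_measure. tensor_inner r T (divergence Y) x)"
    by (intro integral_S3_cong tensor_inner_cong) (auto simp: tensor_eq_def divergence_frame[OF Y])
  finally show ?thesis .
qed

lemma smooth_tensor_divergence_pow:
  fixes Y :: "'v::euclidean_space tensor_field"
  shows "smooth_tensor (r + j) Y \<Longrightarrow> smooth_tensor r ((divergence ^^ j) Y)"
proof (induction j arbitrary: Y)
  case (Suc j)
  have "smooth_tensor (r + j) (divergence Y)" using smooth_tensor_divergence[of "r + j" Y] Suc.prems by simp
  from Suc.IH[OF this] show ?case by (simp only: funpow_Suc_right o_def)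
qed simp

lemma smooth_tensor_nabla_pow:
  fixes T :: "'v::euclidean_space tensor_field"
  shows "smooth_tensor r T \<Longrightarrow> smooth_tensor (r + j) ((nabla ^^ j) T)"
  by (induction j) (auto intro: smooth_tensor_nabla)

lemma integral_nabla_pow_by_parts:
  fixes T Y :: "'v::euclidean_space tensor_field"
  assumes T: "smooth_tensor r T"
  shows "smooth_tensor (r + j) Y \<Longrightarrow> (LINT x|S3_measure. tensor_inner (r + j) ((nabla ^^ j) T) Y x)
     = (- 1) ^ j * (LINT x|S3_measure. tensor_inner r T ((divergence ^^ j) Y) x)"
proof (induction j arbitrary: Y)
  case (Suc j)
  have "(LINT x|S3_measure. tensor_inner (r + Suc j) ((nabla ^^ Suc j) T) Y x)
     = - (LINT x|S3_measure. tensor_inner (r + j) ((nabla ^^ j) T) (divergence Y) x)"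
    using integral_nabla_by_parts[OF smooth_tensor_nabla_pow[OF T, of j], of Y] Suc.prems by simp
  also have "\<dots> = - ((- 1) ^ j * (LINT x|S3_measure. tensor_inner r T ((divergence ^^ j) (divergence Y)) x))"
    using Suc.IH[of "divergence Y"] smooth_tensor_divergence[of "r + j" Y] Suc.prems by simp
  finally show ?case by (simp only: funpow_Suc_right o_def) simp
qed simp

section \<open>Frame norms of tensor fields and of their covariant derivatives\<close>

primrec tN :: "nat \<Rightarrow> nat \<Rightarrow> 'v::euclidean_space tensor_field \<Rightarrow> real" where
  "tN 0 k T = hN k (\<lambda>x. T x [])"
| "tN (Suc r) k T = (\<Sum>a\<in>UNIV. tN r k (con a T))"

lemma tN_nonneg [simp]: "tN r k T \<ge> 0"
  by (induction r arbitrary: T) (auto intro: sum_nonneg)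

lemma tN_cong: "tensor_eq r S T \<Longrightarrow> tN r k S = tN r k T"
proof (induction r arbitrary: S T)
  case 0 then show ?case by (auto simp: tensor_eq_def intro: hN_cong)
next
  case (Suc r)
  have "tN r k (con a S) = tN r k (con a T)" for a by (rule Suc.IH[OF tensor_eq_con[OF Suc.prems]])
  then show ?case by simp
qed

lemma tN_mono: "j \<le> k \<Longrightarrow> tN r j T \<le> tN r k T"
  by (induction r arbitrary: T) (auto intro: hN_mono sum_mono)

lemma tN_add:
  "smooth_tensor r S \<Longrightarrow> smooth_tensor r T \<Longrightarrow> tN r k (\<lambda>x vs. S x vs + T x vs) \<le> 2 * tN r k S + 2 * tN r k T"
proof (induction r arbitrary: S T)
  case 0 then show ?case by (simp add: smooth_tensor_0 hN_add)
next
  case (Suc r)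
  have "tN r k (con a (\<lambda>x vs. S x vs + T x vs)) \<le> 2 * tN r k (con a S) + 2 * tN r k (con a T)" for a
    using Suc.IH[OF smooth_tensor_con[OF Suc.prems(1)] smooth_tensor_con[OF Suc.prems(2)], of a a] by (simp add: con_def)
  then have "tN (Suc r) k (\<lambda>x vs. S x vs + T x vs) \<le> (\<Sum>a\<in>UNIV. 2 * tN r k (con a S) + 2 * tN r k (con a T))"
    by (simp add: sum_mono)
  then show ?case by (simp add: sum.distrib sum_distrib_left)
qed

lemma tN_scaleR: "smooth_tensor r T \<Longrightarrow> tN r k (\<lambda>x vs. c *\<^sub>R T x vs) = c\<^sup>2 * tN r k T"
proof (induction r arbitrary: T)
  case 0 then show ?case by (simp add: smooth_tensor_0 hN_scaleR)
next
  case (Suc r)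
  have "tN r k (con a (\<lambda>x vs. c *\<^sub>R T x vs)) = c\<^sup>2 * tN r k (con a T)" for a
    using Suc.IH[OF smooth_tensor_con[OF Suc.prems], of a] by (simp add: con_def)
  then show ?case by (simp add: sum_distrib_left)
qed

lemma abs_eps_le: "(eps a b c)\<^sup>2 \<le> 1"
  by (simp add: eps_def)

lemma tN_eps_sum:
  assumes "\<And>c::3. smooth_tensor r (F c)"
  shows "tN r k (\<lambda>x vs. \<Sum>c\<in>UNIV. eps c b a *\<^sub>R F c x vs) \<le> 4 * (\<Sum>c\<in>UNIV. tN r k (F c))"
proof -
  define G where "G c = (\<lambda>x vs. eps c b a *\<^sub>R F c x vs)" for c
  have G: "smooth_tensor r (G c)" for c unfolding G_def by (intro smooth_tensor_scaleR assms)
  have GF: "tN r k (G c) \<le> tN r k (F c)" for c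
    unfolding G_def using tN_scaleR[OF assms, of k "eps c b a"] mult_right_mono[OF abs_eps_le tN_nonneg, of c b a r k "F c"] by simp
  have "tN r k (\<lambda>x vs. (G 1 x vs + G 2 x vs) + G 3 x vs) \<le> 2 * tN r k (\<lambda>x vs. G 1 x vs + G 2 x vs) + 2 * tN r k (G 3)"
    using G by (intro tN_add smooth_tensor_add) auto
  also have "\<dots> \<le> 2 * (2 * tN r k (G 1) + 2 * tN r k (G 2)) + 2 * tN r k (G 3)"
    using tN_add[OF G G, of k 1 2] by simp
  also have "\<dots> \<le> 4 * (tN r k (F 1) + tN r k (F 2) + tN r k (F 3))"
    using GF[of 1] GF[of 2] GF[of 3] tN_nonneg[of r k "G 3"] by (simp only: distrib_left)
  finally show ?thesis unfolding sum_3 G_def .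
qed

text \<open>Each rank costs a factor 26 = 24 + 2: the connection terms give \<open>2 * 4\<close> for
  each of the three components, the differentiated components give 2.\<close>

lemma tN_nab_le:
  fixes T :: "'v::euclidean_space tensor_field"
  shows "smooth_tensor r T \<Longrightarrow> tN r k (nab b T) \<le> 26 ^ r * tN r (Suc k) T"
proof (induction r arbitrary: T)
  case 0
  show ?case unfolding tN.simps nab_Nil using hN_X_le[of k b "\<lambda>x. T x []"] by simp
next
  case (Suc r)
  have sc: "smooth_tensor r (con a T)" for a by (rule smooth_tensor_con[OF Suc.prems])
  have sn: "smooth_tensor r (nab b (con a T))" for a by (intro smooth_tensor_con smooth_tensor_nabla sc)
  have "tN r k (con a (nab b T)) \<le> 8 * tN (Suc r) (Suc k) T + 2 * 26 ^ r * tN r (Suc k) (con a T)" for a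
  proof -
    have "tN r k (con a (nab b T)) = tN r k (\<lambda>x ws. (\<Sum>c\<in>UNIV. eps c b a *\<^sub>R con c T x ws) + nab b (con a T) x ws)"
      by (rule tN_cong) (simp add: tensor_eq_def con_nab[OF Suc.prems])
    also have "\<dots> \<le> 2 * tN r k (\<lambda>x ws. \<Sum>c\<in>UNIV. eps c b a *\<^sub>R con c T x ws) + 2 * tN r k (nab b (con a T))"
      by (intro tN_add smooth_tensor_sum smooth_tensor_scaleR sc sn)
    also have "\<dots> \<le> 2 * (4 * tN (Suc r) k T) + 2 * (26 ^ r * tN r (Suc k) (con a T))"
      using tN_eps_sum[of r "\<lambda>c. con c T", OF sc] Suc.IH[OF sc] by (intro add_mono mult_left_mono) auto
    also have "\<dots> \<le> 8 * tN (Suc r) (Suc k) T + 2 * 26 ^ r * tN r (Suc k) (con a T)"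
      using tN_mono[of k "Suc k" "Suc r" T] by (simp del: tN.simps)
    finally show ?thesis .
  qed
  then have "tN (Suc r) k (nab b T) \<le> (\<Sum>a\<in>UNIV. 8 * tN (Suc r) (Suc k) T + 2 * 26 ^ r * tN r (Suc k) (con a T))"
    unfolding tN.simps(2)[of r k] by (rule sum_mono)
  also have "\<dots> = 24 * tN (Suc r) (Suc k) T + 2 * 26 ^ r * tN (Suc r) (Suc k) T"
    by (simp add: sum.distrib sum_distrib_left)
  also have "\<dots> \<le> 24 * 26 ^ r * tN (Suc r) (Suc k) T + 2 * 26 ^ r * tN (Suc r) (Suc k) T"
    by (intro add_mono mult_right_mono tN_nonneg order_refl) simp
  finally show ?case by (simp add: algebra_simps)
qed

text \<open>\<open>con_nab\<close> is solved for the frame derivatives of the components. Each rank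
  costs 73 = 1 + 72, where 72 counts the connection terms, 8 for each of the nine pairs of
  indices.\<close>

lemma tN_le_nab:
  fixes T :: "'v::euclidean_space tensor_field"
  shows "smooth_tensor r T \<Longrightarrow> tN r (Suc k) T \<le> 73 ^ r * (tN r k T + (\<Sum>b\<in>UNIV. tN r k (nab b T)))"
proof (induction r arbitrary: T)
  case 0
  show ?case unfolding tN.simps nab_Nil hN_Suc
    using hN_mono[of 0 k "\<lambda>x. T x []"] by (simp add: hN_0[symmetric] del: hB.simps)
next
  case (Suc r)
  have sc: "smooth_tensor r (con a T)" for a by (rule smooth_tensor_con[OF Suc.prems])
  have snc: "smooth_tensor r (con a (nab b T))" for a b
    by (intro smooth_tensor_con smooth_tensor_nabla Suc.prems)
  define N where "N = tN (Suc r) k T"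
  have nc: "tN r k (nab b (con a T)) \<le> 2 * tN r k (con a (nab b T)) + 8 * N" for a b
  proof -
    have "tN r k (nab b (con a T)) = tN r k (\<lambda>x ws. con a (nab b T) x ws + (- 1) *\<^sub>R (\<Sum>c\<in>UNIV. eps c b a *\<^sub>R con c T x ws))"
      by (rule tN_cong) (simp add: tensor_eq_def con_nab[OF Suc.prems])
    also have "\<dots> \<le> 2 * tN r k (con a (nab b T)) + 2 * tN r k (\<lambda>x ws. (- 1) *\<^sub>R (\<Sum>c\<in>UNIV. eps c b a *\<^sub>R con c T x ws))"
      by (intro tN_add smooth_tensor_sum smooth_tensor_scaleR sc snc)
    also have "tN r k (\<lambda>x ws. (- 1) *\<^sub>R (\<Sum>c\<in>UNIV. eps c b a *\<^sub>R con c T x ws)) = tN r k (\<lambda>x ws. \<Sum>c\<in>UNIV. eps c b a *\<^sub>R con c T x ws)"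
      using tN_scaleR[of r "\<lambda>x ws. \<Sum>c\<in>UNIV. eps c b a *\<^sub>R con c T x ws" k "- 1"]
      by (simp add: smooth_tensor_sum smooth_tensor_scaleR sc)
    also have "\<dots> \<le> 4 * N" unfolding N_def using tN_eps_sum[of r "\<lambda>c. con c T", OF sc] by simp
    finally show ?thesis by simp
  qed
  have "tN (Suc r) (Suc k) T \<le> (\<Sum>a\<in>UNIV. 73 ^ r * (tN r k (con a T) + (\<Sum>b\<in>UNIV. 2 * tN r k (con a (nab b T)) + 8 * N)))"
    unfolding tN.simps(2)[of r "Suc k"]
  proof (rule sum_mono)
    fix a :: 3
    have "tN r (Suc k) (con a T) \<le> 73 ^ r * (tN r k (con a T) + (\<Sum>b\<in>UNIV. tN r k (nab b (con a T))))"
      by (rule Suc.IH[OF sc])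
    also have "\<dots> \<le> 73 ^ r * (tN r k (con a T) + (\<Sum>b\<in>UNIV. 2 * tN r k (con a (nab b T)) + 8 * N))"
      using nc by (intro mult_left_mono add_left_mono sum_mono) auto
    finally show "tN r (Suc k) (con a T) \<le> \<dots>" .
  qed
  also have "\<dots> = 73 ^ r * (N + 2 * (\<Sum>b\<in>UNIV. tN (Suc r) k (nab b T)) + 72 * N)"
  proof -
    have "(\<Sum>a\<in>UNIV. \<Sum>b\<in>UNIV. tN r k (con a (nab b T))) = (\<Sum>b\<in>UNIV. tN (Suc r) k (nab b T))"
      unfolding tN.simps by (rule sum.swap)
    then show ?thesis unfolding N_def
      by (simp add: sum.distrib sum_distrib_left[symmetric])
  qed
  also have "\<dots> \<le> 73 ^ r * (73 * N + 73 * (\<Sum>b\<in>UNIV. tN (Suc r) k (nab b T)))"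
    using sum_nonneg[of UNIV "\<lambda>b. tN (Suc r) k (nab b T)"]
    by (intro mult_left_mono) (simp_all del: tN.simps)
  finally show ?case unfolding N_def by (simp add: algebra_simps del: tN.simps)
qed

subsection \<open>Weak covariant derivatives\<close>

lemma smooth_S3_polynomial: "real_polynomial_function p \<Longrightarrow> smooth_S3 p"
  by (induction rule: real_polynomial_function.induct) (auto intro: smooth_S3_linear_map)

text \<open>Polynomials restrict to smooth functions on the sphere and are uniformly dense in the
  continuous ones by Stone-Weierstrass.\<close>

lemma integral_zero_continuous:
  fixes g h :: "real^4 \<Rightarrow> real"
  assumes g: "integrable S3_measure g" and z: "\<And>p. smooth_S3 p \<Longrightarrow> (LINT x|S3_measure. g x * p x) = 0"
    and h: "continuous_on S3 h"
  shows "(LINT x|S3_measure. g x * h x) = 0"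
proof -
  define G where "G = (LINT x|S3_measure. \<bar>g x\<bar>)"
  have G: "G \<ge> 0" unfolding G_def by simp
  have le: "\<bar>LINT x|S3_measure. g x * h x\<bar> \<le> e * G" if e: "e > 0" for e
  proof -
    obtain p where p: "real_polynomial_function p" "\<And>x. x \<in> S3 \<Longrightarrow> \<bar>h x - p x\<bar> < e"
      using Stone_Weierstrass_real_polynomial_function[OF compact_sphere h e] by blast
    have ps: "smooth_S3 p" by (rule smooth_S3_polynomial[OF p(1)])
    have gm: "integrable S3_measure (\<lambda>x. g x * q x)" if q: "continuous_on S3 q" for q :: "real^4 \<Rightarrow> real"
    proof -
      have "compact (q ` S3)" by (intro compact_continuous_image q compact_sphere)
      then obtain B where B: "\<And>x. x \<in> S3 \<Longrightarrow> norm (q x) \<le> B"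
        using compact_imp_bounded bounded_iff by (metis imageI)
      have "integrable S3_measure (\<lambda>x. B * g x)" using g by simp
      then show ?thesis
      proof (rule Bochner_Integration.integrable_bound)
        show "(\<lambda>x. g x * q x) \<in> borel_measurable S3_measure"
          using g measurable_S3_continuous[OF q] by (intro borel_measurable_times) auto
        show "AE x in S3_measure. norm (g x * q x) \<le> norm (B * g x)"
        proof (rule AE_I2)
          fix x assume "x \<in> space S3_measure"
          then have "\<bar>q x\<bar> \<le> \<bar>B\<bar>" using B[of x] by auto
          then show "norm (g x * q x) \<le> norm (B * g x)"
            using mult_right_mono[of "\<bar>q x\<bar>" "\<bar>B\<bar>" "\<bar>g x\<bar>"] by (simp add: abs_mult mult.commute)
        qed
      qed
    qed
    have i: "integrable S3_measure (\<lambda>x. g x * h x)" "integrable S3_measure (\<lambda>x. g x * p x)"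
      by (intro gm h smooth_S3_continuous_on[OF ps])+
    have "(LINT x|S3_measure. g x * h x) = (LINT x|S3_measure. g x * h x) - (LINT x|S3_measure. g x * p x)"
      using z[OF ps] by simp
    also have "\<dots> = (LINT x|S3_measure. g x * (h x - p x))"
      using i by (simp add: right_diff_distrib)
    also have "\<bar>\<dots>\<bar> \<le> (LINT x|S3_measure. e * \<bar>g x\<bar>)"
    proof (rule integral_abs_bound_integral)
      show "integrable S3_measure (\<lambda>x. g x * (h x - p x))"
        by (intro gm continuous_intros h smooth_S3_continuous_on[OF ps])
      fix x assume "x \<in> space S3_measure"
      then show "\<bar>g x * (h x - p x)\<bar> \<le> e * \<bar>g x\<bar>"
        using mult_right_mono[of "\<bar>h x - p x\<bar>" e "\<bar>g x\<bar>"] p(2)[of x] by (simp add: abs_mult mult.commute)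
    qed (use g in auto)
    also have "\<dots> = e * G" unfolding G_def by simp
    finally show ?thesis .
  qed
  have "\<bar>LINT x|S3_measure. g x * h x\<bar> \<le> 0"
  proof (rule field_le_epsilon)
    fix e :: real assume e: "e > 0"
    have "e / (G + 1) * G \<le> e" using G e by (simp add: field_simps)
    then show "\<bar>LINT x|S3_measure. g x * h x\<bar> \<le> 0 + e" using le[of "e / (G + 1)"] G e by simp
  qed
  then show ?thesis by simp
qed

lemma sets_S3_Int: "A \<in> sets borel \<Longrightarrow> A \<inter> S3 \<in> sets S3_measure"
  unfolding sets_S3_measure sets_restrict_space Int_commute[of A] by (rule imageI)

text \<open>The continuous functions \<open>h n\<close> decrease to the indicator of the closed set
  as their slope grows; convergence is dominated by the absolute value of \<open>g\<close>.\<close>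

lemma set_integral_zero_closed:
  fixes g :: "real^4 \<Rightarrow> real"
  assumes g: "integrable S3_measure g" and z: "\<And>p. smooth_S3 p \<Longrightarrow> (LINT x|S3_measure. g x * p x) = 0"
    and K: "closed K"
  shows "(LINT x:K \<inter> S3|S3_measure. g x) = 0"
proof (cases "K = {}")
  case False
  define h where "h n x = max 0 (1 - real n * infdist x K)" for n x
  have hc: "continuous_on S3 (h n)" for n unfolding h_def by (intro continuous_intros)
  have "(\<lambda>n. LINT x|S3_measure. g x * h n x) \<longlonglongrightarrow> (LINT x|S3_measure. indicator (K \<inter> S3) x *\<^sub>R g x)"
  proof (rule integral_dominated_convergence[where w="\<lambda>x. \<bar>g x\<bar>"])
    show "(\<lambda>x. indicator (K \<inter> S3) x *\<^sub>R g x) \<in> borel_measurable S3_measure"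
    proof (intro borel_measurable_scaleR borel_measurable_indicator)
      show "K \<inter> S3 \<in> sets S3_measure" by (intro sets_S3_Int borel_closed K)
    qed (use g in auto)
    show "(\<lambda>x. g x * h n x) \<in> borel_measurable S3_measure" for n
      using g measurable_S3_continuous[OF hc] by (intro borel_measurable_times) auto
    show "AE x in S3_measure. (\<lambda>n. g x * h n x) \<longlonglongrightarrow> indicator (K \<inter> S3) x *\<^sub>R g x"
    proof (rule AE_I2)
      fix x assume "x \<in> space S3_measure"
      then have x: "x \<in> S3" by simp
      have "(\<lambda>n. h n x) \<longlonglongrightarrow> indicator K x"
      proof (cases "x \<in> K")
        case True
        then show ?thesis by (simp add: h_def)
      next
        case False
        then have d: "infdist x K > 0" using K \<open>K \<noteq> {}\<close> infdist_pos_not_in_closed by blast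
        obtain N :: nat where N: "1 / infdist x K < real N" using reals_Archimedean2 by blast
        have "h n x = 0" if "n \<ge> N" for n
        proof -
          have "1 < real N * infdist x K" using N d by (simp add: field_simps)
          also have "\<dots> \<le> real n * infdist x K" using that d by (intro mult_right_mono) auto
          finally show ?thesis by (simp add: h_def)
        qed
        then have "eventually (\<lambda>n. h n x = 0) sequentially" by (auto simp: eventually_sequentially)
        then show ?thesis using False by (simp add: tendsto_eventually)
      qed
      then have "(\<lambda>n. g x * h n x) \<longlonglongrightarrow> g x * indicator K x" by (intro tendsto_mult tendsto_const)
      then show "(\<lambda>n. g x * h n x) \<longlonglongrightarrow> indicator (K \<inter> S3) x *\<^sub>R g x"
        using x by (simp add: indicator_def mult.commute)
    qed
    show "AE x in S3_measure. norm (g x * h n x) \<le> \<bar>g x\<bar>" for n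
    proof (rule AE_I2)
      fix x
      have "\<bar>h n x\<bar> \<le> 1" unfolding h_def using infdist_nonneg[of x K] by (auto simp: max_def)
      then show "norm (g x * h n x) \<le> \<bar>g x\<bar>" by (simp add: abs_mult mult_left_le)
    qed
  qed (use g in auto)
  moreover have "(LINT x|S3_measure. g x * h n x) = 0" for n
    by (rule integral_zero_continuous[OF g z hc])
  ultimately have "(\<lambda>n. 0) \<longlonglongrightarrow> (LINT x|S3_measure. indicator (K \<inter> S3) x *\<^sub>R g x)" by simp
  then show ?thesis unfolding set_lebesgue_integral_def LIMSEQ_const_iff by simp
qed (simp add: set_lebesgue_integral_def)

text \<open>Closed sets are stable under intersection and generate the Borel sets, so the vanishing
  of set integrals extends to all Borel sets by a Dynkin argument. Then \<open>g\<close> and 0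
  define the same density.\<close>

lemma AE_zero_if_integral_zero:
  fixes g :: "real^4 \<Rightarrow> real"
  assumes g: "integrable S3_measure g" and z: "\<And>p. smooth_S3 p \<Longrightarrow> (LINT x|S3_measure. g x * p x) = 0"
  shows "AE x in S3_measure. g x = 0"
proof -
  note rs = sets_S3_Int
  have si: "set_integrable S3_measure (A \<inter> S3) g" if "A \<in> sets borel" for A
    unfolding set_integrable_def using integrable_mult_indicator[OF rs[OF that] g] .
  have clo: "(LINT x:K \<inter> S3|S3_measure. g x) = 0" if "closed K" for K
    by (rule set_integral_zero_closed[OF g z that])
  have all: "(LINT x:A \<inter> S3|S3_measure. g x) = 0" if A: "A \<in> sets borel" for A
  proof -
    have "Int_stable (Collect (closed :: (real^4) set \<Rightarrow> bool))" "Collect closed \<subseteq> Pow UNIV"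
      by (auto simp: Int_stable_def)
    moreover have "A \<in> sigma_sets UNIV (Collect closed)" using A by (simp add: borel_eq_closed)
    ultimately show ?thesis
    proof (induct rule: sigma_sets_induct_disjoint)
      case (basic K)
      then show ?case using clo by simp
    next
      case empty
      show ?case by (simp add: set_lebesgue_integral_def)
    next
      case (compl A)
      have Ab: "A \<in> sets borel" using compl by (simp add: borel_eq_closed)
      have "(LINT x:S3|S3_measure. g x) = (LINT x:(A \<inter> S3) \<union> ((UNIV - A) \<inter> S3)|S3_measure. g x)"
        by (rule arg_cong[of _ _ "\<lambda>B. set_lebesgue_integral S3_measure B g"]) auto
      also have "\<dots> = (LINT x:A \<inter> S3|S3_measure. g x) + (LINT x:(UNIV - A) \<inter> S3|S3_measure. g x)"
        using Ab by (intro set_integral_Un si) auto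
      finally show ?case using compl clo[of UNIV] by simp
    next
      case (union F)
      have Fb: "F i \<in> sets borel" for i using union by (auto simp: borel_eq_closed)
      have "(\<Union>i. F i) \<inter> S3 = (\<Union>i. F i \<inter> S3)" by auto
      then have "(LINT x:(\<Union>i. F i) \<inter> S3|S3_measure. g x) = (LINT x:(\<Union>i. F i \<inter> S3)|S3_measure. g x)" by simp
      also have "\<dots> = (\<Sum>i. (LINT x:F i \<inter> S3|S3_measure. g x))"
      proof (rule lebesgue_integral_countable_add)
        show "\<And>i j. i \<noteq> j \<Longrightarrow> F i \<inter> S3 \<inter> (F j \<inter> S3) = {}"
          using union(1) by (auto simp: disjoint_family_on_def)
        show "set_integrable S3_measure (\<Union>i. F i \<inter> S3) g"
          unfolding \<open>(\<Union>i. F i) \<inter> S3 = (\<Union>i. F i \<inter> S3)\<close>[symmetric]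
          by (intro si sets.countable_UN image_subsetI Fb)
      qed (rule rs[OF Fb])
      also have "\<dots> = 0" using union by simp
      finally show ?case .
    qed
  qed
  have "AE x in S3_measure. g x = (\<lambda>x. 0) x"
  proof (rule density_unique_real)
    fix A assume A: "A \<in> sets S3_measure"
    then obtain B where B: "B \<in> sets borel" "A = S3 \<inter> B"
      unfolding sets_S3_measure sets_restrict_space by (elim imageE)
    show "(LINT x:A|S3_measure. g x) = (LINT x:A|S3_measure. 0)"
      using all[OF B(1)] B(2) by (simp add: set_lebesgue_integral_def Int_commute)
  qed (use g in auto)
  then show ?thesis by simp
qed

section \<open>Square integrable tensor fields and uniqueness of weak derivatives\<close>

lemma abs_tensor_inner_le: "2 * \<bar>tensor_inner r S T x\<bar> \<le> tensor_inner r S S x + tensor_inner r T T x"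
proof -
  have pt: "2 * \<bar>u \<bullet> v\<bar> \<le> u \<bullet> u + v \<bullet> v" for u v :: 'a
  proof -
    have "0 \<le> (u - v) \<bullet> (u - v)" "0 \<le> (u + v) \<bullet> (u + v)" by (rule inner_ge_zero)+
    then show ?thesis by (simp add: inner_diff_left inner_diff_right inner_add_left inner_add_right inner_commute)
  qed
  have "2 * \<bar>tensor_inner r S T x\<bar> \<le> (\<Sum>es\<in>basis_lists r. 2 * \<bar>S x es \<bullet> T x es\<bar>)"
    unfolding tensor_inner_def sum_distrib_left[symmetric] by (intro mult_left_mono sum_abs) simp
  also have "\<dots> \<le> (\<Sum>es\<in>basis_lists r. S x es \<bullet> S x es + T x es \<bullet> T x es)"
    by (intro sum_mono pt)
  finally show ?thesis unfolding tensor_inner_def sum.distrib .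
qed

lemma tensor_inner_nonneg [simp]: "tensor_inner r S S x \<ge> 0"
  unfolding tensor_inner_def by (intro sum_nonneg) auto

lemma tensor_inner_diff_left:
  "tensor_inner r (\<lambda>x vs. S x vs - S' x vs) T x = tensor_inner r S T x - tensor_inner r S' T x"
  unfolding tensor_inner_def inner_diff_left by (rule sum_subtractf)

lemma tensor_inner_le_diff:
  "tensor_inner r S S x \<le> 2 * tensor_inner r T T x + 2 * tensor_inner r (\<lambda>x vs. T x vs - S x vs) (\<lambda>x vs. T x vs - S x vs) x"
proof -
  have pt: "u \<bullet> u \<le> 2 * (v \<bullet> v) + 2 * ((v - u) \<bullet> (v - u))" for u v :: 'a
  proof -
    have "0 \<le> (2 *\<^sub>R v - u) \<bullet> (2 *\<^sub>R v - u)" by (rule inner_ge_zero)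
    then show ?thesis by (simp add: inner_diff_left inner_diff_right inner_commute)
  qed
  show ?thesis unfolding tensor_inner_def sum_distrib_left sum.distrib[symmetric] by (intro sum_mono pt)
qed

lemma tensor_inner_diff_self_le:
  "tensor_inner r (\<lambda>x vs. T x vs - S x vs) (\<lambda>x vs. T x vs - S x vs) x \<le> 2 * tensor_inner r T T x + 2 * tensor_inner r S S x"
proof -
  have pt: "(v - u) \<bullet> (v - u) \<le> 2 * (v \<bullet> v) + 2 * (u \<bullet> u)" for u v :: 'a
  proof -
    have "0 \<le> (v + u) \<bullet> (v + u)" by (rule inner_ge_zero)
    then show ?thesis by (simp add: inner_diff_left inner_diff_right inner_add_left inner_add_right inner_commute)
  qed
  show ?thesis unfolding tensor_inner_def sum_distrib_left sum.distrib[symmetric] by (intro sum_mono pt)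
qed

lemma L2_tensorD:
  assumes "L2_tensor r T"
  shows "is_tensor_field r T" "length vs = r \<Longrightarrow> (\<lambda>x. T x vs) \<in> borel_measurable S3_measure"
    "integrable S3_measure (tensor_inner r T T)"
  using assms by (auto simp: L2_tensor_def)

lemma measurable_tensor_inner:
  fixes S T :: "'v::euclidean_space tensor_field"
  assumes "\<And>vs. length vs = r \<Longrightarrow> (\<lambda>x. S x vs) \<in> borel_measurable S3_measure"
    "\<And>vs. length vs = r \<Longrightarrow> (\<lambda>x. T x vs) \<in> borel_measurable S3_measure"
  shows "tensor_inner r S T \<in> borel_measurable S3_measure"
  unfolding tensor_inner_def using assms
  by (intro borel_measurable_sum borel_measurable_inner) (auto simp: basis_lists_def)

lemma integrable_tensor_inner:
  fixes S T :: "'v::euclidean_space tensor_field"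
  assumes "L2_tensor r S" "L2_tensor r T"
  shows "integrable S3_measure (tensor_inner r S T)"
proof (rule Bochner_Integration.integrable_bound)
  show "integrable S3_measure (\<lambda>x. tensor_inner r S S x + tensor_inner r T T x)"
    using L2_tensorD(3)[OF assms(1)] L2_tensorD(3)[OF assms(2)] by simp
  show "tensor_inner r S T \<in> borel_measurable S3_measure"
    by (intro measurable_tensor_inner L2_tensorD(2)[OF assms(1)] L2_tensorD(2)[OF assms(2)])
  show "AE x in S3_measure. norm (tensor_inner r S T x) \<le> norm (tensor_inner r S S x + tensor_inner r T T x)"
  proof (rule AE_I2)
    fix x
    show "norm (tensor_inner r S T x) \<le> norm (tensor_inner r S S x + tensor_inner r T T x)"
      using abs_tensor_inner_le[of r S T x] tensor_inner_nonneg[of r S x] tensor_inner_nonneg[of r T x]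
      by (simp del: tensor_inner_nonneg)
  qed
qed

lemma L2_tensor_diff:
  fixes S T :: "'v::euclidean_space tensor_field"
  assumes "L2_tensor r S" "L2_tensor r T"
  shows "L2_tensor r (\<lambda>x vs. T x vs - S x vs)"
  unfolding L2_tensor_def
proof (intro conjI allI impI)
  show "is_tensor_field r (\<lambda>x vs. T x vs - S x vs)"
    using L2_tensorD(1)[OF assms(1)] L2_tensorD(1)[OF assms(2)] unfolding is_tensor_field_def
    by (auto intro: linear_compose_sub)
  show m: "(\<lambda>x. T x vs - S x vs) \<in> borel_measurable S3_measure" if "length vs = r" for vs
    by (intro borel_measurable_diff L2_tensorD(2)[OF assms(1)] L2_tensorD(2)[OF assms(2)] that)
  show "integrable S3_measure (tensor_inner r (\<lambda>x vs. T x vs - S x vs) (\<lambda>x vs. T x vs - S x vs))"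
  proof (rule Bochner_Integration.integrable_bound)
    show "integrable S3_measure (\<lambda>x. 2 * tensor_inner r T T x + 2 * tensor_inner r S S x)"
      using L2_tensorD(3)[OF assms(1)] L2_tensorD(3)[OF assms(2)] by simp
    show "tensor_inner r (\<lambda>x vs. T x vs - S x vs) (\<lambda>x vs. T x vs - S x vs) \<in> borel_measurable S3_measure"
      by (intro measurable_tensor_inner m)
  qed (use tensor_inner_diff_self_le[of r T S] in auto)
qed

lemma L2_tensor_smooth:
  fixes T :: "'v::euclidean_space tensor_field"
  assumes "smooth_tensor r T"
  shows "L2_tensor r T"
  unfolding L2_tensor_def using smooth_tensorD[OF assms] smooth_tensor_inner[OF assms assms]
  by (auto intro!: measurable_S3_continuous smooth_S3_continuous_on)

lemma L2_tensor_con: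
  fixes D :: "'v::euclidean_space tensor_field"
  assumes "L2_tensor (Suc r) D"
  shows "L2_tensor r (con a D)"
  unfolding L2_tensor_def
proof (intro conjI allI impI)
  note tf = L2_tensorD(1)[OF assms]
  show "is_tensor_field r (con a D)" by (rule is_tensor_field_con[OF tf])
  show m: "(\<lambda>x. con a D x vs) \<in> borel_measurable S3_measure" if vs: "length vs = r" for vs
  proof -
    have "(\<lambda>x. \<Sum>e\<in>Basis. (J a x \<bullet> e) *\<^sub>R D x (e # vs)) \<in> borel_measurable S3_measure"
      using vs by (intro borel_measurable_sum borel_measurable_scaleR L2_tensorD(2)[OF assms] measurable_S3_continuous
          continuous_intros) auto
    then show ?thesis
      by (rule measurable_cong[THEN iffD1, rotated]) (simp add: con_def tensor_cons_basis[OF tf _ vs, of _ "J a _"])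
  qed
  show "integrable S3_measure (tensor_inner r (con a D) (con a D))"
  proof (rule Bochner_Integration.integrable_bound[OF L2_tensorD(3)[OF assms]])
    show "tensor_inner r (con a D) (con a D) \<in> borel_measurable S3_measure"
      by (intro measurable_tensor_inner m)
    show "AE x in S3_measure. norm (tensor_inner r (con a D) (con a D) x) \<le> norm (tensor_inner (Suc r) D D x)"
    proof (rule AE_I2)
      fix x assume "x \<in> space S3_measure"
      then have "tensor_inner (Suc r) D D x = (\<Sum>a\<in>UNIV. tensor_inner r (con a D) (con a D) x)"
        by (intro tensor_inner_Suc tf) simp
      then show "norm (tensor_inner r (con a D) (con a D) x) \<le> norm (tensor_inner (Suc r) D D x)"
        using member_le_sum[of a UNIV "\<lambda>a. tensor_inner r (con a D) (con a D) x"] by (simp add: sum_nonneg)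
    qed
  qed
qed

text \<open>On the sphere a right inverse of \<open>con a\<close> that the other contractions
  annihilate. It lifts a test tensor for one frame component to a test tensor of the next
  rank.\<close>

definition frame_slot :: "3 \<Rightarrow> 'v::real_normed_vector tensor_field \<Rightarrow> 'v tensor_field" where
  "frame_slot a Y = (\<lambda>x vs. (hd vs \<bullet> J a x) *\<^sub>R Y x (tl vs))"

lemma con_frame_slot: "x \<in> S3 \<Longrightarrow> con b (frame_slot a Y) x vs = (if b = a then 1 else 0) *\<^sub>R Y x vs"
  by (simp add: con_def frame_slot_def J_orthonormal)

lemma is_tensor_field_frame_slot:
  fixes Y :: "'v::real_normed_vector tensor_field"
  assumes Y: "is_tensor_field r Y"
  shows "is_tensor_field (Suc r) (frame_slot a Y)"
  unfolding is_tensor_field_def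
proof (intro ballI allI impI conjI)
  fix x and vs :: "(real^4) list" assume x: "x \<in> S3" and "length vs = Suc r"
  then obtain v ws where vs: "vs = v # ws" and ws: "length ws = r" by (cases vs) auto
  have "tan_proj x v \<bullet> J a x = v \<bullet> J a x" by (simp add: tan_proj_def inner_diff_left)
  then show "frame_slot a Y x (map (tan_proj x) vs) = frame_slot a Y x vs"
    unfolding vs frame_slot_def using tensor_tan[OF Y x ws] by simp
  fix k assume k: "k < Suc r"
  show "linear (\<lambda>v. frame_slot a Y x (vs[k := v]))"
  proof (cases k)
    case 0
    show ?thesis unfolding 0 vs frame_slot_def by (auto intro!: linearI simp: inner_add_left scaleR_add_left)
  next
    case (Suc j)
    then have "linear (\<lambda>v. Y x (ws[j := v]))" using Y x ws k unfolding is_tensor_field_def by auto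
    then show ?thesis unfolding Suc vs frame_slot_def by (simp add: linear_compose_scale_right)
  qed
qed

lemma smooth_tensor_frame_slot:
  fixes Y :: "'v::euclidean_space tensor_field"
  assumes Y: "smooth_tensor r Y"
  shows "smooth_tensor (Suc r) (frame_slot a Y)"
proof (rule smooth_tensorI)
  show "is_tensor_field (Suc r) (frame_slot a Y)"
    by (rule is_tensor_field_frame_slot[OF smooth_tensorD(1)[OF Y]])
  fix b
  show "smooth_tensor r (con b (frame_slot a Y))"
    by (rule smooth_tensor_cong[OF smooth_tensor_scaleR[OF Y, of "if b = a then 1 else 0"]])
      (simp add: tensor_eq_def con_frame_slot)
qed

text \<open>Reduction to scalars, slot by slot: testing \<open>D\<close> with
  \<open>frame_slot a Y\<close> amounts to testing \<open>con a D\<close> with \<open>Y\<close>. In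
  rank 0 the test fields are smooth functions times a basis vector of the space of values.\<close>

lemma AE_zero_if_weakly_zero:
  fixes D :: "'v::euclidean_space tensor_field"
  shows "L2_tensor r D \<Longrightarrow> (\<And>Y. smooth_tensor r Y \<Longrightarrow> (LINT x|S3_measure. tensor_inner r D Y x) = 0) \<Longrightarrow>
    AE x in S3_measure. tensor_inner r D D x = 0"
proof (induction r arbitrary: D)
  case 0
  define f where "f x = D x []" for x
  have fm [measurable]: "f \<in> borel_measurable S3_measure" unfolding f_def using L2_tensorD(2)[OF 0(1), of "[]"] by simp
  have f2: "integrable S3_measure (\<lambda>x. f x \<bullet> f x)"
    using L2_tensorD(3)[OF 0(1)] unfolding f_def tensor_inner_0[abs_def] .
  have "AE x in S3_measure. f x \<bullet> c = 0" if c: "c \<in> Basis" for c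
  proof (rule AE_zero_if_integral_zero)
    show "integrable S3_measure (\<lambda>x. f x \<bullet> c)"
    proof (rule Bochner_Integration.integrable_bound)
      show "integrable S3_measure (\<lambda>x. 1 + f x \<bullet> f x)" using f2 by simp
      show "AE x in S3_measure. norm (f x \<bullet> c) \<le> norm (1 + f x \<bullet> f x)"
      proof (rule AE_I2)
        fix x
        have "norm (f x \<bullet> c) \<le> norm (f x)" using Cauchy_Schwarz_ineq2[of "f x" c] c by simp
        also have "\<dots> \<le> 1 + (norm (f x))\<^sup>2"
        proof -
          have "0 \<le> (norm (f x) - 1)\<^sup>2" by simp
          then have "2 * norm (f x) \<le> (norm (f x))\<^sup>2 + 1" by (simp add: power2_diff)
          then show ?thesis using zero_le_power2[of "norm (f x)"] by linarith
        qed
        finally show "norm (f x \<bullet> c) \<le> norm (1 + f x \<bullet> f x)" by (simp add: dot_square_norm)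
      qed
    qed measurable
    fix p :: "real^4 \<Rightarrow> real" assume p: "smooth_S3 p"
    have "smooth_tensor 0 (\<lambda>x vs. p x *\<^sub>R c)" unfolding smooth_tensor_0 using p by simp
    from 0(2)[OF this] show "(LINT x|S3_measure. f x \<bullet> c * p x) = 0"
      unfolding tensor_inner_0 f_def by (simp add: mult.commute)
  qed
  then have "AE x in S3_measure. \<forall>c\<in>Basis. f x \<bullet> c = 0" by (intro AE_finite_allI) auto
  then show ?case
  proof eventually_elim
    case (elim x)
    then have "f x = 0" by (subst euclidean_eq_iff) simp
    then show ?case by (simp add: tensor_inner_0 f_def)
  qed
next
  case (Suc r)
  note tf = L2_tensorD(1)[OF Suc.prems(1)]
  have "AE x in S3_measure. tensor_inner r (con a D) (con a D) x = 0" for a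
  proof (rule Suc.IH[OF L2_tensor_con[OF Suc.prems(1)]])
    fix Y :: "'v tensor_field" assume Y: "smooth_tensor r Y"
    have sY: "smooth_tensor (Suc r) (frame_slot a Y)" by (rule smooth_tensor_frame_slot[OF Y])
    have "(LINT x|S3_measure. tensor_inner r (con a D) Y x) = (LINT x|S3_measure. tensor_inner (Suc r) D (frame_slot a Y) x)"
    proof (rule integral_S3_cong)
      fix x assume x: "x \<in> S3"
      have "tensor_inner (Suc r) D (frame_slot a Y) x = (\<Sum>b\<in>UNIV. tensor_inner r (con b D) (con b (frame_slot a Y)) x)"
        by (rule tensor_inner_Suc[OF tf smooth_tensorD(1)[OF sY] x])
      also have "\<dots> = (\<Sum>b\<in>UNIV. tensor_inner r (con b D) (\<lambda>x vs. (if b = a then 1 else 0) *\<^sub>R Y x vs) x)"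
        by (intro sum.cong refl tensor_inner_cong x) (auto simp: tensor_eq_def con_frame_slot)
      also have "\<dots> = tensor_inner r (con a D) Y x"
        unfolding tensor_inner_scaleR_right by (simp add: if_distrib[of "\<lambda>u. u * _"] cong: if_cong)
      finally show "tensor_inner r (con a D) Y x = tensor_inner (Suc r) D (frame_slot a Y) x" ..
    qed
    also have "\<dots> = 0" by (rule Suc.prems(2)[OF sY])
    finally show "(LINT x|S3_measure. tensor_inner r (con a D) Y x) = 0" .
  qed
  then have "AE x in S3_measure. \<forall>a\<in>UNIV. tensor_inner r (con a D) (con a D) x = 0"
    by (intro AE_finite_allI) auto
  moreover have "AE x in S3_measure. x \<in> S3" by (rule AE_I2) simp
  ultimately show ?case by eventually_elim (simp add: tensor_inner_Suc[OF tf tf])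
qed

text \<open>Weak derivatives agree almost everywhere only, so their squared norms are compared; this
  is what the choice operator in \<open>Sobolev_sq\<close> calls for.\<close>

lemma weak_nabla_unique:
  fixes S S' :: "'v::euclidean_space tensor_field"
  assumes S: "is_weak_nabla j r T S" and S': "is_weak_nabla j r T S'"
  shows "(LINT x|S3_measure. tensor_inner (r + j) S S x) = (LINT x|S3_measure. tensor_inner (r + j) S' S' x)"
proof -
  have L: "L2_tensor (r + j) S" "L2_tensor (r + j) S'" using S S' by (auto simp: is_weak_nabla_def)
  have "AE x in S3_measure. tensor_inner (r + j) (\<lambda>x vs. S' x vs - S x vs) (\<lambda>x vs. S' x vs - S x vs) x = 0"
  proof (rule AE_zero_if_weakly_zero[OF L2_tensor_diff[OF L]])
    fix Y :: "'v tensor_field" assume Y: "smooth_tensor (r + j) Y"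
    have "(LINT x|S3_measure. tensor_inner (r + j) (\<lambda>x vs. S' x vs - S x vs) Y x)
       = (LINT x|S3_measure. tensor_inner (r + j) S' Y x) - (LINT x|S3_measure. tensor_inner (r + j) S Y x)"
      unfolding tensor_inner_diff_left
      by (intro Bochner_Integration.integral_diff integrable_tensor_inner L L2_tensor_smooth Y)
    then show "(LINT x|S3_measure. tensor_inner (r + j) (\<lambda>x vs. S' x vs - S x vs) Y x) = 0"
      using S S' Y by (simp add: is_weak_nabla_def)
  qed
  then have "AE x in S3_measure. tensor_inner (r + j) S S x = tensor_inner (r + j) S' S' x"
  proof eventually_elim
    case (elim x)
    then have "\<forall>es\<in>basis_lists (r + j). (S' x es - S x es) \<bullet> (S' x es - S x es) = 0"
      unfolding tensor_inner_def by (subst (asm) sum_nonneg_eq_0_iff) (auto simp: finite_basis_lists)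
    then show ?case unfolding tensor_inner_def by (intro sum.cong) auto
  qed
  then show ?thesis
    by (intro integral_cong_AE measurable_tensor_inner L2_tensorD(2)[OF L(1)] L2_tensorD(2)[OF L(2)])
qed

lemma Sobolev_sq_eq:
  fixes T :: "'v::euclidean_space tensor_field"
  assumes "\<And>j. j \<le> k \<Longrightarrow> is_weak_nabla j r T (S j)"
  shows "Sobolev_sq k r T = (\<Sum>j\<le>k. LINT x|S3_measure. tensor_inner (r + j) (S j) (S j) x)"
  unfolding Sobolev_sq_def Let_def
proof (intro sum.cong refl)
  fix j assume "j \<in> {..k}"
  then have j: "is_weak_nabla j r T (S j)" using assms by simp
  show "(LINT x|S3_measure. tensor_inner (r + j) (SOME S. is_weak_nabla j r T S) (SOME S. is_weak_nabla j r T S) x)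
      = (LINT x|S3_measure. tensor_inner (r + j) (S j) (S j) x)"
    by (rule weak_nabla_unique[OF someI[of "is_weak_nabla j r T", OF j] j])
qed

lemma weak_nabla_diff:
  fixes S S' T T' :: "'v::euclidean_space tensor_field"
  assumes S: "is_weak_nabla j r T S" and S': "is_weak_nabla j r T' S'" and T: "L2_tensor r T" "L2_tensor r T'"
  shows "is_weak_nabla j r (\<lambda>x vs. T' x vs - T x vs) (\<lambda>x vs. S' x vs - S x vs)"
  unfolding is_weak_nabla_def
proof (intro conjI allI impI)
  have L: "L2_tensor (r + j) S" "L2_tensor (r + j) S'" using S S' by (auto simp: is_weak_nabla_def)
  show "L2_tensor (r + j) (\<lambda>x vs. S' x vs - S x vs)" by (rule L2_tensor_diff[OF L])
  fix Y :: "'v tensor_field" assume Y: "smooth_tensor (r + j) Y"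
  have Z: "L2_tensor r ((divergence ^^ j) Y)" by (intro L2_tensor_smooth smooth_tensor_divergence_pow Y)
  show "(LINT x|S3_measure. tensor_inner (r + j) (\<lambda>x vs. S' x vs - S x vs) Y x)
     = (- 1) ^ j * (LINT x|S3_measure. tensor_inner r (\<lambda>x vs. T' x vs - T x vs) ((divergence ^^ j) Y) x)"
    unfolding tensor_inner_diff_left
    using S S' Y integrable_tensor_inner[OF L(1) L2_tensor_smooth[OF Y]] integrable_tensor_inner[OF L(2) L2_tensor_smooth[OF Y]]
      integrable_tensor_inner[OF T(1) Z] integrable_tensor_inner[OF T(2) Z]
    by (simp add: is_weak_nabla_def right_diff_distrib)
qed

text \<open>The triangle inequality for squared norms, derived for explicit families of weak
  derivatives and their differences, since \<open>Sobolev_sq\<close> hides an arbitrary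
  choice.\<close>

lemma Sobolev_sq_le_diff:
  fixes T T' :: "'v::euclidean_space tensor_field"
  assumes T: "in_Sobolev k r T" and T': "in_Sobolev k r T'"
  shows "Sobolev_sq k r T \<le> 2 * Sobolev_sq k r T' + 2 * Sobolev_sq k r (\<lambda>x vs. T' x vs - T x vs)"
    and "Sobolev_sq k r T' \<le> 2 * Sobolev_sq k r T + 2 * Sobolev_sq k r (\<lambda>x vs. T' x vs - T x vs)"
    and "Sobolev_sq k r T \<ge> 0" and "Sobolev_sq k r (\<lambda>x vs. T' x vs - T x vs) \<ge> 0"
proof -
  obtain S where S: "\<And>j. j \<le> k \<Longrightarrow> is_weak_nabla j r T (S j)"
    using T unfolding in_Sobolev_def by metis
  obtain S' where S': "\<And>j. j \<le> k \<Longrightarrow> is_weak_nabla j r T' (S' j)"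
    using T' unfolding in_Sobolev_def by metis
  have L: "L2_tensor r T" "L2_tensor r T'" using T T' by (auto simp: in_Sobolev_def)
  define D where "D j = (\<lambda>x vs. S' j x vs - S j x vs)" for j
  have D: "is_weak_nabla j r (\<lambda>x vs. T' x vs - T x vs) (D j)" if "j \<le> k" for j
    unfolding D_def by (rule weak_nabla_diff[OF S[OF that] S'[OF that] L])
  have i: "integrable S3_measure (tensor_inner (r + j) (S j) (S j))"
    "integrable S3_measure (tensor_inner (r + j) (S' j) (S' j))"
    "integrable S3_measure (tensor_inner (r + j) (D j) (D j))" if "j \<le> k" for j
    using S[OF that] S'[OF that] D[OF that] by (auto simp: is_weak_nabla_def L2_tensor_def)
  have eqs: "Sobolev_sq k r T = (\<Sum>j\<le>k. LINT x|S3_measure. tensor_inner (r + j) (S j) (S j) x)"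
    "Sobolev_sq k r T' = (\<Sum>j\<le>k. LINT x|S3_measure. tensor_inner (r + j) (S' j) (S' j) x)"
    "Sobolev_sq k r (\<lambda>x vs. T' x vs - T x vs) = (\<Sum>j\<le>k. LINT x|S3_measure. tensor_inner (r + j) (D j) (D j) x)"
    using Sobolev_sq_eq[of k r T S] Sobolev_sq_eq[of k r T' S'] Sobolev_sq_eq[of k r _ D] S S' D by auto
  have 1: "(LINT x|S3_measure. tensor_inner (r + j) (S j) (S j) x)
     \<le> 2 * (LINT x|S3_measure. tensor_inner (r + j) (S' j) (S' j) x) + 2 * (LINT x|S3_measure. tensor_inner (r + j) (D j) (D j) x)"
    if "j \<le> k" for j
  proof -
    have "(LINT x|S3_measure. tensor_inner (r + j) (S j) (S j) x)
      \<le> (LINT x|S3_measure. 2 * tensor_inner (r + j) (S' j) (S' j) x + 2 * tensor_inner (r + j) (D j) (D j) x)"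
      using i[OF that] by (intro integral_mono) (auto simp: D_def intro: tensor_inner_le_diff)
    then show ?thesis using i[OF that] by simp
  qed
  have 2: "(LINT x|S3_measure. tensor_inner (r + j) (S' j) (S' j) x)
     \<le> 2 * (LINT x|S3_measure. tensor_inner (r + j) (S j) (S j) x) + 2 * (LINT x|S3_measure. tensor_inner (r + j) (D j) (D j) x)"
    if "j \<le> k" for j
  proof -
    have pt: "tensor_inner (r + j) (S' j) (S' j) x \<le> 2 * tensor_inner (r + j) (S j) (S j) x + 2 * tensor_inner (r + j) (D j) (D j) x" for x
    proof -
      have "u \<bullet> u \<le> 2 * (v \<bullet> v) + 2 * ((u - v) \<bullet> (u - v))" for u v :: 'v
      proof -
        have "0 \<le> (2 *\<^sub>R v - u) \<bullet> (2 *\<^sub>R v - u)" by (rule inner_ge_zero)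
        then show ?thesis by (simp add: inner_diff_left inner_diff_right inner_commute)
      qed
      then show ?thesis unfolding tensor_inner_def sum_distrib_left sum.distrib[symmetric] D_def by (intro sum_mono)
    qed
    have "(LINT x|S3_measure. tensor_inner (r + j) (S' j) (S' j) x)
      \<le> (LINT x|S3_measure. 2 * tensor_inner (r + j) (S j) (S j) x + 2 * tensor_inner (r + j) (D j) (D j) x)"
      using i[OF that] by (intro integral_mono pt) auto
    then show ?thesis using i[OF that] by simp
  qed
  show "Sobolev_sq k r T \<le> 2 * Sobolev_sq k r T' + 2 * Sobolev_sq k r (\<lambda>x vs. T' x vs - T x vs)"
    unfolding eqs sum_distrib_left sum.distrib[symmetric] by (intro sum_mono 1) simp
  show "Sobolev_sq k r T' \<le> 2 * Sobolev_sq k r T + 2 * Sobolev_sq k r (\<lambda>x vs. T' x vs - T x vs)"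
    unfolding eqs sum_distrib_left sum.distrib[symmetric] by (intro sum_mono 2) simp
  show "Sobolev_sq k r T \<ge> 0" "Sobolev_sq k r (\<lambda>x vs. T' x vs - T x vs) \<ge> 0"
    unfolding eqs by (auto intro!: sum_nonneg)
qed

section \<open>Sobolev norms of smooth tensor fields are equivalent to frame norms\<close>

lemma weak_nabla_smooth:
  fixes T :: "'v::euclidean_space tensor_field"
  assumes "smooth_tensor r T"
  shows "is_weak_nabla j r T ((nabla ^^ j) T)"
  unfolding is_weak_nabla_def
  using L2_tensor_smooth[OF smooth_tensor_nabla_pow[OF assms]] integral_nabla_pow_by_parts[OF assms] by blast

lemma in_Sobolev_smooth:
  fixes T :: "'v::euclidean_space tensor_field"
  shows "smooth_tensor r T \<Longrightarrow> in_Sobolev k r T"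
  unfolding in_Sobolev_def using L2_tensor_smooth weak_nabla_smooth by blast

lemma integral_tensor_inner_self:
  fixes T :: "'v::euclidean_space tensor_field"
  shows "smooth_tensor r T \<Longrightarrow> (LINT x|S3_measure. tensor_inner r T T x) = tN r 0 T"
proof (induction r arbitrary: T)
  case 0
  show ?case by (simp add: tensor_inner_0 hN_0)
next
  case (Suc r)
  note s = smooth_tensor_con[OF Suc.prems]
  have "(LINT x|S3_measure. tensor_inner (Suc r) T T x) = (LINT x|S3_measure. (\<Sum>a\<in>UNIV. tensor_inner r (con a T) (con a T) x))"
    by (intro integral_S3_cong tensor_inner_Suc smooth_tensorD(1)[OF Suc.prems])
  also have "\<dots> = (\<Sum>a\<in>UNIV. (LINT x|S3_measure. tensor_inner r (con a T) (con a T) x))"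
    using smooth_tensor_inner[OF s s] by simp
  also have "\<dots> = tN (Suc r) 0 T" using Suc.IH[OF s] by simp
  finally show ?case .
qed

lemma Sobolev_sq_smooth:
  fixes T :: "'v::euclidean_space tensor_field"
  assumes "smooth_tensor r T"
  shows "Sobolev_sq k r T = (\<Sum>j\<le>k. tN (r + j) 0 ((nabla ^^ j) T))"
  using Sobolev_sq_eq[of k r T "\<lambda>j. (nabla ^^ j) T"] weak_nabla_smooth[OF assms] integral_tensor_inner_self[OF smooth_tensor_nabla_pow[OF assms]]
  by simp

lemma tN_nabla_pow_le:
  "\<exists>C>0. \<forall>(T :: 'v::euclidean_space tensor_field) i. smooth_tensor r T \<longrightarrow> tN (r + j) i ((nabla ^^ j) T) \<le> C * tN r (i + j) T"
proof (induction j)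
  case 0
  show ?case by (intro exI[of _ 1]) simp
next
  case (Suc j)
  then obtain C where C: "C > 0" "\<And>(T :: 'v tensor_field) i. smooth_tensor r T \<Longrightarrow> tN (r + j) i ((nabla ^^ j) T) \<le> C * tN r (i + j) T"
    by blast
  have "tN (r + Suc j) i ((nabla ^^ Suc j) T) \<le> 3 * 26 ^ (r + j) * C * tN r (i + Suc j) T"
    if T: "smooth_tensor r T" for T :: "'v tensor_field" and i
  proof -
    have "tN (r + Suc j) i ((nabla ^^ Suc j) T) = (\<Sum>b\<in>UNIV. tN (r + j) i (nab b ((nabla ^^ j) T)))" by simp
    also have "\<dots> \<le> (\<Sum>b\<in>(UNIV::3 set). 26 ^ (r + j) * tN (r + j) (Suc i) ((nabla ^^ j) T))"
      by (intro sum_mono tN_nab_le smooth_tensor_nabla_pow T)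
    also have "\<dots> = 3 * 26 ^ (r + j) * tN (r + j) (Suc i) ((nabla ^^ j) T)" by simp
    also have "\<dots> \<le> 3 * 26 ^ (r + j) * (C * tN r (Suc i + j) T)"
      by (intro mult_left_mono C(2) T) simp
    finally show ?thesis by (simp add: mult_ac)
  qed
  then show ?case using C(1) by (intro exI[of _ "3 * 26 ^ (r + j) * C"]) auto
qed

lemma tN_le_nabla_pow:
  "\<exists>C>0. \<forall>T :: 'v::euclidean_space tensor_field. smooth_tensor r T \<longrightarrow> tN r k T \<le> C * (\<Sum>j\<le>k. tN (r + j) 0 ((nabla ^^ j) T))"
proof (induction k arbitrary: r)
  case 0
  show ?case by (intro exI[of _ 1]) simp
next
  case (Suc k)
  obtain C where C: "C > 0" "\<And>T :: 'v tensor_field. smooth_tensor r T \<Longrightarrow> tN r k T \<le> C * (\<Sum>j\<le>k. tN (r + j) 0 ((nabla ^^ j) T))"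
    using Suc.IH by blast
  \<comment> \<open>The induction hypothesis is used at rank \<open>r + 1\<close> as well, to be
    applied to \<open>nabla T\<close>.\<close>
  obtain C' where C': "C' > 0" "\<And>T :: 'v tensor_field. smooth_tensor (Suc r) T \<Longrightarrow> tN (Suc r) k T \<le> C' * (\<Sum>j\<le>k. tN (Suc r + j) 0 ((nabla ^^ j) T))"
    using Suc.IH by blast
  have "tN r (Suc k) T \<le> 73 ^ r * (C + C') * (\<Sum>j\<le>Suc k. tN (r + j) 0 ((nabla ^^ j) T))"
    if T: "smooth_tensor r T" for T :: "'v tensor_field"
  proof -
    define Q where "Q = (\<Sum>j\<le>Suc k. tN (r + j) 0 ((nabla ^^ j) T))"
    have Q1: "(\<Sum>j\<le>k. tN (r + j) 0 ((nabla ^^ j) T)) \<le> Q"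
      unfolding Q_def by (intro sum_mono2) auto
    have "(\<Sum>j\<le>k. tN (Suc r + j) 0 ((nabla ^^ j) (nabla T))) = (\<Sum>j\<le>k. tN (r + Suc j) 0 ((nabla ^^ Suc j) T))"
      by (simp only: funpow_Suc_right o_def add_Suc_right add_Suc)
    also have "\<dots> \<le> Q" unfolding Q_def sum.atMost_Suc_shift[of _ k] using tN_nonneg[of r 0 T] by (simp del: tN.simps funpow.simps)
    finally have Q2: "(\<Sum>j\<le>k. tN (Suc r + j) 0 ((nabla ^^ j) (nabla T))) \<le> Q" .
    have "tN r (Suc k) T \<le> 73 ^ r * (tN r k T + tN (Suc r) k (nabla T))"
      using tN_le_nab[OF T] by simp
    also have "\<dots> \<le> 73 ^ r * (C * Q + C' * Q)"
    proof (intro mult_left_mono add_mono)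
      show "tN r k T \<le> C * Q" using order_trans[OF C(2)[OF T] mult_left_mono[OF Q1]] C(1) by simp
      show "tN (Suc r) k (nabla T) \<le> C' * Q"
        using order_trans[OF C'(2)[OF smooth_tensor_nabla[OF T]] mult_left_mono[OF Q2]] C'(1) by (simp del: tN.simps)
    qed simp
    finally show ?thesis unfolding Q_def by (simp only: distrib_right distrib_left mult.assoc)
  qed
  then show ?case using C(1) C'(1) by (intro exI[of _ "73 ^ r * (C + C')"]) auto
qed

lemma Sobolev_sq_equiv:
  obtains C where "C > 0"
    "\<And>T :: 'v::euclidean_space tensor_field. smooth_tensor r T \<Longrightarrow> Sobolev_sq k r T \<le> C * tN r k T \<and> tN r k T \<le> C * Sobolev_sq k r T"
proof -
  have "\<forall>j. \<exists>C>0. \<forall>(T :: 'v tensor_field) i. smooth_tensor r T \<longrightarrow> tN (r + j) i ((nabla ^^ j) T) \<le> C * tN r (i + j) T"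
    using tN_nabla_pow_le by blast
  then obtain A where A: "\<And>j. A j > 0" "\<And>j (T :: 'v tensor_field) i. smooth_tensor r T \<Longrightarrow> tN (r + j) i ((nabla ^^ j) T) \<le> A j * tN r (i + j) T"
    by metis
  obtain B where B: "B > 0" "\<And>T :: 'v tensor_field. smooth_tensor r T \<Longrightarrow> tN r k T \<le> B * (\<Sum>j\<le>k. tN (r + j) 0 ((nabla ^^ j) T))"
    using tN_le_nabla_pow by blast
  define C where "C = (\<Sum>j\<le>k. A j) + B"
  have C: "C > 0" unfolding C_def using B(1) by (intro add_nonneg_pos sum_nonneg less_imp_le[OF A(1)])
  have "Sobolev_sq k r T \<le> C * tN r k T \<and> tN r k T \<le> C * Sobolev_sq k r T" if T: "smooth_tensor r T" for T :: "'v tensor_field"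
  proof
    have "Sobolev_sq k r T \<le> (\<Sum>j\<le>k. A j * tN r k T)"
      unfolding Sobolev_sq_smooth[OF T]
    proof (rule sum_mono)
      fix j assume "j \<in> {..k}"
      then have "A j * tN r (0 + j) T \<le> A j * tN r k T" using A(1)[of j] by (intro mult_left_mono tN_mono) auto
      then show "tN (r + j) 0 ((nabla ^^ j) T) \<le> A j * tN r k T" using A(2)[OF T, of j 0] by linarith
    qed
    also have "\<dots> \<le> C * tN r k T"
      unfolding sum_distrib_right[symmetric] C_def using B(1) by (intro mult_right_mono) auto
    finally show "Sobolev_sq k r T \<le> C * tN r k T" .
    have "tN r k T \<le> B * Sobolev_sq k r T" using B(2)[OF T] Sobolev_sq_smooth[OF T] by simp
    also have "\<dots> \<le> C * Sobolev_sq k r T"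
    proof (rule mult_right_mono)
      have "0 \<le> (\<Sum>j\<le>k. A j)" using A(1) by (intro sum_nonneg less_imp_le)
      then show "B \<le> C" unfolding C_def by simp
      show "0 \<le> Sobolev_sq k r T" unfolding Sobolev_sq_smooth[OF T] by (intro sum_nonneg tN_nonneg)
    qed
    finally show "tN r k T \<le> C * Sobolev_sq k r T" .
  qed
  then show thesis using that C by blast
qed

subsection \<open>Functions on the slab\<close>

abbreviation slab_ext :: "(real \<Rightarrow> real^4 \<Rightarrow> 'v) \<Rightarrow> real \<times> (real^4) \<Rightarrow> 'v" where
  "slab_ext f \<equiv> \<lambda>p. ext (f (fst p)) (snd p)"

abbreviation slab :: "(real \<times> (real^4)) set" where
  "slab \<equiv> dS_times \<times> (- {0})"

lemma smooth_slab_Cinf: "smooth_slab f \<longleftrightarrow> Cinf_on slab (slab_ext f)"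
  by (simp add: smooth_slab_def Cinf_on_def ext_def)

lemma axis_thick_slab_dS: "axis_thick slab"
  unfolding dS_times_def by (rule axis_thick_slab[OF axis_thick_punctured]) (use pi_gt_zero in linarith)

lemma smooth_slab_slice: "smooth_slab f \<Longrightarrow> \<tau> \<in> dS_times \<Longrightarrow> smooth_S3 (f \<tau>)"
  unfolding smooth_slab_Cinf smooth_S3_Cinf Cinf_on_def using Ck_on_slice[of \<tau> dS_times _ "- {0}" "slab_ext f"] by simp

lemma dS_vector_derivative_unique:
  assumes "\<tau> \<in> dS_times" "(f has_vector_derivative D) (at \<tau> within dS_times)" "(f has_vector_derivative D') (at \<tau> within dS_times)"
  shows "D = D'"
  using vector_derivative_unique_within_closed_interval[of "- (pi/2)" "pi/2" \<tau> f D D'] assms pi_gt_zero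
  unfolding dS_times_def by simp

lemma dt_eqI:
  assumes "\<tau> \<in> dS_times" "((\<lambda>s. f s x) has_vector_derivative D) (at \<tau> within dS_times)"
  shows "dt f \<tau> x = D"
proof -
  have "(\<lambda>s. f s x) differentiable (at \<tau> within dS_times)"
    using assms(2) by (rule differentiableI_vector)
  then have "((\<lambda>s. f s x) has_vector_derivative dt f \<tau> x) (at \<tau> within dS_times)"
    unfolding dt_def by (rule vector_derivative_works[THEN iffD1])
  then show ?thesis using dS_vector_derivative_unique[OF assms(1) _ assms(2)] by blast
qed

text \<open>One smooth differential on the product contains the time derivative and the
  differentials on the slices; exporting both from the same \<open>f'\<close> allows each to be
  differentiated in the direction of the other.\<close>

lemma smooth_slab_derivative:
  fixes f :: "real \<Rightarrow> real^4 \<Rightarrow> 'v::real_normed_vector"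
  assumes f: "smooth_slab f"
  obtains f' where "\<And>p. p \<in> slab \<Longrightarrow> (slab_ext f has_derivative f' p) (at p within slab)"
    "\<And>v. Cinf_on slab (\<lambda>p. f' p v)"
    "\<And>\<tau> x v. \<tau> \<in> dS_times \<Longrightarrow> x \<noteq> 0 \<Longrightarrow> f' (\<tau>, x) (0, v) = extD (f \<tau>) x v"
    "\<And>\<tau> x. \<tau> \<in> dS_times \<Longrightarrow> x \<noteq> 0 \<Longrightarrow>
       ((\<lambda>s. ext (f s) x) has_vector_derivative f' (\<tau>, x) (1, 0)) (at \<tau> within dS_times)"
    "\<And>\<tau> x. \<tau> \<in> dS_times \<Longrightarrow> x \<noteq> 0 \<Longrightarrow> ext (dt f \<tau>) x = f' (\<tau>, x) (1, 0)"
proof -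
  obtain f' where f': "\<And>p. p \<in> slab \<Longrightarrow> (slab_ext f has_derivative f' p) (at p within slab)"
    "\<And>v. Cinf_on slab (\<lambda>p. f' p v)"
    using Cinf_on_derivative[OF axis_thick_slab_dS f[unfolded smooth_slab_Cinf]] by blast
  have sp: "f' (\<tau>, x) (0, v) = extD (f \<tau>) x v" if t: "\<tau> \<in> dS_times" and x: "x \<noteq> 0" for \<tau> x v
  proof -
    have "((\<lambda>x. slab_ext f (\<tau>, x)) has_derivative (\<lambda>v. f' (\<tau>, x) (0, v))) (at x within - {0})"
    proof (rule has_derivative_in_compose[OF has_derivative_Pair[OF has_derivative_const has_derivative_ident]])
      show "(slab_ext f has_derivative f' (\<tau>, x)) (at (\<tau>, x) within Pair \<tau> ` (- {0}))"
        by (rule has_derivative_subset[OF f'(1)]) (use t x in auto)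
    qed
    then have "(ext (f \<tau>) has_derivative (\<lambda>v. f' (\<tau>, x) (0, v))) (at x)"
      using x by (simp add: at_within_punctured)
    then show ?thesis by (simp add: extD_eqI)
  qed
  have tm: "((\<lambda>s. ext (f s) x) has_vector_derivative f' (\<tau>, x) (1, 0)) (at \<tau> within dS_times)"
    if t: "\<tau> \<in> dS_times" and x: "x \<noteq> 0" for \<tau> x
  proof -
    have lin: "linear (f' (\<tau>, x))" using f'(1)[of "(\<tau>, x)"] t x has_derivative_linear by auto
    have "((\<lambda>s. slab_ext f (s, x)) has_derivative (\<lambda>h. f' (\<tau>, x) (h, 0))) (at \<tau> within dS_times)"
    proof (rule has_derivative_in_compose[OF has_derivative_Pair[OF has_derivative_ident has_derivative_const]])
      show "(slab_ext f has_derivative f' (\<tau>, x)) (at (\<tau>, x) within (\<lambda>s. (s, x)) ` dS_times)"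
        by (rule has_derivative_subset[OF f'(1)]) (use t x in auto)
    qed
    moreover have "(\<lambda>h. f' (\<tau>, x) (h, 0)) = (\<lambda>h. h *\<^sub>R f' (\<tau>, x) (1, 0))"
    proof
      fix h show "f' (\<tau>, x) (h, 0) = h *\<^sub>R f' (\<tau>, x) (1, 0)"
        using linear_cmul[OF lin, of h "(1, 0)"] by simp
    qed
    ultimately show ?thesis unfolding has_vector_derivative_def by (simp only: fst_conv snd_conv)
  qed
  have dtf: "ext (dt f \<tau>) x = f' (\<tau>, x) (1, 0)" if t: "\<tau> \<in> dS_times" and x: "x \<noteq> 0" for \<tau> x
    unfolding ext_def by (rule dt_eqI[OF t]) (use tm[OF t x] in \<open>simp add: ext_def\<close>)
  show thesis using that[OF f' sp tm dtf] .
qed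

lemma smooth_slab_dt [simp]:
  fixes f :: "real \<Rightarrow> real^4 \<Rightarrow> 'v::real_normed_vector"
  assumes "smooth_slab f"
  shows "smooth_slab (dt f)"
proof (rule smooth_slab_derivative[OF assms])
  fix f' :: "real \<times> (real^4) \<Rightarrow> real \<times> (real^4) \<Rightarrow> 'v" assume f': "\<And>v. Cinf_on slab (\<lambda>p. f' p v)"
    "\<And>\<tau> x. \<tau> \<in> dS_times \<Longrightarrow> x \<noteq> 0 \<Longrightarrow> ext (dt f \<tau>) x = f' (\<tau>, x) (1, 0)"
  show ?thesis unfolding smooth_slab_Cinf
  proof (rule Cinf_on_cong[OF f'(1)[of "(1, 0)"]])
    fix p assume "p \<in> slab"
    then have "fst p \<in> dS_times" "snd p \<noteq> 0" by auto
    from f'(2)[OF this] show "f' p (1, 0) = slab_ext (dt f) p" by simp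
  qed
qed

lemma has_vector_derivative_dt:
  fixes f :: "real \<Rightarrow> real^4 \<Rightarrow> 'v::real_normed_vector"
  assumes "smooth_slab f" "\<tau> \<in> dS_times" "x \<in> S3"
  shows "((\<lambda>s. f s x) has_vector_derivative dt f \<tau> x) (at \<tau> within dS_times)"
proof (rule smooth_slab_derivative[OF assms(1)])
  fix f' :: "real \<times> (real^4) \<Rightarrow> real \<times> (real^4) \<Rightarrow> 'v" assume f': "\<And>\<tau> x. \<tau> \<in> dS_times \<Longrightarrow> x \<noteq> 0 \<Longrightarrow>
       ((\<lambda>s. ext (f s) x) has_vector_derivative f' (\<tau>, x) (1, 0)) (at \<tau> within dS_times)"
    "\<And>\<tau> x. \<tau> \<in> dS_times \<Longrightarrow> x \<noteq> 0 \<Longrightarrow> ext (dt f \<tau>) x = f' (\<tau>, x) (1, 0)"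
  show ?thesis using f'(1)[of \<tau> x] f'(2)[of \<tau> x] assms by simp
qed

lemma Cinf_on_snd:
  "Cinf_on (- {0}) g \<Longrightarrow> Cinf_on slab (\<lambda>p. g (snd p))"
  unfolding Cinf_on_def using Ck_on_compose_snd by blast

lemma smooth_slab_static [simp]: "smooth_S3 g \<Longrightarrow> smooth_slab (\<lambda>\<tau>. g)"
  unfolding smooth_slab_Cinf smooth_S3_Cinf by (rule Cinf_on_snd)

lemma smooth_slab_X [simp]:
  fixes f :: "real \<Rightarrow> real^4 \<Rightarrow> 'v::real_normed_vector"
  assumes f: "smooth_slab f"
  shows "smooth_slab (\<lambda>\<tau>. X a (f \<tau>))"
proof (rule smooth_slab_derivative[OF f])
  fix f' :: "real \<times> (real^4) \<Rightarrow> real \<times> (real^4) \<Rightarrow> 'v" assume f': "\<And>v. Cinf_on slab (\<lambda>p. f' p v)"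
    "\<And>\<tau> x v. \<tau> \<in> dS_times \<Longrightarrow> x \<noteq> 0 \<Longrightarrow> f' (\<tau>, x) (0, v) = extD (f \<tau>) x v"
  show ?thesis unfolding smooth_slab_Cinf
  proof (rule Cinf_on_cong)
    show "Cinf_on slab (\<lambda>p. \<Sum>e\<in>Basis. (J a (snd p) \<bullet> e) *\<^sub>R f' p (0, e))"
      by (rule Cinf_on_sum, rule Cinf_on_bounded_bilinear[OF bounded_bilinear_scaleR], rule Cinf_on_snd,
          rule Cinf_on_bounded_bilinear[OF bounded_bilinear_inner])
        (auto intro: f' Cinf_on_bounded_linear bounded_linear_J)
    fix p :: "real \<times> (real^4)" assume "p \<in> slab"
    then obtain \<tau> x where p: "p = (\<tau>, x)" "\<tau> \<in> dS_times" "x \<noteq> 0" by (cases p) auto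
    note s = smooth_slab_slice[OF f p(2)]
    interpret l: linear "extD (f \<tau>) x" by (rule linear_extD[OF s p(3)])
    have "extD (f \<tau>) x (J a x) = extD (f \<tau>) x (\<Sum>e\<in>Basis. (J a x \<bullet> e) *\<^sub>R e)" by (simp add: euclidean_representation)
    then show "(\<Sum>e\<in>Basis. (J a (snd p) \<bullet> e) *\<^sub>R f' p (0, e)) = slab_ext (\<lambda>\<tau>. X a (f \<tau>)) p"
      using p by (simp add: ext_X[OF s] X_def l.sum l.scale f'(2))
  qed
qed

text \<open>Symmetry of second derivatives on the slab, also at its boundary times. The vector
  \<open>J a x\<close> is frozen as \<open>w\<close>, so that both orders become mixed second
  derivatives in two fixed directions.\<close>

lemma dt_X:
  fixes f :: "real \<Rightarrow> real^4 \<Rightarrow> 'v::euclidean_space"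
  assumes f: "smooth_slab f" and t: "\<tau> \<in> dS_times" and x: "x \<in> S3"
  shows "dt (\<lambda>s. X a (f s)) \<tau> x = X a (dt f \<tau>) x"
proof (rule smooth_slab_derivative[OF f])
  fix f' :: "real \<times> (real^4) \<Rightarrow> real \<times> (real^4) \<Rightarrow> 'v" assume f': "\<And>p. p \<in> slab \<Longrightarrow> (slab_ext f has_derivative f' p) (at p within slab)"
    "\<And>v. Cinf_on slab (\<lambda>p. f' p v)"
    "\<And>\<tau> x v. \<tau> \<in> dS_times \<Longrightarrow> x \<noteq> 0 \<Longrightarrow> f' (\<tau>, x) (0, v) = extD (f \<tau>) x v"
    "\<And>\<tau> x. \<tau> \<in> dS_times \<Longrightarrow> x \<noteq> 0 \<Longrightarrow> ext (dt f \<tau>) x = f' (\<tau>, x) (1, 0)"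
  have x0: "x \<noteq> 0" and nx: "norm x = 1" using x by auto
  have p: "(\<tau>, x) \<in> slab" using t x0 by auto
  define w where "w = J a x"
  have nw: "norm w = 1" unfolding w_def using nx by simp
  obtain g where g: "\<And>p. p \<in> slab \<Longrightarrow> ((\<lambda>p. f' p (1, 0)) has_derivative g p) (at p within slab)"
    "\<And>v. Cinf_on slab (\<lambda>p. g p v)"
    using Cinf_on_derivative[OF axis_thick_slab_dS f'(2)[of "(1, 0)"]] by blast
  obtain h where h: "\<And>p. p \<in> slab \<Longrightarrow> ((\<lambda>p. f' p (0, w)) has_derivative h p) (at p within slab)"
    "\<And>v. Cinf_on slab (\<lambda>p. h p v)"
    using Cinf_on_derivative[OF axis_thick_slab_dS f'(2)[of "(0, w)"]] by blast
  \<comment> \<open>A time direction that points into the interval. As \<open>pi / 2\<close> is at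
    least 1, steps of length up to 1/2 stay inside, and steps of this length along \<open>w\<close>
    keep \<open>x\<close> away from the origin.\<close>
  define \<sigma> :: real where "\<sigma> = (if \<tau> < 0 then 1 else - 1)"
  have lin: "linear (f' p)" if "p \<in> slab" for p using f'(1)[OF that] has_derivative_linear by blast
  have linh: "linear (h p)" if "p \<in> slab" for p using h(1)[OF that] has_derivative_linear by blast
  have sc: "(\<sigma>, 0) = \<sigma> *\<^sub>R (1, 0 :: real^4)" by simp
  have "\<sigma> *\<^sub>R g (\<tau>, x) (0, w) = h (\<tau>, x) (\<sigma>, 0)"
  proof (rule second_derivative_symmetric[where S=slab and f="slab_ext f" and f'=f' and p="(\<tau>, x)" and r="1/2" and g'="\<lambda>p v. \<sigma> *\<^sub>R g p v"])
    show "\<And>p. p \<in> slab \<Longrightarrow> ((\<lambda>p. f' p (\<sigma>, 0)) has_derivative (\<lambda>v. \<sigma> *\<^sub>R g p v)) (at p within slab)"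
    proof -
      fix p assume p: "p \<in> slab"
      have "((\<lambda>p. \<sigma> *\<^sub>R f' p (1, 0)) has_derivative (\<lambda>v. \<sigma> *\<^sub>R g p v)) (at p within slab)"
        by (intro has_derivative_scaleR_right g(1) p)
      then show "((\<lambda>p. f' p (\<sigma>, 0)) has_derivative (\<lambda>v. \<sigma> *\<^sub>R g p v)) (at p within slab)"
        by (rule has_derivative_transform[OF p, rotated]) (use linear_cmul[OF lin] in \<open>simp add: sc del: scaleR_Pair\<close>)
    qed
    show "continuous_on slab (\<lambda>p. \<sigma> *\<^sub>R g p (0, w))"
      by (intro continuous_intros Cinf_on_imp_continuous_on g)
    show "continuous_on slab (\<lambda>p. h p (\<sigma>, 0))" by (intro Cinf_on_imp_continuous_on h)
    fix s r :: real assume s: "s \<in> {0..1/2}" and r: "r \<in> {0..1/2}"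
    have "norm (r *\<^sub>R w) \<le> 1/2" using r nw by simp
    then have "x + r *\<^sub>R w \<noteq> 0" using nx norm_diff_ineq[of x "r *\<^sub>R w"] by auto
    moreover have "\<tau> + s * \<sigma> \<in> dS_times"
      using t s pi_ge_two unfolding dS_times_def \<sigma>_def by (auto split: if_splits)
    ultimately show "(\<tau>, x) + s *\<^sub>R (\<sigma>, 0) + r *\<^sub>R (0, w) \<in> slab" by simp
  qed (use f'(1) h(1) in auto)
  also have "\<dots> = \<sigma> *\<^sub>R h (\<tau>, x) (1, 0)" using linear_cmul[OF linh[OF p], of \<sigma> "(1, 0)"] by simp
  finally have eq: "g (\<tau>, x) (0, w) = h (\<tau>, x) (1, 0)" by (auto simp: \<sigma>_def split: if_splits)
  have "dt (\<lambda>s. X a (f s)) \<tau> x = h (\<tau>, x) (1, 0)"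
  proof (rule dt_eqI[OF t])
    have "((\<lambda>s. f' (s, x) (0, w)) has_derivative (\<lambda>k. h (\<tau>, x) (k, 0))) (at \<tau> within dS_times)"
    proof (rule has_derivative_in_compose[OF has_derivative_Pair[OF has_derivative_ident has_derivative_const]])
      show "((\<lambda>p. f' p (0, w)) has_derivative h (\<tau>, x)) (at (\<tau>, x) within (\<lambda>s. (s, x)) ` dS_times)"
        by (rule has_derivative_subset[OF h(1)[OF p]]) (use x0 in auto)
    qed
    moreover have "(\<lambda>k. h (\<tau>, x) (k, 0)) = (\<lambda>k. k *\<^sub>R h (\<tau>, x) (1, 0))"
    proof
      fix k show "h (\<tau>, x) (k, 0) = k *\<^sub>R h (\<tau>, x) (1, 0)"
        using linear_cmul[OF linh[OF p], of k "(1, 0)"] by simp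
    qed
    ultimately have "((\<lambda>s. f' (s, x) (0, w)) has_vector_derivative h (\<tau>, x) (1, 0)) (at \<tau> within dS_times)"
      unfolding has_vector_derivative_def by (simp only:)
    then show "((\<lambda>s. X a (f s) x) has_vector_derivative h (\<tau>, x) (1, 0)) (at \<tau> within dS_times)"
      by (rule has_vector_derivative_transform[OF t, rotated]) (simp add: f'(3)[OF _ x0] X_def w_def)
  qed
  also have "\<dots> = extD (dt f \<tau>) x w"
  proof -
    have "((\<lambda>y. f' (\<tau>, y) (1, 0)) has_derivative (\<lambda>v. g (\<tau>, x) (0, v))) (at x within - {0})"
    proof (rule has_derivative_in_compose[OF has_derivative_Pair[OF has_derivative_const has_derivative_ident]])
      show "((\<lambda>p. f' p (1, 0)) has_derivative g (\<tau>, x)) (at (\<tau>, x) within Pair \<tau> ` (- {0}))"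
        by (rule has_derivative_subset[OF g(1)[OF p]]) (use t in auto)
    qed
    then have "(ext (dt f \<tau>) has_derivative (\<lambda>v. g (\<tau>, x) (0, v))) (at x within - {0})"
      by (rule has_derivative_transform[rotated 2]) (use x0 f'(4)[OF t] in auto)
    then show ?thesis using x0 eq by (simp add: at_within_punctured extD_eqI)
  qed
  finally show ?thesis unfolding X_def w_def .
qed

section \<open>Calculus of time derivatives on the slab\<close>

lemma smooth_slab_linear:
  "bounded_linear L \<Longrightarrow> smooth_slab f \<Longrightarrow> smooth_slab (\<lambda>\<tau> x. L (f \<tau> x))"
  unfolding smooth_slab_def
  using Ck_on_bounded_linear_compose[of L _ slab "\<lambda>p. f (fst p) (snd p /\<^sub>R norm (snd p))"] by blast

lemma smooth_slab_bilinear: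
  "bounded_bilinear P \<Longrightarrow> smooth_slab f \<Longrightarrow> smooth_slab g \<Longrightarrow> smooth_slab (\<lambda>\<tau> x. P (f \<tau> x) (g \<tau> x))"
  unfolding smooth_slab_def
  using Ck_on_bounded_bilinear[of P _ slab "\<lambda>p. f (fst p) (snd p /\<^sub>R norm (snd p))" "\<lambda>p. g (fst p) (snd p /\<^sub>R norm (snd p))"]
  by blast

lemma smooth_slab_add [simp]: "smooth_slab f \<Longrightarrow> smooth_slab g \<Longrightarrow> smooth_slab (\<lambda>\<tau> x. f \<tau> x + g \<tau> x)"
  unfolding smooth_slab_def by (simp add: Ck_on_add)

lemma smooth_slab_diff [simp]: "smooth_slab f \<Longrightarrow> smooth_slab g \<Longrightarrow> smooth_slab (\<lambda>\<tau> x. f \<tau> x - g \<tau> x)"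
  unfolding smooth_slab_def by (simp add: Ck_on_diff)

lemma smooth_slab_sum [simp]:
  "(\<And>i. i \<in> I \<Longrightarrow> smooth_slab (F i)) \<Longrightarrow> smooth_slab (\<lambda>\<tau> x. \<Sum>i\<in>I. F i \<tau> x)"
  unfolding smooth_slab_def by (simp add: Ck_on_sum)

lemma smooth_slab_const [simp]: "smooth_slab (\<lambda>\<tau> x. c)"
  unfolding smooth_slab_def by simp

lemma smooth_slab_mult [simp]:
  "smooth_slab f \<Longrightarrow> smooth_slab g \<Longrightarrow> smooth_slab (\<lambda>\<tau> x. f \<tau> x * g \<tau> x :: 'a::real_normed_algebra)"
  by (rule smooth_slab_bilinear[OF bounded_bilinear_mult])

lemma smooth_slab_power [simp]:
  "smooth_slab f \<Longrightarrow> smooth_slab (\<lambda>\<tau> x. f \<tau> x ^ n :: 'a::real_normed_algebra_1)"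
  by (induction n) simp_all

lemma dt_linear:
  fixes f :: "real \<Rightarrow> real^4 \<Rightarrow> 'v::real_normed_vector"
  assumes "bounded_linear L" "smooth_slab f" "\<tau> \<in> dS_times" "x \<in> S3"
  shows "dt (\<lambda>\<tau> x. L (f \<tau> x)) \<tau> x = L (dt f \<tau> x)"
  by (rule dt_eqI[OF assms(3)]) (intro bounded_linear.has_vector_derivative[OF assms(1)] has_vector_derivative_dt assms)

lemma dt_cong:
  assumes "\<And>\<tau>. \<tau> \<in> dS_times \<Longrightarrow> f \<tau> x = g \<tau> x" "\<tau> \<in> dS_times"
  shows "dt f \<tau> x = dt g \<tau> x"
proof -
  have "((\<lambda>s. f s x) has_vector_derivative D) (at \<tau> within dS_times) \<longleftrightarrow> ((\<lambda>s. g s x) has_vector_derivative D) (at \<tau> within dS_times)" for D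
    using assms has_vector_derivative_transform[of \<tau> dS_times "\<lambda>s. f s x" "\<lambda>s. g s x" D]
      has_vector_derivative_transform[of \<tau> dS_times "\<lambda>s. g s x" "\<lambda>s. f s x" D] by auto
  then show ?thesis unfolding dt_def vector_derivative_def by simp
qed

lemma dt_const [simp]: "\<tau> \<in> dS_times \<Longrightarrow> dt (\<lambda>\<tau> x. c) \<tau> x = 0"
  by (rule dt_eqI) auto

lemma dt_add [simp]:
  assumes "smooth_slab f" "smooth_slab g" "\<tau> \<in> dS_times" "x \<in> S3"
  shows "dt (\<lambda>\<tau> x. f \<tau> x + g \<tau> x) \<tau> x = dt f \<tau> x + dt g \<tau> x"
  by (rule dt_eqI[OF assms(3)]) (intro has_vector_derivative_add has_vector_derivative_dt assms)

lemma dt_diff [simp]: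
  assumes "smooth_slab f" "smooth_slab g" "\<tau> \<in> dS_times" "x \<in> S3"
  shows "dt (\<lambda>\<tau> x. f \<tau> x - g \<tau> x) \<tau> x = dt f \<tau> x - dt g \<tau> x"
  by (rule dt_eqI[OF assms(3)]) (intro has_vector_derivative_diff has_vector_derivative_dt assms)

lemma dt_sum [simp]:
  assumes "\<And>i. i \<in> I \<Longrightarrow> smooth_slab (F i)" "\<tau> \<in> dS_times" "x \<in> S3"
  shows "dt (\<lambda>\<tau> x. \<Sum>i\<in>I. F i \<tau> x) \<tau> x = (\<Sum>i\<in>I. dt (F i) \<tau> x)"
  by (rule dt_eqI[OF assms(2)]) (intro has_vector_derivative_sum has_vector_derivative_dt assms)

lemma dt_mult:
  fixes f g :: "real \<Rightarrow> real^4 \<Rightarrow> 'a::real_normed_algebra"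
  assumes "smooth_slab f" "smooth_slab g" "\<tau> \<in> dS_times" "x \<in> S3"
  shows "dt (\<lambda>\<tau> x. f \<tau> x * g \<tau> x) \<tau> x = f \<tau> x * dt g \<tau> x + dt f \<tau> x * g \<tau> x"
  by (rule dt_eqI[OF assms(3)]) (intro has_vector_derivative_mult has_vector_derivative_dt assms)

lemma dt_square:
  fixes f :: "real \<Rightarrow> real^4 \<Rightarrow> real"
  assumes "smooth_slab f" "\<tau> \<in> dS_times" "x \<in> S3"
  shows "dt (\<lambda>\<tau> x. (f \<tau> x)\<^sup>2) \<tau> x = 2 * f \<tau> x * dt f \<tau> x"
  using dt_mult[OF assms(1,1,2,3)] by (simp add: power2_eq_square)

lemma continuous_on_slab:
  assumes "smooth_slab f"
  shows "continuous_on (dS_times \<times> S3) (\<lambda>p. f (fst p) (snd p))"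
proof -
  have "continuous_on slab (slab_ext f)"
    using assms unfolding smooth_slab_Cinf by (rule Cinf_on_imp_continuous_on)
  then have "continuous_on (dS_times \<times> S3) (slab_ext f)" by (rule continuous_on_subset) auto
  then show ?thesis by (rule continuous_on_eq) auto
qed

lemma has_derivative_integral_slab:
  fixes f :: "real \<Rightarrow> real^4 \<Rightarrow> 'v::euclidean_space"
  assumes f: "smooth_slab f" and t: "\<tau> \<in> dS_times"
  shows "((\<lambda>s. LINT x|S3_measure. f s x) has_vector_derivative (LINT x|S3_measure. dt f \<tau> x)) (at \<tau> within dS_times)"
  unfolding dS_times_def
  by (rule has_vector_derivative_integral_S3)
    (use has_vector_derivative_dt[OF f] continuous_on_slab[OF smooth_slab_dt[OF f]]
      smooth_S3_continuous_on[OF smooth_slab_slice[OF f]] t in \<open>auto simp: dS_times_def\<close>)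

lemma has_derivative_hB_slab:
  fixes f g :: "real \<Rightarrow> real^4 \<Rightarrow> 'v::euclidean_space"
  assumes t: "\<tau> \<in> dS_times"
  shows "smooth_slab f \<Longrightarrow> smooth_slab g \<Longrightarrow>
    ((\<lambda>s. hB k (f s) (g s)) has_real_derivative (hB k (dt f \<tau>) (g \<tau>) + hB k (f \<tau>) (dt g \<tau>))) (at \<tau> within dS_times)"
proof (induction k arbitrary: f g)
  case 0
  note [simp] = smooth_slab_slice[OF _ t]
  have fg: "smooth_slab (\<lambda>\<tau> x. f \<tau> x \<bullet> g \<tau> x)" by (rule smooth_slab_bilinear[OF bounded_bilinear_inner 0])
  have "(LINT x|S3_measure. dt (\<lambda>\<tau> x. f \<tau> x \<bullet> g \<tau> x) \<tau> x) = (LINT x|S3_measure. dt f \<tau> x \<bullet> g \<tau> x + f \<tau> x \<bullet> dt g \<tau> x)"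
  proof (rule integral_S3_cong)
    fix x assume x: "x \<in> S3"
    have "dt (\<lambda>\<tau> x. f \<tau> x \<bullet> g \<tau> x) \<tau> x = f \<tau> x \<bullet> dt g \<tau> x + dt f \<tau> x \<bullet> g \<tau> x"
      by (rule dt_eqI[OF t]) (intro bounded_bilinear.has_vector_derivative[OF bounded_bilinear_inner] has_vector_derivative_dt 0 t x)
    then show "dt (\<lambda>\<tau> x. f \<tau> x \<bullet> g \<tau> x) \<tau> x = dt f \<tau> x \<bullet> g \<tau> x + f \<tau> x \<bullet> dt g \<tau> x" by simp
  qed
  also have "\<dots> = hB 0 (dt f \<tau>) (g \<tau>) + hB 0 (f \<tau>) (dt g \<tau>)"
    using 0 by simp
  finally show ?case
    using has_derivative_integral_slab[OF fg t] by (simp add: has_real_derivative_iff_has_vector_derivative)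
next
  case (Suc k)
  have "((\<lambda>s. hB k (X a (f s)) (X a (g s))) has_real_derivative
      (hB k (X a (dt f \<tau>)) (X a (g \<tau>)) + hB k (X a (f \<tau>)) (X a (dt g \<tau>)))) (at \<tau> within dS_times)" for a
  proof -
    have "hB k (dt (\<lambda>s. X a (f s)) \<tau>) (X a (g \<tau>)) = hB k (X a (dt f \<tau>)) (X a (g \<tau>))"
      by (intro hB_cong dt_X Suc.prems t refl)
    moreover have "hB k (X a (f \<tau>)) (dt (\<lambda>s. X a (g s)) \<tau>) = hB k (X a (f \<tau>)) (X a (dt g \<tau>))"
      by (intro hB_cong dt_X Suc.prems t refl)
    ultimately show ?thesis
      using Suc.IH[OF smooth_slab_X[OF Suc.prems(1), of a] smooth_slab_X[OF Suc.prems(2), of a]] by simp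
  qed
  then show ?case unfolding hB.simps sum.distrib[symmetric] by (intro DERIV_sum)
qed

lemma has_derivative_hB_self:
  fixes f :: "real \<Rightarrow> real^4 \<Rightarrow> 'v::euclidean_space"
  assumes "\<tau> \<in> dS_times" "smooth_slab f"
  shows "((\<lambda>s. hB k (f s) (f s)) has_real_derivative 2 * hB k (f \<tau>) (dt f \<tau>)) (at \<tau> within dS_times)"
  using has_derivative_hB_slab[OF assms(1,2,2), of k] by (simp add: hB_sym[of k "dt f \<tau>"])

subsection \<open>The Maxwell-scalar field system in the frame\<close>

lemma smooth_tensor_scalar: "smooth_tensor 0 (scalar_field f) \<longleftrightarrow> smooth_S3 f"
  by (simp add: smooth_tensor_0 scalar_field_def)

lemma laplacian_frame:
  fixes T :: "'v::euclidean_space tensor_field"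
  assumes "smooth_tensor r T" "x \<in> S3" "length vs = r"
  shows "laplacian T x vs = (\<Sum>b\<in>UNIV. nab b (nab b T) x vs)"
  unfolding laplacian_def by (rule divergence_frame[OF smooth_tensor_nabla[OF assms(1)] assms(2,3)])

lemma laplacian_scalar:
  fixes f :: "real^4 \<Rightarrow> 'v::euclidean_space"
  assumes f: "smooth_S3 f" and x: "x \<in> S3"
  shows "laplacian (scalar_field f) x [] = lap f x"
  using laplacian_frame[of 0 "scalar_field f" x "[]"] f x
  by (simp add: smooth_tensor_scalar nab_Nil lap_def) (simp add: scalar_field_def)

lemma nabla_scalar:
  fixes f :: "real^4 \<Rightarrow> 'v::euclidean_space"
  assumes f: "smooth_S3 f" and x: "x \<in> S3"
  shows "nabla (scalar_field f) x [w] = (\<Sum>c\<in>UNIV. (w \<bullet> J c x) *\<^sub>R X c f x)"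
proof -
  have "is_tensor_field (Suc 0) (nabla (scalar_field f))"
    using f by (intro is_tensor_field_nabla) (simp add: smooth_tensor_scalar)
  from tensor_cons_frame[OF this x, of "[]" w] show ?thesis
    by (simp add: nab_Nil) (simp add: scalar_field_def)
qed

lemma smooth_tensor_one_form:
  assumes A: "smooth_S3 A" and t: "tangential A"
  shows "smooth_tensor (Suc 0) (one_form A)"
  unfolding smooth_tensor_def is_tensor_field_def
proof (intro conjI ballI allI impI)
  fix x and vs :: "(real^4) list" assume x: "x \<in> S3" and "length vs = Suc 0"
  then obtain v where vs: "vs = [v]" by (cases vs) auto
  show "one_form A x (map (tan_proj x) vs) = one_form A x vs"
    using t x unfolding vs one_form_def tangential_def by (simp add: tan_proj_def inner_diff_right)
  fix k assume "k < Suc 0"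
  then show "linear (\<lambda>v. one_form A x (vs[k := v]))"
    unfolding vs one_form_def by (auto intro!: linearI simp: inner_add_right)
next
  fix vs :: "(real^4) list"
  show "smooth_S3 (\<lambda>x. one_form A x vs)" unfolding one_form_def using A by simp
qed

lemma con_one_form: "con c (one_form A) x vs = A x \<bullet> J c x"
  by (simp add: con_def one_form_def)

lemma divergence_one_form:
  assumes A: "smooth_S3 A" and t: "tangential A" and x: "x \<in> S3"
  shows "divergence (one_form A) x [] = (\<Sum>c\<in>UNIV. X c (\<lambda>x. A x \<bullet> J c x) x)"
  using divergence_frame[OF smooth_tensor_one_form[OF A t] x, of "[]"]
  by (simp add: nab_Nil con_one_form)

text \<open>Up to sign the first-order part of the curl in the frame; the full curl has a further
  zeroth-order term from the connection.\<close>

definition curl :: "(3 \<Rightarrow> real^4 \<Rightarrow> real) \<Rightarrow> 3 \<Rightarrow> real^4 \<Rightarrow> real" where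
  "curl f c x = (\<Sum>b\<in>UNIV. \<Sum>d\<in>UNIV. eps d b c * X b (f d) x)"

lemma eps_eps_sum: "(\<Sum>b\<in>UNIV. \<Sum>d\<in>UNIV. eps d b c * (\<Sum>e\<in>UNIV. eps e b d * t e)) = - (2 * t c)"
  by (rule all3[of _ c]) (simp_all add: sum_3 eps_def)

text \<open>\<open>con_nab\<close> is used twice: the two mixed terms add up to twice the curl, and
  the product of two connection coefficients contracts to -2 by \<open>eps_eps_sum\<close>.\<close>

lemma laplacian_one_form:
  assumes A: "smooth_S3 A" and t: "tangential A" and x: "x \<in> S3"
  defines "f \<equiv> \<lambda>c x. A x \<bullet> J c x"
  shows "laplacian (one_form A) x [J c x] = lap (f c) x + 2 * curl f c x - 2 * f c x"
proof -
  define T where "T = one_form A"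
  have T: "smooth_tensor (Suc 0) T" unfolding T_def by (rule smooth_tensor_one_form[OF A t])
  have nT: "smooth_tensor (Suc 0) (nab b T)" for b by (intro smooth_tensor_con smooth_tensor_nabla T)
  have sf: "smooth_S3 (f d)" for d unfolding f_def using A by simp
  have cT: "con d T x [] = f d x" for d x unfolding T_def con_one_form f_def ..
  have n1: "con d (nab b T) y [] = (\<Sum>e\<in>UNIV. eps e b d * f e y) + X b (f d) y" if y: "y \<in> S3" for b d y
    using con_nab[OF T y, of "[]" d b] by (simp add: cT nab_Nil)
  have n2: "con c (nab b (nab b T)) x []
     = (\<Sum>d\<in>UNIV. eps d b c * ((\<Sum>e\<in>UNIV. eps e b d * f e x) + X b (f d) x))
       + ((\<Sum>d\<in>UNIV. eps d b c * X b (f d) x) + X b (X b (f c)) x)" for b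
  proof -
    have "nab b (con c (nab b T)) x [] = X b (\<lambda>y. (\<Sum>e\<in>UNIV. eps e b c * f e y) + X b (f c) y) x"
      unfolding nab_Nil by (rule X_cong[OF n1 x])
    also have "\<dots> = (\<Sum>d\<in>UNIV. eps d b c * X b (f d) x) + X b (X b (f c)) x"
      using sf x by simp
    finally show ?thesis using con_nab[OF nT x, of "[]" c b b] by (simp add: n1[OF x])
  qed
  have "laplacian (one_form A) x [J c x] = (\<Sum>b\<in>UNIV. con c (nab b (nab b T)) x [])"
    using laplacian_frame[OF T x, of "[J c x]"] by (simp add: T_def con_def)
  also have "\<dots> = (\<Sum>b\<in>UNIV. \<Sum>d\<in>UNIV. eps d b c * (\<Sum>e\<in>UNIV. eps e b d * f e x))
      + 2 * curl f c x + lap (f c) x"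
    unfolding n2 curl_def lap_def by (simp add: sum.distrib distrib_left sum_distrib_left)
  finally show ?thesis unfolding eps_eps_sum by simp
qed

lemma norm_tangent:
  assumes x: "x \<in> S3" and w: "w \<bullet> x = 0"
  shows "(norm w)\<^sup>2 = (\<Sum>c\<in>UNIV. (w \<bullet> J c x)\<^sup>2)"
proof -
  have "w = (\<Sum>c\<in>UNIV. (w \<bullet> J c x) *\<^sub>R J c x)" using J_expand[of x w] x w by simp
  then have "w \<bullet> w = (\<Sum>c\<in>UNIV. (w \<bullet> J c x) *\<^sub>R J c x) \<bullet> w" by simp
  also have "\<dots> = (\<Sum>c\<in>UNIV. (w \<bullet> J c x)\<^sup>2)"
    by (simp add: inner_sum_left power2_eq_square inner_commute[of "J _ x" w])
  finally show ?thesis by (simp add: power2_norm_eq_inner)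
qed

text \<open>\<open>u + i v\<close> is the scalar field, \<open>b\<close> the time component and
  \<open>a c\<close> the frame components of the spatial potential. In \<open>eq_a\<close> the mass
  4 is the 2 of the system plus 2 from the Laplacian of 1-forms.\<close>

locale frame_solution =
  fixes u v b :: "real \<Rightarrow> real^4 \<Rightarrow> real" and a :: "3 \<Rightarrow> real \<Rightarrow> real^4 \<Rightarrow> real"
  assumes slab_u [simp]: "smooth_slab u" and slab_v [simp]: "smooth_slab v"
    and slab_b [simp]: "smooth_slab b" and slab_a [simp]: "\<And>c. smooth_slab (a c)"
    and eq_u: "\<And>\<tau> x. \<tau> \<in> dS_times \<Longrightarrow> x \<in> S3 \<Longrightarrow> dt (dt u) \<tau> x = lap (u \<tau>) x + 2 * b \<tau> x * dt v \<tau> x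
        - 2 * (\<Sum>c\<in>UNIV. a c \<tau> x * X c (v \<tau>) x)
        - (1 - (b \<tau> x)\<^sup>2 + (\<Sum>c\<in>UNIV. (a c \<tau> x)\<^sup>2)) * u \<tau> x + dt b \<tau> x * v \<tau> x"
    and eq_v: "\<And>\<tau> x. \<tau> \<in> dS_times \<Longrightarrow> x \<in> S3 \<Longrightarrow> dt (dt v) \<tau> x = lap (v \<tau>) x - 2 * b \<tau> x * dt u \<tau> x
        + 2 * (\<Sum>c\<in>UNIV. a c \<tau> x * X c (u \<tau>) x)
        - (1 - (b \<tau> x)\<^sup>2 + (\<Sum>c\<in>UNIV. (a c \<tau> x)\<^sup>2)) * v \<tau> x - dt b \<tau> x * u \<tau> x"
    and eq_a: "\<And>\<tau> x c. \<tau> \<in> dS_times \<Longrightarrow> x \<in> S3 \<Longrightarrow> dt (dt (a c)) \<tau> x = lap (a c \<tau>) x - 4 * a c \<tau> x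
        + 2 * curl (\<lambda>d. a d \<tau>) c x - ((u \<tau> x)\<^sup>2 + (v \<tau> x)\<^sup>2) * a c \<tau> x
        - (u \<tau> x * X c (v \<tau>) x - v \<tau> x * X c (u \<tau>) x) + X c (dt b \<tau>) x"
    and eq_b: "\<And>\<tau> x. \<tau> \<in> dS_times \<Longrightarrow> x \<in> S3 \<Longrightarrow>
        lap (b \<tau>) x = ((u \<tau> x)\<^sup>2 + (v \<tau> x)\<^sup>2) * b \<tau> x + (u \<tau> x * dt v \<tau> x - v \<tau> x * dt u \<tau> x)"
    and div_a: "\<And>\<tau> x. \<tau> \<in> dS_times \<Longrightarrow> x \<in> S3 \<Longrightarrow> (\<Sum>c\<in>UNIV. X c (a c \<tau>) x) = 0"
    and mean_b: "\<And>\<tau>. \<tau> \<in> dS_times \<Longrightarrow> (LINT x|S3_measure. b \<tau> x) = 0"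

lemma dt_inner_J:
  assumes A: "smooth_slab A" and t: "\<tau> \<in> dS_times" and x: "x \<in> S3"
  shows "dt (\<lambda>\<tau> x. A \<tau> x \<bullet> J c x) \<tau> x = dt A \<tau> x \<bullet> J c x"
  by (rule dt_eqI[OF t])
    (intro bounded_linear.has_vector_derivative[OF bounded_linear_inner_left] has_vector_derivative_dt A t x)

lemma smooth_solution_frame:
  assumes sol: "smooth_solution \<phi> A A0"
  shows "frame_solution (\<lambda>\<tau> x. Re (\<phi> \<tau> x)) (\<lambda>\<tau> x. Im (\<phi> \<tau> x)) A0 (\<lambda>c \<tau> x. A \<tau> x \<bullet> J c x)"
proof -
  have s\<phi>: "smooth_slab \<phi>" and sA: "smooth_slab A" and sA0: "smooth_slab A0"
    using sol by (auto simp: smooth_solution_def)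
  define u v where "u \<tau> x = Re (\<phi> \<tau> x)" and "v \<tau> x = Im (\<phi> \<tau> x)" for \<tau> x
  define a where "a c \<tau> x = A \<tau> x \<bullet> J c x" for c \<tau> x
  have su: "smooth_slab u" unfolding u_def[abs_def] by (rule smooth_slab_linear[OF bounded_linear_Re s\<phi>])
  have sv: "smooth_slab v" unfolding v_def[abs_def] by (rule smooth_slab_linear[OF bounded_linear_Im s\<phi>])
  have sa: "smooth_slab (a c)" for c unfolding a_def[abs_def]
    by (rule smooth_slab_bilinear[OF bounded_bilinear_inner sA smooth_slab_static[OF smooth_S3_J]])
  have dtu: "dt u \<tau> x = Re (dt \<phi> \<tau> x)" "dt v \<tau> x = Im (dt \<phi> \<tau> x)" "dt (a c) \<tau> x = dt A \<tau> x \<bullet> J c x"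
    if "\<tau> \<in> dS_times" "x \<in> S3" for \<tau> x c
    unfolding u_def[abs_def] v_def[abs_def] a_def[abs_def]
    using dt_linear[OF bounded_linear_Re s\<phi> that] dt_linear[OF bounded_linear_Im s\<phi> that] dt_inner_J[OF sA that] by auto
  have ddtu: "dt (dt u) \<tau> x = Re (dt (dt \<phi>) \<tau> x)" "dt (dt v) \<tau> x = Im (dt (dt \<phi>) \<tau> x)"
      "dt (dt (a c)) \<tau> x = dt (dt A) \<tau> x \<bullet> J c x"
    if t: "\<tau> \<in> dS_times" and x: "x \<in> S3" for \<tau> x c
  proof -
    have "dt (dt u) \<tau> x = dt (\<lambda>\<tau> x. Re (dt \<phi> \<tau> x)) \<tau> x" by (rule dt_cong[of "dt u" x "\<lambda>\<tau> x. Re (dt \<phi> \<tau> x)", OF dtu(1)[OF _ x] t])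
    then show "dt (dt u) \<tau> x = Re (dt (dt \<phi>) \<tau> x)"
      using dt_linear[OF bounded_linear_Re smooth_slab_dt[OF s\<phi>] t x] by simp
    have "dt (dt v) \<tau> x = dt (\<lambda>\<tau> x. Im (dt \<phi> \<tau> x)) \<tau> x" by (rule dt_cong[of "dt v" x "\<lambda>\<tau> x. Im (dt \<phi> \<tau> x)", OF dtu(2)[OF _ x] t])
    then show "dt (dt v) \<tau> x = Im (dt (dt \<phi>) \<tau> x)"
      using dt_linear[OF bounded_linear_Im smooth_slab_dt[OF s\<phi>] t x] by simp
    have "dt (dt (a c)) \<tau> x = dt (\<lambda>\<tau> x. dt A \<tau> x \<bullet> J c x) \<tau> x" by (rule dt_cong[of "dt (a c)" x "\<lambda>\<tau> x. dt A \<tau> x \<bullet> J c x", OF dtu(3)[OF _ x] t])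
    then show "dt (dt (a c)) \<tau> x = dt (dt A) \<tau> x \<bullet> J c x"
      using dt_inner_J[OF smooth_slab_dt[OF sA] t x] by simp
  qed
  have "frame_solution u v A0 a"
  proof
    show "smooth_slab u" "smooth_slab v" "smooth_slab A0" "\<And>c. smooth_slab (a c)" by (fact su sv sA0 sa)+
    fix \<tau> assume t: "\<tau> \<in> dS_times"
    note sl\<phi> = smooth_slab_slice[OF s\<phi> t] and slA = smooth_slab_slice[OF sA t] and slA0 = smooth_slab_slice[OF sA0 t]
    have tanA: "tangential (A \<tau>)" using sol t by (simp add: smooth_solution_def)
    show "(LINT x|S3_measure. A0 \<tau> x) = 0" using sol t by (simp add: smooth_solution_def)
    fix x assume x: "x \<in> S3"
    have Xu: "X c (u \<tau>) y = Re (X c (\<phi> \<tau>) y)" if "y \<in> S3" for c y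
      unfolding u_def[abs_def] by (rule X_linear[OF bounded_linear_Re sl\<phi> that])
    have Xv: "X c (v \<tau>) y = Im (X c (\<phi> \<tau>) y)" if "y \<in> S3" for c y
      unfolding v_def[abs_def] by (rule X_linear[OF bounded_linear_Im sl\<phi> that])
    have lu: "lap (u \<tau>) x = Re (lap (\<phi> \<tau>) x)"
    proof -
      have "X c (X c (u \<tau>)) x = Re (X c (X c (\<phi> \<tau>)) x)" for c
      proof -
        have "X c (X c (u \<tau>)) x = X c (\<lambda>y. Re (X c (\<phi> \<tau>) y)) x" by (rule X_cong[OF Xu x])
        also have "\<dots> = Re (X c (X c (\<phi> \<tau>)) x)"
          by (rule X_linear[OF bounded_linear_Re smooth_S3_X[OF sl\<phi>] x])
        finally show ?thesis .
      qed
      then show ?thesis unfolding lap_def by simp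
    qed
    have lv: "lap (v \<tau>) x = Im (lap (\<phi> \<tau>) x)"
    proof -
      have "X c (X c (v \<tau>)) x = Im (X c (X c (\<phi> \<tau>)) x)" for c
      proof -
        have "X c (X c (v \<tau>)) x = X c (\<lambda>y. Im (X c (\<phi> \<tau>) y)) x" by (rule X_cong[OF Xv x])
        also have "\<dots> = Im (X c (X c (\<phi> \<tau>)) x)"
          by (rule X_linear[OF bounded_linear_Im smooth_S3_X[OF sl\<phi>] x])
        finally show ?thesis .
      qed
      then show ?thesis unfolding lap_def by simp
    qed
    have n\<phi>: "nabla (scalar_field (\<phi> \<tau>)) x [w] = (\<Sum>c\<in>UNIV. (w \<bullet> J c x) *\<^sub>R X c (\<phi> \<tau>) x)" for w
      by (rule nabla_scalar[OF sl\<phi> x])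
    have nJ: "nabla (scalar_field f) x [J c x] = X c f x" if "smooth_S3 f" for f :: "real^4 \<Rightarrow> 'w::euclidean_space" and c
      unfolding nabla_scalar[OF that x] using x
      by (simp add: J_orthonormal if_distrib[of "\<lambda>u. u *\<^sub>R _"] cong: if_cong)
    have nA: "(norm (A \<tau> x))\<^sup>2 = (\<Sum>c\<in>UNIV. (a c \<tau> x)\<^sup>2)"
      unfolding a_def by (rule norm_tangent[OF x]) (use tanA x in \<open>simp add: tangential_def\<close>)
    have E: "dt (dt \<phi>) \<tau> x - lap (\<phi> \<tau>) x
               + 2 * \<i> * of_real (A0 \<tau> x) * dt \<phi> \<tau> x
               - 2 * \<i> * (\<Sum>c\<in>UNIV. a c \<tau> x *\<^sub>R X c (\<phi> \<tau>) x)
               + (1 - of_real ((A0 \<tau> x)\<^sup>2) + of_real (\<Sum>c\<in>UNIV. (a c \<tau> x)\<^sup>2)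
                  + \<i> * of_real (dt A0 \<tau> x)) * \<phi> \<tau> x = 0"
    proof -
      have "dt (dt \<phi>) \<tau> x - laplacian (scalar_field (\<phi> \<tau>)) x []
               + 2 * \<i> * of_real (A0 \<tau> x) * dt \<phi> \<tau> x
               - 2 * \<i> * nabla (scalar_field (\<phi> \<tau>)) x [A \<tau> x]
               + (1 - of_real ((A0 \<tau> x)\<^sup>2) + of_real ((norm (A \<tau> x))\<^sup>2)
                  + \<i> * of_real (dt A0 \<tau> x)) * \<phi> \<tau> x = 0"
        using sol t x unfolding smooth_solution_def by blast
      moreover have "nabla (scalar_field (\<phi> \<tau>)) x [A \<tau> x] = (\<Sum>c\<in>UNIV. a c \<tau> x *\<^sub>R X c (\<phi> \<tau>) x)"
        unfolding a_def by (rule n\<phi>)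
      ultimately show ?thesis by (simp only: nA laplacian_scalar[OF sl\<phi> x])
    qed
    define q where "q = 1 - (A0 \<tau> x)\<^sup>2 + (\<Sum>c\<in>UNIV. (a c \<tau> x)\<^sup>2)"
    have E': "dt (dt \<phi>) \<tau> x = lap (\<phi> \<tau>) x
               - 2 * \<i> * of_real (A0 \<tau> x) * dt \<phi> \<tau> x
               + 2 * \<i> * (\<Sum>c\<in>UNIV. a c \<tau> x *\<^sub>R X c (\<phi> \<tau>) x)
               - (of_real q + \<i> * of_real (dt A0 \<tau> x)) * \<phi> \<tau> x"
      using E unfolding q_def by (simp add: algebra_simps)
    show "dt (dt u) \<tau> x = lap (u \<tau>) x + 2 * A0 \<tau> x * dt v \<tau> x
        - 2 * (\<Sum>c\<in>UNIV. a c \<tau> x * X c (v \<tau>) x)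
        - (1 - (A0 \<tau> x)\<^sup>2 + (\<Sum>c\<in>UNIV. (a c \<tau> x)\<^sup>2)) * u \<tau> x + dt A0 \<tau> x * v \<tau> x"
      unfolding ddtu(1)[OF t x] dtu(2)[OF t x] lu Xv[OF x] q_def[symmetric] E' u_def v_def
      by (simp add: algebra_simps)
    show "dt (dt v) \<tau> x = lap (v \<tau>) x - 2 * A0 \<tau> x * dt u \<tau> x
        + 2 * (\<Sum>c\<in>UNIV. a c \<tau> x * X c (u \<tau>) x)
        - (1 - (A0 \<tau> x)\<^sup>2 + (\<Sum>c\<in>UNIV. (a c \<tau> x)\<^sup>2)) * v \<tau> x - dt A0 \<tau> x * u \<tau> x"
      unfolding ddtu(2)[OF t x] dtu(1)[OF t x] lv Xu[OF x] q_def[symmetric] E' u_def v_def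
      by (simp add: algebra_simps)
    have c2: "(cmod (\<phi> \<tau> x))\<^sup>2 = (u \<tau> x)\<^sup>2 + (v \<tau> x)\<^sup>2" unfolding u_def v_def by (rule cmod_power2)
    fix c :: 3
    have "dt (dt A) \<tau> x \<bullet> J c x - laplacian (one_form (A \<tau>)) x [J c x]
               + (2 + (cmod (\<phi> \<tau> x))\<^sup>2) * (A \<tau> x \<bullet> J c x)
               = - Im (cnj (\<phi> \<tau> x) * nabla (scalar_field (\<phi> \<tau>)) x [J c x])
                 + nabla (scalar_field (dt A0 \<tau>)) x [J c x]"
      using sol t x unfolding smooth_solution_def by blast
    then show "dt (dt (a c)) \<tau> x = lap (a c \<tau>) x - 4 * a c \<tau> x
        + 2 * curl (\<lambda>d. a d \<tau>) c x - ((u \<tau> x)\<^sup>2 + (v \<tau> x)\<^sup>2) * a c \<tau> x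
        - (u \<tau> x * X c (v \<tau>) x - v \<tau> x * X c (u \<tau>) x) + X c (dt A0 \<tau>) x"
      unfolding nJ[OF sl\<phi>] nJ[OF smooth_slab_slice[OF smooth_slab_dt[OF sA0] t]] laplacian_one_form[OF slA tanA x]
        ddtu(3)[OF t x] c2 Xu[OF x] Xv[OF x]
      unfolding a_def[symmetric, abs_def] a_def[symmetric] by (simp add: algebra_simps u_def v_def)
  next
    fix \<tau> x assume t: "\<tau> \<in> dS_times" and x: "x \<in> S3"
    note slA = smooth_slab_slice[OF sA t] and slA0 = smooth_slab_slice[OF sA0 t]
    have tanA: "tangential (A \<tau>)" using sol t by (simp add: smooth_solution_def)
    have c2: "(cmod (\<phi> \<tau> x))\<^sup>2 = (u \<tau> x)\<^sup>2 + (v \<tau> x)\<^sup>2" unfolding u_def v_def by (rule cmod_power2)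
    have "- laplacian (scalar_field (A0 \<tau>)) x [] + (cmod (\<phi> \<tau> x))\<^sup>2 * A0 \<tau> x
               = - Im (cnj (\<phi> \<tau> x) * dt \<phi> \<tau> x)"
      using sol t x unfolding smooth_solution_def by blast
    then show "lap (A0 \<tau>) x = ((u \<tau> x)\<^sup>2 + (v \<tau> x)\<^sup>2) * A0 \<tau> x + (u \<tau> x * dt v \<tau> x - v \<tau> x * dt u \<tau> x)"
      unfolding laplacian_scalar[OF slA0 x] c2 dtu(1,2)[OF t x] by (simp add: u_def v_def algebra_simps)
    have "divergence (one_form (A \<tau>)) x [] = 0" using sol t x unfolding smooth_solution_def by blast
    then show "(\<Sum>c\<in>UNIV. X c (a c \<tau>) x) = 0"
      unfolding divergence_one_form[OF slA tanA x] a_def[abs_def] .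
  qed
  then show ?thesis unfolding u_def[abs_def] v_def[abs_def] a_def[abs_def] .
qed

section \<open>Consequences of the gauge condition\<close>

context frame_solution
begin

text \<open>The gauge invariant current \<open>Im (cnj phi * D_c phi)\<close> with
  \<open>D_c = X c + i a c\<close>. It takes in the cubic term, so that \<open>eq_a'\<close> is
  linear apart from it.\<close>

definition cur :: "3 \<Rightarrow> real \<Rightarrow> real^4 \<Rightarrow> real" where
  "cur c \<tau> x = (u \<tau> x * X c (v \<tau>) x - v \<tau> x * X c (u \<tau>) x) + ((u \<tau> x)\<^sup>2 + (v \<tau> x)\<^sup>2) * a c \<tau> x"

lemma slab_cur [simp]: "smooth_slab (cur c)"
  unfolding cur_def[abs_def] by simp

lemma slices [simp]:
  assumes "\<tau> \<in> dS_times"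
  shows "smooth_S3 (u \<tau>)" "smooth_S3 (v \<tau>)" "smooth_S3 (b \<tau>)" "smooth_S3 (a c \<tau>)"
    "smooth_S3 (dt u \<tau>)" "smooth_S3 (dt v \<tau>)" "smooth_S3 (dt b \<tau>)" "smooth_S3 (dt (a c) \<tau>)"
    "smooth_S3 (dt (dt u) \<tau>)" "smooth_S3 (dt (dt v) \<tau>)" "smooth_S3 (dt (dt (a c)) \<tau>)" "smooth_S3 (cur c \<tau>)"
  by (rule smooth_slab_slice[OF _ assms], simp)+

lemma smooth_S3_curl [simp]: "\<tau> \<in> dS_times \<Longrightarrow> smooth_S3 (curl (\<lambda>d. a d \<tau>) c)"
  unfolding curl_def[abs_def] by simp

lemma eq_a': "\<tau> \<in> dS_times \<Longrightarrow> x \<in> S3 \<Longrightarrow>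
  dt (dt (a c)) \<tau> x = lap (a c \<tau>) x - 4 * a c \<tau> x + 2 * curl (\<lambda>d. a d \<tau>) c x - cur c \<tau> x + X c (dt b \<tau>) x"
  unfolding eq_a cur_def by simp

lemma div_dt_a: "\<tau> \<in> dS_times \<Longrightarrow> x \<in> S3 \<Longrightarrow> (\<Sum>c\<in>UNIV. X c (dt (a c) \<tau>) x) = 0"
proof -
  assume t: "\<tau> \<in> dS_times" and x: "x \<in> S3"
  have "(\<Sum>c\<in>UNIV. X c (dt (a c) \<tau>) x) = (\<Sum>c\<in>UNIV. dt (\<lambda>s. X c (a c s)) \<tau> x)"
    using t x by (simp add: dt_X)
  also have "\<dots> = dt (\<lambda>\<tau> x. \<Sum>c\<in>UNIV. X c (a c \<tau>) x) \<tau> x" using t x by simp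
  also have "\<dots> = dt (\<lambda>\<tau> x. 0) \<tau> x" by (rule dt_cong[of "\<lambda>\<tau> x. \<Sum>c\<in>UNIV. X c (a c \<tau>) x" x "\<lambda>\<tau> x. 0", OF div_a[OF _ x] t])
  finally show ?thesis using t by simp
qed

lemma div_ddt_a: "\<tau> \<in> dS_times \<Longrightarrow> x \<in> S3 \<Longrightarrow> (\<Sum>c\<in>UNIV. X c (dt (dt (a c)) \<tau>) x) = 0"
proof -
  assume t: "\<tau> \<in> dS_times" and x: "x \<in> S3"
  have "(\<Sum>c\<in>UNIV. X c (dt (dt (a c)) \<tau>) x) = (\<Sum>c\<in>UNIV. dt (\<lambda>s. X c (dt (a c) s)) \<tau> x)"
    using t x by (simp add: dt_X)
  also have "\<dots> = dt (\<lambda>\<tau> x. \<Sum>c\<in>UNIV. X c (dt (a c) \<tau>) x) \<tau> x" using t x by simp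
  also have "\<dots> = dt (\<lambda>\<tau> x. 0) \<tau> x" by (rule dt_cong[of "\<lambda>\<tau> x. \<Sum>c\<in>UNIV. X c (dt (a c) \<tau>) x" x "\<lambda>\<tau> x. 0", OF div_dt_a[OF _ x] t])
  finally show ?thesis using t by simp
qed

lemma div_lap_a: "\<tau> \<in> dS_times \<Longrightarrow> x \<in> S3 \<Longrightarrow> (\<Sum>c\<in>UNIV. X c (lap (a c \<tau>)) x) = 0"
proof -
  assume t: "\<tau> \<in> dS_times" and x: "x \<in> S3"
  have "(\<Sum>c\<in>UNIV. X c (lap (a c \<tau>)) x) = (\<Sum>c\<in>UNIV. lap (X c (a c \<tau>)) x)" using t x by (simp add: X_lap)
  also have "\<dots> = lap (\<lambda>x. \<Sum>c\<in>UNIV. X c (a c \<tau>) x) x"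
  proof -
    have "X e (X e (\<lambda>x. \<Sum>c\<in>UNIV. X c (a c \<tau>) x)) x = (\<Sum>c\<in>UNIV. X e (X e (X c (a c \<tau>))) x)" for e
    proof -
      have "X e (X e (\<lambda>x. \<Sum>c\<in>UNIV. X c (a c \<tau>) x)) x = X e (\<lambda>x. \<Sum>c\<in>UNIV. X e (X c (a c \<tau>)) x) x"
        by (rule X_cong[OF _ x]) (simp add: t)
      then show ?thesis using t x by simp
    qed
    then show ?thesis unfolding lap_def by (simp only:) (rule sum.swap)
  qed
  also have "\<dots> = lap (\<lambda>x. 0) x" by (rule lap_cong[OF div_a[OF t] x])
  also have "\<dots> = 0" unfolding lap_def using X_cong[of "X _ (\<lambda>x. 0 :: real)" "\<lambda>x. 0" x] x by simp
  finally show ?thesis .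
qed

text \<open>As the frame fields do not commute, antisymmetrized second derivatives leave first-order
  terms. These add up to a multiple of the divergence of \<open>a\<close>, which vanishes by the
  gauge condition.\<close>

lemma div_curl: "\<tau> \<in> dS_times \<Longrightarrow> x \<in> S3 \<Longrightarrow> (\<Sum>c\<in>UNIV. X c (curl (\<lambda>d. a d \<tau>) c) x) = 0"
proof -
  assume t: "\<tau> \<in> dS_times" and x: "x \<in> S3"
  have "X c (curl (\<lambda>d. a d \<tau>) c) x = (\<Sum>b\<in>UNIV. \<Sum>d\<in>UNIV. eps d b c * X c (X b (a d \<tau>)) x)" for c
    unfolding curl_def[abs_def] using t x by simp
  then have "(\<Sum>c\<in>UNIV. X c (curl (\<lambda>d. a d \<tau>) c) x)
     = (X 2 (X 3 (a 1 \<tau>)) x - X 3 (X 2 (a 1 \<tau>)) x) * (eps 1 3 2)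
     + (X 1 (X 3 (a 2 \<tau>)) x - X 3 (X 1 (a 2 \<tau>)) x) * (eps 2 3 1)
     + (X 1 (X 2 (a 3 \<tau>)) x - X 2 (X 1 (a 3 \<tau>)) x) * (eps 3 2 1)"
    by (simp add: sum_3 eps_def)
  also have "X 2 (X 3 (a 1 \<tau>)) x - X 3 (X 2 (a 1 \<tau>)) x = - 2 * X 1 (a 1 \<tau>) x"
    using X_commutator[of "a 1 \<tau>" x 2 3] t x by (simp add: sum_3 eps_def)
  also have "X 1 (X 3 (a 2 \<tau>)) x - X 3 (X 1 (a 2 \<tau>)) x = 2 * X 2 (a 2 \<tau>) x"
    using X_commutator[of "a 2 \<tau>" x 1 3] t x by (simp add: sum_3 eps_def)
  also have "X 1 (X 2 (a 3 \<tau>)) x - X 2 (X 1 (a 3 \<tau>)) x = - 2 * X 3 (a 3 \<tau>) x"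
    using X_commutator[of "a 3 \<tau>" x 1 2] t x by (simp add: sum_3 eps_def)
  finally show ?thesis using div_a[OF t x] by (simp add: sum_3 eps_def)
qed

text \<open>In the divergence of the wave equation for the potential, the gauge condition, its time
  derivatives and \<open>div_curl\<close> remove everything but the current and the gradient of
  \<open>dt b\<close>. Differentiating \<open>eq_b\<close> in time instead would bring in second
  time derivatives of the scalar field.\<close>

lemma lap_dt_b:
  assumes t: "\<tau> \<in> dS_times" and x: "x \<in> S3"
  shows "lap (dt b \<tau>) x = (\<Sum>c\<in>UNIV. X c (cur c \<tau>) x)"
proof -
  have "X c (dt (dt (a c)) \<tau>) x = X c (lap (a c \<tau>)) x - 4 * X c (a c \<tau>) x + 2 * X c (curl (\<lambda>d. a d \<tau>) c) x
      - X c (cur c \<tau>) x + X c (X c (dt b \<tau>)) x" for c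
  proof -
    have "X c (dt (dt (a c)) \<tau>) x = X c (\<lambda>x. lap (a c \<tau>) x - 4 * a c \<tau> x + 2 * curl (\<lambda>d. a d \<tau>) c x - cur c \<tau> x + X c (dt b \<tau>) x) x"
      by (rule X_cong[OF eq_a'[OF t] x])
    then show ?thesis using t x by simp
  qed
  then have "(\<Sum>c\<in>UNIV. X c (dt (dt (a c)) \<tau>) x) = (\<Sum>c\<in>UNIV. X c (lap (a c \<tau>)) x) - 4 * (\<Sum>c\<in>UNIV. X c (a c \<tau>) x)
      + 2 * (\<Sum>c\<in>UNIV. X c (curl (\<lambda>d. a d \<tau>) c) x) - (\<Sum>c\<in>UNIV. X c (cur c \<tau>) x) + (\<Sum>c\<in>UNIV. X c (X c (dt b \<tau>)) x)"
    by (simp add: sum.distrib sum_subtractf sum_distrib_left)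
  then show ?thesis
    unfolding div_ddt_a[OF t x] div_lap_a[OF t x] div_a[OF t x] div_curl[OF t x] lap_def by simp
qed

lemma mean_dt_b:
  assumes t: "\<tau> \<in> dS_times"
  shows "(LINT x|S3_measure. dt b \<tau> x) = 0"
proof -
  have "((\<lambda>s. 0) has_vector_derivative (LINT x|S3_measure. dt b \<tau> x)) (at \<tau> within dS_times)"
    by (rule has_vector_derivative_transform[OF t _ has_derivative_integral_slab[OF slab_b t]]) (simp add: mean_b)
  from dS_vector_derivative_unique[OF t this has_vector_derivative_const] show ?thesis .
qed

end

subsection \<open>Energy estimates\<close>

text \<open>As long as \<open>y \<le> \<delta>\<close>, the product of \<open>y\<close> with
  \<open>exp (- (K * t))\<close> does not increase and that with \<open>exp (K * t)\<close> does not
  decrease. Strict smallness of \<open>y 0\<close> excludes a first time at which \<delta> is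
  reached, so the proviso holds throughout.\<close>

lemma gronwall_bootstrap:
  fixes y y' :: "real \<Rightarrow> real"
  assumes T: "T \<ge> 0" and K: "K \<ge> 0"
    and d: "\<And>t. t \<in> {0..T} \<Longrightarrow> (y has_real_derivative y' t) (at t within {0..T})"
    and bound: "\<And>t. t \<in> {0..T} \<Longrightarrow> y t \<le> \<delta> \<Longrightarrow> \<bar>y' t\<bar> \<le> K * y t"
    and small: "y 0 * exp (K * T) < \<delta>" and nonneg: "\<And>t. t \<in> {0..T} \<Longrightarrow> y t \<ge> 0"
  shows "y T \<le> exp (K * T) * y 0 \<and> y 0 \<le> exp (K * T) * y T \<and> y T \<le> \<delta>"
proof -
  have cont: "continuous_on {0..T} y"
    using d by (intro DERIV_continuous_on) auto
  \<comment> \<open>The bound is assumed on the open interval only, as the mean value theorem yields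
    interior times; hence this also applies when \<open>s\<close> is the first time with
    \<open>y s \<ge> \<delta>\<close>.\<close>
  have step: "y s \<le> exp (K * s) * y 0 \<and> y 0 \<le> exp (K * s) * y s"
    if s: "s \<in> {0..T}" and le: "\<And>t. t \<in> {0<..<s} \<Longrightarrow> y t \<le> \<delta>" for s
  proof (cases "s = 0")
    case False
    then have s0: "0 < s" using s by simp
    have ds: "(y has_real_derivative y' t) (at t within {0..s})" if "t \<in> {0..s}" for t
      by (rule DERIV_subset[OF d]) (use that s in auto)
    have b: "\<bar>y' t\<bar> \<le> K * y t" if "t \<in> {0<..<s}" for t
      using bound[of t] le[of t] that s by auto
    have d1: "((\<lambda>t. y t * exp (- (K * t))) has_derivative (\<lambda>h. h * ((y' t - K * y t) * exp (- (K * t))))) (at t within {0..s})"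
      if "t \<in> {0..s}" for t
    proof -
      have "((\<lambda>t. y t * exp (- (K * t))) has_real_derivative ((y' t - K * y t) * exp (- (K * t)))) (at t within {0..s})"
        using ds[OF that] by (auto intro!: derivative_eq_intros simp: algebra_simps)
      then show ?thesis by (simp add: has_field_derivative_def mult_commute_abs)
    qed
    from mvt_simple[OF s0 d1] obtain t where t: "t \<in> {0<..<s}"
      "y s * exp (- (K * s)) - y 0 = s * ((y' t - K * y t) * exp (- (K * t)))" by auto
    have "(y' t - K * y t) * exp (- (K * t)) \<le> 0" using b[OF t(1)] by (intro mult_nonpos_nonneg) auto
    then have "y s * exp (- (K * s)) - y 0 \<le> 0" unfolding t(2) by (rule mult_nonneg_nonpos[OF less_imp_le[OF s0]])
    then have "exp (K * s) * (y s * exp (- (K * s))) \<le> exp (K * s) * y 0" by (intro mult_left_mono) auto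
    then have 1: "y s \<le> exp (K * s) * y 0" by (simp add: exp_minus field_simps)
    have d2: "((\<lambda>t. y t * exp (K * t)) has_derivative (\<lambda>h. h * ((y' t + K * y t) * exp (K * t)))) (at t within {0..s})"
      if "t \<in> {0..s}" for t
    proof -
      have "((\<lambda>t. y t * exp (K * t)) has_real_derivative ((y' t + K * y t) * exp (K * t))) (at t within {0..s})"
        using ds[OF that] by (auto intro!: derivative_eq_intros simp: algebra_simps)
      then show ?thesis by (simp add: has_field_derivative_def mult_commute_abs)
    qed
    from mvt_simple[OF s0 d2] obtain t where t: "t \<in> {0<..<s}"
      "y s * exp (K * s) - y 0 = s * ((y' t + K * y t) * exp (K * t))" by auto
    have "(y' t + K * y t) * exp (K * t) \<ge> 0" using b[OF t(1)] by (intro mult_nonneg_nonneg) auto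
    then have "y s * exp (K * s) - y 0 \<ge> 0" unfolding t(2) by (rule mult_nonneg_nonneg[OF less_imp_le[OF s0]])
    then show ?thesis using 1 by (simp add: mult.commute)
  qed simp
  have small_s: "y 0 * exp (K * s) < \<delta>" if "s \<in> {0..T}" for s
  proof -
    have "exp (K * s) \<le> exp (K * T)" using that K by (simp add: mult_left_mono)
    then have "y 0 * exp (K * s) \<le> y 0 * exp (K * T)" using nonneg[of 0] T by (intro mult_left_mono) auto
    then show ?thesis using small by linarith
  qed
  have all: "y t < \<delta>" if t: "t \<in> {0..T}" for t
  proof (rule ccontr)
    assume "\<not> y t < \<delta>"
    define A where "A = {0..T} \<inter> y -` {\<delta>..}"
    have "closed A" unfolding A_def by (intro continuous_closed_preimage cont) auto
    moreover have "bounded A" unfolding A_def by (rule bounded_subset[of "{0..T}"]) auto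
    ultimately have "compact A" by (simp add: compact_eq_bounded_closed)
    moreover have "A \<noteq> {}" using t \<open>\<not> y t < \<delta>\<close> by (auto simp: A_def)
    ultimately obtain s where s: "s \<in> A" "\<And>r. r \<in> A \<Longrightarrow> s \<le> r" using compact_attains_inf[of A] by auto
    have "y r \<le> \<delta>" if "r \<in> {0<..<s}" for r
      using s(2)[of r] s(1) that by (force simp: A_def)
    then have "y s \<le> exp (K * s) * y 0" using step[of s] s(1) by (auto simp: A_def)
    also have "\<dots> < \<delta>" using small_s[of s] s(1) by (simp add: A_def mult.commute)
    finally show False using s(1) by (simp add: A_def)
  qed
  have "y t \<le> \<delta>" if "t \<in> {0<..<T}" for t using all[of t] that by auto
  then show ?thesis using step[of T] all[of T] T by auto
qed

text \<open>Negative times are reflected to positive ones. Both halves of the interval have length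
  \<open>pi / 2\<close>, so the exponent \<open>pi\<close> is generous.\<close>

lemma gronwall_dS:
  fixes y y' :: "real \<Rightarrow> real"
  assumes K: "K \<ge> 0"
    and d: "\<And>t. t \<in> dS_times \<Longrightarrow> (y has_real_derivative y' t) (at t within dS_times)"
    and bound: "\<And>t. t \<in> dS_times \<Longrightarrow> y t \<le> \<delta> \<Longrightarrow> \<bar>y' t\<bar> \<le> K * y t"
    and small: "y 0 * exp (K * pi) < \<delta>" and nonneg: "\<And>t. t \<in> dS_times \<Longrightarrow> y t \<ge> 0"
    and t: "t \<in> dS_times"
  shows "y t \<le> exp (K * pi) * y 0 \<and> y 0 \<le> exp (K * pi) * y t \<and> y t \<le> \<delta>"
proof -
  have z: "0 \<in> dS_times" by (simp add: dS_times_def)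
  have tpi: "\<bar>t\<bar> \<le> pi" using t pi_gt_zero unfolding dS_times_def by auto
  have ex: "exp (K * \<bar>t\<bar>) \<le> exp (K * pi)" using K tpi by (simp add: mult_left_mono)
  have small': "y 0 * exp (K * \<bar>t\<bar>) < \<delta>"
    using small mult_left_mono[OF ex nonneg[OF z]] by linarith
  have "y t \<le> exp (K * \<bar>t\<bar>) * y 0 \<and> y 0 \<le> exp (K * \<bar>t\<bar>) * y t \<and> y t \<le> \<delta>"
  proof (cases "t \<ge> 0")
    case True
    have sub: "{0..t} \<subseteq> dS_times" using t True unfolding dS_times_def by auto
    have dy: "(y has_real_derivative y' s) (at s within {0..t})" if "s \<in> {0..t}" for s
      using DERIV_subset[OF d sub] that sub by blast
    have "y t \<le> exp (K * t) * y 0 \<and> y 0 \<le> exp (K * t) * y t \<and> y t \<le> \<delta>"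
      by (rule gronwall_bootstrap[OF True K dy])
        (use sub small' True bound nonneg in auto)
    then show ?thesis using True by simp
  next
    case False
    define w where "w s = y (- s)" for s
    have sub: "s \<in> {0..- t} \<Longrightarrow> - s \<in> dS_times" for s using t False unfolding dS_times_def by auto
    have dw: "(w has_real_derivative - y' (- s)) (at s within {0..- t})" if s: "s \<in> {0..- t}" for s
    proof -
      have "(y has_real_derivative y' (- s)) (at (- s) within uminus ` {0..- t})"
        by (rule DERIV_subset[OF d[OF sub[OF s]]]) (use t False in \<open>auto simp: dS_times_def\<close>)
      moreover have "(uminus has_real_derivative - 1) (at s within {0..- t})" by (auto intro!: derivative_eq_intros)
      ultimately have "(y \<circ> uminus has_real_derivative y' (- s) * - 1) (at s within {0..- t})" by (rule DERIV_image_chain)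
      then show ?thesis unfolding w_def[abs_def] by (simp add: o_def)
    qed
    have "w (- t) \<le> exp (K * - t) * w 0 \<and> w 0 \<le> exp (K * - t) * w (- t) \<and> w (- t) \<le> \<delta>"
      by (rule gronwall_bootstrap[OF _ K dw])
        (use sub small' False in \<open>auto simp: w_def intro: bound nonneg\<close>)
    then show ?thesis using False by (simp add: w_def)
  qed
  moreover have "exp (K * \<bar>t\<bar>) * y 0 \<le> exp (K * pi) * y 0" "exp (K * \<bar>t\<bar>) * y t \<le> exp (K * pi) * y t"
    using ex nonneg[OF z] nonneg[OF t] by (auto intro: mult_right_mono)
  ultimately show ?thesis by linarith
qed

text \<open>The Poincare constant of the lemma \<open>Poincare_hB\<close>.\<close>

abbreviation PC :: real where "PC \<equiv> 3 * pi\<^sup>2"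

section \<open>Elliptic estimates and the energy of a wave equation\<close>

lemma hN_Suc_shift: "hN (Suc k) f = hB 0 f f + (\<Sum>j\<le>k. hB (Suc j) f f)"
  unfolding hN_def by (rule sum.atMost_Suc_shift)

text \<open>From order two on, \<open>hB (Suc (Suc j)) f f\<close> equals
  \<open>hB j (lap f) (lap f)\<close>. Order one comes from pairing \<open>lap f\<close> with
  \<open>f\<close> and order zero from the Poincare inequality; they contribute \<open>PC\<close>
  and its square.\<close>

lemma elliptic_lap:
  fixes f :: "real^4 \<Rightarrow> real"
  assumes f: "smooth_S3 f" and mean: "(LINT x|S3_measure. f x) = 0"
  shows "hN (Suc k) f \<le> (1 + PC + PC\<^sup>2) * hN k (lap f)"
proof -
  define Q where "Q = hB 0 (lap f) (lap f)"
  have Q: "0 \<le> Q" "Q \<le> hN k (lap f)" unfolding Q_def using hB_le_hN[of 0 k] by (simp_all del: hB.simps)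
  have P: "hB 0 f f \<le> PC * hB 1 f f" by (rule Poincare_hB[OF f mean])
  have P0: "PC > 0" by simp
  have "2 * hB 1 f f \<le> 2 * \<bar>hB 0 (lap f) f\<bar>" using hB_Suc_lap[OF f f, of 0] by (simp del: hB.simps)
  \<comment> \<open>The weight is the Poincare constant, so that the last term is at most
    \<open>hB 1 f f\<close> and is absorbed by one of the two copies on the left.\<close>
  also have "\<dots> \<le> PC * Q + hB 0 f f / PC" unfolding Q_def by (rule hB_weighted) (use f in auto)
  also have "hB 0 f f / PC \<le> hB 1 f f" using P P0 by (subst pos_divide_le_eq) (auto simp: mult.commute simp del: hB.simps)
  finally have 1: "hB 1 f f \<le> PC * Q" by simp
  have "PC * hB 1 f f \<le> PC * (PC * Q)" using 1 P0 by (intro mult_left_mono) auto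
  moreover have "PC * (PC * Q) = PC\<^sup>2 * Q" by (simp only: power2_eq_square mult.assoc)
  ultimately have 0: "hB 0 f f \<le> PC\<^sup>2 * Q" using P by linarith
  have rest: "(\<Sum>j\<le>k. hB (Suc j) f f) \<le> PC * Q + hN k (lap f)"
  proof (cases k)
    case 0
    then show ?thesis using 1 hN_nonneg[of k "lap f"] by (simp del: hB.simps hN_nonneg)
  next
    case (Suc j)
    have "(\<Sum>i\<le>Suc j. hB (Suc i) f f) = hB 1 f f + (\<Sum>i\<le>j. hB (Suc (Suc i)) f f)"
      by (simp add: sum.atMost_Suc_shift del: hB.simps sum.atMost_Suc)
    also have "(\<Sum>i\<le>j. hB (Suc (Suc i)) f f) = hN j (lap f)"
      unfolding hN_def by (intro sum.cong refl hB_lap_lap f)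
    also have "\<dots> \<le> hN k (lap f)" unfolding Suc by (rule hN_mono) simp
    finally show ?thesis using 1 unfolding Suc by (simp del: hB.simps)
  qed
  have "PC\<^sup>2 * Q + PC * Q + hN k (lap f) \<le> PC\<^sup>2 * hN k (lap f) + PC * hN k (lap f) + hN k (lap f)"
    using Q by (intro add_mono mult_left_mono) auto
  then show ?thesis unfolding hN_Suc_shift using rest 0 by (simp add: algebra_simps del: hB.simps)
qed

text \<open>\<open>hN_div_form\<close> covers every positive order with constant 1, and the Poincare
  inequality covers order zero; hence the constant \<open>1 + PC\<close>.\<close>

lemma elliptic_div:
  fixes f :: "real^4 \<Rightarrow> real"
  assumes f: "smooth_S3 f" and mean: "(LINT x|S3_measure. f x) = 0" and G: "\<And>a. smooth_S3 (G a)"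
    and eq: "\<And>x. x \<in> S3 \<Longrightarrow> lap f x = (\<Sum>a\<in>UNIV. X a (G a) x)"
  shows "hN (Suc k) f \<le> (1 + PC) * (\<Sum>a\<in>UNIV. hN k (G a))"
proof -
  define Q where "Q = (\<Sum>a\<in>UNIV. hN k (G a))"
  have h: "hB (Suc j) f f \<le> (\<Sum>a\<in>UNIV. hB j (G a) (G a))" for j by (rule hN_div_form[OF f G eq])
  have "hB 0 f f \<le> PC * hB 1 f f" by (rule Poincare_hB[OF f mean])
  also have "hB 1 f f \<le> Q"
  proof -
    have "hB 1 f f \<le> (\<Sum>a\<in>UNIV. hB 0 (G a) (G a))" using h[of 0] by (simp only: One_nat_def)
    also have "\<dots> \<le> Q" unfolding Q_def by (intro sum_mono hB_le_hN le0)
    finally show ?thesis .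
  qed
  finally have 0: "hB 0 f f \<le> PC * Q" by (simp add: mult_left_mono del: hB.simps)
  have "(\<Sum>j\<le>k. hB (Suc j) f f) \<le> (\<Sum>j\<le>k. \<Sum>a\<in>UNIV. hB j (G a) (G a))" by (intro sum_mono h)
  also have "\<dots> = Q" unfolding Q_def hN_def by (rule sum.swap)
  finally show ?thesis unfolding hN_Suc_shift Q_def[symmetric] using 0 by (simp add: algebra_simps del: hB.simps)
qed

text \<open>At each order the terms without source cancel by \<open>hB_Suc_lap\<close>, as for the
  free wave equation. There remain the source paired with \<open>dt w\<close> and the zeroth-order
  part of the norm, which the cancellation does not reach.\<close>

lemma energy_derivative:
  fixes w :: "real \<Rightarrow> real^4 \<Rightarrow> real"
  assumes w: "smooth_slab w" and t: "\<tau> \<in> dS_times"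
  obtains D where "((\<lambda>\<tau>. hN k (dt w \<tau>) + hN (Suc k) (w \<tau>)) has_real_derivative D) (at \<tau> within dS_times)"
    "\<bar>D\<bar> \<le> 2 * (hN k (dt w \<tau>) + hN (Suc k) (w \<tau>)) + hN k (\<lambda>x. dt (dt w) \<tau> x - lap (w \<tau>) x)"
proof -
  define F where "F x = dt (dt w) \<tau> x - lap (w \<tau>) x" for x
  note s = smooth_slab_slice[OF w t] smooth_slab_slice[OF smooth_slab_dt[OF w] t]
    smooth_slab_slice[OF smooth_slab_dt[OF smooth_slab_dt[OF w]] t]
  have sF: "smooth_S3 F" unfolding F_def[abs_def] using s by simp
  define D where "D = (\<Sum>j\<le>k. 2 * hB j (dt w \<tau>) F) + 2 * hB 0 (w \<tau>) (dt w \<tau>)"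
  have "((\<lambda>\<tau>. (\<Sum>j\<le>k. hB j (dt w \<tau>) (dt w \<tau>) + hB (Suc j) (w \<tau>) (w \<tau>)) + hB 0 (w \<tau>) (w \<tau>)) has_real_derivative
      (\<Sum>j\<le>k. 2 * hB j (dt w \<tau>) (dt (dt w) \<tau>) + 2 * hB (Suc j) (w \<tau>) (dt w \<tau>)) + 2 * hB 0 (w \<tau>) (dt w \<tau>)) (at \<tau> within dS_times)"
    using w by (intro DERIV_add DERIV_sum has_derivative_hB_self[OF t]) auto
  moreover have "(\<lambda>\<tau>. (\<Sum>j\<le>k. hB j (dt w \<tau>) (dt w \<tau>) + hB (Suc j) (w \<tau>) (w \<tau>)) + hB 0 (w \<tau>) (w \<tau>))
     = (\<lambda>\<tau>. hN k (dt w \<tau>) + hN (Suc k) (w \<tau>))"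
    unfolding hN_Suc_shift by (auto simp: hN_def sum.distrib simp del: hB.simps)
  moreover have "(\<Sum>j\<le>k. 2 * hB j (dt w \<tau>) (dt (dt w) \<tau>) + 2 * hB (Suc j) (w \<tau>) (dt w \<tau>)) + 2 * hB 0 (w \<tau>) (dt w \<tau>) = D"
  proof -
    have "2 * hB j (dt w \<tau>) (dt (dt w) \<tau>) + 2 * hB (Suc j) (w \<tau>) (dt w \<tau>) = 2 * hB j (dt w \<tau>) F" for j
    proof -
      have "hB (Suc j) (w \<tau>) (dt w \<tau>) = - hB j (lap (w \<tau>)) (dt w \<tau>)" by (rule hB_Suc_lap[OF s(1,2)])
      moreover have "hB j (dt w \<tau>) F = hB j (dt (dt w) \<tau>) (dt w \<tau>) - hB j (lap (w \<tau>)) (dt w \<tau>)"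
        unfolding hB_sym[of j "dt w \<tau>" F] F_def using s by (intro hB_diff_left) auto
      ultimately show ?thesis by (simp add: hB_sym[of j "dt w \<tau>" "dt (dt w) \<tau>"] del: hB.simps)
    qed
    then show ?thesis unfolding D_def by simp
  qed
  ultimately have 1: "((\<lambda>\<tau>. hN k (dt w \<tau>) + hN (Suc k) (w \<tau>)) has_real_derivative D) (at \<tau> within dS_times)" by simp
  have "\<bar>D\<bar> \<le> \<bar>\<Sum>j\<le>k. 2 * hB j (dt w \<tau>) F\<bar> + \<bar>2 * hB 0 (w \<tau>) (dt w \<tau>)\<bar>"
    unfolding D_def by (rule abs_triangle_ineq)
  also have "\<dots> \<le> (\<Sum>j\<le>k. hB j (dt w \<tau>) (dt w \<tau>) + hB j F F) + (hB 0 (w \<tau>) (w \<tau>) + hB 0 (dt w \<tau>) (dt w \<tau>))"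
  proof (intro add_mono order_trans[OF sum_abs] sum_mono)
    fix j show "\<bar>2 * hB j (dt w \<tau>) F\<bar> \<le> hB j (dt w \<tau>) (dt w \<tau>) + hB j F F"
      using hB_le[OF s(2) sF, of j] by (simp add: abs_mult)
    show "\<bar>2 * hB 0 (w \<tau>) (dt w \<tau>)\<bar> \<le> hB 0 (w \<tau>) (w \<tau>) + hB 0 (dt w \<tau>) (dt w \<tau>)"
      using hB_le[OF s(1,2), of 0] by (simp add: abs_mult del: hB.simps)
  qed
  also have "\<dots> = hN k (dt w \<tau>) + hN k F + hB 0 (w \<tau>) (w \<tau>) + hB 0 (dt w \<tau>) (dt w \<tau>)"
    by (simp add: hN_def sum.distrib del: hB.simps)
  also have "\<dots> \<le> hN k (dt w \<tau>) + hN k F + hN (Suc k) (w \<tau>) + hN k (dt w \<tau>)"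
    by (intro add_mono hB_le_hN le0 order_refl)
  also have "\<dots> \<le> 2 * (hN k (dt w \<tau>) + hN (Suc k) (w \<tau>)) + hN k F" by simp
  finally show thesis using that[OF 1] unfolding F_def by blast
qed

text \<open>The frame counterpart of \<open>energy_dyn (Suc k)\<close>. The time component is left
  out, since the elliptic equation determines it from the rest.\<close>

definition dyn_norm :: "(real \<Rightarrow> real^4 \<Rightarrow> real) \<Rightarrow> (real \<Rightarrow> real^4 \<Rightarrow> real) \<Rightarrow> (3 \<Rightarrow> real \<Rightarrow> real^4 \<Rightarrow> real) \<Rightarrow> nat \<Rightarrow> real \<Rightarrow> real" where
  "dyn_norm u v a k \<tau> = (hN k (dt u \<tau>) + hN (Suc k) (u \<tau>)) + (hN k (dt v \<tau>) + hN (Suc k) (v \<tau>))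
     + (\<Sum>c\<in>UNIV. hN k (dt (a c) \<tau>) + hN (Suc k) (a c \<tau>))"

lemma dyn_norm_nonneg [simp]: "dyn_norm u v a k \<tau> \<ge> 0"
  unfolding dyn_norm_def by (intro add_nonneg_nonneg sum_nonneg) auto

lemma dyn_norm_ge:
  "hN k (dt u \<tau>) \<le> dyn_norm u v a k \<tau>" "hN (Suc k) (u \<tau>) \<le> dyn_norm u v a k \<tau>"
  "hN k (dt v \<tau>) \<le> dyn_norm u v a k \<tau>" "hN (Suc k) (v \<tau>) \<le> dyn_norm u v a k \<tau>"
  "hN k (dt (a c) \<tau>) \<le> dyn_norm u v a k \<tau>" "hN (Suc k) (a c \<tau>) \<le> dyn_norm u v a k \<tau>"
proof -
  define A where "A = (\<Sum>c\<in>UNIV. hN k (dt (a c) \<tau>) + hN (Suc k) (a c \<tau>))"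
  have "hN k (dt (a c) \<tau>) + hN (Suc k) (a c \<tau>) \<le> A" "0 \<le> A"
    unfolding A_def using member_le_sum[of c UNIV "\<lambda>c. hN k (dt (a c) \<tau>) + hN (Suc k) (a c \<tau>)"]
    by (auto intro: sum_nonneg)
  then show "hN k (dt u \<tau>) \<le> dyn_norm u v a k \<tau>" "hN (Suc k) (u \<tau>) \<le> dyn_norm u v a k \<tau>"
    "hN k (dt v \<tau>) \<le> dyn_norm u v a k \<tau>" "hN (Suc k) (v \<tau>) \<le> dyn_norm u v a k \<tau>"
    "hN k (dt (a c) \<tau>) \<le> dyn_norm u v a k \<tau>" "hN (Suc k) (a c \<tau>) \<le> dyn_norm u v a k \<tau>"
    unfolding dyn_norm_def A_def[symmetric]
    using hN_nonneg[of k "dt u \<tau>"] hN_nonneg[of "Suc k" "u \<tau>"] hN_nonneg[of k "dt v \<tau>"] hN_nonneg[of "Suc k" "v \<tau>"]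
      hN_nonneg[of k "dt (a c) \<tau>"] hN_nonneg[of "Suc k" "a c \<tau>"]
    by linarith+
qed

text \<open>144 = 12 * 12: each of the two nested sums over three indices costs 4 per term.\<close>

lemma hN_curl_le:
  assumes "\<And>d. smooth_S3 (f d)" "\<And>d. hN (Suc k) (f d) \<le> M"
  shows "hN k (curl f c) \<le> 144 * M"
proof -
  have t: "hN k (\<lambda>x. eps d b c * X b (f d) x) \<le> M" for b d
  proof -
    have "hN k (\<lambda>x. eps d b c * X b (f d) x) = (eps d b c)\<^sup>2 * hN k (X b (f d))" using assms(1) by (intro hN_cmult) simp
    also have "\<dots> \<le> 1 * hN k (X b (f d))" by (intro mult_right_mono abs_eps_le hN_nonneg)
    also have "\<dots> \<le> M" using hN_X_le[of k b "f d"] assms(2)[of d] by linarith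
    finally show ?thesis .
  qed
  have "hN k (curl f c) \<le> 4 * (\<Sum>b\<in>UNIV. hN k (\<lambda>x. \<Sum>d\<in>UNIV. eps d b c * X b (f d) x))"
    unfolding curl_def[abs_def] using assms(1) by (intro hN_sum3) simp
  also have "\<dots> \<le> 4 * (\<Sum>b\<in>(UNIV::3 set). 4 * (\<Sum>d\<in>(UNIV::3 set). M))"
    using assms(1) t by (intro mult_left_mono sum_mono order_trans[OF hN_sum3] mult_left_mono) auto
  finally show ?thesis by simp
qed

section \<open>Bounds of the nonlinear terms under a product estimate\<close>

context frame_solution
begin

context
  fixes k :: nat and C :: real and \<tau> :: real
  assumes C: "C > 0" "\<forall>f g :: real^4 \<Rightarrow> real. smooth_S3 f \<longrightarrow> smooth_S3 g \<longrightarrow> hN k (\<lambda>x. f x * g x) \<le> C * hN (Suc k) f * hN k g"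
    and t: "\<tau> \<in> dS_times" and S1: "dyn_norm u v a k \<tau> \<le> 1"
begin

abbreviation (input) "S \<equiv> dyn_norm u v a k \<tau>"

text \<open>In the applications the factor that carries a derivative is put second and measured with
  \<open>k\<close> derivatives; the first factor is measured with \<open>k + 1\<close>.\<close>

lemma prod_le:
  fixes f g :: "real^4 \<Rightarrow> real"
  assumes "smooth_S3 f" "smooth_S3 g" "hN (Suc k) f \<le> M" "hN k g \<le> N"
  shows "hN k (\<lambda>x. f x * g x) \<le> C * M * N"
proof -
  have "C * hN (Suc k) f * hN k g \<le> C * M * N"
    using assms(3,4) C(1) order_trans[OF hN_nonneg assms(3)] by (intro mult_mono) auto
  then show ?thesis using C(2)[rule_format, OF assms(1,2)] by linarith
qed

lemma S_powers: "S * S \<le> S" "S * (S * S) \<le> S * S" "0 \<le> S * S"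
proof -
  show 1: "S * S \<le> S" using mult_left_mono[OF S1 dyn_norm_nonneg] by simp
  show "S * (S * S) \<le> S * S" using mult_left_mono[OF 1 dyn_norm_nonneg] .
  show "0 \<le> S * S" by simp
qed

lemma S_ge:
  "hN k (dt u \<tau>) \<le> S" "hN (Suc k) (u \<tau>) \<le> S" "hN k (dt v \<tau>) \<le> S" "hN (Suc k) (v \<tau>) \<le> S"
  "hN k (dt (a c) \<tau>) \<le> S" "hN (Suc k) (a c \<tau>) \<le> S"
  "hN k (u \<tau>) \<le> S" "hN k (v \<tau>) \<le> S" "hN k (a c \<tau>) \<le> S"
  "hN k (X c (u \<tau>)) \<le> S" "hN k (X c (v \<tau>)) \<le> S" "hN k (X d (a c \<tau>)) \<le> S"
  using dyn_norm_ge[where a=a and u=u and v=v and k=k and \<tau>=\<tau>]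
    hN_mono[of k "Suc k" "u \<tau>"] hN_mono[of k "Suc k" "v \<tau>"] hN_mono[of k "Suc k" "a c \<tau>"]
    hN_X_le[of k c "u \<tau>"] hN_X_le[of k c "v \<tau>"] hN_X_le[of k d "a c \<tau>"]
  by (auto intro: order_trans)

lemma triple_le:
  fixes f g h :: "real^4 \<Rightarrow> real"
  assumes "smooth_S3 f" "smooth_S3 g" "smooth_S3 h" "hN (Suc k) f \<le> M" "hN (Suc k) g \<le> N" "hN k h \<le> L"
  shows "hN k (\<lambda>x. f x * (g x * h x)) \<le> C\<^sup>2 * (M * N * L)"
proof -
  have "hN k (\<lambda>x. f x * (g x * h x)) \<le> C * M * (C * N * L)"
    using assms by (intro prod_le) auto
  then show ?thesis by (simp add: power2_eq_square mult_ac)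
qed

lemma phi_sq_le:
  fixes h :: "real^4 \<Rightarrow> real"
  assumes h: "smooth_S3 h" "hN k h \<le> L"
  shows "hN k (\<lambda>x. ((u \<tau> x)\<^sup>2 + (v \<tau> x)\<^sup>2) * h x) \<le> 4 * C\<^sup>2 * (S * S * L)"
proof -
  have "hN k (\<lambda>x. ((u \<tau> x)\<^sup>2 + (v \<tau> x)\<^sup>2) * h x) = hN k (\<lambda>x. u \<tau> x * (u \<tau> x * h x) + v \<tau> x * (v \<tau> x * h x))"
    by (intro hN_cong) (simp add: power2_eq_square algebra_simps)
  also have "\<dots> \<le> 2 * hN k (\<lambda>x. u \<tau> x * (u \<tau> x * h x)) + 2 * hN k (\<lambda>x. v \<tau> x * (v \<tau> x * h x))"
    using t h by (intro hN_add) auto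
  also have "\<dots> \<le> 2 * (C\<^sup>2 * (S * S * L)) + 2 * (C\<^sup>2 * (S * S * L))"
    using t h S_ge by (intro add_mono mult_left_mono triple_le) auto
  finally show ?thesis by (simp add: mult_ac)
qed

text \<open>Quadratic up to a cubic term, which \<open>S \<le> 1\<close> turns into a quadratic
  one.\<close>

lemma cur_le: "hN k (cur c \<tau>) \<le> (8 * C + 8 * C\<^sup>2) * (S * S)"
proof -
  have "hN k (cur c \<tau>) \<le> 2 * hN k (\<lambda>x. u \<tau> x * X c (v \<tau>) x - v \<tau> x * X c (u \<tau>) x)
      + 2 * hN k (\<lambda>x. ((u \<tau> x)\<^sup>2 + (v \<tau> x)\<^sup>2) * a c \<tau> x)"
    unfolding cur_def[abs_def] using t by (intro hN_add) auto
  also have "\<dots> \<le> 2 * (2 * hN k (\<lambda>x. u \<tau> x * X c (v \<tau>) x) + 2 * hN k (\<lambda>x. v \<tau> x * X c (u \<tau>) x))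
      + 2 * (4 * C\<^sup>2 * (S * S * S))"
    using t S_ge by (intro add_mono mult_left_mono hN_diff phi_sq_le) auto
  also have "\<dots> \<le> 2 * (2 * (C * S * S) + 2 * (C * S * S)) + 2 * (4 * C\<^sup>2 * (S * S))"
    using t S_ge S_powers C(1) by (intro add_mono mult_left_mono prod_le) (auto simp: mult.assoc)
  also have "\<dots> = (8 * C + 8 * C\<^sup>2) * (S * S)" by (simp add: algebra_simps)
  finally show ?thesis .
qed

text \<open>\<open>b\<close> also stands on the right of its elliptic equation, multiplied by the
  square of the scalar field; smallness lets half of its norm be absorbed. The rest is the charge
  density, which is quadratic.\<close>

lemma b_le:
  assumes small: "(1 + PC + PC\<^sup>2) * (8 * C\<^sup>2) * S \<le> 1 / 2"
  shows "hN (Suc k) (b \<tau>) \<le> (1 + PC + PC\<^sup>2) * (16 * C) * (2 * (S * S))"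
proof -
  define E where "E = 1 + PC + PC\<^sup>2"
  have E: "E \<ge> 0" unfolding E_def by simp
  define B where "B = hN (Suc k) (b \<tau>)"
  have "hN k (lap (b \<tau>)) = hN k (\<lambda>x. ((u \<tau> x)\<^sup>2 + (v \<tau> x)\<^sup>2) * b \<tau> x + (u \<tau> x * dt v \<tau> x - v \<tau> x * dt u \<tau> x))"
    by (rule hN_cong[OF eq_b[OF t]])
  also have "\<dots> \<le> 2 * hN k (\<lambda>x. ((u \<tau> x)\<^sup>2 + (v \<tau> x)\<^sup>2) * b \<tau> x) + 2 * hN k (\<lambda>x. u \<tau> x * dt v \<tau> x - v \<tau> x * dt u \<tau> x)"
    using t by (intro hN_add) auto
  also have "\<dots> \<le> 2 * (4 * C\<^sup>2 * (S * S * B)) + 2 * (2 * hN k (\<lambda>x. u \<tau> x * dt v \<tau> x) + 2 * hN k (\<lambda>x. v \<tau> x * dt u \<tau> x))"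
    using t hN_mono[of k "Suc k" "b \<tau>"] unfolding B_def by (intro add_mono mult_left_mono hN_diff phi_sq_le) auto
  also have "\<dots> \<le> 2 * (4 * C\<^sup>2 * (S * B)) + 2 * (2 * (C * S * S) + 2 * (C * S * S))"
    using t S_ge S_powers mult_right_mono[OF S_powers(1), of B]
    by (intro add_mono mult_left_mono prod_le) (auto simp: B_def)
  finally have L: "hN k (lap (b \<tau>)) \<le> 8 * C\<^sup>2 * S * B + 8 * C * (S * S)" by (simp add: mult.assoc)
  have "B \<le> E * hN k (lap (b \<tau>))" unfolding B_def E_def using t by (intro elliptic_lap mean_b) auto
  also have "\<dots> \<le> E * (8 * C\<^sup>2 * S * B + 8 * C * (S * S))" using L E by (intro mult_left_mono)
  also have "\<dots> = (E * (8 * C\<^sup>2) * S) * B + E * (8 * C) * (S * S)" by (simp add: algebra_simps)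
  also have "\<dots> \<le> 1 / 2 * B + E * (8 * C) * (S * S)"
    using small unfolding E_def[symmetric] by (intro add_right_mono mult_right_mono) (auto simp: B_def)
  finally have "B \<le> 2 * (E * (8 * C) * (S * S))" by linarith
  also have "\<dots> = E * (16 * C) * (S * S)" by simp
  also have "\<dots> \<le> E * (16 * C) * (2 * (S * S))" using E C(1) by (intro mult_left_mono) auto
  finally show ?thesis unfolding E_def B_def .
qed

text \<open>The right-hand side of \<open>lap_dt_b\<close> is in divergence form, so
  \<open>elliptic_div\<close> makes up for the derivative that the current contains.\<close>

lemma dt_b_le: "hN (Suc k) (dt b \<tau>) \<le> (1 + PC) * (3 * ((8 * C + 8 * C\<^sup>2) * (S * S)))"
proof -
  have "hN (Suc k) (dt b \<tau>) \<le> (1 + PC) * (\<Sum>c\<in>UNIV. hN k (cur c \<tau>))"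
    by (rule elliptic_div) (use t lap_dt_b mean_dt_b in auto)
  also have "\<dots> \<le> (1 + PC) * (\<Sum>c\<in>(UNIV::3 set). (8 * C + 8 * C\<^sup>2) * (S * S))"
    by (intro mult_left_mono sum_mono cur_le) auto
  finally show ?thesis by simp
qed

text \<open>Covers the equations of \<open>u\<close> and \<open>v\<close> together: \<open>f\<close>
  is the unknown, \<open>g\<close> the other component of the scalar field, \<open>h\<close> the
  time derivative of \<open>g\<close> in the applications, and \<sigma> the sign of the
  coupling.\<close>

lemma wave_le:
  assumes f: "smooth_S3 f" "smooth_S3 h" "smooth_S3 g" and B: "hN (Suc k) (b \<tau>) \<le> M" "hN (Suc k) (dt b \<tau>) \<le> M"
    and M: "M \<le> K * S" "K \<ge> 0"
    and le: "hN (Suc k) f \<le> S" "hN (Suc k) g \<le> S" "hN k h \<le> S" and \<sigma>: "\<sigma> = 1 \<or> \<sigma> = - 1"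
  shows "hN k (\<lambda>x. \<sigma> * (2 * b \<tau> x * h x - 2 * (\<Sum>c\<in>UNIV. a c \<tau> x * X c g x) + dt b \<tau> x * g x)
      - (1 - (b \<tau> x)\<^sup>2 + (\<Sum>c\<in>UNIV. (a c \<tau> x)\<^sup>2)) * f x)
    \<le> (72 * C * K + 768 * C + 4 + 4 * C\<^sup>2 * K\<^sup>2 + 48 * C\<^sup>2) * S"
proof -
  have lek: "hN k f \<le> S" "hN k g \<le> S" "hN k (X c g) \<le> S" for c
    using hN_mono[of k "Suc k" f] hN_mono[of k "Suc k" g] hN_X_le[of k c g] le by auto
  have M0: "0 \<le> M" using B(1) hN_nonneg[of "Suc k" "b \<tau>"] by linarith
  have MS: "M * S \<le> K * S"
  proof -
    have "M * S \<le> M * 1" using S1 M0 by (intro mult_left_mono)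
    then show ?thesis using M by simp
  qed
  have MMS: "M * M * S \<le> K\<^sup>2 * S"
  proof -
    have "M * M * S \<le> (K * S) * (K * S) * 1" using M M0 S1 by (intro mult_mono) auto
    also have "\<dots> = K\<^sup>2 * (S * S)" by (simp add: power2_eq_square)
    also have "\<dots> \<le> K\<^sup>2 * S" using S_powers by (intro mult_left_mono) auto
    finally show ?thesis .
  qed
  define T1 where "T1 x = b \<tau> x * h x" for x
  define T2 where "T2 x = (\<Sum>c\<in>UNIV. a c \<tau> x * X c g x)" for x
  define T3 where "T3 x = dt b \<tau> x * g x" for x
  define T4 where "T4 x = b \<tau> x * (b \<tau> x * f x)" for x
  define T5 where "T5 x = (\<Sum>c\<in>UNIV. a c \<tau> x * (a c \<tau> x * f x))" for x
  have s: "smooth_S3 T1" "smooth_S3 T2" "smooth_S3 T3" "smooth_S3 T4" "smooth_S3 T5"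
    unfolding T1_def[abs_def] T2_def[abs_def] T3_def[abs_def] T4_def[abs_def] T5_def[abs_def] using f t by auto
  have n1: "hN k T1 \<le> C * K * S"
  proof -
    have "hN k T1 \<le> C * M * S" unfolding T1_def[abs_def] using t f B le by (intro prod_le) auto
    also have "\<dots> \<le> C * (K * S)" using MS C(1) by (simp add: mult.assoc)
    finally show ?thesis by (simp add: mult.assoc)
  qed
  have n3: "hN k T3 \<le> C * K * S"
  proof -
    have "hN k T3 \<le> C * M * S" unfolding T3_def[abs_def] using t f B lek by (intro prod_le) auto
    also have "\<dots> \<le> C * (K * S)" using MS C(1) by (simp add: mult.assoc)
    finally show ?thesis by (simp add: mult.assoc)
  qed
  have n2: "hN k T2 \<le> 12 * C * S"
  proof -
    have "hN k T2 \<le> 4 * (\<Sum>c\<in>UNIV. hN k (\<lambda>x. a c \<tau> x * X c g x))"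
      unfolding T2_def[abs_def] using t f by (intro hN_sum3) auto
    also have "\<dots> \<le> 4 * (\<Sum>c\<in>(UNIV::3 set). C * S * S)"
      using t f lek S_ge by (intro mult_left_mono sum_mono prod_le) auto
    also have "\<dots> = 12 * C * (S * S)" by simp
    also have "\<dots> \<le> 12 * C * S" using S_powers C(1) by (intro mult_left_mono) auto
    finally show ?thesis .
  qed
  have n4: "hN k T4 \<le> C\<^sup>2 * K\<^sup>2 * S"
  proof -
    have "hN k T4 \<le> C\<^sup>2 * (M * M * S)" unfolding T4_def[abs_def] using t f B lek by (intro triple_le) auto
    also have "\<dots> \<le> C\<^sup>2 * (K\<^sup>2 * S)" using MMS by (intro mult_left_mono) auto
    finally show ?thesis by (simp add: mult.assoc)
  qed
  have n5: "hN k T5 \<le> 12 * C\<^sup>2 * S"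
  proof -
    have "hN k T5 \<le> 4 * (\<Sum>c\<in>UNIV. hN k (\<lambda>x. a c \<tau> x * (a c \<tau> x * f x)))"
      unfolding T5_def[abs_def] using t f by (intro hN_sum3) auto
    also have "\<dots> \<le> 4 * (\<Sum>c\<in>(UNIV::3 set). C\<^sup>2 * (S * S * S))"
      using t f lek S_ge by (intro mult_left_mono sum_mono triple_le) auto
    also have "\<dots> = 12 * C\<^sup>2 * (S * (S * S))" by simp
    also have "\<dots> \<le> 12 * C\<^sup>2 * S" using S_powers by (intro mult_left_mono) auto
    finally show ?thesis .
  qed
  define Z where "Z x = ((2 * T1 x - 2 * T2 x) + T3 x)" for x
  have sZ: "smooth_S3 Z" unfolding Z_def[abs_def] using s by simp
  have nZ: "hN k Z \<le> 16 * hN k T1 + 16 * hN k T2 + 2 * hN k T3"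
  proof -
    have "hN k Z \<le> 2 * hN k (\<lambda>x. 2 * T1 x - 2 * T2 x) + 2 * hN k T3"
      unfolding Z_def[abs_def] using s by (intro hN_add) auto
    also have "hN k (\<lambda>x. 2 * T1 x - 2 * T2 x) \<le> 2 * hN k (\<lambda>x. 2 * T1 x) + 2 * hN k (\<lambda>x. 2 * T2 x)"
      using s by (intro hN_diff) auto
    finally show ?thesis using s by (simp add: hN_cmult)
  qed
  have s\<sigma>: "hN k (\<lambda>x. \<sigma> * Z x) = hN k Z" using \<sigma> sZ by (auto simp: hN_cmult hN_minus)
  have "hN k (\<lambda>x. \<sigma> * (2 * b \<tau> x * h x - 2 * (\<Sum>c\<in>UNIV. a c \<tau> x * X c g x) + dt b \<tau> x * g x)
      - (1 - (b \<tau> x)\<^sup>2 + (\<Sum>c\<in>UNIV. (a c \<tau> x)\<^sup>2)) * f x)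
      = hN k (\<lambda>x. (\<sigma> * Z x - f x) + (T4 x - T5 x))"
    by (intro hN_cong) (simp add: Z_def T1_def T2_def T3_def T4_def T5_def sum_3 power2_eq_square algebra_simps)
  also have "\<dots> \<le> 2 * hN k (\<lambda>x. \<sigma> * Z x - f x) + 2 * hN k (\<lambda>x. T4 x - T5 x)"
    using s sZ f by (intro hN_add) auto
  also have "\<dots> \<le> 2 * (2 * hN k (\<lambda>x. \<sigma> * Z x) + 2 * hN k f) + 2 * (2 * hN k T4 + 2 * hN k T5)"
    using s sZ f by (intro add_mono mult_left_mono hN_diff) auto
  also have "\<dots> \<le> (72 * C * K + 768 * C + 4 + 4 * C\<^sup>2 * K\<^sup>2 + 48 * C\<^sup>2) * S"
  proof -
    define x1 x2 x4 x5 where "x1 = C * K * S" and "x2 = C * S" and "x4 = C\<^sup>2 * K\<^sup>2 * S" and "x5 = C\<^sup>2 * S"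
    have n: "hN k T1 \<le> x1" "hN k T2 \<le> 12 * x2" "hN k T3 \<le> x1" "hN k T4 \<le> x4" "hN k T5 \<le> 12 * x5"
      using n1 n2 n3 n4 n5 unfolding x1_def x2_def x4_def x5_def by (simp_all add: mult.assoc)
    have "2 * (2 * hN k Z + 2 * hN k f) + 2 * (2 * hN k T4 + 2 * hN k T5)
        \<le> 2 * (2 * (16 * x1 + 16 * (12 * x2) + 2 * x1) + 2 * S) + 2 * (2 * x4 + 2 * (12 * x5))"
      by (intro add_mono mult_left_mono order_trans[OF nZ] n lek) auto
    then show ?thesis unfolding s\<sigma> x1_def x2_def x4_def x5_def by (simp add: algebra_simps)
  qed
  finally show ?thesis .
qed

end

end

section \<open>The differential inequality for the dynamical norm\<close>

context frame_solution
begin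

context
  fixes k :: nat and C K \<tau> :: real
  assumes C: "C > 0" "\<forall>f g :: real^4 \<Rightarrow> real. smooth_S3 f \<longrightarrow> smooth_S3 g \<longrightarrow> hN k (\<lambda>x. f x * g x) \<le> C * hN (Suc k) f * hN k g"
    and t: "\<tau> \<in> dS_times" and S1: "dyn_norm u v a k \<tau> \<le> 1"
    and small: "(1 + PC + PC\<^sup>2) * (8 * C\<^sup>2) * dyn_norm u v a k \<tau> \<le> 1 / 2"
    and K: "K = (1 + PC + PC\<^sup>2) * (16 * C) * 2 + (1 + PC) * (3 * (8 * C + 8 * C\<^sup>2))"
begin

abbreviation (input) "N \<equiv> dyn_norm u v a k \<tau>"

text \<open>The bounds of \<open>b_le\<close> and \<open>dt_b_le\<close> are quadratic;
  \<open>N \<le> 1\<close> weakens them to linear ones with a common constant, the form in which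
  Gronwall's lemma uses them.\<close>

lemma b_le_linear: "hN (Suc k) (b \<tau>) \<le> K * N" "hN (Suc k) (dt b \<tau>) \<le> K * N"
proof -
  define P Q where "P = (1 + PC + PC\<^sup>2) * (16 * C) * 2" and "Q = (1 + PC) * (3 * (8 * C + 8 * C\<^sup>2))"
  have PQ: "0 \<le> P" "0 \<le> Q" unfolding P_def Q_def using C(1) by simp_all
  have KPQ: "K = P + Q" unfolding K P_def Q_def by simp
  have SS: "N * N \<le> N" "0 \<le> N" by (rule S_powers(1)[OF C t S1]) (rule dyn_norm_nonneg)
  have "hN (Suc k) (b \<tau>) \<le> P * (N * N)" using b_le[OF C t S1 small] unfolding P_def by (simp only: mult.assoc)
  also have "\<dots> \<le> K * N" using PQ SS unfolding KPQ by (intro mult_mono) auto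
  finally show "hN (Suc k) (b \<tau>) \<le> K * N" .
  have "hN (Suc k) (dt b \<tau>) \<le> Q * (N * N)" using dt_b_le[OF C t S1] unfolding Q_def by (simp only: mult.assoc)
  also have "\<dots> \<le> K * N" using PQ SS unfolding KPQ by (intro mult_mono) auto
  finally show "hN (Suc k) (dt b \<tau>) \<le> K * N" .
qed

lemma K_nonneg: "K \<ge> 0"
  unfolding K using C(1) by simp

text \<open>The equations of \<open>u\<close> and \<open>v\<close> are instances of
  \<open>wave_le\<close> with opposite signs and exchanged roles. For the potential, 2368 = 4 * (4 *
  144 + 16) collects the curl and the mass term.\<close>

lemma rhs_le:
  defines "W \<equiv> 72 * C * K + 768 * C + 4 + 4 * C\<^sup>2 * K\<^sup>2 + 48 * C\<^sup>2"
  shows "hN k (\<lambda>x. dt (dt u) \<tau> x - lap (u \<tau>) x) \<le> W * N"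
    "hN k (\<lambda>x. dt (dt v) \<tau> x - lap (v \<tau>) x) \<le> W * N"
    "hN k (\<lambda>x. dt (dt (a c)) \<tau> x - lap (a c \<tau>) x) \<le> (2368 + 4 * K + 32 * C + 32 * C\<^sup>2) * N"
proof -
  note ge = S_ge[OF C t S1]
  have "hN k (\<lambda>x. dt (dt u) \<tau> x - lap (u \<tau>) x)
      = hN k (\<lambda>x. 1 * (2 * b \<tau> x * dt v \<tau> x - 2 * (\<Sum>c\<in>UNIV. a c \<tau> x * X c (v \<tau>) x) + dt b \<tau> x * v \<tau> x)
      - (1 - (b \<tau> x)\<^sup>2 + (\<Sum>c\<in>UNIV. (a c \<tau> x)\<^sup>2)) * u \<tau> x)"
    by (rule hN_cong) (simp add: eq_u[OF t])
  also have "\<dots> \<le> W * N"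
    unfolding W_def
    by (rule wave_le[OF C t S1 slices(1,6,2)[OF t] b_le_linear order_refl K_nonneg ge(2,4,3)]) simp
  finally show "hN k (\<lambda>x. dt (dt u) \<tau> x - lap (u \<tau>) x) \<le> W * N" .
  have "hN k (\<lambda>x. dt (dt v) \<tau> x - lap (v \<tau>) x)
      = hN k (\<lambda>x. (- 1) * (2 * b \<tau> x * dt u \<tau> x - 2 * (\<Sum>c\<in>UNIV. a c \<tau> x * X c (u \<tau>) x) + dt b \<tau> x * u \<tau> x)
      - (1 - (b \<tau> x)\<^sup>2 + (\<Sum>c\<in>UNIV. (a c \<tau> x)\<^sup>2)) * v \<tau> x)"
    by (rule hN_cong) (simp add: eq_v[OF t])
  also have "\<dots> \<le> W * N"
    unfolding W_def
    by (rule wave_le[OF C t S1 slices(2,5,1)[OF t] b_le_linear order_refl K_nonneg ge(4,2,1)]) simp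
  finally show "hN k (\<lambda>x. dt (dt v) \<tau> x - lap (v \<tau>) x) \<le> W * N" .
  have cu: "hN k (curl (\<lambda>d. a d \<tau>) c) \<le> 144 * N" by (rule hN_curl_le) (use t ge in auto)
  have cr: "hN k (cur c \<tau>) \<le> (8 * C + 8 * C\<^sup>2) * N"
    by (rule order_trans[OF cur_le[OF C t S1]]) (use C(1) S_powers(1)[OF C t S1] in \<open>intro mult_left_mono, auto\<close>)
  have bd: "hN k (X c (dt b \<tau>)) \<le> K * N" using hN_X_le[of k c "dt b \<tau>"] b_le_linear(2) by linarith
  have "hN k (\<lambda>x. dt (dt (a c)) \<tau> x - lap (a c \<tau>) x)
      = hN k (\<lambda>x. (2 * curl (\<lambda>d. a d \<tau>) c x - 4 * a c \<tau> x) + (X c (dt b \<tau>) x - cur c \<tau> x))"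
    by (rule hN_cong) (simp add: eq_a'[OF t])
  also have "\<dots> \<le> 2 * hN k (\<lambda>x. 2 * curl (\<lambda>d. a d \<tau>) c x - 4 * a c \<tau> x) + 2 * hN k (\<lambda>x. X c (dt b \<tau>) x - cur c \<tau> x)"
    using t by (intro hN_add) auto
  also have "\<dots> \<le> 2 * (2 * hN k (\<lambda>x. 2 * curl (\<lambda>d. a d \<tau>) c x) + 2 * hN k (\<lambda>x. 4 * a c \<tau> x))
      + 2 * (2 * hN k (X c (dt b \<tau>)) + 2 * hN k (cur c \<tau>))"
    using t by (intro add_mono mult_left_mono hN_diff) auto
  also have "\<dots> = 2 * (2 * (2\<^sup>2 * hN k (curl (\<lambda>d. a d \<tau>) c)) + 2 * (4\<^sup>2 * hN k (a c \<tau>)))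
      + 2 * (2 * hN k (X c (dt b \<tau>)) + 2 * hN k (cur c \<tau>))"
    using t by (simp only: hN_cmult[OF smooth_S3_curl] hN_cmult[OF slices(4)])
  also have "\<dots> \<le> 2 * (2 * (2\<^sup>2 * (144 * N)) + 2 * (4\<^sup>2 * N)) + 2 * (2 * (K * N) + 2 * ((8 * C + 8 * C\<^sup>2) * N))"
    by (intro add_mono mult_left_mono cu cr bd ge) auto
  also have "\<dots> = (2368 + 4 * K + 32 * C + 32 * C\<^sup>2) * N" by (simp add: algebra_simps)
  finally show "hN k (\<lambda>x. dt (dt (a c)) \<tau> x - lap (a c \<tau>) x) \<le> (2368 + 4 * K + 32 * C + 32 * C\<^sup>2) * N" .
qed

lemma dyn_norm_derivative:
  defines "W \<equiv> 72 * C * K + 768 * C + 4 + 4 * C\<^sup>2 * K\<^sup>2 + 48 * C\<^sup>2"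
  obtains D where "(dyn_norm u v a k has_real_derivative D) (at \<tau> within dS_times)"
    "\<bar>D\<bar> \<le> (2 + 2 * W + 3 * (2368 + 4 * K + 32 * C + 32 * C\<^sup>2)) * N"
proof -
  define V where "V = 2368 + 4 * K + 32 * C + 32 * C\<^sup>2"
  obtain Du where Du: "((\<lambda>\<tau>. hN k (dt u \<tau>) + hN (Suc k) (u \<tau>)) has_real_derivative Du) (at \<tau> within dS_times)"
    "\<bar>Du\<bar> \<le> 2 * (hN k (dt u \<tau>) + hN (Suc k) (u \<tau>)) + hN k (\<lambda>x. dt (dt u) \<tau> x - lap (u \<tau>) x)"
    by (rule energy_derivative[OF slab_u t])
  obtain Dv where Dv: "((\<lambda>\<tau>. hN k (dt v \<tau>) + hN (Suc k) (v \<tau>)) has_real_derivative Dv) (at \<tau> within dS_times)"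
    "\<bar>Dv\<bar> \<le> 2 * (hN k (dt v \<tau>) + hN (Suc k) (v \<tau>)) + hN k (\<lambda>x. dt (dt v) \<tau> x - lap (v \<tau>) x)"
    by (rule energy_derivative[OF slab_v t])
  have "\<forall>c. \<exists>D. ((\<lambda>\<tau>. hN k (dt (a c) \<tau>) + hN (Suc k) (a c \<tau>)) has_real_derivative D) (at \<tau> within dS_times) \<and>
    \<bar>D\<bar> \<le> 2 * (hN k (dt (a c) \<tau>) + hN (Suc k) (a c \<tau>)) + hN k (\<lambda>x. dt (dt (a c)) \<tau> x - lap (a c \<tau>) x)"
    by (rule allI, rule energy_derivative[OF slab_a t, where k = k]) (intro exI conjI, assumption+)
  from choice[OF this] obtain Da where
    "\<forall>c. ((\<lambda>\<tau>. hN k (dt (a c) \<tau>) + hN (Suc k) (a c \<tau>)) has_real_derivative Da c) (at \<tau> within dS_times) \<and>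
    \<bar>Da c\<bar> \<le> 2 * (hN k (dt (a c) \<tau>) + hN (Suc k) (a c \<tau>)) + hN k (\<lambda>x. dt (dt (a c)) \<tau> x - lap (a c \<tau>) x)" ..
  note Da = this[rule_format, THEN conjunct1] this[rule_format, THEN conjunct2]
  have 1: "(dyn_norm u v a k has_real_derivative (Du + Dv) + (\<Sum>c\<in>UNIV. Da c)) (at \<tau> within dS_times)"
    unfolding dyn_norm_def[abs_def] by (intro DERIV_add DERIV_sum Du Dv Da)
  have "\<bar>\<Sum>c\<in>UNIV. Da c\<bar> \<le> (\<Sum>c\<in>UNIV. 2 * (hN k (dt (a c) \<tau>) + hN (Suc k) (a c \<tau>)) + V * N)"
    by (intro order_trans[OF sum_abs] sum_mono order_trans[OF Da(2)] add_left_mono) (unfold V_def, rule rhs_le)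
  also have "\<dots> = 2 * (\<Sum>c\<in>UNIV. hN k (dt (a c) \<tau>) + hN (Suc k) (a c \<tau>)) + 3 * (V * N)"
    by (simp add: sum.distrib sum_distrib_left)
  finally have Da': "\<bar>\<Sum>c\<in>UNIV. Da c\<bar> \<le> 2 * (\<Sum>c\<in>UNIV. hN k (dt (a c) \<tau>) + hN (Suc k) (a c \<tau>)) + 3 * (V * N)" .
  define A where "A = (\<Sum>c\<in>UNIV. hN k (dt (a c) \<tau>) + hN (Suc k) (a c \<tau>))"
  define x where "x = W * N"
  have N2: "2 * N = 2 * (hN k (dt u \<tau>) + hN (Suc k) (u \<tau>)) + 2 * (hN k (dt v \<tau>) + hN (Suc k) (v \<tau>)) + 2 * A"
    unfolding dyn_norm_def A_def by simp
  have "\<bar>Du\<bar> \<le> 2 * (hN k (dt u \<tau>) + hN (Suc k) (u \<tau>)) + x"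
    using Du(2) rhs_le(1) unfolding x_def W_def by linarith
  moreover have "\<bar>Dv\<bar> \<le> 2 * (hN k (dt v \<tau>) + hN (Suc k) (v \<tau>)) + x"
    using Dv(2) rhs_le(2) unfolding x_def W_def by linarith
  ultimately have "\<bar>(Du + Dv) + (\<Sum>c\<in>UNIV. Da c)\<bar> \<le> 2 * N + 2 * x + 3 * (V * N)"
    using Da' unfolding N2 A_def[symmetric] by linarith
  also have "\<dots> = (2 + 2 * W + 3 * V) * N" unfolding x_def by (simp add: algebra_simps)
  finally show thesis using that[OF 1] unfolding V_def by blast
qed

end

end

lemma energy_estimate_high:
  assumes k: "k \<ge> 1"
  obtains \<delta> C where "\<delta> > 0" "C > 0" "\<And>u v b a \<tau>. frame_solution u v b a \<Longrightarrow> dyn_norm u v a k 0 \<le> \<delta> \<Longrightarrow> \<tau> \<in> dS_times \<Longrightarrow>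
     dyn_norm u v a k \<tau> \<le> C * dyn_norm u v a k 0 \<and> dyn_norm u v a k 0 \<le> C * dyn_norm u v a k \<tau>
     \<and> hN (Suc k) (b \<tau>) \<le> C * dyn_norm u v a k \<tau>"
proof -
  \<comment> \<open>In \<open>hN_mult_le\<close> the third condition reads
    \<open>k + 2 \<le> Suc k + k\<close>; this is where \<open>k \<ge> 1\<close> enters.\<close>
  obtain C where C: "C > 0" "\<forall>f g :: real^4 \<Rightarrow> real. smooth_S3 f \<longrightarrow> smooth_S3 g \<longrightarrow> hN k (\<lambda>x. f x * g x) \<le> C * hN (Suc k) f * hN k g"
  proof (rule hN_mult_le[of k "Suc k" k])
    fix C assume "C > 0" "\<And>f g :: real^4 \<Rightarrow> real. smooth_S3 f \<Longrightarrow> smooth_S3 g \<Longrightarrow> hN k (\<lambda>x. f x * g x) \<le> C * hN (Suc k) f * hN k g"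
    then show thesis by (intro that[of C]) blast+
  qed (use k in auto)
  define K where "K = (1 + PC + PC\<^sup>2) * (16 * C) * 2 + (1 + PC) * (3 * (8 * C + 8 * C\<^sup>2))"
  have K0: "K \<ge> 0" unfolding K_def using C(1) by (intro add_nonneg_nonneg mult_nonneg_nonneg) auto
  define L where "L = 2 + 2 * (72 * C * K + 768 * C + 4 + 4 * C\<^sup>2 * K\<^sup>2 + 48 * C\<^sup>2) + 3 * (2368 + 4 * K + 32 * C + 32 * C\<^sup>2)"
  have L0: "L \<ge> 0" unfolding L_def using C(1) K0 by (intro add_nonneg_nonneg mult_nonneg_nonneg) auto
  define E where "E = (1 + PC + PC\<^sup>2) * (8 * C\<^sup>2)"
  have E0: "E > 0" unfolding E_def using C(1) by (intro mult_pos_pos add_pos_nonneg) auto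
  \<comment> \<open>The radius within which the bound 1 on the norm and the absorption in
    \<open>b_le\<close> are both available.\<close>
  define r where "r = min 1 (1 / (2 * E))"
  have r: "r > 0" "r \<le> 1" "E * r \<le> 1 / 2"
  proof -
    show "r > 0" "r \<le> 1" unfolding r_def using E0 by auto
    have "E * r \<le> E * (1 / (2 * E))" unfolding r_def using E0 by (intro mult_left_mono) auto
    then show "E * r \<le> 1 / 2" using E0 by simp
  qed
  define M where "M = max (exp (L * pi)) K"
  have main: "dyn_norm u v a k \<tau> \<le> M * dyn_norm u v a k 0 \<and> dyn_norm u v a k 0 \<le> M * dyn_norm u v a k \<tau>
     \<and> hN (Suc k) (b \<tau>) \<le> M * dyn_norm u v a k \<tau>"
    if fs: "frame_solution u v b a" and small: "dyn_norm u v a k 0 \<le> r / (2 * exp (L * pi))" and t: "\<tau> \<in> dS_times" for u v b a \<tau>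
  proof -
    interpret frame_solution u v b a by (rule fs)
    have small_E: "(1 + PC + PC\<^sup>2) * (8 * C\<^sup>2) * dyn_norm u v a k s \<le> 1 / 2" if "dyn_norm u v a k s \<le> r" for s
      using mult_left_mono[OF that, of E] E0 r(3) unfolding E_def[symmetric] by linarith
    have "\<exists>D. (dyn_norm u v a k has_real_derivative D) (at s within dS_times) \<and> (dyn_norm u v a k s \<le> r \<longrightarrow> \<bar>D\<bar> \<le> L * dyn_norm u v a k s)"
      if s: "s \<in> dS_times" for s
    proof (cases "dyn_norm u v a k s \<le> r")
      case True
      show ?thesis
        by (rule dyn_norm_derivative[OF C s order_trans[OF True r(2)] small_E[OF True] K_def])
          (unfold L_def, intro exI conjI impI)
    next
      \<comment> \<open>Outside the small region Gronwall's lemma asks for differentiability alone,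
        so any derivative will do.\<close>
      case False
      have "\<exists>D. ((\<lambda>\<tau>. hN k (dt w \<tau>) + hN (Suc k) (w \<tau>)) has_real_derivative D) (at s within dS_times)" if "smooth_slab w" for w :: "real \<Rightarrow> real^4 \<Rightarrow> real"
        by (rule energy_derivative[OF that s, where k = k]) (intro exI, assumption)
      then obtain D where D: "\<And>w :: real \<Rightarrow> real^4 \<Rightarrow> real. smooth_slab w \<Longrightarrow> ((\<lambda>\<tau>. hN k (dt w \<tau>) + hN (Suc k) (w \<tau>)) has_real_derivative D w) (at s within dS_times)"
        by metis
      have "(dyn_norm u v a k has_real_derivative (D u + D v) + (\<Sum>c\<in>UNIV. D (a c))) (at s within dS_times)"
        unfolding dyn_norm_def[abs_def] by (intro DERIV_add DERIV_sum D) auto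
      then show ?thesis using False by blast
    qed
    then obtain D where D: "\<And>s. s \<in> dS_times \<Longrightarrow> (dyn_norm u v a k has_real_derivative D s) (at s within dS_times)"
      "\<And>s. s \<in> dS_times \<Longrightarrow> dyn_norm u v a k s \<le> r \<Longrightarrow> \<bar>D s\<bar> \<le> L * dyn_norm u v a k s"
      by metis
    \<comment> \<open>The 2 in the threshold provides the strict inequality that
      \<open>gronwall_dS\<close> requires.\<close>
    have "dyn_norm u v a k 0 * exp (L * pi) \<le> r / (2 * exp (L * pi)) * exp (L * pi)"
      using small by (intro mult_right_mono) auto
    also have "\<dots> < r" using r(1) by simp
    finally have small': "dyn_norm u v a k 0 * exp (L * pi) < r" .
    have "dyn_norm u v a k \<tau> \<le> exp (L * pi) * dyn_norm u v a k 0 \<and> dyn_norm u v a k 0 \<le> exp (L * pi) * dyn_norm u v a k \<tau>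
      \<and> dyn_norm u v a k \<tau> \<le> r"
      by (rule gronwall_dS[where y = "dyn_norm u v a k" and y' = D, OF L0 D(1) D(2) small' dyn_norm_nonneg t])
    then have g: "dyn_norm u v a k \<tau> \<le> exp (L * pi) * dyn_norm u v a k 0" "dyn_norm u v a k 0 \<le> exp (L * pi) * dyn_norm u v a k \<tau>"
      "dyn_norm u v a k \<tau> \<le> r" by blast+
    have b: "hN (Suc k) (b \<tau>) \<le> K * dyn_norm u v a k \<tau>"
      by (rule b_le_linear(1)[OF C t order_trans[OF g(3) r(2)] small_E[OF g(3)] K_def])
    have "exp (L * pi) * dyn_norm u v a k s \<le> M * dyn_norm u v a k s" "K * dyn_norm u v a k s \<le> M * dyn_norm u v a k s" for s
      unfolding M_def by (intro mult_right_mono; simp)+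
    from order_trans[OF g(1) this(1)] order_trans[OF g(2) this(1)] order_trans[OF b this(2)]
    show ?thesis by (intro conjI)
  qed
  show thesis
  proof (rule that[where \<delta> = "r / (2 * exp (L * pi))" and C = M])
    show "r / (2 * exp (L * pi)) > 0" using r(1) by simp
    show "M > 0" unfolding M_def by (simp add: less_max_iff_disj)
  qed (fact main)
qed

subsection \<open>The gauge covariant energy\<close>

context frame_solution
begin

text \<open>Real and imaginary parts of \<open>D_t phi = dt phi + i b phi\<close>, followed by those
  of \<open>D_c phi = X c phi + i a c phi\<close>.\<close>

definition cov_t_re :: "real \<Rightarrow> real^4 \<Rightarrow> real" where "cov_t_re \<tau> x = dt u \<tau> x - b \<tau> x * v \<tau> x"
definition cov_t_im :: "real \<Rightarrow> real^4 \<Rightarrow> real" where "cov_t_im \<tau> x = dt v \<tau> x + b \<tau> x * u \<tau> x"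
definition cov_re :: "3 \<Rightarrow> real \<Rightarrow> real^4 \<Rightarrow> real" where "cov_re c \<tau> x = X c (u \<tau>) x - a c \<tau> x * v \<tau> x"
definition cov_im :: "3 \<Rightarrow> real \<Rightarrow> real^4 \<Rightarrow> real" where "cov_im c \<tau> x = X c (v \<tau>) x + a c \<tau> x * u \<tau> x"

lemma slab_cov [simp]: "smooth_slab cov_t_re" "smooth_slab cov_t_im" "smooth_slab (cov_re c)" "smooth_slab (cov_im c)"
  unfolding cov_t_re_def[abs_def] cov_t_im_def[abs_def] cov_re_def[abs_def] cov_im_def[abs_def] by simp_all

lemma slices_cov [simp]:
  assumes "\<tau> \<in> dS_times"
  shows "smooth_S3 (cov_t_re \<tau>)" "smooth_S3 (cov_t_im \<tau>)" "smooth_S3 (cov_re c \<tau>)" "smooth_S3 (cov_im c \<tau>)"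
  by (rule smooth_slab_slice[OF _ assms], simp)+

text \<open>In complex terms: \<open>D_t D_t phi\<close> is the sum of the
  \<open>D_c D_c phi\<close> minus \<open>phi\<close>, where the term with the divergence of
  \<open>a\<close> drops out by the gauge condition; and \<open>D_t\<close> and \<open>D_c\<close>
  commute up to \<open>i\<close> times the electric field \<open>dt (a c) - X c b\<close>.\<close>

lemma dt_cov:
  assumes t: "\<tau> \<in> dS_times" and x: "x \<in> S3"
  shows "dt cov_t_re \<tau> x = b \<tau> x * cov_t_im \<tau> x + (\<Sum>c\<in>UNIV. X c (cov_re c \<tau>) x - a c \<tau> x * cov_im c \<tau> x) - u \<tau> x"
    "dt cov_t_im \<tau> x = - b \<tau> x * cov_t_re \<tau> x + (\<Sum>c\<in>UNIV. X c (cov_im c \<tau>) x + a c \<tau> x * cov_re c \<tau> x) - v \<tau> x"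
    "dt (cov_re c) \<tau> x = b \<tau> x * cov_im c \<tau> x + X c (cov_t_re \<tau>) x - a c \<tau> x * cov_t_im \<tau> x
      - (dt (a c) \<tau> x - X c (b \<tau>) x) * v \<tau> x"
    "dt (cov_im c) \<tau> x = - b \<tau> x * cov_re c \<tau> x + X c (cov_t_im \<tau>) x + a c \<tau> x * cov_t_re \<tau> x
      + (dt (a c) \<tau> x - X c (b \<tau>) x) * u \<tau> x"
proof -
  have X_re: "X d (cov_re c \<tau>) x = X d (X c (u \<tau>)) x - (X d (a c \<tau>) x * v \<tau> x + a c \<tau> x * X d (v \<tau>) x)"
    and X_im: "X d (cov_im c \<tau>) x = X d (X c (v \<tau>)) x + (X d (a c \<tau>) x * u \<tau> x + a c \<tau> x * X d (u \<tau>) x)" for c d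
    unfolding cov_re_def[abs_def] cov_im_def[abs_def] using t x by (simp_all add: X_mult)
  have X_t: "X d (cov_t_re \<tau>) x = X d (dt u \<tau>) x - (X d (b \<tau>) x * v \<tau> x + b \<tau> x * X d (v \<tau>) x)"
    "X d (cov_t_im \<tau>) x = X d (dt v \<tau>) x + (X d (b \<tau>) x * u \<tau> x + b \<tau> x * X d (u \<tau>) x)" for d
    unfolding cov_t_re_def[abs_def] cov_t_im_def[abs_def] using t x by (simp_all add: X_mult)
  have div: "X 1 (a 1 \<tau>) x = - X 2 (a 2 \<tau>) x - X 3 (a 3 \<tau>) x" using div_a[OF t x] by (simp add: sum_3)
  have "dt cov_t_re \<tau> x = dt (dt u) \<tau> x - (b \<tau> x * dt v \<tau> x + dt b \<tau> x * v \<tau> x)"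
    unfolding cov_t_re_def[abs_def] using t x by (simp add: dt_mult)
  then show "dt cov_t_re \<tau> x = b \<tau> x * cov_t_im \<tau> x + (\<Sum>c\<in>UNIV. X c (cov_re c \<tau>) x - a c \<tau> x * cov_im c \<tau> x) - u \<tau> x"
    unfolding eq_u[OF t x] X_re cov_t_im_def cov_im_def lap_def
    by (simp add: sum_3 div power2_eq_square algebra_simps)
  have "dt cov_t_im \<tau> x = dt (dt v) \<tau> x + (b \<tau> x * dt u \<tau> x + dt b \<tau> x * u \<tau> x)"
    unfolding cov_t_im_def[abs_def] using t x by (simp add: dt_mult)
  then show "dt cov_t_im \<tau> x = - b \<tau> x * cov_t_re \<tau> x + (\<Sum>c\<in>UNIV. X c (cov_im c \<tau>) x + a c \<tau> x * cov_re c \<tau> x) - v \<tau> x"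
    unfolding eq_v[OF t x] X_im cov_t_re_def cov_re_def lap_def
    by (simp add: sum_3 div power2_eq_square algebra_simps)
  have "dt (cov_re c) \<tau> x = X c (dt u \<tau>) x - (a c \<tau> x * dt v \<tau> x + dt (a c) \<tau> x * v \<tau> x)"
    unfolding cov_re_def[abs_def] using t x by (simp add: dt_mult dt_X)
  then show "dt (cov_re c) \<tau> x = b \<tau> x * cov_im c \<tau> x + X c (cov_t_re \<tau>) x - a c \<tau> x * cov_t_im \<tau> x
      - (dt (a c) \<tau> x - X c (b \<tau>) x) * v \<tau> x"
    unfolding X_t cov_im_def cov_t_im_def by (simp add: algebra_simps)
  have "dt (cov_im c) \<tau> x = X c (dt v \<tau>) x + (a c \<tau> x * dt u \<tau> x + dt (a c) \<tau> x * u \<tau> x)"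
    unfolding cov_im_def[abs_def] using t x by (simp add: dt_mult dt_X)
  then show "dt (cov_im c) \<tau> x = - b \<tau> x * cov_re c \<tau> x + X c (cov_t_im \<tau>) x + a c \<tau> x * cov_t_re \<tau> x
      + (dt (a c) \<tau> x - X c (b \<tau>) x) * u \<tau> x"
    unfolding X_t cov_re_def cov_t_re_def by (simp add: algebra_simps)
qed

lemma cur_cov: "cur c \<tau> x = cov_im c \<tau> x * u \<tau> x - cov_re c \<tau> x * v \<tau> x"
  unfolding cur_def cov_im_def cov_re_def by (simp add: power2_eq_square algebra_simps)

text \<open>The electric energy enters as the squares of \<open>dt a\<close> and of the gradient of
  \<open>b\<close>: their mixed product integrates to zero because \<open>dt a\<close> is divergence
  free. The square of \<open>a\<close> completes the \<open>H^1\<close> norm of the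
  potential.\<close>

definition cov_density :: "real \<Rightarrow> real^4 \<Rightarrow> real" where
  "cov_density \<tau> x = ((cov_t_re \<tau> x)\<^sup>2 + (cov_t_im \<tau> x)\<^sup>2) + (\<Sum>c\<in>UNIV. (cov_re c \<tau> x)\<^sup>2 + (cov_im c \<tau> x)\<^sup>2)
    + ((u \<tau> x)\<^sup>2 + (v \<tau> x)\<^sup>2)
    + (\<Sum>c\<in>UNIV. (dt (a c) \<tau> x)\<^sup>2 + ((a c \<tau> x)\<^sup>2 + (\<Sum>d\<in>UNIV. (X d (a c \<tau>) x)\<^sup>2)))
    + (\<Sum>d\<in>UNIV. (X d (b \<tau>) x)\<^sup>2)"

definition cov_energy :: "real \<Rightarrow> real" where
  "cov_energy \<tau> = (hB 0 (cov_t_re \<tau>) (cov_t_re \<tau>) + hB 0 (cov_t_im \<tau>) (cov_t_im \<tau>))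
    + (\<Sum>c\<in>UNIV. hB 0 (cov_re c \<tau>) (cov_re c \<tau>) + hB 0 (cov_im c \<tau>) (cov_im c \<tau>))
    + (hB 0 (u \<tau>) (u \<tau>) + hB 0 (v \<tau>) (v \<tau>))
    + (\<Sum>c\<in>UNIV. hN 0 (dt (a c) \<tau>) + hN (Suc 0) (a c \<tau>)) + hB (Suc 0) (b \<tau>) (b \<tau>)"

lemma cov_energy_integral: "\<tau> \<in> dS_times \<Longrightarrow> cov_energy \<tau> = (LINT x|S3_measure. cov_density \<tau> x)"
  unfolding cov_energy_def cov_density_def hN_1 hN_0 hB.simps(2) unfolding hB_0_real
  by (simp add: integral_sum)

text \<open>The matter flux, the flux of the free wave equation for \<open>a\<close>, and terms that
  integrate the couplings to \<open>b\<close> and \<open>dt b\<close> by parts. Its divergence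
  collects all second derivatives in space.\<close>

definition flux :: "3 \<Rightarrow> real \<Rightarrow> real^4 \<Rightarrow> real" where
  "flux c \<tau> x = cov_re c \<tau> x * cov_t_re \<tau> x + cov_im c \<tau> x * cov_t_im \<tau> x
    + (\<Sum>d\<in>UNIV. X c (a d \<tau>) x * dt (a d) \<tau> x) + dt (a c) \<tau> x * dt b \<tau> x
    + b \<tau> x * (X c (dt b \<tau>) x - cur c \<tau> x)"

lemma smooth_flux [simp]: "\<tau> \<in> dS_times \<Longrightarrow> smooth_S3 (flux c \<tau>)"
  unfolding flux_def[abs_def] by simp

text \<open>The work of the electric field on the current cancels against the forcing by
  \<open>cur\<close> in \<open>eq_a'\<close> and a term of the flux. The remainder pairs
  \<open>dt a\<close> with terms linear in \<open>a\<close>, where -3 is the -4 of the equation plus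
  1 from the square of \<open>a\<close> in the density.\<close>

lemma dt_cov_density:
  assumes t: "\<tau> \<in> dS_times" and x: "x \<in> S3"
  shows "dt cov_density \<tau> x = 2 * (\<Sum>c\<in>UNIV. X c (flux c \<tau>) x)
    + 2 * (\<Sum>c\<in>UNIV. dt (a c) \<tau> x * (2 * curl (\<lambda>d. a d \<tau>) c x - 3 * a c \<tau> x))"
proof -
  have 1: "dt cov_density \<tau> x = 2 * (cov_t_re \<tau> x * dt cov_t_re \<tau> x + cov_t_im \<tau> x * dt cov_t_im \<tau> x)
    + 2 * (\<Sum>c\<in>UNIV. cov_re c \<tau> x * dt (cov_re c) \<tau> x + cov_im c \<tau> x * dt (cov_im c) \<tau> x)
    + 2 * (u \<tau> x * dt u \<tau> x + v \<tau> x * dt v \<tau> x)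
    + 2 * (\<Sum>c\<in>UNIV. dt (a c) \<tau> x * dt (dt (a c)) \<tau> x + (a c \<tau> x * dt (a c) \<tau> x + (\<Sum>d\<in>UNIV. X d (a c \<tau>) x * X d (dt (a c) \<tau>) x)))
    + 2 * (\<Sum>d\<in>UNIV. X d (b \<tau>) x * X d (dt b \<tau>) x)"
    unfolding cov_density_def[abs_def] using t x by (simp add: dt_square dt_X sum_3)
  have 2: "cov_t_re \<tau> x * dt cov_t_re \<tau> x + cov_t_im \<tau> x * dt cov_t_im \<tau> x
    = (\<Sum>c\<in>UNIV. cov_t_re \<tau> x * X c (cov_re c \<tau>) x + cov_t_im \<tau> x * X c (cov_im c \<tau>) x
        + a c \<tau> x * (cov_t_im \<tau> x * cov_re c \<tau> x - cov_t_re \<tau> x * cov_im c \<tau> x))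
      - (cov_t_re \<tau> x * u \<tau> x + cov_t_im \<tau> x * v \<tau> x)"
    unfolding dt_cov(1,2)[OF t x] by (simp add: sum_3 algebra_simps)
  \<comment> \<open>The terms with \<open>a c\<close> in front are the negatives of those in the
    preceding identity; the last one is the work of the electric field on the current.\<close>
  have 3: "cov_re c \<tau> x * dt (cov_re c) \<tau> x + cov_im c \<tau> x * dt (cov_im c) \<tau> x
    = cov_re c \<tau> x * X c (cov_t_re \<tau>) x + cov_im c \<tau> x * X c (cov_t_im \<tau>) x
      - a c \<tau> x * (cov_t_im \<tau> x * cov_re c \<tau> x - cov_t_re \<tau> x * cov_im c \<tau> x)
      + (dt (a c) \<tau> x - X c (b \<tau>) x) * cur c \<tau> x" for c
    unfolding dt_cov(3,4)[OF t x] cur_cov by (simp add: algebra_simps)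
  have 4: "u \<tau> x * dt u \<tau> x + v \<tau> x * dt v \<tau> x = cov_t_re \<tau> x * u \<tau> x + cov_t_im \<tau> x * v \<tau> x"
    unfolding cov_t_re_def cov_t_im_def by (simp add: algebra_simps)
  have 5: "X c (flux c \<tau>) x = (X c (cov_re c \<tau>) x * cov_t_re \<tau> x + cov_re c \<tau> x * X c (cov_t_re \<tau>) x)
      + (X c (cov_im c \<tau>) x * cov_t_im \<tau> x + cov_im c \<tau> x * X c (cov_t_im \<tau>) x)
      + (\<Sum>d\<in>UNIV. X c (X c (a d \<tau>)) x * dt (a d) \<tau> x + X c (a d \<tau>) x * X c (dt (a d) \<tau>) x)
      + (X c (dt (a c) \<tau>) x * dt b \<tau> x + dt (a c) \<tau> x * X c (dt b \<tau>) x)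
      + (X c (b \<tau>) x * (X c (dt b \<tau>) x - cur c \<tau> x) + b \<tau> x * (X c (X c (dt b \<tau>)) x - X c (cur c \<tau>) x))" for c
    unfolding flux_def[abs_def] using t x by (simp add: X_mult)
  \<comment> \<open>These two identities dispose of the flux terms with undifferentiated
    \<open>b\<close> and \<open>dt b\<close>, the first by the elliptic equation for
    \<open>dt b\<close>, the second by the gauge condition.\<close>
  have 6: "b \<tau> x * lap (dt b \<tau>) x = b \<tau> x * (\<Sum>c\<in>UNIV. X c (cur c \<tau>) x)" using lap_dt_b[OF t x] by simp
  have 7: "(\<Sum>c\<in>UNIV. X c (dt (a c) \<tau>) x) * dt b \<tau> x = 0" using div_dt_a[OF t x] by simp
  show ?thesis
    using 1 2 3[of 1] 3[of 2] 3[of 3] 4 5[of 1] 5[of 2] 5[of 3] 6 7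
    unfolding eq_a'[OF t x] by (simp only: lap_def sum_3 algebra_simps)
qed

text \<open>The flux integrates to zero and the remainder is quadratic, so the inequality holds for
  data of any size. 1170 = 2 * 4 * 144 + 2 * 9 comes from the curl and the mass term, and 3513 = 3 *
  1171.\<close>

lemma cov_energy_derivative:
  obtains D where "\<And>\<tau>. \<tau> \<in> dS_times \<Longrightarrow> (cov_energy has_real_derivative D \<tau>) (at \<tau> within dS_times)"
    "\<And>\<tau>. \<tau> \<in> dS_times \<Longrightarrow> \<bar>D \<tau>\<bar> \<le> 3513 * cov_energy \<tau>"
proof -
  define G where "G c \<tau> x = 2 * curl (\<lambda>d. a d \<tau>) c x - 3 * a c \<tau> x" for c \<tau> x
  have sG [simp]: "smooth_S3 (G c \<tau>)" if "\<tau> \<in> dS_times" for c \<tau> unfolding G_def[abs_def] using that by simp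
  have slab_density: "smooth_slab cov_density" unfolding cov_density_def[abs_def] by simp
  have D: "(cov_energy has_real_derivative (LINT x|S3_measure. dt cov_density \<tau> x)) (at \<tau> within dS_times)"
    if t: "\<tau> \<in> dS_times" for \<tau>
    unfolding has_real_derivative_iff_has_vector_derivative
    by (rule has_vector_derivative_transform[OF t _ has_derivative_integral_slab[OF slab_density t]]) (simp add: cov_energy_integral)
  have "\<bar>LINT x|S3_measure. dt cov_density \<tau> x\<bar> \<le> 3513 * cov_energy \<tau>" if t: "\<tau> \<in> dS_times" for \<tau>
  proof -
    define Ea where "Ea = (\<Sum>c\<in>UNIV. hN 0 (dt (a c) \<tau>) + hN (Suc 0) (a c \<tau>))"
    have Ea: "Ea \<le> cov_energy \<tau>" unfolding cov_energy_def Ea_def[symmetric]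
      using hB_nonneg sum_nonneg[of "UNIV :: 3 set" "\<lambda>c. hB 0 (cov_re c \<tau>) (cov_re c \<tau>) + hB 0 (cov_im c \<tau>) (cov_im c \<tau>)"]
      by (simp del: hB.simps)
    have Ea1: "hN 0 (dt (a c) \<tau>) + hN (Suc 0) (a c \<tau>) \<le> Ea" for c
      unfolding Ea_def by (rule member_le_sum) auto
    have Ea2: "hN 0 (dt (a c) \<tau>) \<le> Ea" "hN (Suc 0) (a c \<tau>) \<le> Ea" for c
      using Ea1[of c] hN_nonneg[of 0 "dt (a c) \<tau>"] hN_nonneg[of "Suc 0" "a c \<tau>"] by linarith+
    have "hN 0 (G c \<tau>) \<le> 1170 * Ea" for c
    proof -
      have "hN 0 (G c \<tau>) \<le> 2 * hN 0 (\<lambda>x. 2 * curl (\<lambda>d. a d \<tau>) c x) + 2 * hN 0 (\<lambda>x. 3 * a c \<tau> x)"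
        unfolding G_def[abs_def] using t by (intro hN_diff) auto
      also have "\<dots> = 2 * (2\<^sup>2 * hN 0 (curl (\<lambda>d. a d \<tau>) c)) + 2 * (3\<^sup>2 * hN 0 (a c \<tau>))"
        using t by (simp only: hN_cmult[OF smooth_S3_curl] hN_cmult[OF slices(4)])
      also have "\<dots> \<le> 2 * (2\<^sup>2 * (144 * Ea)) + 2 * (3\<^sup>2 * Ea)"
        using t Ea2(2) by (intro add_mono mult_left_mono hN_curl_le order_trans[OF hN_mono[OF le0]]) auto
      finally show ?thesis by simp
    qed
    then have G: "hB 0 (G c \<tau>) (G c \<tau>) \<le> 1170 * Ea" for c unfolding hN_0 by simp
    have "(LINT x|S3_measure. dt cov_density \<tau> x) = (LINT x|S3_measure. (\<Sum>c\<in>UNIV. 2 * X c (flux c \<tau>) x) + (\<Sum>c\<in>UNIV. 2 * (dt (a c) \<tau> x * G c \<tau> x)))"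
      by (rule integral_S3_cong) (simp only: dt_cov_density[OF t] G_def sum_distrib_left)
    also have "\<dots> = (\<Sum>c\<in>UNIV. 2 * (LINT x|S3_measure. X c (flux c \<tau>) x)) + (\<Sum>c\<in>UNIV. 2 * (LINT x|S3_measure. dt (a c) \<tau> x * G c \<tau> x))"
      using t by simp
    also have "\<dots> = (\<Sum>c\<in>UNIV. 2 * hB 0 (dt (a c) \<tau>) (G c \<tau>))"
      using integral_X[OF smooth_flux[OF t]] by simp
    also have "\<bar>\<dots>\<bar> \<le> (\<Sum>c\<in>(UNIV::3 set). Ea + 1170 * Ea)"
    proof (intro order_trans[OF sum_abs] sum_mono)
      fix c
      have "\<bar>2 * hB 0 (dt (a c) \<tau>) (G c \<tau>)\<bar> \<le> hB 0 (dt (a c) \<tau>) (dt (a c) \<tau>) + hB 0 (G c \<tau>) (G c \<tau>)"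
        using hB_le[of "dt (a c) \<tau>" "G c \<tau>" 0] t by (simp add: abs_mult del: hB.simps)
      also have "\<dots> \<le> Ea + 1170 * Ea" using Ea2(1)[of c] G unfolding hN_0 by (intro add_mono)
      finally show "\<bar>2 * hB 0 (dt (a c) \<tau>) (G c \<tau>)\<bar> \<le> Ea + 1170 * Ea" .
    qed
    also have "\<dots> = 3513 * Ea" by simp
    finally show ?thesis using Ea by simp
  qed
  with D show thesis by (rule that)
qed

text \<open>The elliptic equation is paired with \<open>b\<close>. The term with the squares of the
  scalar field and of \<open>b\<close> has the favourable sign, and completing squares with it
  bounds the charge term by the time derivatives, for data of any size.\<close>

lemma b_gradient_le:
  assumes t: "\<tau> \<in> dS_times"
  shows "hB (Suc 0) (b \<tau>) (b \<tau>) \<le> hN 0 (dt u \<tau>) + hN 0 (dt v \<tau>)"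
proof -
  have "hB (Suc 0) (b \<tau>) (b \<tau>) = - (LINT x|S3_measure. lap (b \<tau>) x * b \<tau> x)"
    using hB_Suc_lap[of "b \<tau>" "b \<tau>" 0] t by simp
  also have "(LINT x|S3_measure. lap (b \<tau>) x * b \<tau> x)
    = (LINT x|S3_measure. (((u \<tau> x)\<^sup>2 + (v \<tau> x)\<^sup>2) * b \<tau> x + (u \<tau> x * dt v \<tau> x - v \<tau> x * dt u \<tau> x)) * b \<tau> x)"
    by (rule integral_S3_cong) (simp only: eq_b[OF t])
  also have "- \<dots> = (LINT x|S3_measure. - ((((u \<tau> x)\<^sup>2 + (v \<tau> x)\<^sup>2) * b \<tau> x + (u \<tau> x * dt v \<tau> x - v \<tau> x * dt u \<tau> x)) * b \<tau> x))"
    by simp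
  also have "\<dots> \<le> (LINT x|S3_measure. (dt u \<tau> x)\<^sup>2 + (dt v \<tau> x)\<^sup>2)"
  proof (intro integral_mono)
    fix x
    have "- ((((u \<tau> x)\<^sup>2 + (v \<tau> x)\<^sup>2) * b \<tau> x + (u \<tau> x * dt v \<tau> x - v \<tau> x * dt u \<tau> x)) * b \<tau> x)
       = (dt u \<tau> x)\<^sup>2 / 4 + (dt v \<tau> x)\<^sup>2 / 4 - (u \<tau> x * b \<tau> x + dt v \<tau> x / 2)\<^sup>2 - (v \<tau> x * b \<tau> x - dt u \<tau> x / 2)\<^sup>2"
      by (simp add: power2_eq_square field_simps)
    also have "\<dots> \<le> (dt u \<tau> x)\<^sup>2 + (dt v \<tau> x)\<^sup>2"
      using zero_le_power2[of "u \<tau> x * b \<tau> x + dt v \<tau> x / 2"] zero_le_power2[of "v \<tau> x * b \<tau> x - dt u \<tau> x / 2"]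
        zero_le_power2[of "dt u \<tau> x"] zero_le_power2[of "dt v \<tau> x"] by linarith
    finally show "- ((((u \<tau> x)\<^sup>2 + (v \<tau> x)\<^sup>2) * b \<tau> x + (u \<tau> x * dt v \<tau> x - v \<tau> x * dt u \<tau> x)) * b \<tau> x)
       \<le> (dt u \<tau> x)\<^sup>2 + (dt v \<tau> x)\<^sup>2" .
  qed (use t in auto)
  also have "\<dots> = hN 0 (dt u \<tau>) + hN 0 (dt v \<tau>)" unfolding hN_0 hB_0_real using t by simp
  finally show ?thesis .
qed

lemma b_le_gradient: "\<tau> \<in> dS_times \<Longrightarrow> hN (Suc 0) (b \<tau>) \<le> (1 + PC) * hB (Suc 0) (b \<tau>) (b \<tau>)"
  using Poincare_hB[OF slices(3) mean_b] unfolding hN_Suc_last hN_0 One_nat_def by (simp add: algebra_simps del: hB.simps)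

context
  fixes C \<tau> :: real
  assumes C: "C > 0" "\<forall>f g :: real^4 \<Rightarrow> real. smooth_S3 f \<longrightarrow> smooth_S3 g \<longrightarrow> hN 0 (\<lambda>x. f x * g x) \<le> C * hN (Suc 0) f * hN (Suc 0) g"
    and t: "\<tau> \<in> dS_times"
begin

text \<open>Plain and covariant derivatives differ by products of \<open>b\<close> or
  \<open>a\<close> with \<open>u\<close> or \<open>v\<close>, bounded in \<open>L^2\<close> by two
  \<open>H^1\<close> norms. The factor in front of the dynamical norm involves only \<open>b\<close>
  and \<open>a\<close>, so smallness of either energy makes it small.\<close>

lemma product_error:
  defines "A \<equiv> (\<Sum>c\<in>UNIV. hN 0 (dt (a c) \<tau>) + hN (Suc 0) (a c \<tau>))"
  shows "dyn_norm u v a 0 \<tau> \<le> 2 * cov_energy \<tau> + 2 * C * (hN (Suc 0) (b \<tau>) + A) * dyn_norm u v a 0 \<tau>"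
    "cov_energy \<tau> \<le> 2 * dyn_norm u v a 0 \<tau> + hB (Suc 0) (b \<tau>) (b \<tau>) + 2 * C * (hN (Suc 0) (b \<tau>) + A) * dyn_norm u v a 0 \<tau>"
proof -
  define S where "S = dyn_norm u v a 0 \<tau>"
  define B where "B = hN (Suc 0) (b \<tau>)"
  define U V where "U = hN (Suc 0) (u \<tau>)" and "V = hN (Suc 0) (v \<tau>)"
  define H where "H = (\<Sum>c\<in>UNIV. hN (Suc 0) (a c \<tau>))"
  have HA: "H \<le> A" unfolding H_def A_def by (intro sum_mono) simp
  have UV: "U + V \<le> S"
    using sum_nonneg[of "UNIV :: 3 set" "\<lambda>c. hN 0 (dt (a c) \<tau>) + hN (Suc 0) (a c \<tau>)"]
      hN_nonneg[of 0 "dt u \<tau>"] hN_nonneg[of 0 "dt v \<tau>"]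
    unfolding U_def V_def S_def dyn_norm_def by simp
  have pr: "hN 0 (\<lambda>x. f x * g x) \<le> C * hN (Suc 0) f * hN (Suc 0) g" if "smooth_S3 f" "smooth_S3 g" for f g :: "real^4 \<Rightarrow> real"
    using C(2) that by blast
  have add: "hN 0 f \<le> 2 * hN 0 (\<lambda>x. f x + g x) + 2 * hN 0 g" "hN 0 (\<lambda>x. f x + g x) \<le> 2 * hN 0 f + 2 * hN 0 g"
    "hN 0 f \<le> 2 * hN 0 (\<lambda>x. f x - g x) + 2 * hN 0 g" "hN 0 (\<lambda>x. f x - g x) \<le> 2 * hN 0 f + 2 * hN 0 g"
    if "smooth_S3 f" "smooth_S3 g" for f g :: "real^4 \<Rightarrow> real"
    using hN_diff[of "\<lambda>x. f x + g x" g 0] hN_add[of "\<lambda>x. f x - g x" g 0] hN_add[of f g 0] hN_diff[of f g 0] that by simp_all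
  have p1: "hN 0 (\<lambda>x. b \<tau> x * v \<tau> x) \<le> C * B * V" "hN 0 (\<lambda>x. b \<tau> x * u \<tau> x) \<le> C * B * U"
    unfolding B_def U_def V_def using t by (intro pr; simp)+
  have p2: "hN 0 (\<lambda>x. a c \<tau> x * v \<tau> x) \<le> C * hN (Suc 0) (a c \<tau>) * V" "hN 0 (\<lambda>x. a c \<tau> x * u \<tau> x) \<le> C * hN (Suc 0) (a c \<tau>) * U" for c
    unfolding U_def V_def using t by (intro pr; simp)+
  define PT where "PT = hN 0 (cov_t_re \<tau>) + hN 0 (cov_t_im \<tau>)"
  define DT where "DT = hN 0 (dt u \<tau>) + hN 0 (dt v \<tau>)"
  define PX where "PX = (\<Sum>c\<in>UNIV. hN 0 (cov_re c \<tau>) + hN 0 (cov_im c \<tau>))"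
  define DX where "DX = (\<Sum>c\<in>UNIV. hN 0 (X c (u \<tau>)) + hN 0 (X c (v \<tau>)))"
  define Z where "Z = hN 0 (u \<tau>) + hN 0 (v \<tau>)"
  have e1: "DT \<le> 2 * PT + 2 * (C * B * (U + V))" "PT \<le> 2 * DT + 2 * (C * B * (U + V))"
    using add[of "dt u \<tau>" "\<lambda>x. b \<tau> x * v \<tau> x"] add[of "dt v \<tau>" "\<lambda>x. b \<tau> x * u \<tau> x"] p1 t
    unfolding DT_def PT_def cov_t_re_def[abs_def] cov_t_im_def[abs_def] distrib_left by simp_all
  have e2: "hN 0 (X c (u \<tau>)) + hN 0 (X c (v \<tau>)) \<le> 2 * (hN 0 (cov_re c \<tau>) + hN 0 (cov_im c \<tau>)) + 2 * (C * hN (Suc 0) (a c \<tau>) * (U + V))"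
    "hN 0 (cov_re c \<tau>) + hN 0 (cov_im c \<tau>) \<le> 2 * (hN 0 (X c (u \<tau>)) + hN 0 (X c (v \<tau>))) + 2 * (C * hN (Suc 0) (a c \<tau>) * (U + V))" for c
    using add[of "X c (u \<tau>)" "\<lambda>x. a c \<tau> x * v \<tau> x"] add[of "X c (v \<tau>)" "\<lambda>x. a c \<tau> x * u \<tau> x"] p2[of c] t
    unfolding cov_re_def[abs_def] cov_im_def[abs_def] distrib_left by simp_all
  have H': "(\<Sum>c\<in>UNIV. 2 * (C * hN (Suc 0) (a c \<tau>) * (U + V))) = 2 * (C * H * (U + V))"
    unfolding H_def by (simp add: sum_distrib_left sum_distrib_right)
  have e3: "DX \<le> 2 * PX + 2 * (C * H * (U + V))" "PX \<le> 2 * DX + 2 * (C * H * (U + V))"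
    using sum_mono[of "UNIV :: 3 set", OF e2(1)] sum_mono[of "UNIV :: 3 set", OF e2(2)]
    unfolding DX_def PX_def H'[symmetric] sum.distrib[of "\<lambda>c. 2 * _ c"] sum_distrib_left by (simp_all add: sum.distrib)
  have S: "S = DT + Z + DX + A"
    unfolding S_def dyn_norm_def DT_def Z_def DX_def A_def hN_Suc hN_0 by (simp add: sum.distrib del: hB.simps)
  have E: "cov_energy \<tau> = PT + PX + Z + A + hB (Suc 0) (b \<tau>) (b \<tau>)"
    unfolding cov_energy_def PT_def PX_def Z_def A_def hN_0 ..
  define err where "err = 2 * (C * B * (U + V)) + 2 * (C * H * (U + V))"
  have nn: "0 \<le> Z" "0 \<le> A" "0 \<le> hB (Suc 0) (b \<tau>) (b \<tau>)"
    unfolding Z_def A_def by (auto intro!: sum_nonneg add_nonneg_nonneg simp del: hB.simps)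
  have "err = 2 * C * (B + H) * (U + V)" unfolding err_def by (simp add: algebra_simps)
  also have "\<dots> \<le> 2 * C * (B + A) * S"
    using C(1) HA UV nn(2) by (intro mult_mono) (auto simp: B_def H_def U_def V_def S_def intro!: mult_nonneg_nonneg add_nonneg_nonneg sum_nonneg)
  finally have err: "err \<le> 2 * C * (B + A) * S" .
  \<comment> \<open>The bookkeeping is isolated in linear arithmetic over plain variables, with the
    product bounds as opaque terms.\<close>
  have lin: "s \<le> 2 * e + r \<and> e \<le> 2 * s + q + r"
    if "2 * x + 2 * y \<le> r" "d \<le> 2 * p + 2 * x" "p \<le> 2 * d + 2 * x" "d' \<le> 2 * p' + 2 * y" "p' \<le> 2 * d' + 2 * y"
      "0 \<le> z" "0 \<le> w" "0 \<le> q" "s = d + z + d' + w" "e = p + p' + z + w + q"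
    for s e r x y d p d' p' z w q :: real
    using that by linarith
  define R where "R = 2 * C * (B + A) * S"
  have "S \<le> 2 * cov_energy \<tau> + R \<and> cov_energy \<tau> \<le> 2 * S + hB (Suc 0) (b \<tau>) (b \<tau>) + R"
    by (rule lin[OF err[folded R_def, unfolded err_def] e1 e3 nn S E])
  then show "dyn_norm u v a 0 \<tau> \<le> 2 * cov_energy \<tau> + 2 * C * (hN (Suc 0) (b \<tau>) + A) * dyn_norm u v a 0 \<tau>"
    "cov_energy \<tau> \<le> 2 * dyn_norm u v a 0 \<tau> + hB (Suc 0) (b \<tau>) (b \<tau>) + 2 * C * (hN (Suc 0) (b \<tau>) + A) * dyn_norm u v a 0 \<tau>"
    unfolding R_def B_def S_def by simp_all
qed

end

end

text \<open>Smallness is passed along a chain: small data make the covariant energy small at time 0,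
  its growth is bounded whatever its size, and a small covariant energy controls the plain norm
  again.\<close>

lemma energy_estimate_low:
  obtains \<delta> C where "\<delta> > 0" "C > 0" "\<And>u v b a \<tau>. frame_solution u v b a \<Longrightarrow> dyn_norm u v a 0 0 \<le> \<delta> \<Longrightarrow> \<tau> \<in> dS_times \<Longrightarrow>
     dyn_norm u v a 0 \<tau> \<le> C * dyn_norm u v a 0 0 \<and> dyn_norm u v a 0 0 \<le> C * dyn_norm u v a 0 \<tau>
     \<and> hN (Suc 0) (b \<tau>) \<le> C * dyn_norm u v a 0 \<tau>"
proof -
  obtain C where C: "C > 0" "\<forall>f g :: real^4 \<Rightarrow> real. smooth_S3 f \<longrightarrow> smooth_S3 g \<longrightarrow> hN 0 (\<lambda>x. f x * g x) \<le> C * hN (Suc 0) f * hN (Suc 0) g"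
  proof (rule hN_0_mult_le[of "Suc 0" "Suc 0"])
    fix C assume "C > 0" "\<And>f g :: real^4 \<Rightarrow> real. smooth_S3 f \<Longrightarrow> smooth_S3 g \<Longrightarrow> hN 0 (\<lambda>x. f x * g x) \<le> C * hN (Suc 0) f * hN (Suc 0) g"
    then show thesis by (intro that[of C]) blast+
  qed simp
  define D where "D = 2 * C * (2 + PC)"
  have D0: "D > 0" unfolding D_def using C(1) by (intro mult_pos_pos add_pos_pos) auto
  define g where "g = exp (3513 * pi)"
  have g1: "g \<ge> 1" unfolding g_def by simp
  define M where "M = 3 + D"
  have M1: "M \<ge> 1" unfolding M_def using D0 by simp
  \<comment> \<open>\<open>D * r \<le> 1 / 2\<close> allows the error to be absorbed in
    \<open>down\<close>; \<open>4 * r \<le> 1\<close> brings the plain norm back below 1, as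
    \<open>up\<close> requires.\<close>
  define r where "r = min (1 / 4) (1 / (2 * D))"
  have r: "r > 0" "4 * r \<le> 1" "D * r \<le> 1 / 2"
  proof -
    show "r > 0" "4 * r \<le> 1" unfolding r_def using D0 by auto
    have "D * r \<le> D * (1 / (2 * D))" unfolding r_def using D0 by (intro mult_left_mono) auto
    then show "D * r \<le> 1 / 2" using D0 by simp
  qed
  define \<delta> where "\<delta> = min 1 (r / (g * M))"
  define L where "L = max (4 * g * M) (1 + PC)"
  have main: "dyn_norm u v a 0 \<tau> \<le> L * dyn_norm u v a 0 0 \<and> dyn_norm u v a 0 0 \<le> L * dyn_norm u v a 0 \<tau>
     \<and> hN (Suc 0) (b \<tau>) \<le> L * dyn_norm u v a 0 \<tau>"
    if fs: "frame_solution u v b a" and small: "dyn_norm u v a 0 0 \<le> \<delta>" and t: "\<tau> \<in> dS_times" for u v b a \<tau>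
  proof -
    interpret frame_solution u v b a by (rule fs)
    define S where "S s = dyn_norm u v a 0 s" for s
    have z: "0 \<in> dS_times" by (simp add: dS_times_def)
    have S0: "0 \<le> S s" for s unfolding S_def by simp
    have bS: "hB (Suc 0) (b s) (b s) \<le> S s" if s: "s \<in> dS_times" for s
      using b_gradient_le[OF s] hN_nonneg[of "Suc 0" "u s"] hN_nonneg[of "Suc 0" "v s"]
        sum_nonneg[of "UNIV :: 3 set" "\<lambda>c. hN 0 (dt (a c) s) + hN (Suc 0) (a c s)", OF add_nonneg_nonneg[OF hN_nonneg hN_nonneg]]
      unfolding S_def dyn_norm_def by linarith
    have aS: "(\<Sum>c\<in>UNIV. hN 0 (dt (a c) s) + hN (Suc 0) (a c s)) \<le> S s" for s
      unfolding S_def dyn_norm_def by simp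
    have bE: "hB (Suc 0) (b s) (b s) \<le> cov_energy s" and aE: "(\<Sum>c\<in>UNIV. hN 0 (dt (a c) s) + hN (Suc 0) (a c s)) \<le> cov_energy s"
      and E0: "0 \<le> cov_energy s" for s
      unfolding cov_energy_def by (auto intro!: add_nonneg_nonneg sum_nonneg simp del: hB.simps)
    have factor: "2 * C * (hN (Suc 0) (b s) + (\<Sum>c\<in>UNIV. hN 0 (dt (a c) s) + hN (Suc 0) (a c s))) * S s \<le> (D * x) * S s"
      if s: "s \<in> dS_times" and x: "hB (Suc 0) (b s) (b s) \<le> x" "(\<Sum>c\<in>UNIV. hN 0 (dt (a c) s) + hN (Suc 0) (a c s)) \<le> x" for s x
    proof -
      have "hN (Suc 0) (b s) \<le> (1 + PC) * x"
        by (rule order_trans[OF b_le_gradient[OF s]]) (use x(1) in \<open>intro mult_left_mono, auto\<close>)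
      then have "hN (Suc 0) (b s) + (\<Sum>c\<in>UNIV. hN 0 (dt (a c) s) + hN (Suc 0) (a c s)) \<le> (2 + PC) * x"
        using x(2) by (simp add: algebra_simps)
      then have "2 * C * (hN (Suc 0) (b s) + (\<Sum>c\<in>UNIV. hN 0 (dt (a c) s) + hN (Suc 0) (a c s))) \<le> 2 * C * ((2 + PC) * x)"
        using C(1) by (intro mult_left_mono) auto
      also have "\<dots> = D * x" unfolding D_def by (simp only: mult.assoc)
      finally show ?thesis using S0 by (intro mult_right_mono)
    qed
    have up: "cov_energy s \<le> M * S s" if s: "s \<in> dS_times" and le: "S s \<le> 1" for s
    proof -
      have "cov_energy s \<le> 2 * S s + hB (Suc 0) (b s) (b s) + (D * S s) * S s"
        using product_error(2)[OF C s] factor[OF s bS[OF s] aS] unfolding S_def by linarith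
      also have "\<dots> \<le> 2 * S s + S s + (D * 1) * S s"
        using bS[OF s] D0 le S0 by (intro add_mono mult_right_mono mult_left_mono) auto
      finally show ?thesis unfolding M_def by (simp add: algebra_simps)
    qed
    have down: "S s \<le> 4 * cov_energy s" if s: "s \<in> dS_times" and le: "cov_energy s \<le> r" for s
    proof -
      have "S s \<le> 2 * cov_energy s + (D * cov_energy s) * S s"
        using product_error(1)[OF C s] factor[OF s bE aE] unfolding S_def by linarith
      also have "\<dots> \<le> 2 * cov_energy s + (D * r) * S s"
        using le D0 S0 by (intro add_left_mono mult_right_mono mult_left_mono) auto
      also have "\<dots> \<le> 2 * cov_energy s + (1 / 2) * S s"
        using r(3) S0 by (intro add_left_mono mult_right_mono) auto
      finally show ?thesis by simp
    qed
    obtain d where d: "\<And>\<tau>. \<tau> \<in> dS_times \<Longrightarrow> (cov_energy has_real_derivative d \<tau>) (at \<tau> within dS_times)"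
      "\<And>\<tau>. \<tau> \<in> dS_times \<Longrightarrow> \<bar>d \<tau>\<bar> \<le> 3513 * cov_energy \<tau>" by (rule cov_energy_derivative) blast
    \<comment> \<open>The growth bound holds at every size, so the threshold of
      \<open>gronwall_dS\<close> is simply placed 1 above the value that its smallness condition
      compares with.\<close>
    have gr: "cov_energy \<tau> \<le> g * cov_energy 0 \<and> cov_energy 0 \<le> g * cov_energy \<tau> \<and> cov_energy \<tau> \<le> cov_energy 0 * g + 1"
      unfolding g_def by (rule gronwall_dS[where y = cov_energy and y' = d]) (use d E0 t in auto)
    have small': "S 0 \<le> 1" "S 0 \<le> r / (g * M)" using small unfolding S_def \<delta>_def by auto
    have gM: "g * M * S 0 \<le> r"
    proof -
      have "g * M > 0" using g1 M1 by simp
      then show ?thesis using small'(2) by (simp add: pos_le_divide_eq mult.commute)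
    qed
    have "g * cov_energy 0 \<le> g * (M * S 0)" using up[OF z small'(1)] g1 by (intro mult_left_mono) auto
    then have gE: "g * cov_energy 0 \<le> g * M * S 0" by (simp only: mult.assoc)
    have E1: "cov_energy \<tau> \<le> r" using gr gE gM by linarith
    have "1 * cov_energy 0 \<le> g * cov_energy 0" using g1 E0 by (intro mult_right_mono)
    then have E2: "cov_energy 0 \<le> r" using gE gM by linarith
    have S\<tau>: "S \<tau> \<le> 1" using down[OF t E1] E1 r(2) by linarith
    have 1: "S \<tau> \<le> 4 * g * M * S 0" using down[OF t E1] gr gE by linarith
    have "g * cov_energy \<tau> \<le> g * (M * S \<tau>)" using up[OF t S\<tau>] g1 by (intro mult_left_mono) auto
    then have 2: "S 0 \<le> 4 * g * M * S \<tau>" using down[OF z E2] gr by (simp only: mult.assoc) linarith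
    have 3: "hN (Suc 0) (b \<tau>) \<le> (1 + PC) * S \<tau>"
      by (rule order_trans[OF b_le_gradient[OF t]]) (use bS[OF t] in \<open>intro mult_left_mono, auto\<close>)
    have L: "4 * g * M * S s \<le> L * S s" "(1 + PC) * S s \<le> L * S s" for s
      unfolding L_def using S0 by (intro mult_right_mono; simp)+
    show ?thesis
      using order_trans[OF 1 L(1)] order_trans[OF 2 L(1)] order_trans[OF 3 L(2)] unfolding S_def by (intro conjI)
  qed
  show thesis
  proof (rule that[where \<delta> = \<delta> and C = L])
    show "\<delta> > 0" unfolding \<delta>_def using r(1) g1 M1 by simp
    show "L > 0" unfolding L_def by (simp add: less_max_iff_disj add_pos_nonneg)
  qed (fact main)
qed

lemma energy_estimate:
  obtains \<delta> C where "\<delta> > 0" "C > 0" "\<And>u v b a \<tau>. frame_solution u v b a \<Longrightarrow> dyn_norm u v a k 0 \<le> \<delta> \<Longrightarrow> \<tau> \<in> dS_times \<Longrightarrow>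
     dyn_norm u v a k \<tau> \<le> C * dyn_norm u v a k 0 \<and> dyn_norm u v a k 0 \<le> C * dyn_norm u v a k \<tau>
     \<and> hN (Suc k) (b \<tau>) \<le> C * dyn_norm u v a k \<tau>"
proof (cases "k = 0")
  case True
  show thesis unfolding that[unfolded True] by (rule energy_estimate_low, rule that[unfolded True]; assumption)
next
  case False
  show thesis by (rule energy_estimate_high[of k]) (use False in simp, rule that)
qed

subsection \<open>From frame norms to the energies\<close>

lemma hN_Re_Im:
  fixes f :: "real^4 \<Rightarrow> complex"
  assumes f: "smooth_S3 f"
  shows "hN k (\<lambda>x. Re (f x)) + hN k (\<lambda>x. Im (f x)) \<le> 2 * hN k f"
    "hN k f \<le> 2 * (hN k (\<lambda>x. Re (f x)) + hN k (\<lambda>x. Im (f x)))"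
proof -
  have re: "smooth_S3 (\<lambda>x. Re (f x))" and im: "smooth_S3 (\<lambda>x. Im (f x))"
    using smooth_S3_linear[OF bounded_linear_Re f] smooth_S3_linear[OF bounded_linear_Im f] by simp_all
  have "hN k (\<lambda>x. Re (f x)) \<le> 1\<^sup>2 * hN k f" by (rule hN_linear_le[OF bounded_linear_Re _ f]) (simp add: abs_Re_le_cmod)
  moreover have "hN k (\<lambda>x. Im (f x)) \<le> 1\<^sup>2 * hN k f" by (rule hN_linear_le[OF bounded_linear_Im _ f]) (simp add: abs_Im_le_cmod)
  ultimately show "hN k (\<lambda>x. Re (f x)) + hN k (\<lambda>x. Im (f x)) \<le> 2 * hN k f" by simp
  have li: "bounded_linear (\<lambda>t. \<i> * complex_of_real t)"
    by (intro bounded_linear_const_mult bounded_linear_of_real)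
  have "hN k (\<lambda>x. complex_of_real (Re (f x))) \<le> 1\<^sup>2 * hN k (\<lambda>x. Re (f x))"
    by (rule hN_linear_le[OF bounded_linear_of_real _ re]) simp
  moreover have "hN k (\<lambda>x. \<i> * complex_of_real (Im (f x))) \<le> 1\<^sup>2 * hN k (\<lambda>x. Im (f x))"
    by (rule hN_linear_le[OF li _ im]) (simp add: norm_mult)
  moreover have "hN k f = hN k (\<lambda>x. complex_of_real (Re (f x)) + \<i> * complex_of_real (Im (f x)))"
    by (rule hN_cong) (simp add: complex_eq[symmetric])
  moreover have "\<dots> \<le> 2 * hN k (\<lambda>x. complex_of_real (Re (f x))) + 2 * hN k (\<lambda>x. \<i> * complex_of_real (Im (f x)))"
    using smooth_S3_linear[OF bounded_linear_of_real re] smooth_S3_linear[OF li im] by (rule hN_add)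
  ultimately show "hN k f \<le> 2 * (hN k (\<lambda>x. Re (f x)) + hN k (\<lambda>x. Im (f x)))" by simp
qed

lemma tN_scalar: "tN 0 k (scalar_field f) = hN k f"
  by (simp add: scalar_field_def)

lemma tN_one_form: "tN (Suc 0) k (one_form A) = (\<Sum>c\<in>UNIV. hN k (\<lambda>x. A x \<bullet> J c x))"
  by (simp add: con_one_form)

lemma Sobolev_complex_equiv:
  obtains C where "C > 0" "\<And>f :: real^4 \<Rightarrow> complex. smooth_S3 f \<Longrightarrow>
    Sobolev_sq k 0 (scalar_field f) \<le> C * (hN k (\<lambda>x. Re (f x)) + hN k (\<lambda>x. Im (f x)))
    \<and> hN k (\<lambda>x. Re (f x)) + hN k (\<lambda>x. Im (f x)) \<le> C * Sobolev_sq k 0 (scalar_field f)"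
proof -
  obtain C where C: "C > 0" "\<And>T :: complex tensor_field. smooth_tensor 0 T \<Longrightarrow> Sobolev_sq k 0 T \<le> C * tN 0 k T \<and> tN 0 k T \<le> C * Sobolev_sq k 0 T"
    by (rule Sobolev_sq_equiv[where r = 0 and k = k], rule that)
  show thesis
  proof (rule that[of "2 * C"])
    fix f :: "real^4 \<Rightarrow> complex" assume f: "smooth_S3 f"
    define h where "h = hN k (\<lambda>x. Re (f x)) + hN k (\<lambda>x. Im (f x))"
    have 1: "Sobolev_sq k 0 (scalar_field f) \<le> C * hN k f" "hN k f \<le> C * Sobolev_sq k 0 (scalar_field f)"
      using C(2)[of "scalar_field f"] f unfolding smooth_tensor_scalar tN_scalar by simp_all
    have 2: "h \<le> 2 * hN k f" "hN k f \<le> 2 * h" using hN_Re_Im[OF f] unfolding h_def .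
    show "Sobolev_sq k 0 (scalar_field f) \<le> 2 * C * (hN k (\<lambda>x. Re (f x)) + hN k (\<lambda>x. Im (f x)))
      \<and> hN k (\<lambda>x. Re (f x)) + hN k (\<lambda>x. Im (f x)) \<le> 2 * C * Sobolev_sq k 0 (scalar_field f)"
      using order_trans[OF 1(1) mult_left_mono[OF 2(2)]] 1(2) 2(1) C(1) unfolding h_def[symmetric] by (simp add: mult_ac)
  qed (use C in simp)
qed

lemma Sobolev_one_form_equiv:
  obtains C where "C > 0" "\<And>A. smooth_S3 A \<Longrightarrow> tangential A \<Longrightarrow>
    Sobolev_sq k 1 (one_form A) \<le> C * (\<Sum>c\<in>UNIV. hN k (\<lambda>x. A x \<bullet> J c x))
    \<and> (\<Sum>c\<in>UNIV. hN k (\<lambda>x. A x \<bullet> J c x)) \<le> C * Sobolev_sq k 1 (one_form A)"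
proof -
  obtain C where C: "C > 0" "\<And>T :: real tensor_field. smooth_tensor (Suc 0) T \<Longrightarrow>
      Sobolev_sq k (Suc 0) T \<le> C * tN (Suc 0) k T \<and> tN (Suc 0) k T \<le> C * Sobolev_sq k (Suc 0) T"
    by (rule Sobolev_sq_equiv[where r = "Suc 0" and k = k], rule that)
  show thesis
    using C(2)[OF smooth_tensor_one_form] C(1) unfolding tN_one_form by (intro that[of C]) simp_all
qed

text \<open>Links the covariant norms of the claim to the frame norms. The time component is bounded
  in one direction, the one in which the frame norm supplied by \<open>energy_estimate\<close> is
  used.\<close>

lemma slice_comparison:
  obtains C where "C > 0" "\<And>\<phi> A A0 \<tau>. smooth_solution \<phi> A A0 \<Longrightarrow> \<tau> \<in> dS_times \<Longrightarrow>
    energy_dyn (Suc k) (slice_of \<phi> A A0 \<tau>) \<le> C * dyn_norm (\<lambda>\<tau> x. Re (\<phi> \<tau> x)) (\<lambda>\<tau> x. Im (\<phi> \<tau> x)) (\<lambda>c \<tau> x. A \<tau> x \<bullet> J c x) k \<tau>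
    \<and> dyn_norm (\<lambda>\<tau> x. Re (\<phi> \<tau> x)) (\<lambda>\<tau> x. Im (\<phi> \<tau> x)) (\<lambda>c \<tau> x. A \<tau> x \<bullet> J c x) k \<tau> \<le> C * energy_dyn (Suc k) (slice_of \<phi> A A0 \<tau>)
    \<and> Sobolev_sq (Suc k) 0 (scalar_field (A0 \<tau>)) \<le> C * hN (Suc k) (A0 \<tau>)
    \<and> slice_in_Sobolev (Suc k) (slice_of \<phi> A A0 \<tau>)"
proof -
  obtain C1 where C1: "C1 > 0" "\<And>f :: real^4 \<Rightarrow> complex. smooth_S3 f \<Longrightarrow>
    Sobolev_sq k 0 (scalar_field f) \<le> C1 * (hN k (\<lambda>x. Re (f x)) + hN k (\<lambda>x. Im (f x)))
    \<and> hN k (\<lambda>x. Re (f x)) + hN k (\<lambda>x. Im (f x)) \<le> C1 * Sobolev_sq k 0 (scalar_field f)"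
    by (rule Sobolev_complex_equiv[where k = k], rule that)
  obtain C2 where C2: "C2 > 0" "\<And>f :: real^4 \<Rightarrow> complex. smooth_S3 f \<Longrightarrow>
    Sobolev_sq (Suc k) 0 (scalar_field f) \<le> C2 * (hN (Suc k) (\<lambda>x. Re (f x)) + hN (Suc k) (\<lambda>x. Im (f x)))
    \<and> hN (Suc k) (\<lambda>x. Re (f x)) + hN (Suc k) (\<lambda>x. Im (f x)) \<le> C2 * Sobolev_sq (Suc k) 0 (scalar_field f)"
    by (rule Sobolev_complex_equiv[where k = "Suc k"], rule that)
  obtain C3 where C3: "C3 > 0" "\<And>A. smooth_S3 A \<Longrightarrow> tangential A \<Longrightarrow>
    Sobolev_sq k 1 (one_form A) \<le> C3 * (\<Sum>c\<in>UNIV. hN k (\<lambda>x. A x \<bullet> J c x))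
    \<and> (\<Sum>c\<in>UNIV. hN k (\<lambda>x. A x \<bullet> J c x)) \<le> C3 * Sobolev_sq k 1 (one_form A)"
    by (rule Sobolev_one_form_equiv[where k = k], rule that)
  obtain C4 where C4: "C4 > 0" "\<And>A. smooth_S3 A \<Longrightarrow> tangential A \<Longrightarrow>
    Sobolev_sq (Suc k) 1 (one_form A) \<le> C4 * (\<Sum>c\<in>UNIV. hN (Suc k) (\<lambda>x. A x \<bullet> J c x))
    \<and> (\<Sum>c\<in>UNIV. hN (Suc k) (\<lambda>x. A x \<bullet> J c x)) \<le> C4 * Sobolev_sq (Suc k) 1 (one_form A)"
    by (rule Sobolev_one_form_equiv[where k = "Suc k"], rule that)
  obtain C5 where C5: "C5 > 0" "\<And>T :: real tensor_field. smooth_tensor 0 T \<Longrightarrow>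
      Sobolev_sq (Suc k) 0 T \<le> C5 * tN 0 (Suc k) T \<and> tN 0 (Suc k) T \<le> C5 * Sobolev_sq (Suc k) 0 T"
    by (rule Sobolev_sq_equiv[where r = 0 and k = "Suc k"], rule that)
  define C where "C = C1 + C2 + C3 + C4 + C5"
  have le: "C1 \<le> C" "C2 \<le> C" "C3 \<le> C" "C4 \<le> C" "C5 \<le> C" and C0: "C > 0"
    unfolding C_def using C1(1) C2(1) C3(1) C4(1) C5(1) by linarith+
  \<comment> \<open>Enlarging the constant relies on \<open>0 \<le> x\<close>, which follows from
    \<open>y \<le> C' * x\<close> and \<open>0 \<le> y\<close>.\<close>
  have big: "x \<le> C * y \<and> y \<le> C * x" if "x \<le> C' * y \<and> y \<le> C' * x" "C' > 0" "C' \<le> C" "0 \<le> y" for x y C'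
  proof -
    have "0 \<le> C' * x" using that by linarith
    then have "0 \<le> x" using that(2) by (simp add: zero_le_mult_iff)
    then have "C' * y \<le> C * y" "C' * x \<le> C * x" using that by (auto intro: mult_right_mono)
    then show ?thesis using that by linarith
  qed
  show thesis
  proof (rule that[OF C0])
    fix \<phi> A A0 \<tau> assume sol: "smooth_solution \<phi> A A0" and t: "\<tau> \<in> dS_times"
    have slab: "smooth_slab \<phi>" "smooth_slab A" "smooth_slab A0"
      and tan: "\<And>s. s \<in> dS_times \<Longrightarrow> tangential (A s)"
      using sol unfolding smooth_solution_def by auto
    note s = smooth_slab_slice[OF slab(1) t] smooth_slab_slice[OF slab(2) t] smooth_slab_slice[OF slab(3) t]
      smooth_slab_slice[OF smooth_slab_dt[OF slab(1)] t] smooth_slab_slice[OF smooth_slab_dt[OF slab(2)] t]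
    \<comment> \<open>The equivalence of norms for 1-forms presupposes tangential fields, so
      tangency has to be passed on to the time derivative.\<close>
    have tan_dt: "tangential (dt A \<tau>)" unfolding tangential_def
    proof
      fix x :: "real^4" assume x: "x \<in> S3"
      have "dt A \<tau> x \<bullet> x = dt (\<lambda>s y. A s y \<bullet> x) \<tau> x"
        by (rule dt_linear[OF bounded_linear_inner_left slab(2) t x, symmetric])
      also have "\<dots> = dt (\<lambda>s y. 0) \<tau> x"
        by (rule dt_cong[OF _ t]) (use tan x in \<open>auto simp only: tangential_def\<close>)
      finally show "dt A \<tau> x \<bullet> x = 0" using t by simp
    qed
    let ?u = "\<lambda>\<tau> x. Re (\<phi> \<tau> x)" and ?v = "\<lambda>\<tau> x. Im (\<phi> \<tau> x)" and ?a = "\<lambda>c \<tau> x. A \<tau> x \<bullet> J c x"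
    have d: "hN k (dt ?u \<tau>) = hN k (\<lambda>x. Re (dt \<phi> \<tau> x))" "hN k (dt ?v \<tau>) = hN k (\<lambda>x. Im (dt \<phi> \<tau> x))"
      "hN k (dt (?a c) \<tau>) = hN k (\<lambda>x. dt A \<tau> x \<bullet> J c x)" for c
      by (rule hN_cong, rule dt_linear[OF bounded_linear_Re slab(1) t], assumption)
        (rule hN_cong, rule dt_linear[OF bounded_linear_Im slab(1) t], assumption,
         rule hN_cong, rule dt_inner_J[OF slab(2) t], assumption)
    have dyn: "dyn_norm ?u ?v ?a k \<tau> =
      ((hN k (\<lambda>x. Re (dt \<phi> \<tau> x)) + hN k (\<lambda>x. Im (dt \<phi> \<tau> x))) + (hN (Suc k) (\<lambda>x. Re (\<phi> \<tau> x)) + hN (Suc k) (\<lambda>x. Im (\<phi> \<tau> x))))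
      + ((\<Sum>c\<in>UNIV. hN k (\<lambda>x. dt A \<tau> x \<bullet> J c x)) + (\<Sum>c\<in>UNIV. hN (Suc k) (\<lambda>x. A \<tau> x \<bullet> J c x)))"
      unfolding dyn_norm_def d by (simp add: sum.distrib)
    have en: "energy_dyn (Suc k) (slice_of \<phi> A A0 \<tau>) =
      (Sobolev_sq k 0 (scalar_field (dt \<phi> \<tau>)) + Sobolev_sq (Suc k) 0 (scalar_field (\<phi> \<tau>)))
      + (Sobolev_sq k 1 (one_form (dt A \<tau>)) + Sobolev_sq (Suc k) 1 (one_form (A \<tau>)))"
      unfolding energy_dyn_def slice_of_def by simp
    note b = big[OF C1(2)[OF s(4)] C1(1) le(1)] big[OF C2(2)[OF s(1)] C2(1) le(2)]
      big[OF C3(2)[OF s(5) tan_dt] C3(1) le(3)] big[OF C4(2)[OF s(2) tan[OF t]] C4(1) le(4)]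
    have b': "Sobolev_sq k 0 (scalar_field (dt \<phi> \<tau>)) \<le> C * (hN k (\<lambda>x. Re (dt \<phi> \<tau> x)) + hN k (\<lambda>x. Im (dt \<phi> \<tau> x)))
        \<and> hN k (\<lambda>x. Re (dt \<phi> \<tau> x)) + hN k (\<lambda>x. Im (dt \<phi> \<tau> x)) \<le> C * Sobolev_sq k 0 (scalar_field (dt \<phi> \<tau>))"
      "Sobolev_sq (Suc k) 0 (scalar_field (\<phi> \<tau>)) \<le> C * (hN (Suc k) (\<lambda>x. Re (\<phi> \<tau> x)) + hN (Suc k) (\<lambda>x. Im (\<phi> \<tau> x)))
        \<and> hN (Suc k) (\<lambda>x. Re (\<phi> \<tau> x)) + hN (Suc k) (\<lambda>x. Im (\<phi> \<tau> x)) \<le> C * Sobolev_sq (Suc k) 0 (scalar_field (\<phi> \<tau>))"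
      "Sobolev_sq k 1 (one_form (dt A \<tau>)) \<le> C * (\<Sum>c\<in>UNIV. hN k (\<lambda>x. dt A \<tau> x \<bullet> J c x))
        \<and> (\<Sum>c\<in>UNIV. hN k (\<lambda>x. dt A \<tau> x \<bullet> J c x)) \<le> C * Sobolev_sq k 1 (one_form (dt A \<tau>))"
      "Sobolev_sq (Suc k) 1 (one_form (A \<tau>)) \<le> C * (\<Sum>c\<in>UNIV. hN (Suc k) (\<lambda>x. A \<tau> x \<bullet> J c x))
        \<and> (\<Sum>c\<in>UNIV. hN (Suc k) (\<lambda>x. A \<tau> x \<bullet> J c x)) \<le> C * Sobolev_sq (Suc k) 1 (one_form (A \<tau>))"
      by (intro b add_nonneg_nonneg sum_nonneg hN_nonneg)+
    have "Sobolev_sq (Suc k) 0 (scalar_field (A0 \<tau>)) \<le> C5 * hN (Suc k) (A0 \<tau>)"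
      using C5(2)[of "scalar_field (A0 \<tau>)"] s(3) unfolding smooth_tensor_scalar tN_scalar by simp
    also have "\<dots> \<le> C * hN (Suc k) (A0 \<tau>)" by (intro mult_right_mono le hN_nonneg)
    finally have A0: "Sobolev_sq (Suc k) 0 (scalar_field (A0 \<tau>)) \<le> C * hN (Suc k) (A0 \<tau>)" .
    have slice: "slice_in_Sobolev (Suc k) (slice_of \<phi> A A0 \<tau>)"
      unfolding slice_in_Sobolev_def slice_of_def
      using s tan[OF t] tan_dt smooth_tensor_one_form by (simp add: in_Sobolev_smooth smooth_tensor_scalar)
    have lin: "x1 + x2 + (x3 + x4) \<le> C * (y1 + y2 + (y3 + y4)) \<and> y1 + y2 + (y3 + y4) \<le> C * (x1 + x2 + (x3 + x4))"
      if "x1 \<le> C * y1 \<and> y1 \<le> C * x1" "x2 \<le> C * y2 \<and> y2 \<le> C * x2" "x3 \<le> C * y3 \<and> y3 \<le> C * x3" "x4 \<le> C * y4 \<and> y4 \<le> C * x4"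
      for x1 x2 x3 x4 y1 y2 y3 y4 :: real
      using that unfolding distrib_left by linarith
    show "energy_dyn (Suc k) (slice_of \<phi> A A0 \<tau>) \<le> C * dyn_norm ?u ?v ?a k \<tau>
      \<and> dyn_norm ?u ?v ?a k \<tau> \<le> C * energy_dyn (Suc k) (slice_of \<phi> A A0 \<tau>)
      \<and> Sobolev_sq (Suc k) 0 (scalar_field (A0 \<tau>)) \<le> C * hN (Suc k) (A0 \<tau>)
      \<and> slice_in_Sobolev (Suc k) (slice_of \<phi> A A0 \<tau>)"
      unfolding dyn en using lin[OF b'] A0 slice by blast
  qed
qed

section \<open>Energies of smooth solutions and passage to the limit\<close>

lemma energy_nonneg:
  assumes "slice_in_Sobolev m d"
  shows "0 \<le> energy_dyn m d" "energy_dyn m d \<le> energy m d"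
proof -
  have "0 \<le> Sobolev_sq (m - 1) 0 (scalar_field (phi_dot d))" "0 \<le> Sobolev_sq m 0 (scalar_field (phi d))"
    "0 \<le> Sobolev_sq (m - 1) 1 (one_form (pot_dot d))" "0 \<le> Sobolev_sq m 1 (one_form (pot d))"
    "0 \<le> Sobolev_sq m 0 (scalar_field (pot0 d))"
    using assms Sobolev_sq_le_diff(3) unfolding slice_in_Sobolev_def by blast+
  then show "0 \<le> energy_dyn m d" "energy_dyn m d \<le> energy m d"
    unfolding energy_dyn_def energy_def by linarith+
qed

text \<open>The triangle inequality for squared norms. The third form bounds the dynamical part by
  the full energy of the difference, which is the quantity that the notion of solution makes
  small.\<close>

lemma energy_le_diff:
  assumes d: "slice_in_Sobolev m d" and e: "slice_in_Sobolev m e"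
  shows "energy m d \<le> 2 * energy m e + 2 * energy m (slice_diff e d)"
    "energy m e \<le> 2 * energy m d + 2 * energy m (slice_diff e d)"
    "energy_dyn m e \<le> 2 * energy_dyn m d + 2 * energy m (slice_diff e d)"
proof -
  have scalar: "scalar_field (\<lambda>x. f x - g x) = (\<lambda>x vs. scalar_field f x vs - scalar_field g x vs)" for f g :: "real^4 \<Rightarrow> 'v::euclidean_space"
    by (simp add: scalar_field_def)
  have form: "one_form (\<lambda>x. f x - g x) = (\<lambda>x vs. one_form f x vs - one_form g x vs)" for f g
    by (simp add: one_form_def inner_diff_left)
  note D = Sobolev_sq_le_diff[where k = "m - 1" and r = 0 and T = "scalar_field (phi_dot d)" and T' = "scalar_field (phi_dot e)"]
    Sobolev_sq_le_diff[where k = m and r = 0 and T = "scalar_field (phi d)" and T' = "scalar_field (phi e)"]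
    Sobolev_sq_le_diff[where k = "m - 1" and r = 1 and T = "one_form (pot_dot d)" and T' = "one_form (pot_dot e)"]
    Sobolev_sq_le_diff[where k = m and r = 1 and T = "one_form (pot d)" and T' = "one_form (pot e)"]
    Sobolev_sq_le_diff[where k = m and r = 0 and T = "scalar_field (pot0 d)" and T' = "scalar_field (pot0 e)"]
  have lin: "x1 + x2 + (x3 + x4) + x5 \<le> 2 * (y1 + y2 + (y3 + y4) + y5) + 2 * (z1 + z2 + (z3 + z4) + z5) \<and>
    x1 + x2 + (x3 + x4) \<le> 2 * (y1 + y2 + (y3 + y4)) + 2 * (z1 + z2 + (z3 + z4) + z5)"
    if "x1 \<le> 2 * y1 + 2 * z1" "x2 \<le> 2 * y2 + 2 * z2" "x3 \<le> 2 * y3 + 2 * z3" "x4 \<le> 2 * y4 + 2 * z4" "x5 \<le> 2 * y5 + 2 * z5" "0 \<le> z5"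
    for x1 x2 x3 x4 x5 y1 y2 y3 y4 y5 z1 z2 z3 z4 z5 :: real
  proof
    have 1: "x1 + x2 + (x3 + x4) \<le> 2 * (y1 + y2 + (y3 + y4)) + 2 * (z1 + z2 + (z3 + z4))"
      using add_mono[OF add_mono[OF that(1,2)] add_mono[OF that(3,4)]] by simp
    show "x1 + x2 + (x3 + x4) + x5 \<le> 2 * (y1 + y2 + (y3 + y4) + y5) + 2 * (z1 + z2 + (z3 + z4) + z5)"
      using add_mono[OF 1 that(5)] by simp
    show "x1 + x2 + (x3 + x4) \<le> 2 * (y1 + y2 + (y3 + y4)) + 2 * (z1 + z2 + (z3 + z4) + z5)"
      using 1 that(6) by simp
  qed
  note mem = d[unfolded slice_in_Sobolev_def] e[unfolded slice_in_Sobolev_def]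
  show "energy m d \<le> 2 * energy m e + 2 * energy m (slice_diff e d)"
    unfolding energy_def energy_dyn_def slice_diff_def slice.simps scalar form
    using mem by (intro lin[THEN conjunct1] D(1,5,9,13,17) D(20)) blast+
  show "energy m e \<le> 2 * energy m d + 2 * energy m (slice_diff e d)"
    unfolding energy_def energy_dyn_def slice_diff_def slice.simps scalar form
    using mem by (intro lin[THEN conjunct1] D(2,6,10,14,18) D(20)) blast+
  show "energy_dyn m e \<le> 2 * energy_dyn m d + 2 * energy m (slice_diff e d)"
    unfolding energy_def energy_dyn_def slice_diff_def slice.simps scalar form
    by (rule lin[THEN conjunct2, OF D(2) D(6) D(10) D(14) D(18) D(20)]) (use mem in blast)+
qed

text \<open>At each single time the dynamical norm and the full energy bound each other, the time
  component being controlled by \<open>energy_estimate\<close>; different times are then related by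
  the growth factor alone.\<close>

lemma smooth_energy_estimate:
  obtains \<epsilon> C where "\<epsilon> > 0" "C > 0" "\<And>\<phi> A A0 \<tau>. smooth_solution \<phi> A A0 \<Longrightarrow> energy_dyn (Suc k) (slice_of \<phi> A A0 0) \<le> \<epsilon> \<Longrightarrow> \<tau> \<in> dS_times \<Longrightarrow>
     comparable C (energy (Suc k) (slice_of \<phi> A A0 0)) (energy (Suc k) (slice_of \<phi> A A0 \<tau>))
     \<and> slice_in_Sobolev (Suc k) (slice_of \<phi> A A0 \<tau>)"
proof -
  obtain \<delta> M where M: "\<delta> > 0" "M > 0" "\<And>u v b a \<tau>. frame_solution u v b a \<Longrightarrow> dyn_norm u v a k 0 \<le> \<delta> \<Longrightarrow> \<tau> \<in> dS_times \<Longrightarrow>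
     dyn_norm u v a k \<tau> \<le> M * dyn_norm u v a k 0 \<and> dyn_norm u v a k 0 \<le> M * dyn_norm u v a k \<tau>
     \<and> hN (Suc k) (b \<tau>) \<le> M * dyn_norm u v a k \<tau>" by (rule energy_estimate[of k]) blast
  obtain K where K: "K > 0" "\<And>\<phi> A A0 \<tau>. smooth_solution \<phi> A A0 \<Longrightarrow> \<tau> \<in> dS_times \<Longrightarrow>
    energy_dyn (Suc k) (slice_of \<phi> A A0 \<tau>) \<le> K * dyn_norm (\<lambda>\<tau> x. Re (\<phi> \<tau> x)) (\<lambda>\<tau> x. Im (\<phi> \<tau> x)) (\<lambda>c \<tau> x. A \<tau> x \<bullet> J c x) k \<tau>
    \<and> dyn_norm (\<lambda>\<tau> x. Re (\<phi> \<tau> x)) (\<lambda>\<tau> x. Im (\<phi> \<tau> x)) (\<lambda>c \<tau> x. A \<tau> x \<bullet> J c x) k \<tau> \<le> K * energy_dyn (Suc k) (slice_of \<phi> A A0 \<tau>)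
    \<and> Sobolev_sq (Suc k) 0 (scalar_field (A0 \<tau>)) \<le> K * hN (Suc k) (A0 \<tau>)
    \<and> slice_in_Sobolev (Suc k) (slice_of \<phi> A A0 \<tau>)" by (rule slice_comparison[of k]) blast
  \<comment> \<open>Energy by dynamical norm costs \<open>K * (1 + M)\<close>, the change of time
    \<open>M\<close>, and the return to the energy \<open>K\<close>.\<close>
  define C where "C = K * (1 + M) * M * K"
  show thesis
  proof (rule that[of "\<delta> / K" C])
    show "\<delta> / K > 0" "C > 0" unfolding C_def using M(1,2) K(1) by simp_all
    fix \<phi> A A0 \<tau> assume sol: "smooth_solution \<phi> A A0" and small: "energy_dyn (Suc k) (slice_of \<phi> A A0 0) \<le> \<delta> / K"
      and t: "\<tau> \<in> dS_times"
    have z: "0 \<in> dS_times" by (simp add: dS_times_def)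
    define S where "S s = dyn_norm (\<lambda>\<tau> x. Re (\<phi> \<tau> x)) (\<lambda>\<tau> x. Im (\<phi> \<tau> x)) (\<lambda>c \<tau> x. A \<tau> x \<bullet> J c x) k s" for s
    define X where "X s = energy (Suc k) (slice_of \<phi> A A0 s)" for s
    define Y where "Y s = energy_dyn (Suc k) (slice_of \<phi> A A0 s)" for s
    have S0: "0 \<le> S s" for s unfolding S_def by simp
    have sl: "slice_in_Sobolev (Suc k) (slice_of \<phi> A A0 s)" if "s \<in> dS_times" for s using K(2)[OF sol that] by blast
    have YS: "Y s \<le> K * S s" and SY: "S s \<le> K * Y s" and A0: "Sobolev_sq (Suc k) 0 (scalar_field (A0 s)) \<le> K * hN (Suc k) (A0 s)"
      if "s \<in> dS_times" for s using K(2)[OF sol that] unfolding Y_def S_def by blast+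
    have YX: "Y s \<le> X s" if "s \<in> dS_times" for s using energy_nonneg(2)[OF sl[OF that]] unfolding X_def Y_def .
    have "K * Y 0 \<le> \<delta>" using small K(1) unfolding Y_def by (simp add: field_simps)
    then have "S 0 \<le> \<delta>" using SY[OF z] by linarith
    then have est: "S s \<le> M * S 0" "S 0 \<le> M * S s" "hN (Suc k) (A0 s) \<le> M * S s" if "s \<in> dS_times" for s
      using M(3)[OF smooth_solution_frame[OF sol] _ that] unfolding S_def by blast+
    have XS: "X s \<le> K * (1 + M) * S s" if s: "s \<in> dS_times" for s
    proof -
      have "X s = Y s + Sobolev_sq (Suc k) 0 (scalar_field (A0 s))"
        unfolding X_def Y_def energy_def slice_of_def by simp
      also have "\<dots> \<le> K * S s + K * (M * S s)"
        using YS[OF s] A0[OF s] mult_left_mono[OF est(3)[OF s], of K] K(1) by linarith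
      finally show ?thesis by (simp add: algebra_simps)
    qed
    have chain: "X r \<le> C * X s" if r: "r \<in> dS_times" and s: "s \<in> dS_times" and rs: "S r \<le> M * S s" for r s
    proof -
      have "S s \<le> K * X s" using SY[OF s] mult_left_mono[OF YX[OF s], of K] K(1) by linarith
      then have "M * S s \<le> M * (K * X s)" using M(2) by (intro mult_left_mono) auto
      then have "S r \<le> M * (K * X s)" using rs by linarith
      then have "K * (1 + M) * S r \<le> K * (1 + M) * (M * (K * X s))" using K(1) M(2) by (intro mult_left_mono) auto
      then show ?thesis using XS[OF r] unfolding C_def by (simp only: mult.assoc)
    qed
    show "comparable C (energy (Suc k) (slice_of \<phi> A A0 0)) (energy (Suc k) (slice_of \<phi> A A0 \<tau>))
     \<and> slice_in_Sobolev (Suc k) (slice_of \<phi> A A0 \<tau>)"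
      using chain[OF z t est(2)[OF t]] chain[OF t z est(1)[OF t]] sl[OF t] unfolding comparable_def X_def by blast
  qed
qed

theorem theorem5p2:
  fixes m :: nat
  assumes "m \<ge> 1"
  shows "\<exists>\<epsilon>>0. \<exists>C>0. \<forall>d u.
           admissible m d \<longrightarrow> energy_dyn m d \<le> \<epsilon> \<longrightarrow> solution m u \<longrightarrow> u 0 = d \<longrightarrow>
             (\<forall>\<tau>\<in>dS_times. comparable C (energy m (u 0)) (energy m (u \<tau>)))
             \<and> comparable C (energy m (u scri_minus)) (energy m (u scri_plus))"
proof -
  obtain k where m: "m = Suc k" using assms by (cases m) auto
  obtain \<epsilon> C where C: "\<epsilon> > 0" "C > 0" "\<And>\<phi> A A0 \<tau>. smooth_solution \<phi> A A0 \<Longrightarrow> energy_dyn m (slice_of \<phi> A A0 0) \<le> \<epsilon> \<Longrightarrow> \<tau> \<in> dS_times \<Longrightarrow>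
     comparable C (energy m (slice_of \<phi> A A0 0)) (energy m (slice_of \<phi> A A0 \<tau>)) \<and> slice_in_Sobolev m (slice_of \<phi> A A0 \<tau>)"
    unfolding m by (rule smooth_energy_estimate[of k]) blast
  have z: "0 \<in> dS_times" and ends: "scri_minus \<in> dS_times" "scri_plus \<in> dS_times" by (auto simp: dS_times_def)
  have sl: "slice_in_Sobolev m (slice_of \<phi> A A0 \<tau>)" if "smooth_solution \<phi> A A0" "\<tau> \<in> dS_times" for \<phi> A A0 \<tau>
    unfolding m by (rule slice_comparison[of k]) (use that in blast)
  \<comment> \<open>Passing from the solution to an approximant and back costs a factor 2 each way,
    whence \<open>4 * C\<close>; the error terms disappear in the limit.\<close>
  have main: "comparable (4 * C) (energy m (u 0)) (energy m (u \<tau>))"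
    if small: "energy_dyn m (u 0) \<le> \<epsilon> / 4" and u: "solution m u" and t: "\<tau> \<in> dS_times" for u \<tau>
  proof -
    have us: "slice_in_Sobolev m (u s)" if "s \<in> dS_times" for s using u that unfolding solution_def by blast
    obtain \<phi> A A0 where sol: "\<And>n::nat. smooth_solution (\<phi> n) (A n) (A0 n)"
      and lim: "uniform_limit dS_times (\<lambda>n \<tau>. energy m (slice_diff (slice_of (\<phi> n) (A n) (A0 n) \<tau>) (u \<tau>))) (\<lambda>_. 0) sequentially"
      using u unfolding solution_def by blast
    define e where "e n s = energy m (slice_diff (slice_of (\<phi> n) (A n) (A0 n) s) (u s))" for n s
    have e: "(\<lambda>n. e n s) \<longlonglongrightarrow> 0" if "s \<in> dS_times" for s
      unfolding e_def using tendsto_uniform_limitI[OF lim that] .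
    define X where "X s = energy m (u s)" for s
    define Y where "Y n s = energy m (slice_of (\<phi> n) (A n) (A0 n) s)" for n s
    have XY: "X s \<le> 2 * Y n s + 2 * e n s" "Y n s \<le> 2 * X s + 2 * e n s"
      "energy_dyn m (slice_of (\<phi> n) (A n) (A0 n) s) \<le> 2 * energy_dyn m (u s) + 2 * e n s" if "s \<in> dS_times" for n s
      unfolding X_def Y_def e_def by (rule energy_le_diff[OF us[OF that] sl[OF sol that]])+
    \<comment> \<open>By then the approximants have dynamical energy at most
      \<open>2 * (\<epsilon> / 4) + 2 * (\<epsilon> / 4) = \<epsilon>\<close> at time 0, so the
      estimate for smooth solutions applies to them.\<close>
    have "eventually (\<lambda>n. e n 0 < \<epsilon> / 4) sequentially"
      using order_tendstoD(2)[OF e[OF z], of "\<epsilon> / 4"] C(1) by simp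
    then have ev: "eventually (\<lambda>n. Y n 0 \<le> C * Y n \<tau> \<and> Y n \<tau> \<le> C * Y n 0) sequentially"
    proof eventually_elim
      case (elim n)
      have "energy_dyn m (slice_of (\<phi> n) (A n) (A0 n) 0) \<le> \<epsilon>" using XY(3)[OF z, of n] small elim by linarith
      then show ?case using C(3)[OF sol[of n] _ t] unfolding comparable_def Y_def by blast
    qed
    have bound: "X r \<le> 4 * C * X s" if r: "r \<in> dS_times" and s: "s \<in> dS_times"
      and ev: "eventually (\<lambda>n. Y n r \<le> C * Y n s) sequentially" for r s
    proof (rule tendsto_lowerbound[OF _ _ trivial_limit_sequentially])
      have "(\<lambda>n. 4 * C * X s + 4 * C * e n s + 2 * e n r) \<longlonglongrightarrow> 4 * C * X s + 4 * C * 0 + 2 * 0"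
        by (intro tendsto_intros e r s)
      then show "(\<lambda>n. 4 * C * X s + 4 * C * e n s + 2 * e n r) \<longlonglongrightarrow> 4 * C * X s" by simp
      show "eventually (\<lambda>n. X r \<le> 4 * C * X s + 4 * C * e n s + 2 * e n r) sequentially"
        using ev
      proof eventually_elim
        case (elim n)
        have "C * Y n s \<le> C * (2 * X s + 2 * e n s)" using XY(2)[OF s] C(2) by (intro mult_left_mono) auto
        then have "X r \<le> 2 * (C * (2 * X s + 2 * e n s)) + 2 * e n r" using XY(1)[OF r, of n] elim by linarith
        then show ?case by (simp add: algebra_simps)
      qed
    qed
    show ?thesis
      unfolding comparable_def X_def[symmetric]
      using bound[OF z t eventually_mono[OF ev]] bound[OF t z eventually_mono[OF ev]] by blast
  qed
  \<comment> \<open>\<open>4 * C\<close> compares any time with time 0; the two infinities are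
    compared through time 0, which squares this constant.\<close>
  define L where "L = 4 * C + 16 * C\<^sup>2"
  have L: "\<epsilon> / 4 > 0" "L > 0" unfolding L_def using C(1,2) by (auto intro: add_pos_nonneg)
  show ?thesis
  proof (rule exI[of _ "\<epsilon> / 4"], intro conjI L(1) exI[of _ L] L(2) allI impI ballI)
    fix d u assume *: "energy_dyn m d \<le> \<epsilon> / 4" "solution m u" "u 0 = d"
    have small: "energy_dyn m (u 0) \<le> \<epsilon> / 4" using * by simp
    define X where "X s = energy m (u s)" for s
    have X0: "0 \<le> X s" if "s \<in> dS_times" for s
      using energy_nonneg[of m "u s"] *(2) that unfolding X_def solution_def by force
    have X: "X 0 \<le> 4 * C * X s" "X s \<le> 4 * C * X 0" if "s \<in> dS_times" for s
      using main[OF small *(2) that] unfolding comparable_def X_def by auto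
    have up: "4 * C * X s \<le> L * X s" "16 * C\<^sup>2 * X s \<le> L * X s" if "s \<in> dS_times" for s
      unfolding L_def using C(2) by (intro mult_right_mono X0 that; simp)+
    show "comparable L (energy m (u 0)) (energy m (u \<tau>))" if t: "\<tau> \<in> dS_times" for \<tau>
      using order_trans[OF X(1)[OF t] up(1)[OF t]] order_trans[OF X(2)[OF t] up(1)[OF z]]
      unfolding comparable_def X_def by simp
    have "X r \<le> L * X s" if r: "r \<in> dS_times" and s: "s \<in> dS_times" for r s
    proof -
      have "4 * C * X 0 \<le> 4 * C * (4 * C * X s)" using X(1)[OF s] C(2) by (intro mult_left_mono) auto
      then have "X r \<le> 16 * C\<^sup>2 * X s" using X(2)[OF r] by (simp add: power2_eq_square)
      then show ?thesis using up(2)[OF s] by linarith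
    qed
    then show "comparable L (energy m (u scri_minus)) (energy m (u scri_plus))"
      using ends unfolding comparable_def X_def by blast
  qed
qed

end
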